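(* Let $s\in(0,1)$, $a=1-2s\in(-1,1)$, and $f\in C^{1,\gamma}(\mathbb{R})$ with $\gamma>\max\{0,1-2s\}$. Let $u\in C^2(\widehat{\mathbb{H}})$ be a bounded and stable weak solution of $$\operatorname{div}_{\widehat{\mathbb{H}}}(y^a\nabla_{\widehat{\mathbb{H}}}u)=0\ \text{ in }\mathbb{H}\times(0,\infty),\qquad -y^a u_y=f(u)\ \text{ on }\mathbb{H}\times\{0\},$$ such that $|\nabla_{\mathbb{H}}u|\in L^\infty(\overline{B_R^+})$ for all $R>0$. Suppose also that $$\langle T\nu_{x,y},v_{x,y}\rangle_{\mathbb{H}}\ge0\quad\text{for all }x\in\mathbb{H},\ y>0\ \text{ with }\nabla_{\mathbb{H}}u(x,y)\ne0,$$ and that the function $$\eta(\tau)=\int_{B(0,\tau)}4y^a|\nabla_{\mathbb{H}}u(x_1,x_2,x_3,y)|^2(x_1^2+x_2^2+y^2)\,d(x_1,x_2,x_3,y)$$ satisfies $$\liminf_{R\to+\infty}\frac{\int_{\sqrt R}^R\frac{\eta(\tau)}{\tau^5}\,d\tau+\frac{\eta(R)}{R^4}}{\log^2R}=0.$$ Then for every $y>0$ and $c\in\mathbb{R}$, the set $L=\{x\in\mathbb{R}^3: u(x,y)=c,\ \nabla_{\mathbb{H}}u(x,y)\ne0\}$ is a minimal surface in the Heisenberg group, i.e. $h_{x,y}=0$ for all $x\in L$, and moreover, for all $x\in L$, $$p_{x,y}=-\frac{\langle Hu\,v_{x,y},\nu_{x,y}\rangle_{\mathbb{H}}}{|\nab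la_{\mathbb{H}}u|}.$$
   Context: Heisenberg group: $\mathbb{H}=\mathbb{R}^3$ with law $(x_1,x_2,x_3)\circ(y_1,y_2,y_3)=(x_1+y_1,\,x_2+y_2,\,x_3+y_3+2(x_2y_1-x_1y_2))$. Vector fields: $X=\partial_{x_1}+2x_2\partial_{x_3}$, $Y=\partial_{x_2}-2x_1\partial_{x_3}$, $T=[X,Y]=-4\partial_{x_3}$. On horizontal vectors, written in coordinates with respect to the frame $(X,Y)$, $\langle\cdot,\cdot\rangle_{\mathbb{H}}$ is the inner product making $X,Y$ orthonormal. $\nabla_{\mathbb{H}}u=(Xu,Yu)$ and $\operatorname{div}_{\mathbb{H}}(w_1,w_2)=Xw_1+Yw_2$. Let $\widehat{\mathbb{H}}=\mathbb{H}\times(0,\infty)=\mathbb{R}^4_+=\mathbb{R}^3\times(0,\infty)$ with points $(x,y)$; $\nabla_{\widehat{\mathbb{H}}}u=(Xu,Yu,u_y)$, $\operatorname{div}_{\widehat{\mathbb{H}}}(w_1,w_2,w_3)=Xw_1+Yw_2+\partial_yw_3$, with $\langle\cdot,\cdot\rangle_{\widehat{\mathbb{H}}}$ the standard inner product of these coordinates. Integrals are with respect to Lebesgue measure; $\int_{\mathbb{H}}$ is over $\{y=0\}$. $B_R$ is the Euclidean ball of radius $R$ centered at $0$ in $\mathbb{R}^4$ and $B_R^+=B_R\cap\mathbb{R}^4_+$. By contrast, $B(0,\tau)=\{Z=(x,y)\in\widehat{\mathbb{H}}:|Z|_{\widehat{\mathbb{H}}}<\tau\}$, where $|Z|_{\widehat{\mathbb{H}}}=(|x|_{\mathbb{H}}^2+y^2)^{1/2}$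 and $|x|_{\mathbb{H}}=((x_1^2+x_2^2)^2+x_3^2)^{1/4}$. Weak solution: $u\in L^\infty_{\mathrm{loc}}(\overline{\mathbb{R}^4_+})$, $y^a|\nabla_{\widehat{\mathbb{H}}}u|^2\in L^1(B_R^+)$ for every $R>0$, and $$\int_{\widehat{\mathbb{H}}}y^a\langle\nabla_{\widehat{\mathbb{H}}}u,\nabla_{\widehat{\mathbb{H}}}\xi\rangle_{\widehat{\mathbb{H}}}=\int_{\mathbb{H}}f(u)\xi$$ for all admissible $\xi$, i.e. all $\xi:\mathbb{R}^4_+\to\mathbb{R}$ bounded, locally Lipschitz, vanishing on $\mathbb{R}^4_+\setminus B_R$ for some $R>0$, with $y^a|\nabla_{\widehat{\mathbb{H}}}\xi|^2\in L^1(B_R^+)$. Stable: $\int_{\widehat{\mathbb{H}}}y^a|\nabla_{\widehat{\mathbb{H}}}\xi|^2-\int_{\mathbb{H}}f'(u)\xi^2\ge0$ for all admissible $\xi$. Values on $\{y=0\}$ are boundary values (traces). Hessian: $Hu=\begin{bmatrix} XXu & YXu \\ XYu & YYu \end{bmatrix}$. At points $(x,y)$ with $\nabla_{\mathbb{H}}u(x,y)\ne0$: intrinsic normal $\nu_{x,y}=\nabla_{\mathbb{H}}u/|\nabla_{\mathbb{H}}u|$; intrinsic unit tangent $v_{x,y}=(Yu,-Xu)/|\nabla_{\mathbb{H}}u|$; intrinsic mean curvature $h_{x,y}=\operatorname{div}_{\mathbb{H}}\nu_{x,y}$; imaginary curvature $p_{x,y}=-Tu/|\nabla_{\mathbb{H}}u|$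 (all of the level set of $u(\cdot,y)$ through $x$, with $y$ fixed). $T\nu_{x,y}$ means $T$ applied to each of the two components of $\nu_{x,y}$ in the $(X,Y)$-frame. *)

theory Defs
  imports "HOL-Analysis.Analysis"
begin

text \<open>
  The Heisenberg group is represented by its underlying space \<open>real ^ 3\<close>, and points of the
  extended space are pairs \<open>(x, y)\<close>. Functions on the open half-space \<open>y > 0\<close> are total functions
  on \<open>real ^ 3 \<times> real\<close>; every notion below ignores their values at \<open>y \<le> 0\<close>.
\<close>

type_synonym point = "(real ^ 3) \<times> real"

definition half_space :: "point set" where
  "half_space = {p. snd p > 0}"

definition half_ball :: "real \<Rightarrow> point set" where
  "half_ball R = ball 0 R \<inter> half_space"

definition heis_norm :: "real ^ 3 \<Rightarrow> real" where
  "heis_norm x = root 4 (((x $ 1)\<^sup>2 + (x $ 2)\<^sup>2)\<^sup>2 + (x $ 3)\<^sup>2)"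

definition gauge_norm :: "point \<Rightarrow> real" where
  "gauge_norm p = sqrt ((heis_norm (fst p))\<^sup>2 + (snd p)\<^sup>2)"

definition gauge_ball :: "real \<Rightarrow> point set" where
  "gauge_ball \<tau> = {p \<in> half_space. gauge_norm p < \<tau>}"


subsection \<open>Differential operators\<close>

definition dx :: "3 \<Rightarrow> (point \<Rightarrow> real) \<Rightarrow> point \<Rightarrow> real" where
  "dx i w p = deriv (\<lambda>t. w (fst p + t *\<^sub>R axis i 1, snd p)) 0"

definition dy :: "(point \<Rightarrow> real) \<Rightarrow> point \<Rightarrow> real" where
  "dy w p = deriv (\<lambda>t. w (fst p, t)) (snd p)"

definition X_H :: "(point \<Rightarrow> real) \<Rightarrow> point \<Rightarrow> real" where
  "X_H w p = dx 1 w p + 2 * (fst p $ 2) * dx 3 w p"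

definition Y_H :: "(point \<Rightarrow> real) \<Rightarrow> point \<Rightarrow> real" where
  "Y_H w p = dx 2 w p - 2 * (fst p $ 1) * dx 3 w p"

text \<open>The commutator \<open>[X, Y]\<close>, in its first-order form.\<close>

definition T_H :: "(point \<Rightarrow> real) \<Rightarrow> point \<Rightarrow> real" where
  "T_H w p = - 4 * dx 3 w p"

text \<open>
  Horizontal vectors are given by their coordinates in the frame \<open>(X, Y)\<close>, and vectors of the
  extended space by their coordinates in \<open>(X, Y, \<partial>\<^sub>y)\<close>. The intrinsic inner products are then
  the standard ones on \<open>real ^ 2\<close> and \<open>real ^ 3\<close>.
\<close>

definition grad_H :: "(point \<Rightarrow> real) \<Rightarrow> point \<Rightarrow> real ^ 2" where
  "grad_H w p = vector [X_H w p, Y_H w p]"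

definition grad_ext :: "(point \<Rightarrow> real) \<Rightarrow> point \<Rightarrow> real ^ 3" where
  "grad_ext w p = vector [X_H w p, Y_H w p, dy w p]"

definition div_H :: "(point \<Rightarrow> real ^ 2) \<Rightarrow> point \<Rightarrow> real" where
  "div_H V p = X_H (\<lambda>q. V q $ 1) p + Y_H (\<lambda>q. V q $ 2) p"

definition hess_H :: "(point \<Rightarrow> real) \<Rightarrow> point \<Rightarrow> real ^ 2 ^ 2" where
  "hess_H w p = vector [vector [X_H (X_H w) p, Y_H (X_H w) p],
                        vector [X_H (Y_H w) p, Y_H (Y_H w) p]]"


subsection \<open>Function classes\<close>

definition C2_on :: "'a::real_normed_vector set \<Rightarrow> ('a \<Rightarrow> real) \<Rightarrow> bool" where
  "C2_on S w \<longleftrightarrow> (\<exists>w' w''.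
     (\<forall>p\<in>S. (w has_derivative blinfun_apply (w' p)) (at p) \<and>
            (w' has_derivative blinfun_apply (w'' p)) (at p)) \<and>
     continuous_on S w'')"

text \<open>The class \<open>C\<^sup>1\<^sup>,\<^sup>\<gamma>\<close> of the real line, with the usual convention that the Hoelder condition
  on the derivative is required on compact sets only.\<close>

definition C1_Hoelder :: "real \<Rightarrow> (real \<Rightarrow> real) \<Rightarrow> bool" where
  "C1_Hoelder \<gamma> f \<longleftrightarrow> (\<forall>r. f differentiable (at r)) \<and>
     (\<forall>K. compact K \<longrightarrow> (\<exists>C. \<forall>r\<in>K. \<forall>t\<in>K. \<bar>deriv f r - deriv f t\<bar> \<le> C * \<bar>r - t\<bar> powr \<gamma>))"

definition Linf_on :: "'a::euclidean_space set \<Rightarrow> ('a \<Rightarrow> real) \<Rightarrow> bool" where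
  "Linf_on A w \<longleftrightarrow> set_borel_measurable lebesgue A w \<and>
     (\<exists>C. AE p in lebesgue. p \<in> A \<longrightarrow> \<bar>w p\<bar> \<le> C)"

definition Linf_loc :: "'a::euclidean_space set \<Rightarrow> ('a \<Rightarrow> real) \<Rightarrow> bool" where
  "Linf_loc S w \<longleftrightarrow> (\<forall>K. compact K \<and> K \<subseteq> S \<longrightarrow> Linf_on K w)"

definition loc_lipschitz_on :: "'a::metric_space set \<Rightarrow> ('a \<Rightarrow> real) \<Rightarrow> bool" where
  "loc_lipschitz_on S w \<longleftrightarrow> (\<forall>p\<in>S. \<exists>r>0. \<exists>L. L-lipschitz_on (ball p r \<inter> S) w)"


subsection \<open>Weak and stable solutions\<close>

text \<open>
  The boundary value on \<open>y = 0\<close>. If \<open>w\<close> is locally Lipschitz in the half-space and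
  \<open>y\<^sup>a \<bar>\<partial>\<^sub>y w\<bar>\<^sup>2\<close> is integrable on half-balls, then, because \<open>a < 1\<close>, the function \<open>\<partial>\<^sub>y w(x, \<cdot>)\<close> is
  integrable near \<open>0\<close> for almost every \<open>x\<close>, so this limit exists almost everywhere.
\<close>

definition trace0 :: "(point \<Rightarrow> real) \<Rightarrow> real ^ 3 \<Rightarrow> real" where
  "trace0 w x = Lim (at_right 0) (\<lambda>y. w (x, y))"

text \<open>
  The partial derivatives of a locally Lipschitz \<open>\<xi>\<close> exist almost everywhere, so \<open>grad_ext \<xi>\<close>
  is meaningful under the integral sign.
\<close>

definition admissible :: "real \<Rightarrow> (point \<Rightarrow> real) \<Rightarrow> bool" where
  "admissible a \<xi> \<longleftrightarrow> bounded (\<xi> ` half_space) \<and> loc_lipschitz_on half_space \<xi> \<and>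
     (\<exists>R>0. (\<forall>p \<in> half_space - ball 0 R. \<xi> p = 0) \<and>
            set_integrable lebesgue (half_ball R) (\<lambda>p. snd p powr a * (norm (grad_ext \<xi> p))\<^sup>2))"

text \<open>
  Weak solutions of \<open>div(y\<^sup>a \<nabla>u) = 0\<close> for \<open>y > 0\<close> with \<open>- y\<^sup>a u\<^sub>y = f(u)\<close> on \<open>y = 0\<close>. The
  gradient is the pointwise one, so the notion is meant for \<open>u\<close> of class \<open>C\<^sup>1\<close> in the half-space.
\<close>

definition weak_solution :: "real \<Rightarrow> (real \<Rightarrow> real) \<Rightarrow> (point \<Rightarrow> real) \<Rightarrow> bool" where
  "weak_solution a f u \<longleftrightarrow>
     Linf_loc (closure half_space) u \<and>
     (\<forall>R>0. set_integrable lebesgue (half_ball R) (\<lambda>p. snd p powr a * (norm (grad_ext u p))\<^sup>2)) \<and>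
     (\<forall>\<xi>. admissible a \<xi> \<longrightarrow>
        (LINT p:half_space|lebesgue. snd p powr a * (grad_ext u p \<bullet> grad_ext \<xi> p))
        = (LINT x|lebesgue. f (trace0 u x) * trace0 \<xi> x))"

definition stable_solution :: "real \<Rightarrow> (real \<Rightarrow> real) \<Rightarrow> (point \<Rightarrow> real) \<Rightarrow> bool" where
  "stable_solution a f u \<longleftrightarrow> (\<forall>\<xi>. admissible a \<xi> \<longrightarrow>
     (LINT p:half_space|lebesgue. snd p powr a * (norm (grad_ext \<xi> p))\<^sup>2)
     - (LINT x|lebesgue. deriv f (trace0 u x) * (trace0 \<xi> x)\<^sup>2) \<ge> 0)"


subsection \<open>Geometry of the level sets\<close>

text \<open>
  These are used only where \<open>grad_H u p \<noteq> 0\<close>. None of \<open>X\<close>, \<open>Y\<close>, \<open>T\<close> differentiates in \<open>y\<close>, so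
  they describe the level sets of \<open>u(\<cdot>, y)\<close> for fixed \<open>y\<close>.
\<close>

definition normal_H :: "(point \<Rightarrow> real) \<Rightarrow> point \<Rightarrow> real ^ 2" where
  "normal_H u p = (1 / norm (grad_H u p)) *\<^sub>R grad_H u p"

definition tangent_H :: "(point \<Rightarrow> real) \<Rightarrow> point \<Rightarrow> real ^ 2" where
  "tangent_H u p = (1 / norm (grad_H u p)) *\<^sub>R vector [Y_H u p, - X_H u p]"

definition mean_curv :: "(point \<Rightarrow> real) \<Rightarrow> point \<Rightarrow> real" where
  "mean_curv u p = div_H (normal_H u) p"

definition imag_curv :: "(point \<Rightarrow> real) \<Rightarrow> point \<Rightarrow> real" where
  "imag_curv u p = - T_H u p / norm (grad_H u p)"

definition T_normal :: "(point \<Rightarrow> real) \<Rightarrow> point \<Rightarrow> real ^ 2" where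
  "T_normal u p = vector [T_H (\<lambda>q. normal_H u q $ 1) p, T_H (\<lambda>q. normal_H u q $ 2) p]"

definition eta :: "real \<Rightarrow> (point \<Rightarrow> real) \<Rightarrow> real \<Rightarrow> real" where
  "eta a u \<tau> = (LINT p:gauge_ball \<tau>|lebesgue.
     4 * snd p powr a * (norm (grad_H u p))\<^sup>2 * ((fst p $ 1)\<^sup>2 + (fst p $ 2)\<^sup>2 + (snd p)\<^sup>2))"

end

(*
The fields W generating left translations commute with X and Y, so W u solves the linearised
equation, once it is known to have locally finite energy. That follows from a Caccioppoli estimate
for the difference quotients of u along left translations; its right hand side is controlled by
duality, because W is a combination of X, Y and T = [X, Y], and X u, Y u are locally bounded.
As X u and Y u are combinations of the W u with coefficients x_1, x_2, they solve the linearised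
equation up to commutator terms. Testing it with X u phi^2 and Y u phi^2, and the stability
inequality with |grad_H u| phi, yields

  int y^a (K + S) phi^2 <= int y^a |grad_H u|^2 |grad phi|^2,

where K >= 0 is |grad X u|^2 + |grad Y u|^2 - |grad |grad_H u||^2 and S is a positive multiple of
<T nu, v>. For a logarithmic cutoff phi the growth condition makes the right hand side arbitrarily
small, hence K = 0: the direction of grad_H u is constant along X and Y, and both conclusions are
algebraic consequences of this.
*)

theory Submission
  imports Defs "HOL-Analysis.Analysis"
begin

text \<open>No bound on T u near y = 0 is available, so the difference quotients w of u cannot be
  bounded in L^2 directly. Moving X and Y off the commutator pairs w with a test function psi at the
  cost of psi, X psi and Y psi only. For psi = w zeta^2 this cost contains the gradient of w again,
  but linearly, whereas the pairing is quadratic: the cost is at most a small multiple of mass plus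
  energy, plus a constant, and can be absorbed. Second derivatives of u are controlled only away
  from y = 0, so these integrations by parts take place on y > d. The cutoff may be sharp because no
  field involved moves y, and the constants do not depend on d. The boundary condition is nonlinear;
  passing to the limit in it needs convergence of the traces of w, obtained by comparison with a
  slice at small height. The two terms of the growth condition come from writing 1 / r^4 as 1 / R^4
  plus the integral of 4 / t^5 from r to R and exchanging integrals.\<close>

lemma vector_3' [simp]:
  "(vector [x, y, z] :: real^3) $ 1 = x" "(vector [x, y, z] :: real^3) $ 2 = y"
  "(vector [x, y, z] :: real^3) $ 3 = z"
  by (simp_all add: vector_3)

lemma vector_2' [simp]:
  "(vector [x, y] :: real^2) $ 1 = x" "(vector [x, y] :: real^2) $ 2 = y"
  by (simp_all add: vector_2)

lemma open_half_space: "open half_space"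
  unfolding half_space_def by (intro open_Collect_less continuous_intros)

section \<open>Derivatives along vector fields and functions of class C^1 on the half-space\<close>

definition dV :: "(point \<Rightarrow> point) \<Rightarrow> (point \<Rightarrow> real) \<Rightarrow> point \<Rightarrow> real" where
  "dV V F p = frechet_derivative F (at p) (V p)"

text \<open>Continuity is asked of each directional derivative separately. In finite dimension this
  amounts to continuity of the derivative, and operator norms are avoided.\<close>

definition C1 :: "(point \<Rightarrow> real) \<Rightarrow> bool" where
  "C1 F \<longleftrightarrow> (\<forall>p\<in>half_space. F differentiable (at p)) \<and>
     (\<forall>v. continuous_on half_space (dV (\<lambda>_. v) F))"

definition C2 :: "(point \<Rightarrow> real) \<Rightarrow> bool" where
  "C2 F \<longleftrightarrow> C1 F \<and> (\<forall>v. C1 (dV (\<lambda>_. v) F))"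

text \<open>For \<open>c = 2\<close> the field \<open>b\<^sub>1 X + b\<^sub>2 Y + b\<^sub>3 \<partial>\<^sub>3\<close>, whose flow consists of right translations; for \<open>c = - 2\<close>
  the field generating left translations, which therefore commutes with \<open>X\<close> and \<open>Y\<close>.\<close>

definition vf :: "real^3 \<Rightarrow> real \<Rightarrow> point \<Rightarrow> point" where
  "vf b c p = (vector [b$1, b$2, b$3 + c * (b$1 * fst p$2 - b$2 * fst p$1)], 0)"

text \<open>The frame X, Y, d/dy of the extended space, indexed so that gradients become sums over
  \<open>UNIV\<close>.\<close>

definition fr :: "3 \<Rightarrow> point \<Rightarrow> point" where
  "fr k p = (if k = 1 then vf (vector [1, 0, 0]) 2 p else
             if k = 2 then vf (vector [0, 1, 0]) 2 p else (0, 1))"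

text \<open>The Euler step is the exact flow: \<open>vf b c\<close> is constant along these straight
  lines (\<open>vf_flow\<close>).\<close>

definition flow :: "real^3 \<Rightarrow> real \<Rightarrow> real \<Rightarrow> point \<Rightarrow> point" where
  "flow b c s p = p + s *\<^sub>R vf b c p"

abbreviation G :: "3 \<Rightarrow> (point \<Rightarrow> real) \<Rightarrow> point \<Rightarrow> real" where
  "G k \<equiv> dV (fr k)"

lemma dV_eq: "(F has_derivative F') (at p) \<Longrightarrow> dV V F p = F' (V p)"
  by (simp add: dV_def frechet_derivative_at[symmetric])

lemma C1_has_derivative:
  assumes "C1 F" "p \<in> half_space"
  shows "(F has_derivative (\<lambda>v. dV (\<lambda>_. v) F p)) (at p)"
  using assms frechet_derivative_works[of F "at p"] by (simp add: C1_def dV_def)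

lemma C1I:
  assumes "\<And>p. p \<in> half_space \<Longrightarrow> (F has_derivative F' p) (at p)"
    and "\<And>v. continuous_on half_space (\<lambda>p. F' p v)"
  shows "C1 F"
proof -
  have "dV (\<lambda>_. v) F p = F' p v" if "p \<in> half_space" for v p
    using dV_eq[OF assms(1)[OF that]] .
  then have "dV (\<lambda>_. v) F p = F' p v" if "p \<in> half_space" for p v using that by blast
  moreover have "F differentiable (at p)" if "p \<in> half_space" for p
    using assms(1)[OF that] unfolding differentiable_def by blast
  moreover have "continuous_on half_space (dV (\<lambda>_. v) F)" for v
    by (rule continuous_on_eq[OF assms(2)]) (simp add: calculation(1))
  ultimately show ?thesis unfolding C1_def by blast
qed

lemma C1_continuous: "C1 F \<Longrightarrow> continuous_on half_space F"
  by (meson C1_has_derivative continuous_at_imp_continuous_on has_derivative_continuous)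

lemma C1_continuous_dV: "C1 F \<Longrightarrow> continuous_on half_space (dV (\<lambda>_. v) F)"
  unfolding C1_def by blast

lemma dV_linear:
  assumes "C1 F" "p \<in> half_space"
  shows "linear (\<lambda>v. dV (\<lambda>_. v) F p)"
  using C1_has_derivative[OF assms] has_derivative_linear by blast

lemma dV_frozen: "dV V F p = dV (\<lambda>_. V p) F p"
  by (simp add: dV_def)

lemma dV_Basis:
  assumes "C1 F" "p \<in> half_space"
  shows "dV V F p = (\<Sum>e\<in>Basis. (V p \<bullet> e) * dV (\<lambda>_. e) F p)"
proof -
  have "dV V F p = dV (\<lambda>_. (\<Sum>e\<in>Basis. (V p \<bullet> e) *\<^sub>R e)) F p"
    by (subst dV_frozen) (simp add: euclidean_representation)
  also have "\<dots> = (\<Sum>e\<in>Basis. (V p \<bullet> e) * dV (\<lambda>_. e) F p)"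
    by (simp only: linear_sum[OF dV_linear[OF assms]] linear_cmul[OF dV_linear[OF assms]]
        real_scaleR_def)
  finally show ?thesis .
qed

lemma continuous_on_dV [continuous_intros]:
  assumes "C1 F" "continuous_on half_space V"
  shows "continuous_on half_space (dV V F)"
proof -
  have "continuous_on half_space (\<lambda>p. \<Sum>e\<in>Basis. (V p \<bullet> e) * dV (\<lambda>_. e) F p)"
    using assms by (intro continuous_intros C1_continuous_dV) auto
  then show ?thesis by (rule continuous_on_eq) (simp add: dV_Basis[OF assms(1)])
qed

lemma vf_alt: "vf b c p = (b + (c * (b$1 * fst p$2 - b$2 * fst p$1)) *\<^sub>R axis 3 1, 0)"
  by (simp add: vf_def vec_eq_iff forall_3 axis_def)

lemma continuous_vf [continuous_intros]: "continuous_on S (vf b c)"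
  unfolding vf_alt by (intro continuous_intros)

lemma continuous_fr [continuous_intros]: "continuous_on S (fr k)"
proof -
  consider "fr k = vf (vector [1,0,0]) 2" | "fr k = vf (vector [0,1,0]) 2" | "fr k = (\<lambda>_. (0, 1))"
    by (force simp: fr_def fun_eq_iff)
  then show ?thesis by cases (auto intro: continuous_intros)
qed

lemma C1_vf_continuous: "C1 F \<Longrightarrow> continuous_on half_space (dV (vf b c) F)"
  by (intro continuous_intros)

lemma C1_G_continuous: "C1 F \<Longrightarrow> continuous_on half_space (G k F)"
  by (intro continuous_intros)

lemma C1_const [simp, intro]: "C1 (\<lambda>_. c)"
  by (rule C1I[where F'="\<lambda>_ _. 0"]) auto

lemma dV_const [simp]: "dV V (\<lambda>_. c) p = 0"
  by (rule dV_eq[THEN trans]) (auto intro: derivative_eq_intros)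

lemma C1_add: assumes "C1 F" "C1 K" shows "C1 (\<lambda>p. F p + K p)"
  by (rule C1I[OF has_derivative_add[OF C1_has_derivative C1_has_derivative]])
     (use assms in \<open>auto intro!: continuous_intros C1_continuous_dV\<close>)

lemma C1_diff: assumes "C1 F" "C1 K" shows "C1 (\<lambda>p. F p - K p)"
  by (rule C1I[OF has_derivative_diff[OF C1_has_derivative C1_has_derivative]])
     (use assms in \<open>auto intro!: continuous_intros C1_continuous_dV\<close>)

lemma C1_mult: assumes "C1 F" "C1 K" shows "C1 (\<lambda>p. F p * K p)"
proof (rule C1I[OF has_derivative_mult[OF C1_has_derivative C1_has_derivative]])
  fix v :: point
  show "continuous_on half_space (\<lambda>p. F p * dV (\<lambda>_. v) K p + dV (\<lambda>_. v) F p * K p)"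
    by (intro continuous_intros C1_continuous_dV C1_continuous assms)
qed (use assms in auto)

lemma C1_cmult: "C1 F \<Longrightarrow> C1 (\<lambda>p. c * F p)"
  by (rule C1_mult) auto

lemma C1_power: "C1 F \<Longrightarrow> C1 (\<lambda>p. F p ^ n)"
  by (induction n) (auto intro: C1_mult)

lemma C1_linear: assumes "bounded_linear F" shows "C1 F"
  by (rule C1I[where F'="\<lambda>_. F"]) (use assms in \<open>auto intro: bounded_linear_imp_has_derivative\<close>)

lemma bl_coord: "bounded_linear (\<lambda>p::point. fst p $ i)"
  by (rule bounded_linear_compose[OF bounded_linear_vec_nth bounded_linear_fst])

lemma C1_coord: "C1 (\<lambda>p. fst p $ i)"
  by (rule C1_linear[OF bl_coord])

lemma C1_snd: "C1 snd"
  by (rule C1_linear[OF bounded_linear_snd])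

lemma dV_coord [simp]: "dV V (\<lambda>p. fst p $ i) p = fst (V p) $ i"
  by (rule dV_eq[OF bounded_linear_imp_has_derivative[OF bl_coord]])

lemma dV_snd [simp]: "dV V snd p = snd (V p)"
  by (rule dV_eq[OF bounded_linear_imp_has_derivative[OF bounded_linear_snd]])

lemma has_derivative_comp:
  assumes "C1 F" "p \<in> half_space" "(h has_real_derivative h' (F p)) (at (F p))"
  shows "((\<lambda>p. h (F p)) has_derivative (\<lambda>v. h' (F p) * dV (\<lambda>_. v) F p)) (at p)"
  using has_derivative_compose[OF C1_has_derivative[OF assms(1,2)]
      assms(3)[unfolded has_field_derivative_def]] .

lemma C1_comp:
  assumes "C1 F" "\<And>p. p \<in> half_space \<Longrightarrow> (h has_real_derivative h' (F p)) (at (F p))"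
    "continuous_on (F ` half_space) h'"
  shows "C1 (\<lambda>p. h (F p))"
proof (rule C1I[OF has_derivative_comp[where h=h and h'=h' and F=F]])
  fix v :: point
  show "continuous_on half_space (\<lambda>p. h' (F p) * dV (\<lambda>_. v) F p)"
    by (intro continuous_intros C1_continuous_dV assms
        continuous_on_compose2[OF assms(3) C1_continuous[OF assms(1)]]) auto
qed (use assms in auto)

lemma dV_comp:
  assumes "C1 F" "p \<in> half_space" "(h has_real_derivative h') (at (F p))"
  shows "dV V (\<lambda>p. h (F p)) p = h' * dV V F p"
  using dV_eq[OF has_derivative_comp[OF assms(1,2), of h "\<lambda>_. h'"], of V] assms(3)
  by (simp add: dV_frozen[of V])

lemma dV_add: assumes "C1 F" "C1 K" "p \<in> half_space"
  shows "dV V (\<lambda>p. F p + K p) p = dV V F p + dV V K p"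
  using dV_eq[OF has_derivative_add[OF C1_has_derivative C1_has_derivative], of F p K V] assms
  by (simp add: dV_frozen[of V])

lemma dV_diff: assumes "C1 F" "C1 K" "p \<in> half_space"
  shows "dV V (\<lambda>p. F p - K p) p = dV V F p - dV V K p"
  using dV_eq[OF has_derivative_diff[OF C1_has_derivative C1_has_derivative], of F p K V] assms
  by (simp add: dV_frozen[of V])

lemma dV_mult: assumes "C1 F" "C1 K" "p \<in> half_space"
  shows "dV V (\<lambda>p. F p * K p) p = F p * dV V K p + dV V F p * K p"
  using dV_eq[OF has_derivative_mult[OF C1_has_derivative C1_has_derivative], of F p K V] assms
  by (simp add: dV_frozen[of V])

lemma dV_cmult: assumes "C1 F" "p \<in> half_space"
  shows "dV V (\<lambda>p. c * F p) p = c * dV V F p"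
  using dV_mult[of "\<lambda>_. c" F p V] assms by simp

lemma dV_power2: assumes "C1 F" "p \<in> half_space"
  shows "dV V (\<lambda>p. (F p)\<^sup>2) p = 2 * F p * dV V F p"
  using dV_mult[of F F p V] assms by (simp add: power2_eq_square)

lemma dV_power4: assumes "C1 F" "p \<in> half_space"
  shows "dV V (\<lambda>p. (F p)^4) p = 4 * F p ^ 3 * dV V F p"
proof -
  have "dV V (\<lambda>p. ((F p)\<^sup>2)\<^sup>2) p = 4 * F p ^ 3 * dV V F p"
    using dV_power2[OF C1_power[OF assms(1), of 2] assms(2), of V] dV_power2[OF assms, of V]
    by (simp add: power2_eq_square power3_eq_cube)
  then show ?thesis by (simp flip: power_mult)
qed

text \<open>The half-space is open, so agreement on it is agreement near p. This allows an
  expression to be rewritten pointwise underneath a further derivative.\<close>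

lemma dV_cong:
  assumes "C1 F" "p \<in> half_space" "\<And>q. q \<in> half_space \<Longrightarrow> F q = K q"
  shows "dV V K p = dV V F p"
proof -
  have "(K has_derivative (\<lambda>v. dV (\<lambda>_. v) F p)) (at p)"
    by (rule has_derivative_transform_within_open[OF C1_has_derivative open_half_space])
       (use assms in auto)
  from dV_eq[OF this, of V] show ?thesis by (simp add: dV_frozen[of V F])
qed

lemma C1_cong:
  assumes "C1 F" "\<And>q. q \<in> half_space \<Longrightarrow> F q = K q"
  shows "C1 K"
proof (rule C1I[OF has_derivative_transform_within_open[OF C1_has_derivative open_half_space]])
  show "continuous_on half_space (dV (\<lambda>_. v) F)" for v
    by (rule C1_continuous_dV[OF assms(1)])
qed (use assms in auto)

section \<open>The operators X, Y, T and d/dy as directional derivatives\<close>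

lemma dx_has_derivative:
  assumes "(F has_derivative D) (at p)"
  shows "dx i F p = D (axis i 1, 0)"
proof -
  interpret D: bounded_linear D using assms by (rule has_derivative_bounded_linear)
  have "((\<lambda>t. (fst p + t *\<^sub>R axis i 1, snd p)) has_derivative (\<lambda>t. (t *\<^sub>R axis i 1, 0))) (at 0)"
    by (auto intro!: derivative_eq_intros)
  moreover have "(F has_derivative D) (at (fst p + 0 *\<^sub>R axis i 1, snd p))" using assms by simp
  ultimately have "((\<lambda>t. F (fst p + t *\<^sub>R axis i 1, snd p)) has_derivative (\<lambda>t. D (t *\<^sub>R axis i 1, 0))) (at 0)"
    using has_derivative_compose by blast
  moreover have "D (t *\<^sub>R axis i 1, 0) = D (axis i 1, 0) * t" for t
    using D.scaleR[of t "(axis i 1, 0)"] by simp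
  ultimately have "((\<lambda>t. F (fst p + t *\<^sub>R axis i 1, snd p)) has_real_derivative D (axis i 1, 0)) (at 0)"
    by (simp add: has_field_derivative_def)
  then show ?thesis unfolding dx_def by (rule DERIV_imp_deriv)
qed

lemma XYT_has_derivative:
  assumes "(F has_derivative D) (at p)"
  shows "X_H F p = D (fr 1 p)" "Y_H F p = D (fr 2 p)" "T_H F p = - 4 * D (axis 3 1, 0)"
proof -
  interpret D: bounded_linear D using assms by (rule has_derivative_bounded_linear)
  have 1: "fr 1 p = (axis 1 1, 0) + (2 * fst p $ 2) *\<^sub>R (axis 3 1, 0)"
    by (simp add: fr_def vf_def vec_eq_iff forall_3 axis_def)
  have 2: "fr 2 p = (axis 2 1, 0) - (2 * fst p $ 1) *\<^sub>R (axis 3 1, 0)"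
    by (simp add: fr_def vf_def vec_eq_iff forall_3 axis_def)
  show "X_H F p = D (fr 1 p)" unfolding 1 D.add D.scaleR
    by (simp add: X_H_def dx_has_derivative[OF assms])
  show "Y_H F p = D (fr 2 p)" unfolding 2 D.diff D.scaleR
    by (simp add: Y_H_def dx_has_derivative[OF assms])
  show "T_H F p = - 4 * D (axis 3 1, 0)" by (simp add: T_H_def dx_has_derivative[OF assms])
qed

lemma dy_has_derivative: assumes "C1 F" "p \<in> half_space"
  shows "((\<lambda>t. F (fst p, t)) has_real_derivative G 3 F p) (at (snd p))"
proof -
  have "((\<lambda>t. (fst p, t)) has_derivative (\<lambda>t. (0, t))) (at (snd p))"
    by (auto intro!: derivative_eq_intros)
  moreover have "(F has_derivative (\<lambda>v. dV (\<lambda>_. v) F p)) (at (fst p, snd p))"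
    using C1_has_derivative[OF assms] by simp
  ultimately have "((\<lambda>t. F (fst p, t)) has_derivative (\<lambda>t. dV (\<lambda>_. (0, t)) F p)) (at (snd p))"
    using has_derivative_compose by blast
  moreover have "dV (\<lambda>_. (0, t)) F p = G 3 F p * t" for t
    using linear_cmul[OF dV_linear[OF assms], of t "(0, 1)"]
    by (simp add: dV_frozen[of "fr 3"] fr_def)
  ultimately show ?thesis
    by (simp add: has_field_derivative_def)
qed

lemma dV_fr_cases: assumes "C1 F" "p \<in> half_space"
  shows "G 1 F p = dV (\<lambda>_. (axis 1 1, 0)) F p + 2 * fst p $ 2 * dV (\<lambda>_. (axis 3 1, 0)) F p"
    "G 2 F p = dV (\<lambda>_. (axis 2 1, 0)) F p - 2 * fst p $ 1 * dV (\<lambda>_. (axis 3 1, 0)) F p"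
proof -
  note l = dV_linear[OF assms]
  have 1: "fr 1 p = (axis 1 1, 0) + (2 * fst p $ 2) *\<^sub>R (axis 3 1, 0)"
    by (simp add: fr_def vf_def vec_eq_iff forall_3 axis_def)
  have 2: "fr 2 p = (axis 2 1, 0) - (2 * fst p $ 1) *\<^sub>R (axis 3 1, 0)"
    by (simp add: fr_def vf_def vec_eq_iff forall_3 axis_def)
  show "G 1 F p = dV (\<lambda>_. (axis 1 1, 0)) F p + 2 * fst p $ 2 * dV (\<lambda>_. (axis 3 1, 0)) F p"
    unfolding dV_frozen[of "fr 1"] 1 linear_add[OF l] linear_cmul[OF l] by simp
  show "G 2 F p = dV (\<lambda>_. (axis 2 1, 0)) F p - 2 * fst p $ 1 * dV (\<lambda>_. (axis 3 1, 0)) F p"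
    unfolding dV_frozen[of "fr 2"] 2 linear_diff[OF l] linear_cmul[OF l] by simp
qed

lemma XYy_eq: assumes "C1 F" "p \<in> half_space"
  shows "X_H F p = G 1 F p" "Y_H F p = G 2 F p" "dy F p = G 3 F p"
  using XYT_has_derivative(1,2)[OF C1_has_derivative[OF assms]]
    DERIV_imp_deriv[OF dy_has_derivative[OF assms]]
  by (simp_all add: dV_frozen[of "fr _"] dy_def)

lemma grad_ext_inner: assumes "C1 F" "C1 K" "p \<in> half_space"
  shows "grad_ext F p \<bullet> grad_ext K p = (\<Sum>k\<in>UNIV. G k F p * G k K p)"
  using assms by (simp add: grad_ext_def inner_vec_def sum_3 XYy_eq)

lemma grad_ext_norm2: assumes "C1 F" "p \<in> half_space"
  shows "(norm (grad_ext F p))\<^sup>2 = (\<Sum>k\<in>UNIV. (G k F p)\<^sup>2)"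
  unfolding power2_norm_eq_inner grad_ext_inner[OF assms(1,1,2)] by (simp add: power2_eq_square)

lemma grad_H_norm2: assumes "C1 F" "p \<in> half_space"
  shows "(norm (grad_H F p))\<^sup>2 = (G 1 F p)\<^sup>2 + (G 2 F p)\<^sup>2"
  unfolding power2_norm_eq_inner
  using assms by (simp add: grad_H_def inner_vec_def sum_2 XYy_eq power2_eq_square)

lemma C2_on_imp_C2: assumes "C2_on half_space u" shows "C2 u"
proof -
  obtain w' w'' where w: "\<And>p. p \<in> half_space \<Longrightarrow> (u has_derivative blinfun_apply (w' p)) (at p)"
    "\<And>p. p \<in> half_space \<Longrightarrow> (w' has_derivative blinfun_apply (w'' p)) (at p)"
    "continuous_on half_space w''" using assms unfolding C2_on_def by blast
  have cw': "continuous_on half_space w'"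
    by (meson w(2) continuous_at_imp_continuous_on has_derivative_continuous)
  have 1: "C1 u" by (rule C1I[OF w(1)]) (auto intro!: continuous_intros cw')
  have "C1 (\<lambda>p. w' p v)" for v
  proof (rule C1I)
    fix p :: point assume "p \<in> half_space"
    from w(2)[OF this]
    show "((\<lambda>p. w' p v) has_derivative (\<lambda>h. w'' p h v)) (at p)"
      using bounded_linear.has_derivative[OF bounded_linear_apply_blinfun, of w' "w'' p" _ v ]
      by (auto intro!: derivative_eq_intros)
  qed (auto intro!: continuous_intros w(3))
  then have "C1 (dV (\<lambda>_. v) u)" for v
    by (rule C1_cong) (simp add: dV_eq[OF w(1)])
  with 1 show ?thesis by (simp add: C2_def)
qed

lemma C2_C1: "C2 u \<Longrightarrow> C1 u" and C2_dV: "C2 u \<Longrightarrow> C1 (dV (\<lambda>_. v) u)"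
  unfolding C2_def by blast+

lemma C1_dV:
  assumes "C2 u" "\<And>e. e \<in> Basis \<Longrightarrow> C1 (\<lambda>p. V p \<bullet> e)"
  shows "C1 (dV V u)"
proof -
  have "C1 (\<lambda>p. \<Sum>e\<in>S. (V p \<bullet> e) * dV (\<lambda>_. e) u p)" if "S \<subseteq> Basis" for S
    using finite_subset[OF that finite_Basis] that
    by (induction S rule: finite_induct)
       (auto intro!: C1_add C1_mult assms C2_dV)
  from this[of Basis] show ?thesis
    by (rule C1_cong) (auto simp: dV_Basis[OF C2_C1[OF assms(1)], of _ V])
qed

lemma C1_vf_inner: "C1 (\<lambda>p. vf b c p \<bullet> e)"
  unfolding vf_alt inner_prod_def fst_conv snd_conv inner_add_left inner_scaleR_left
  by (intro C1_add C1_mult C1_diff C1_const C1_coord)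

lemma C1_fr_inner: "C1 (\<lambda>p. fr k p \<bullet> e)"
proof -
  consider "fr k = vf (vector [1,0,0]) 2" | "fr k = vf (vector [0,1,0]) 2" | "fr k = (\<lambda>_. (0, 1))"
    by (force simp: fr_def fun_eq_iff)
  then show ?thesis by cases (auto simp: C1_vf_inner)
qed

lemma C2_vf: "C2 u \<Longrightarrow> C1 (dV (vf b c) u)"
  by (rule C1_dV) (auto intro: C1_vf_inner)

lemma C2_G: "C2 u \<Longrightarrow> C1 (G k u)"
  by (rule C1_dV) (auto intro: C1_fr_inner)

section \<open>Symmetry of second derivatives\<close>

lemma line_derivative:
  assumes "C1 F" "p + t *\<^sub>R v \<in> half_space"
  shows "((\<lambda>t. F (p + t *\<^sub>R v)) has_real_derivative dV (\<lambda>_. v) F (p + t *\<^sub>R v)) (at t)"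
proof -
  have "((\<lambda>t. p + t *\<^sub>R v) has_derivative (\<lambda>t. t *\<^sub>R v)) (at t)"
    by (auto intro!: derivative_eq_intros)
  from has_derivative_compose[OF this C1_has_derivative[OF assms]]
  show ?thesis
    using linear_cmul[OF dV_linear[OF assms]]
    by (simp add: has_field_derivative_def mult.commute[of _ "dV _ _ _"])
qed

text \<open>The mean value theorem is applied twice: in direction v to the increment of u by h w,
  then in direction w to the first derivative. The left side is symmetric in v and w, which is what
  \<open>dV_commute\<close> exploits.\<close>

lemma second_difference:
  assumes "C2 u" "h > 0" "cball p (h * (norm v + norm w)) \<subseteq> half_space"
  shows "\<exists>q \<in> cball p (h * (norm v + norm w)).
    u (p + h *\<^sub>R v + h *\<^sub>R w) - u (p + h *\<^sub>R v) - u (p + h *\<^sub>R w) + u p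
      = h * h * dV (\<lambda>_. w) (dV (\<lambda>_. v) u) q"
proof -
  have mem: "p + s *\<^sub>R v + t *\<^sub>R w \<in> cball p (h * (norm v + norm w))"
    if "0 \<le> s" "s \<le> h" "0 \<le> t" "t \<le> h" for s t
  proof -
    have "norm (s *\<^sub>R v + t *\<^sub>R w) \<le> s * norm v + t * norm w"
      using that by (metis norm_triangle_ineq norm_scaleR abs_of_nonneg)
    also have "\<dots> \<le> h * norm v + h * norm w"
      using that by (intro add_mono mult_right_mono) auto
    finally have "norm (- (s *\<^sub>R v + t *\<^sub>R w)) \<le> h * (norm v + norm w)"
      by (simp only: norm_minus_cancel distrib_left)
    then show ?thesis by (simp add: dist_norm algebra_simps)
  qed
  have memH: "p + s *\<^sub>R v + t *\<^sub>R w \<in> half_space"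
    if "0 \<le> s" "s \<le> h" "0 \<le> t" "t \<le> h" for s t
    using mem[OF that] assms(3) by blast
  let ?f = "\<lambda>s. u ((p + h *\<^sub>R w) + s *\<^sub>R v) - u (p + s *\<^sub>R v)"
  have "\<exists>z>0. z < h \<and> ?f h - ?f 0 = (h - 0) *
     (dV (\<lambda>_. v) u ((p + h *\<^sub>R w) + z *\<^sub>R v) - dV (\<lambda>_. v) u (p + z *\<^sub>R v))"
    using assms(2)
  proof (rule MVT2)
    fix x assume x: "0 \<le> x" "x \<le> h"
    show "(?f has_real_derivative
       (dV (\<lambda>_. v) u ((p + h *\<^sub>R w) + x *\<^sub>R v) - dV (\<lambda>_. v) u (p + x *\<^sub>R v))) (at x)"
      using memH[of x h] memH[of x 0] x assms(2)
      by (intro DERIV_diff line_derivative C2_C1[OF assms(1)]) (auto simp: algebra_simps)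
  qed
  then obtain z where z: "z > 0" "z < h" "?f h - ?f 0 = h *
     (dV (\<lambda>_. v) u ((p + z *\<^sub>R v) + h *\<^sub>R w) - dV (\<lambda>_. v) u (p + z *\<^sub>R v))"
    by (auto simp: algebra_simps)
  let ?g = "\<lambda>t. dV (\<lambda>_. v) u ((p + z *\<^sub>R v) + t *\<^sub>R w)"
  have "\<exists>y>0. y < h \<and> ?g h - ?g 0 = (h - 0) * dV (\<lambda>_. w) (dV (\<lambda>_. v) u) ((p + z *\<^sub>R v) + y *\<^sub>R w)"
    using assms(2)
  proof (rule MVT2)
    fix x assume x: "0 \<le> x" "x \<le> h"
    show "(?g has_real_derivative dV (\<lambda>_. w) (dV (\<lambda>_. v) u) ((p + z *\<^sub>R v) + x *\<^sub>R w)) (at x)"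
      using memH[of z x] x z by (intro line_derivative C2_dV[OF assms(1)]) auto
  qed
  then obtain y where y: "y > 0" "y < h"
    "?g h - ?g 0 = h * dV (\<lambda>_. w) (dV (\<lambda>_. v) u) ((p + z *\<^sub>R v) + y *\<^sub>R w)" by auto
  have "?f h - ?f 0 = h * h * dV (\<lambda>_. w) (dV (\<lambda>_. v) u) ((p + z *\<^sub>R v) + y *\<^sub>R w)"
    using z(3) y(3) by simp
  moreover have "?f h - ?f 0 = u (p + h *\<^sub>R v + h *\<^sub>R w) - u (p + h *\<^sub>R v) - u (p + h *\<^sub>R w) + u p"
    by (simp add: algebra_simps)
  ultimately show ?thesis using mem[of z y] z y by auto
qed

lemma half_dist_contradiction:
  fixes x y a b :: real
  assumes "x = y" "dist y a < dist a b / 2" "dist x b < dist a b / 2"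
  shows False
  using assms dist_triangle_half_r[of y a "dist a b" b] by (simp add: dist_commute)

text \<open>Both orders of differentiation, evaluated at points near p, represent the same second
  difference. Different values at p would contradict this for small h, by continuity.\<close>

theorem dV_commute:
  assumes "C2 u" "p \<in> half_space"
  shows "dV (\<lambda>_. v) (dV (\<lambda>_. w) u) p = dV (\<lambda>_. w) (dV (\<lambda>_. v) u) p"
proof (rule ccontr)
  let ?A = "dV (\<lambda>_. v) (dV (\<lambda>_. w) u)" and ?B = "dV (\<lambda>_. w) (dV (\<lambda>_. v) u)"
  assume "?A p \<noteq> ?B p"
  then have e: "dist (?A p) (?B p) / 2 > 0" by simp
  have cA: "isCont ?A p" and cB: "isCont ?B p"
    using C1_continuous_dV[OF C2_dV[OF assms(1)]] assms(2) open_half_space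
    by (simp_all add: continuous_on_eq_continuous_at)
  obtain d1 where d1: "d1 > 0" "\<And>q. dist q p < d1 \<Longrightarrow> dist (?A q) (?A p) < dist (?A p) (?B p) / 2"
    using cA e unfolding continuous_at_eps_delta by blast
  obtain d2 where d2: "d2 > 0" "\<And>q. dist q p < d2 \<Longrightarrow> dist (?B q) (?B p) < dist (?A p) (?B p) / 2"
    using cB e unfolding continuous_at_eps_delta by blast
  obtain d3 where d3: "d3 > 0" "ball p d3 \<subseteq> half_space"
    using open_half_space assms(2) openE by blast
  define d where "d = min d1 (min d2 d3)"
  \<comment> \<open>The summand 1 keeps c positive when v and w both vanish.\<close>
  obtain c where c: "c = norm v + norm w + 1" by simp
  define h where "h = d / (2 * c)"
  have n: "c > 0" unfolding c by (simp add: add_nonneg_pos)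
  have d: "d > 0" using d1 d2 d3 by (simp add: d_def)
  then have h: "h > 0" using n by (simp add: h_def)
  have "h * (norm v + norm w) \<le> h * c"
    unfolding c using h by (intro mult_left_mono) auto
  also have "\<dots> = d / 2" using n by (simp add: h_def)
  also have "\<dots> < d" using d by simp
  finally have hd: "h * (norm v + norm w) < d" .
  have sub: "cball p (h * (norm v + norm w)) \<subseteq> half_space"
    using hd d3 by (force simp: d_def)
  obtain q where q: "q \<in> cball p (h * (norm v + norm w))"
    "u (p + h *\<^sub>R v + h *\<^sub>R w) - u (p + h *\<^sub>R v) - u (p + h *\<^sub>R w) + u p = h * h * ?B q"
    using second_difference[OF assms(1) h sub] by blast
  obtain r where r: "r \<in> cball p (h * (norm v + norm w))"
    "u (p + h *\<^sub>R w + h *\<^sub>R v) - u (p + h *\<^sub>R w) - u (p + h *\<^sub>R v) + u p = h * h * ?A r"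
    using second_difference[OF assms(1) h, of p w v] sub by (auto simp: add.commute)
  have "h * h * ?B q = h * h * ?A r" using q(2) r(2) by (simp add: algebra_simps)
  then have "?B q = ?A r" using h by simp
  moreover have "dist (?A r) (?A p) < dist (?A p) (?B p) / 2"
  proof (rule d1(2))
    show "dist r p < d1" using r(1) hd by (simp add: d_def dist_commute)
  qed
  moreover have "dist (?B q) (?B p) < dist (?A p) (?B p) / 2"
  proof (rule d2(2))
    show "dist q p < d2" using q(1) hd by (simp add: d_def dist_commute)
  qed
  ultimately show False
    by (rule half_dist_contradiction)
qed

subsection \<open>Flows of the invariant vector fields\<close>

lemma flow_alt: "flow b c s p =
    (fst p + s *\<^sub>R (b + (c * (b$1 * fst p$2 - b$2 * fst p$1)) *\<^sub>R axis 3 1), snd p)"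
  by (simp add: flow_def vf_alt prod_eq_iff)

lemma snd_flow [simp]: "snd (flow b c s p) = snd p"
  by (simp add: flow_alt)

lemma flow_half_space [simp]: "flow b c s p \<in> half_space \<longleftrightarrow> p \<in> half_space"
  by (simp add: half_space_def)

lemma vf_flow [simp]: "vf b c (flow b c s p) = vf b c p"
  by (simp add: vf_def flow_alt vec_eq_iff forall_3 axis_def algebra_simps)

lemma flow_flow: "flow b c s (flow b c t p) = flow b c (s + t) p"
  unfolding flow_def[of b c s "flow b c t p"] vf_flow
  by (simp add: flow_def algebra_simps)

lemma flow_0 [simp]: "flow b c 0 p = p"
  by (simp add: flow_def)

lemma flow_inverse [simp]: "flow b c s (flow b c (- s) p) = p" "flow b c (- s) (flow b c s p) = p"
  by (simp_all add: flow_flow)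

lemma continuous_flow [continuous_intros]:
  "continuous_on S f \<Longrightarrow> continuous_on S g \<Longrightarrow> continuous_on S (\<lambda>x. flow b c (f x) (g x))"
  unfolding flow_alt by (intro continuous_intros)

lemma flow_has_derivative:
  "(flow b c s has_derivative (\<lambda>v. v + s *\<^sub>R ((c * (b$1 * fst v$2 - b$2 * fst v$1)) *\<^sub>R axis 3 1, 0))) (at p)"
proof -
  have "flow b c s = (\<lambda>p. p + s *\<^sub>R (b + (c * (b$1 * fst p$2 - b$2 * fst p$1)) *\<^sub>R axis 3 1, 0))"
    by (simp add: fun_eq_iff flow_alt prod_eq_iff)
  then show ?thesis
    by (auto intro!: derivative_eq_intros bounded_linear.has_derivative[OF bl_coord] simp: algebra_simps)
qed

lemma flow_comp_has_derivative:
  assumes "C1 F" "p \<in> half_space"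
  shows "((\<lambda>p. F (flow b c s p)) has_derivative
    (\<lambda>v. dV (\<lambda>_. v + s *\<^sub>R ((c * (b$1 * fst v$2 - b$2 * fst v$1)) *\<^sub>R axis 3 1, 0)) F (flow b c s p))) (at p)"
  by (rule has_derivative_compose[OF flow_has_derivative C1_has_derivative]) (use assms in auto)

lemma C1_flow: assumes "C1 F" shows "C1 (\<lambda>p. F (flow b c s p))"
proof (rule C1I[OF flow_comp_has_derivative[OF assms]])
  fix v :: point
  show "continuous_on half_space (\<lambda>p. dV (\<lambda>_. v + s *\<^sub>R ((c * (b$1 * fst v$2 - b$2 * fst v$1)) *\<^sub>R axis 3 1, 0)) F (flow b c s p))"
    by (rule continuous_on_compose2[OF C1_continuous_dV[OF assms], of _ "flow b c s"])
       (auto intro: continuous_intros)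
qed

text \<open>The derivative of a left translation carries the frame at p to the frame at the image of
  p.\<close>

lemma G_flow:
  assumes "C1 F" "p \<in> half_space"
  shows "G k (\<lambda>p. F (flow b (-2) s p)) p = G k F (flow b (-2) s p)"
proof -
  have "fr k p + s *\<^sub>R ((-2 * (b$1 * fst (fr k p)$2 - b$2 * fst (fr k p)$1)) *\<^sub>R axis 3 1, 0)
      = fr k (flow b (-2) s p)"
    by (auto simp: fr_def vf_def flow_alt vec_eq_iff forall_3 axis_def algebra_simps)
  then show ?thesis
    using dV_eq[OF flow_comp_has_derivative[OF assms], of "fr k" b "-2" s]
    by (simp add: dV_frozen[of "fr k" F])
qed

text \<open>Every field is invariant under its own flow.\<close>

lemma vf_comp_flow:
  assumes "C1 F" "p \<in> half_space"
  shows "dV (vf b c) (\<lambda>p. F (flow b c s p)) p = dV (vf b c) F (flow b c s p)"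
proof -
  have "vf b c p + s *\<^sub>R ((c * (b$1 * fst (vf b c p)$2 - b$2 * fst (vf b c p)$1)) *\<^sub>R axis 3 1, 0)
      = vf b c (flow b c s p)"
    by (simp only: vf_flow) (simp add: vf_def prod_eq_iff)
  then show ?thesis
    using dV_eq[OF flow_comp_has_derivative[OF assms], of "vf b c" b c s]
    by (simp add: dV_frozen[of "vf b c" F])
qed

lemma flow_derivative:
  assumes "C1 F" "p \<in> half_space"
  shows "((\<lambda>s. F (flow b c s p)) has_real_derivative dV (vf b c) F (flow b c s p)) (at s)"
  using line_derivative[OF assms(1), of p s "vf b c p"] assms(2)
  by (simp add: dV_frozen[of "vf b c"] flow_def[symmetric])

lemma dV_flow_comp: "C1 F \<Longrightarrow> p \<in> half_space \<Longrightarrow> dV (\<lambda>_. v) (\<lambda>p. F (flow b c s p)) p =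
   dV (\<lambda>_. v + s *\<^sub>R ((c * (b$1 * fst v$2 - b$2 * fst v$1)) *\<^sub>R axis 3 1, 0)) F (flow b c s p)"
  by (rule dV_eq[OF flow_comp_has_derivative])

lemma C2_flow: assumes "C2 u" shows "C2 (\<lambda>p. u (flow b c s p))"
  unfolding C2_def
proof (intro conjI allI)
  show "C1 (\<lambda>p. u (flow b c s p))" by (rule C1_flow[OF C2_C1[OF assms]])
  fix v :: point
  show "C1 (dV (\<lambda>_. v) (\<lambda>p. u (flow b c s p)))"
    by (rule C1_cong[OF C1_flow[OF C2_dV[OF assms]]])
       (rule dV_flow_comp[symmetric, OF C2_C1[OF assms]])
qed

text \<open>The coefficients of the fields grow linearly. Hence flows up to time 1 map the ball of
  radius R into that of radius K (1 + R), and local bounds and bounded supports survive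
  translation.\<close>

lemma norm_flow_le:
  obtains K where "K > 0" "\<And>s p. \<bar>s\<bar> \<le> 1 \<Longrightarrow> norm (flow b c s p) \<le> K * (1 + norm p)"
proof -
  define K where "K = 1 + norm b + \<bar>c\<bar> * (\<bar>b$1\<bar> + \<bar>b$2\<bar>)"
  have "norm (flow b c s p) \<le> K * (1 + norm p)" if s: "\<bar>s\<bar> \<le> 1" for s p
  proof -
    have 1: "\<bar>fst p $ i\<bar> \<le> norm p" for i
      using order_trans[OF component_le_norm_cart norm_fst_le[of "fst p" "snd p"], of i] by simp
    have "\<bar>b$1 * fst p$2 - b$2 * fst p$1\<bar> \<le> \<bar>b$1 * fst p$2\<bar> + \<bar>b$2 * fst p$1\<bar>"
      by (rule abs_triangle_ineq4)
    also have "\<dots> \<le> \<bar>b$1\<bar> * norm p + \<bar>b$2\<bar> * norm p"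
      unfolding abs_mult by (intro add_mono mult_left_mono 1) auto
    finally have 2: "\<bar>b$1 * fst p$2 - b$2 * fst p$1\<bar> \<le> (\<bar>b$1\<bar> + \<bar>b$2\<bar>) * norm p"
      by (simp add: distrib_right)
    have "norm (vf b c p) \<le> norm b + \<bar>c\<bar> * \<bar>b$1 * fst p$2 - b$2 * fst p$1\<bar>"
    proof -
      have "norm (vf b c p) = norm (b + (c * (b$1 * fst p$2 - b$2 * fst p$1)) *\<^sub>R axis 3 (1::real))"
        unfolding vf_alt by (simp add: norm_Pair)
      also have "\<dots> \<le> norm b + norm ((c * (b$1 * fst p$2 - b$2 * fst p$1)) *\<^sub>R axis 3 (1::real) :: real^3)"
        by (rule norm_triangle_ineq)
      finally show ?thesis by (simp only: norm_scaleR norm_axis_1 abs_mult mult_1_right)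
    qed
    also have "\<dots> \<le> norm b + \<bar>c\<bar> * ((\<bar>b$1\<bar> + \<bar>b$2\<bar>) * norm p)"
      by (intro add_mono mult_left_mono 2) auto
    finally have 3: "norm (vf b c p) \<le> norm b + \<bar>c\<bar> * (\<bar>b$1\<bar> + \<bar>b$2\<bar>) * norm p" by (simp add: mult.assoc)
    have "norm (flow b c s p) \<le> norm p + \<bar>s\<bar> * norm (vf b c p)"
      unfolding flow_def by (rule order_trans[OF norm_triangle_ineq]) simp
    also have "\<dots> \<le> norm p + 1 * norm (vf b c p)"
      using s by (intro add_mono mult_right_mono) auto
    also have "\<dots> \<le> norm p + (norm b + \<bar>c\<bar> * (\<bar>b$1\<bar> + \<bar>b$2\<bar>) * norm p)" using 3 by simp
    also have "\<dots> \<le> norm p + (norm b + \<bar>c\<bar> * (\<bar>b$1\<bar> + \<bar>b$2\<bar>) * norm p) +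
       (norm b * norm p + 1 + \<bar>c\<bar> * (\<bar>b$1\<bar> + \<bar>b$2\<bar>))"
      using add_nonneg_nonneg[OF add_nonneg_nonneg[OF mult_nonneg_nonneg[OF norm_ge_zero[of b] norm_ge_zero[of p]], of 1]
        mult_nonneg_nonneg[OF abs_ge_zero[of c] add_nonneg_nonneg[OF abs_ge_zero[of "b$1"] abs_ge_zero[of "b$2"]]]]
      by linarith
    also have "\<dots> = K * (1 + norm p)" by (simp add: K_def algebra_simps)
    finally show ?thesis .
  qed
  moreover have "K > 0" unfolding K_def by (intro add_pos_nonneg) auto
  ultimately show ?thesis using that by blast
qed

subsection \<open>The measure with density \<open>y\<^sup>a\<close>\<close>

text \<open>The map is a translation composed with a shear in x_3, of determinant 1. The preimage of
  a box is computed as its image under the inverse \<open>g\<close>, a translate of the linear map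
  \<open>h\<close>, for which the change of volume is known.\<close>

lemma lborel_shear:
  fixes b :: "real^3" and c s :: real
  defines "f \<equiv> \<lambda>x::real^3. x + s *\<^sub>R (b + (c * (b$1 * x$2 - b$2 * x$1)) *\<^sub>R axis 3 1)"
  shows "distr lborel borel f = lborel"
proof (rule lborel_eqI[symmetric])
  define h where "h = (\<lambda>x::real^3. x - (s * (c * (b$1 * x$2 - b$2 * x$1))) *\<^sub>R axis 3 1)"
  define g where "g = (\<lambda>x. - s *\<^sub>R b + h x)"
  have fm: "f \<in> borel_measurable borel"
    unfolding f_def by (intro borel_measurable_continuous_onI continuous_intros)
  have fg: "f (g x) = x" "g (f x) = x" for x
    by (simp_all add: f_def g_def h_def vec_eq_iff forall_3 axis_def algebra_simps)
  have lin: "linear h"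
    by (rule linearI) (simp_all add: h_def vec_eq_iff forall_3 axis_def algebra_simps)
  have det: "det (matrix h) = 1"
    by (simp add: det_3 matrix_def h_def axis_def)
  fix l u :: "real^3"
  assume le: "\<And>e. e \<in> Basis \<Longrightarrow> l \<bullet> e \<le> u \<bullet> e"
  have vim: "f -` box l u = (\<lambda>x. - s *\<^sub>R b + x) ` (h ` box l u)"
  proof -
    have "f -` box l u = g ` box l u"
    proof (intro set_eqI iffI)
      fix x assume "x \<in> f -` box l u"
      then show "x \<in> g ` box l u" by (intro image_eqI[of x g "f x"]) (auto simp only: fg vimage_eq)
    next
      fix x assume "x \<in> g ` box l u"
      then show "x \<in> f -` box l u" by (auto simp only: fg vimage_eq image_iff)
    qed
    then show ?thesis by (simp add: g_def image_image)
  qed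
  have hm: "h ` box l u \<in> lmeasurable"
    by (rule measurable_linear_image[OF lin]) simp
  have fm2: "(\<lambda>x. - s *\<^sub>R b + x) ` (h ` box l u) \<in> lmeasurable"
    by (rule measurable_translation[OF hm])
  have bs: "f -` box l u \<in> sets borel"
    using measurable_sets[OF fm, of "box l u"] by simp
  have "emeasure (distr lborel borel f) (box l u) = emeasure lborel (f -` box l u)"
    using fm by (subst emeasure_distr) auto
  also have "\<dots> = emeasure lebesgue (f -` box l u)"
    using bs by simp
  also have "\<dots> = ennreal (measure lebesgue (f -` box l u))"
    using fm2 unfolding vim by (rule emeasure_eq_measure2)
  also have "measure lebesgue (f -` box l u) = measure lebesgue (h ` box l u)"
    unfolding vim by (rule measure_translation)
  also have "\<dots> = measure lebesgue (box l u)"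
    by (subst measure_linear_image[OF lin]) (auto simp: det)
  also have "\<dots> = (\<Prod>e\<in>Basis. (u - l) \<bullet> e)"
    using le by (simp add: measure_completion emeasure_lborel_box_eq measure_def prod_nonneg inner_diff_left)
  finally show "emeasure (distr lborel borel f) (box l u) = (\<Prod>e\<in>Basis. (u - l) \<bullet> e)" .
qed (simp add: f_def)

lemma lborel_flow: "distr lborel borel (flow b c s) = lborel"
proof -
  let ?f = "\<lambda>x::real^3. x + s *\<^sub>R (b + (c * (b$1 * x$2 - b$2 * x$1)) *\<^sub>R axis 3 1)"
  have "?f \<in> measurable borel borel"
    by (intro borel_measurable_continuous_onI continuous_intros)
  then have fm: "?f \<in> measurable lborel borel" by simp
  have "lborel = distr lborel borel ?f \<Otimes>\<^sub>M distr lborel borel (\<lambda>y::real. y)"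
    unfolding lborel_shear by (simp add: lborel_prod distr_id2)
  also have "\<dots> = distr (lborel \<Otimes>\<^sub>M lborel) (borel \<Otimes>\<^sub>M borel) (\<lambda>(x, y). (?f x, y))"
    by (rule pair_measure_distr[OF fm]) (simp_all add: distr_id2 sigma_finite_lborel)
  also have "\<dots> = distr lborel borel (flow b c s)"
    by (simp add: lborel_prod borel_prod case_prod_beta' flow_alt[abs_def])
  finally show ?thesis by simp
qed

text \<open>The half-space is the carrier and not just the support, so pointwise facts are required
  for y > 0 only and values elsewhere never enter.\<close>

definition wM :: "real \<Rightarrow> point measure" where
  "wM a = density (restrict_space lborel half_space) (\<lambda>p. ennreal (snd p powr a))"

lemma space_wM [simp]: "space (wM a) = half_space"
  by (simp add: wM_def space_restrict_space)

lemma sets_half_space [measurable]: "half_space \<in> sets borel"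
  using open_half_space by simp

lemma sets_wM: "sets (wM a) = sets (restrict_space borel half_space)"
  by (simp add: wM_def cong: sets_restrict_space_cong)

lemma sets_wM_iff: "A \<in> sets (wM a) \<longleftrightarrow> A \<in> sets borel \<and> A \<subseteq> half_space"
  by (auto simp: sets_wM sets_restrict_space_iff)

lemma measurable_wM_eq: "borel_measurable (wM a) = borel_measurable (restrict_space borel half_space)"
  by (rule measurable_cong_sets[OF sets_wM refl])

lemma measurable_wM_iff:
  fixes h :: "point \<Rightarrow> real"
  shows "h \<in> borel_measurable (wM a) \<longleftrightarrow> (\<lambda>p. indicator half_space p * h p) \<in> borel_measurable borel"
  unfolding measurable_wM_eq by (subst borel_measurable_restrict_space_iff) auto

lemma measurable_wM_continuous:
  "continuous_on half_space h \<Longrightarrow> h \<in> borel_measurable (wM a)"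
  unfolding measurable_wM_eq by (rule borel_measurable_continuous_on_restrict)

lemma measurable_wM_borel: "h \<in> borel_measurable borel \<Longrightarrow> h \<in> borel_measurable (wM a)"
  unfolding measurable_wM_eq by (rule measurable_restrict_space1)

lemma measurable_snd_powr [measurable]: "(\<lambda>p::point. snd p powr a) \<in> borel_measurable borel"
proof -
  have "(snd :: point \<Rightarrow> real) \<in> borel_measurable borel"
    by (intro borel_measurable_continuous_onI continuous_intros)
  then show ?thesis by (rule powr_real_measurable) simp
qed

lemma nn_integral_wM:
  assumes "h \<in> borel_measurable (wM a)"
  shows "nn_integral (wM a) h = (\<integral>\<^sup>+p. ennreal (snd p powr a) * h p * indicator half_space p \<partial>lborel)"
proof -
  have h: "h \<in> borel_measurable (restrict_space lborel half_space)"
    using assms by (simp add: wM_def)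
  have "(\<lambda>p::point. ennreal (snd p powr a)) \<in> borel_measurable borel"
    using measurable_snd_powr by (rule measurable_compose[OF _ measurable_ennreal])
  then have w: "(\<lambda>p. ennreal (snd p powr a)) \<in> borel_measurable (restrict_space lborel half_space)"
    by (intro measurable_restrict_space1) simp
  have "nn_integral (wM a) h = nn_integral (restrict_space lborel half_space) (\<lambda>p. ennreal (snd p powr a) * h p)"
    unfolding wM_def by (rule nn_integral_density[OF w h])
  then show ?thesis by (simp add: nn_integral_restrict_space)
qed

lemma integral_wM:
  fixes h :: "point \<Rightarrow> real"
  assumes "h \<in> borel_measurable (wM a)"
  shows "integrable (wM a) h \<longleftrightarrow> set_integrable lebesgue half_space (\<lambda>p. snd p powr a * h p)" (is ?A)
    and "(\<integral>p. h p \<partial>wM a) = (LINT p:half_space|lebesgue. snd p powr a * h p)" (is ?B)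
proof -
  have m: "h \<in> borel_measurable (restrict_space lborel half_space)"
    using assms by (simp add: wM_def)
  have w: "(\<lambda>p. snd p powr a) \<in> borel_measurable (restrict_space lborel half_space)"
    by (rule measurable_restrict_space1) (simp add: measurable_snd_powr)
  have mb: "(\<lambda>p. indicator half_space p *\<^sub>R (snd p powr a * h p)) \<in> borel_measurable lborel"
    using borel_measurable_times[OF w m]
    by (subst (asm) borel_measurable_restrict_space_iff) (auto simp: mult_ac)
  have "integrable (wM a) h \<longleftrightarrow> integrable (restrict_space lborel half_space) (\<lambda>p. snd p powr a *\<^sub>R h p)"
    unfolding wM_def by (rule integrable_density[OF m w]) auto
  also have "\<dots> \<longleftrightarrow> integrable lborel (\<lambda>p. indicator half_space p *\<^sub>R (snd p powr a * h p))"
    by (subst integrable_restrict_space) auto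
  also have "\<dots> \<longleftrightarrow> set_integrable lebesgue half_space (\<lambda>p. snd p powr a * h p)"
    unfolding set_integrable_def by (rule integrable_completion[OF mb, symmetric])
  finally show ?A .
  have "(\<integral>p. h p \<partial>wM a) = integral\<^sup>L (restrict_space lborel half_space) (\<lambda>p. snd p powr a *\<^sub>R h p)"
    unfolding wM_def by (rule integral_density[OF m w]) auto
  also have "\<dots> = integral\<^sup>L lborel (\<lambda>p. indicator half_space p *\<^sub>R (snd p powr a * h p))"
    by (subst integral_restrict_space) auto
  also have "\<dots> = (LINT p:half_space|lebesgue. snd p powr a * h p)"
    unfolding set_lebesgue_integral_def by (rule integral_completion[OF mb, symmetric])
  finally show ?B .
qed

lemma measurable_flow [measurable]: "flow b c s \<in> borel_measurable borel"
  by (intro borel_measurable_continuous_onI continuous_intros)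

lemma measurable_flow_wM: "flow b c s \<in> measurable (wM a) (wM a)"
proof (rule measurableI)
  fix A assume "A \<in> sets (wM a)"
  then have A: "A \<in> sets borel" "A \<subseteq> half_space" by (auto simp: sets_wM_iff)
  have "flow b c s -` A \<in> sets borel" using measurable_sets[OF measurable_flow A(1)] by simp
  then show "flow b c s -` A \<inter> space (wM a) \<in> sets (wM a)"
    by (auto simp: sets_wM_iff)
qed auto

text \<open>Flows preserve Lebesgue measure and leave y, hence the density, unchanged.\<close>

lemma distr_wM_flow: "distr (wM a) (wM a) (flow b c s) = wM a"
proof (rule measure_eqI)
  fix A assume "A \<in> sets (distr (wM a) (wM a) (flow b c s))"
  then have A': "A \<in> sets (wM a)" by simp
  then have A: "A \<in> sets borel" "A \<subseteq> half_space" by (auto simp: sets_wM_iff)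
  have mm: "(\<lambda>p. indicator A p :: ennreal) \<in> borel_measurable (wM a)"
    using A' by (rule borel_measurable_indicator)
  let ?k = "\<lambda>p. ennreal (snd p powr a) * indicator A p * indicator half_space p"
  have "emeasure (distr (wM a) (wM a) (flow b c s)) A
      = (\<integral>\<^sup>+p. indicator A (flow b c s p) \<partial>wM a)"
    using A' by (simp add: nn_integral_indicator[symmetric] nn_integral_distr[OF measurable_flow_wM]
       del: nn_integral_indicator)
  also have "\<dots> = (\<integral>\<^sup>+p. ?k (flow b c s p) \<partial>lborel)"
    by (subst nn_integral_wM[OF measurable_compose[OF measurable_flow_wM borel_measurable_indicator[OF A']]])
       (auto intro!: nn_integral_cong simp: indicator_def)
  also have "\<dots> = (\<integral>\<^sup>+p. ?k p \<partial>distr lborel borel (flow b c s))"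
    using A by (intro nn_integral_distr[symmetric]) auto
  also have "\<dots> = (\<integral>\<^sup>+p. ?k p \<partial>lborel)" unfolding lborel_flow ..
  also have "\<dots> = (\<integral>\<^sup>+p. indicator A p \<partial>wM a)"
    using mm by (simp add: nn_integral_wM)
  also have "\<dots> = emeasure (wM a) A" using A' by simp
  finally show "emeasure (distr (wM a) (wM a) (flow b c s)) A = emeasure (wM a) A" .
qed simp

lemma integral_flow:
  fixes h :: "point \<Rightarrow> real"
  assumes "h \<in> borel_measurable (wM a)"
  shows "integrable (wM a) (\<lambda>p. h (flow b c s p)) \<longleftrightarrow> integrable (wM a) h"
    "(\<integral>p. h (flow b c s p) \<partial>wM a) = (\<integral>p. h p \<partial>wM a)"
  using integrable_distr_eq[OF measurable_flow_wM assms, of b c s]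
    integral_distr[OF measurable_flow_wM assms, of b c s]
  by (simp_all add: distr_wM_flow)

lemma nn_integral_wM_Fubini:
  assumes "h \<in> borel_measurable (wM a)"
  shows "nn_integral (wM a) h =
    (\<integral>\<^sup>+x. \<integral>\<^sup>+y. ennreal (y powr a) * h (x, y) * indicator {0<..} y \<partial>lborel \<partial>lborel)"
proof -
  have "(\<lambda>p. h p * indicator half_space p) \<in> borel_measurable borel"
    using assms unfolding measurable_wM_eq
    by (subst (asm) borel_measurable_restrict_space_iff_ennreal) auto
  then have m: "(\<lambda>p. ennreal (snd p powr a) * (h p * indicator half_space p)) \<in> borel_measurable (lborel \<Otimes>\<^sub>M lborel)"
    unfolding lborel_prod
    using measurable_snd_powr[of a] by (simp add: measurable_compose[OF _ measurable_ennreal] borel_measurable_times_ennreal)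
  show ?thesis unfolding nn_integral_wM[OF assms] mult.assoc
    unfolding lborel_prod[symmetric] lborel.nn_integral_fst[OF m, symmetric]
    by (intro nn_integral_cong) (auto simp: half_space_def indicator_def)
qed

lemma nn_integral_powr:
  fixes a c :: real
  assumes "a > -1" "c \<ge> 0"
  shows "(\<integral>\<^sup>+y. ennreal (y powr a) * indicator {0<..c} y \<partial>lborel) = ennreal (c powr (a + 1) / (a + 1))"
proof -
  have "(\<integral>\<^sup>+y. ennreal (y powr a) * indicator {0<..c} y \<partial>lborel)
      = (\<integral>\<^sup>+y. ennreal (indicator {0..c} y * y powr a) \<partial>lborel)"
    by (intro nn_integral_cong) (auto simp: indicator_def)
  also have "\<dots> = ennreal (c powr (a + 1) / (a + 1))"
    using nn_integral_has_integral_lebesgue[OF _ has_integral_powr_from_0[OF assms]] by simp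
  finally show ?thesis .
qed

text \<open>The lower bound makes y^a integrable at 0, so half-balls have finite measure; the upper
  bound makes y^(-a) integrable at 0, so traces exist.\<close>

locale weight =
  fixes a :: real
  assumes a_gt: "-1 < a" and a_lt: "a < 1"
begin

abbreviation "M \<equiv> wM a"

lemma half_ball_M: "half_ball R \<in> sets M"
  by (auto simp: sets_wM_iff half_ball_def)

lemma emeasure_half_ball: "emeasure M (half_ball R) < \<infinity>"
proof -
  have "emeasure M (half_ball R) = (\<integral>\<^sup>+p. indicator (half_ball R) p \<partial>M)"
    using half_ball_M by simp
  also have "\<dots> = (\<integral>\<^sup>+x. \<integral>\<^sup>+y. ennreal (y powr a) * indicator (half_ball R) (x, y) * indicator {0<..} y \<partial>lborel \<partial>lborel)"
    by (rule nn_integral_wM_Fubini[OF borel_measurable_indicator[OF half_ball_M]])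
  also have "\<dots> \<le> (\<integral>\<^sup>+x. \<integral>\<^sup>+y. indicator (cball 0 \<bar>R\<bar>) (x::real^3) * (ennreal (y powr a) * indicator {0<..\<bar>R\<bar>} y) \<partial>lborel \<partial>lborel)"
  proof (intro nn_integral_mono)
    fix x :: "real^3" and y :: real
    have "norm x \<le> norm (x, y)" "\<bar>y\<bar> \<le> norm (x, y)"
      using norm_fst_le[of x y] norm_snd_le[of y x] by auto
    then show "ennreal (y powr a) * indicator (half_ball R) (x, y) * indicator {0<..} y
       \<le> indicator (cball 0 \<bar>R\<bar>) x * (ennreal (y powr a) * indicator {0<..\<bar>R\<bar>} y)"
      by (auto simp: half_ball_def indicator_def)
  qed
  also have "\<dots> = (\<integral>\<^sup>+x. indicator (cball 0 \<bar>R\<bar>) (x::real^3) * ennreal (\<bar>R\<bar> powr (a + 1) / (a + 1)) \<partial>lborel)"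
    using nn_integral_powr[OF a_gt, of "\<bar>R\<bar>"] by (subst nn_integral_cmult) auto
  also have "\<dots> = emeasure lborel (cball (0::real^3) \<bar>R\<bar>) * ennreal (\<bar>R\<bar> powr (a + 1) / (a + 1))"
    by (subst nn_integral_multc) (auto intro!: borel_measurable_indicator)
  also have "\<dots> < \<infinity>"
    using emeasure_lborel_cball_finite[of "0::real^3" "\<bar>R\<bar>"] by (simp add: ennreal_mult_less_top)
  finally show ?thesis .
qed

lemma sigma_finite_M: "sigma_finite_measure M"
proof
  let ?A = "range (\<lambda>n::nat. half_ball (real n))"
  have "\<Union>?A = half_space"
  proof (intro equalityI subsetI)
    fix p :: point assume "p \<in> half_space"
    moreover obtain n :: nat where "norm p < real n" using reals_Archimedean2 by blast
    ultimately show "p \<in> \<Union>?A" by (auto simp: half_ball_def)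
  qed (auto simp: half_ball_def)
  then show "\<exists>A. countable A \<and> A \<subseteq> sets M \<and> \<Union> A = space M \<and> (\<forall>a\<in>A. emeasure M a \<noteq> \<infinity>)"
    using half_ball_M emeasure_half_ball by (intro exI[of _ ?A]) (auto simp: less_top)
qed

sublocale pair_sigma_finite lborel M
  by (intro pair_sigma_finite.intro sigma_finite_M sigma_finite_lborel)

section \<open>Integration along flows and integration by parts\<close>

lemma measurable_joint_flow:
  "(\<lambda>(s, p). flow b c s p) \<in> measurable (lborel \<Otimes>\<^sub>M M) M"
proof -
  have "(\<lambda>p. p) \<in> measurable M borel"
    by (rule measurable_wM_borel) simp
  then have 1: "(\<lambda>(s, p). (s, p)) \<in> measurable (lborel \<Otimes>\<^sub>M M) (borel \<Otimes>\<^sub>M borel)"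
    unfolding case_prod_beta' by (intro measurable_Pair) (auto intro: measurable_compose[OF measurable_snd])
  have "(\<lambda>(s, p). flow b c s p) \<in> measurable (borel \<Otimes>\<^sub>M borel) borel"
    unfolding borel_prod case_prod_beta' by (intro borel_measurable_continuous_onI continuous_intros)
  from measurable_compose[OF 1 this]
  have "(\<lambda>(s, p). flow b c s p) \<in> measurable (lborel \<Otimes>\<^sub>M M) borel"
    by (simp add: case_prod_beta')
  then have "(\<lambda>(s, p). flow b c s p) \<in> measurable (lborel \<Otimes>\<^sub>M M) (restrict_space borel half_space)"
    by (intro measurable_restrict_space2) (auto simp: space_pair_measure)
  then show ?thesis
    by (simp add: measurable_cong_sets[OF refl sets_wM])
qed

text \<open>The fundamental theorem of calculus on each flow line, followed by Fubini; the L^1 bound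
  uniform in s gives integrability on the product. Regularity is asked along flow lines only, so
  that functions cut off sharply at a height y = d are allowed.\<close>

lemma flow_FTC:
  fixes F F' \<psi> :: "point \<Rightarrow> real"
  assumes F': "F' \<in> borel_measurable M" and psi: "\<psi> \<in> borel_measurable M"
    and der: "\<And>p s. p \<in> half_space \<Longrightarrow> ((\<lambda>s. F (flow b c s p)) has_real_derivative F' (flow b c s p)) (at s)"
    and cont: "\<And>p. p \<in> half_space \<Longrightarrow> continuous_on UNIV (\<lambda>s. F' (flow b c s p))"
    and h: "0 \<le> h"
    and int: "\<And>s. 0 \<le> s \<Longrightarrow> s \<le> h \<Longrightarrow> integrable M (\<lambda>p. F' (flow b c s p) * \<psi> p)"
    and bound: "\<And>s. 0 \<le> s \<Longrightarrow> s \<le> h \<Longrightarrow> (\<integral>p. \<bar>F' (flow b c s p) * \<psi> p\<bar> \<partial>M) \<le> K"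
  shows "integrable lborel (\<lambda>s. indicator {0..h} s * (\<integral>p. F' (flow b c s p) * \<psi> p \<partial>M))"
    and "(\<integral>p. (F (flow b c h p) - F p) * \<psi> p \<partial>M)
      = (\<integral>s. indicator {0..h} s * (\<integral>p. F' (flow b c s p) * \<psi> p \<partial>M) \<partial>lborel)"
proof -
  let ?f = "\<lambda>s p. indicator {0..h} s * (F' (flow b c s p) * \<psi> p)"
  have m: "(\<lambda>(s, p). ?f s p) \<in> borel_measurable (lborel \<Otimes>\<^sub>M M)"
    using measurable_compose[OF measurable_joint_flow F'] measurable_compose[OF measurable_snd psi]
    unfolding case_prod_beta'
    by (intro borel_measurable_times measurable_compose[OF measurable_fst borel_measurable_indicator]) auto
  have int2: "integrable M (\<lambda>p. ?f s p)" for s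
    using int[of s] by (cases "s \<in> {0..h}") auto
  have bd: "(\<integral>p. norm (?f s p) \<partial>M) \<le> \<bar>K\<bar> * indicator {0..h} s" for s
    using bound[of s] by (cases "s \<in> {0..h}") (auto simp: indicator_def)
  have I: "integrable (lborel \<Otimes>\<^sub>M M) (\<lambda>(s, p). ?f s p)"
  proof (rule Fubini_integrable[OF m])
    show "integrable lborel (\<lambda>s. \<integral>p. norm (case (s, p) of (s, p) \<Rightarrow> ?f s p) \<partial>M)"
    proof (rule Bochner_Integration.integrable_bound)
      show "integrable lborel (\<lambda>s. \<bar>K\<bar> * indicator {0..h} s)"
        using h by (intro integrable_mult_right integrable_real_indicator) auto
      show "(\<lambda>s. \<integral>p. norm (case (s, p) of (s, p) \<Rightarrow> ?f s p) \<partial>M) \<in> borel_measurable lborel"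
        using m by (intro M2.borel_measurable_lebesgue_integral) (simp add: case_prod_beta')
      show "AE s in lborel. norm (\<integral>p. norm (case (s, p) of (s, p) \<Rightarrow> ?f s p) \<partial>M) \<le> norm (\<bar>K\<bar> * indicator {0..h} s)"
        using bd by (intro AE_I2) (auto intro: order_trans)
    qed
  qed (use int2 in auto)
  show "integrable lborel (\<lambda>s. indicator {0..h} s * (\<integral>p. F' (flow b c s p) * \<psi> p \<partial>M))"
    using integrable_fst'[OF I] by simp
  have "(\<integral>p. (F (flow b c h p) - F p) * \<psi> p \<partial>M) = (\<integral>p. (\<integral>s. ?f s p \<partial>lborel) \<partial>M)"
  proof (rule Bochner_Integration.integral_cong[OF refl])
    fix p assume "p \<in> space M"
    then have p: "p \<in> half_space" by simp
    have "(\<integral>s. F' (flow b c s p) * indicator {0..h} s \<partial>lborel) = F (flow b c h p) - F (flow b c 0 p)"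
      using integral_FTC_Icc_real[OF h, of "\<lambda>s. F (flow b c s p)" "\<lambda>s. F' (flow b c s p)"] der[OF p] cont[OF p]
      by (simp add: continuous_on_eq_continuous_at)
    moreover have "(\<integral>s. ?f s p \<partial>lborel) = (\<integral>s. (F' (flow b c s p) * indicator {0..h} s) * \<psi> p \<partial>lborel)"
      by (simp add: mult_ac)
    ultimately show "(F (flow b c h p) - F p) * \<psi> p = (\<integral>s. ?f s p \<partial>lborel)" by simp
  qed
  also have "\<dots> = (\<integral>s. (\<integral>p. ?f s p \<partial>M) \<partial>lborel)"
    by (rule Fubini_integral[OF I])
  finally show "(\<integral>p. (F (flow b c h p) - F p) * \<psi> p \<partial>M)
      = (\<integral>s. indicator {0..h} s * (\<integral>p. F' (flow b c s p) * \<psi> p \<partial>M) \<partial>lborel)" by simp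
qed

lemma flow_FTC_bound:
  fixes F F' \<psi> :: "point \<Rightarrow> real"
  assumes F': "F' \<in> borel_measurable M" and psi: "\<psi> \<in> borel_measurable M"
    and der: "\<And>p s. p \<in> half_space \<Longrightarrow> ((\<lambda>s. F (flow b c s p)) has_real_derivative F' (flow b c s p)) (at s)"
    and cont: "\<And>p. p \<in> half_space \<Longrightarrow> continuous_on UNIV (\<lambda>s. F' (flow b c s p))"
    and h: "0 \<le> h"
    and int: "\<And>s. 0 \<le> s \<Longrightarrow> s \<le> h \<Longrightarrow> integrable M (\<lambda>p. F' (flow b c s p) * \<psi> p)"
    and bound: "\<And>s. 0 \<le> s \<Longrightarrow> s \<le> h \<Longrightarrow> (\<integral>p. \<bar>F' (flow b c s p) * \<psi> p\<bar> \<partial>M) \<le> K"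
    and B: "\<And>s. 0 \<le> s \<Longrightarrow> s \<le> h \<Longrightarrow> (\<integral>p. F' (flow b c s p) * \<psi> p \<partial>M) \<le> B"
  shows "(\<integral>p. (F (flow b c h p) - F p) * \<psi> p \<partial>M) \<le> h * B"
proof -
  note * = flow_FTC[where F=F and b=b and c=c, OF assms(1-7)]
  have "(\<integral>p. (F (flow b c h p) - F p) * \<psi> p \<partial>M)
      = (\<integral>s. indicator {0..h} s * (\<integral>p. F' (flow b c s p) * \<psi> p \<partial>M) \<partial>lborel)" by (rule *(2))
  also have "\<dots> \<le> (\<integral>s. indicator {0..h} s * B \<partial>lborel)"
    using h by (intro Bochner_Integration.integral_mono *(1) integrable_mult_left integrable_real_indicator)
      (auto simp: indicator_def B)
  finally show ?thesis using h by simp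
qed

text \<open>F and its translate by the time 1 flow have the same integral. By
  \<open>flow_FTC\<close> the difference of the two is the integral over s in [0, 1] of the
  integrals of the translates of F', which all equal the integral of F'.\<close>

lemma integral_by_parts:
  fixes F F' :: "point \<Rightarrow> real"
  assumes F: "integrable M F" and F': "integrable M F'"
    and der: "\<And>p s. p \<in> half_space \<Longrightarrow> ((\<lambda>s. F (flow b c s p)) has_real_derivative F' (flow b c s p)) (at s)"
    and cont: "\<And>p. p \<in> half_space \<Longrightarrow> continuous_on UNIV (\<lambda>s. F' (flow b c s p))"
  shows "(\<integral>p. F' p \<partial>M) = 0"
proof -
  have m: "F \<in> borel_measurable M" "F' \<in> borel_measurable M" using F F' by auto
  have 0: "(\<integral>p. (F (flow b c 1 p) - F p) * 1 \<partial>M) = 0"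
    using F by (simp add: integral_flow[OF m(1)])
  have i: "integrable M (\<lambda>p. F' (flow b c s p) * 1)" for s
    using F' by (simp add: integral_flow[OF m(2)])
  have j: "(\<integral>p. F' (flow b c s p) * 1 \<partial>M) = (\<integral>p. F' p \<partial>M)" for s
    by (simp add: integral_flow[OF m(2)])
  have k: "(\<integral>p. \<bar>F' (flow b c s p) * 1\<bar> \<partial>M) \<le> (\<integral>p. \<bar>F' p\<bar> \<partial>M)" for s
    using integral_flow(2)[of "\<lambda>p. \<bar>F' p\<bar>" a b c s] m by simp
  have "(\<integral>p. (F (flow b c 1 p) - F p) * 1 \<partial>M) =
    (\<integral>s. indicator {0..1} s * (\<integral>p. F' (flow b c s p) * 1 \<partial>M) \<partial>lborel)"
    by (rule flow_FTC(2)[OF m(2) _ der cont _ i k]) auto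
  then show ?thesis unfolding 0 j by simp
qed

text \<open>Local on the closed half-space: the balls are centred at a boundary point, so
  integrability holds up to y = 0. The same convention governs \<open>loc_bdd\<close>, and
  \<open>supp\<close> likewise imposes nothing at y = 0.\<close>

definition loc_int :: "(point \<Rightarrow> real) \<Rightarrow> bool" where
  "loc_int h \<longleftrightarrow> h \<in> borel_measurable M \<and> (\<forall>R. integrable M (\<lambda>p. indicator (ball 0 R) p * h p))"

definition loc_bdd :: "(point \<Rightarrow> real) \<Rightarrow> bool" where
  "loc_bdd h \<longleftrightarrow> (\<forall>R. \<exists>C. \<forall>p\<in>half_space. norm p < R \<longrightarrow> \<bar>h p\<bar> \<le> C)"

definition supp :: "real \<Rightarrow> (point \<Rightarrow> real) \<Rightarrow> bool" where
  "supp R F \<longleftrightarrow> (\<forall>p\<in>half_space. R \<le> norm p \<longrightarrow> F p = 0)"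

lemma ball_ind_measurable:
  fixes h :: "point \<Rightarrow> real"
  shows "h \<in> borel_measurable M \<Longrightarrow> (\<lambda>p. indicator (ball 0 R) p * h p) \<in> borel_measurable M"
  by (rule borel_measurable_times[OF measurable_wM_borel[OF borel_measurable_indicator]]) auto

lemma integrable_ball: "integrable M (\<lambda>p. indicator (ball 0 R) p * (C::real))"
proof -
  have "integrable M (\<lambda>p. indicator (half_ball R) p * C)"
    using half_ball_M emeasure_half_ball by (intro integrable_mult_left integrable_real_indicator)
  then show ?thesis
    by (rule Bochner_Integration.integrable_cong[OF refl, THEN iffD1, rotated])
       (auto simp: half_ball_def indicator_def)
qed

lemma loc_intI_bound:
  assumes "h \<in> borel_measurable M" "loc_int g" "\<And>p. p \<in> half_space \<Longrightarrow> \<bar>h p\<bar> \<le> g p"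
  shows "loc_int h"
  unfolding loc_int_def
proof (intro conjI allI assms(1))
  fix R
  have "integrable M (\<lambda>p. indicator (ball 0 R) p * g p)" using assms(2) by (simp add: loc_int_def)
  then show "integrable M (\<lambda>p. indicator (ball 0 R) p * h p)"
  proof (rule Bochner_Integration.integrable_bound)
    have "\<bar>h p\<bar> \<le> \<bar>g p\<bar>" if "p \<in> half_space" for p
      using assms(3)[OF that] by linarith
    then show "AE p in M. norm (indicator (ball 0 R) p * h p) \<le> norm (indicator (ball 0 R) p * g p)"
      by (intro AE_I2) (auto simp: indicator_def)
  qed (intro ball_ind_measurable assms(1))
qed

lemma loc_int_measurable: "loc_int h \<Longrightarrow> h \<in> borel_measurable M"
  by (simp add: loc_int_def)

lemma loc_int_add: "loc_int f \<Longrightarrow> loc_int g \<Longrightarrow> loc_int (\<lambda>p. f p + g p)"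
  unfolding loc_int_def distrib_left by (intro conjI allI borel_measurable_add Bochner_Integration.integrable_add) auto

lemma loc_int_cmult: "loc_int f \<Longrightarrow> loc_int (\<lambda>p. c * f p)"
  unfolding loc_int_def mult.left_commute[of _ c]
  by (intro conjI allI borel_measurable_times borel_measurable_const integrable_mult_right) auto

lemma loc_int_loc_bdd_mult:
  assumes "loc_int f" "loc_bdd k" "k \<in> borel_measurable M"
  shows "loc_int (\<lambda>p. f p * k p)"
  unfolding loc_int_def
proof (intro conjI allI borel_measurable_times assms loc_int_measurable)
  fix R
  obtain C where C: "\<And>p. p \<in> half_space \<Longrightarrow> norm p < R \<Longrightarrow> \<bar>k p\<bar> \<le> C"
    using assms(2) unfolding loc_bdd_def by blast
  have "integrable M (\<lambda>p. C * (indicator (ball 0 R) p * f p))" using assms(1) by (simp add: loc_int_def)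
  then show "integrable M (\<lambda>p. indicator (ball 0 R) p * (f p * k p))"
  proof (rule Bochner_Integration.integrable_bound)
    show "(\<lambda>p. indicator (ball 0 R) p * (f p * k p)) \<in> borel_measurable M"
      by (intro ball_ind_measurable borel_measurable_times assms loc_int_measurable)
    have "\<bar>f p * k p\<bar> \<le> \<bar>C * f p\<bar>" if "p \<in> half_space" "norm p < R" for p
    proof -
      have "\<bar>k p\<bar> \<le> \<bar>C\<bar>" using C[OF that] by linarith
      then show ?thesis by (simp add: abs_mult mult.commute[of "\<bar>C\<bar>"] mult_left_mono)
    qed
    then show "AE p in M. norm (indicator (ball 0 R) p * (f p * k p)) \<le> norm (C * (indicator (ball 0 R) p * f p))"
      by (intro AE_I2) (auto simp: indicator_def)
  qed
qed

lemma loc_int_const: "loc_int (\<lambda>_. c)"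
  unfolding loc_int_def by (intro conjI allI integrable_ball borel_measurable_const)

lemma loc_int_loc_bdd: "loc_bdd k \<Longrightarrow> k \<in> borel_measurable M \<Longrightarrow> loc_int k"
  using loc_int_loc_bdd_mult[OF loc_int_const[of 1], of k] by simp

lemma loc_int_mult:
  assumes "f \<in> borel_measurable M" "g \<in> borel_measurable M" "loc_int (\<lambda>p. (f p)\<^sup>2)" "loc_int (\<lambda>p. (g p)\<^sup>2)"
  shows "loc_int (\<lambda>p. f p * g p)"
proof (rule loc_intI_bound)
  show "loc_int (\<lambda>p. (f p)\<^sup>2 + (g p)\<^sup>2)" by (rule loc_int_add[OF assms(3,4)])
  show "\<bar>f p * g p\<bar> \<le> (f p)\<^sup>2 + (g p)\<^sup>2" for p
    using sum_squares_bound[of "\<bar>f p\<bar>" "\<bar>g p\<bar>"] mult_nonneg_nonneg[OF abs_ge_zero[of "f p"] abs_ge_zero[of "g p"]]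
    unfolding abs_mult power2_abs by linarith
qed (use assms in auto)

lemma loc_int_sq_add:
  assumes "f \<in> borel_measurable M" "g \<in> borel_measurable M" "loc_int (\<lambda>p. (f p)\<^sup>2)" "loc_int (\<lambda>p. (g p)\<^sup>2)"
  shows "loc_int (\<lambda>p. (f p + g p)\<^sup>2)"
proof (rule loc_intI_bound)
  show "loc_int (\<lambda>p. 2 * ((f p)\<^sup>2 + (g p)\<^sup>2))" by (intro loc_int_cmult loc_int_add assms)
  show "\<bar>(f p + g p)\<^sup>2\<bar> \<le> 2 * ((f p)\<^sup>2 + (g p)\<^sup>2)" for p
    unfolding abs_power2 using sum_squares_bound[of "f p" "g p"] by (simp add: power2_sum)
qed (use assms in auto)

lemma loc_int_integrable:
  assumes "loc_int h" "supp R h"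
  shows "integrable M h"
proof -
  have "integrable M (\<lambda>p. indicator (ball 0 R) p * h p)" using assms(1) by (simp add: loc_int_def)
  then show ?thesis
    by (rule Bochner_Integration.integrable_cong[OF refl, THEN iffD1, rotated])
       (use assms(2) in \<open>auto simp: supp_def indicator_def\<close>)
qed

text \<open>A change of variables; the ball of radius R is carried into a larger ball, on which h is
  integrable as well.\<close>

lemma loc_int_flow:
  assumes "loc_int h" "\<bar>s\<bar> \<le> 1"
  shows "loc_int (\<lambda>p. h (flow b c s p))"
  unfolding loc_int_def
proof (intro conjI allI)
  have m: "h \<in> borel_measurable M" using assms by (simp add: loc_int_def)
  then show m': "(\<lambda>p. h (flow b c s p)) \<in> borel_measurable M"
    by (rule measurable_compose[OF measurable_flow_wM])
  fix R
  obtain K where K: "K > 0" "\<And>s p. \<bar>s\<bar> \<le> 1 \<Longrightarrow> norm (flow b c s p) \<le> K * (1 + norm p)"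
    using norm_flow_le by blast
  let ?R = "K * (1 + \<bar>R\<bar>)"
  have "integrable M (\<lambda>p. indicator (ball 0 ?R) (flow b c s p) * h (flow b c s p))"
    using assms m unfolding loc_int_def
    by (subst integral_flow(1)) (auto intro: ball_ind_measurable)
  then show "integrable M (\<lambda>p. indicator (ball 0 R) p * h (flow b c s p))"
  proof (rule Bochner_Integration.integrable_bound)
    have "norm (flow b c s p) < ?R" if "norm p < R" for p
    proof -
      have "norm (flow b c s p) \<le> K * (1 + norm p)" using K(2) assms(2) by simp
      also have "\<dots> < ?R" using that K(1) by (intro mult_strict_left_mono) auto
      finally show ?thesis .
    qed
    then show "AE p in M. norm (indicator (ball 0 R) p * h (flow b c s p)) \<le> norm (indicator (ball 0 ?R) (flow b c s p) * h (flow b c s p))"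
      by (intro AE_I2) (auto simp: indicator_def)
  qed (intro ball_ind_measurable m')
qed

lemma loc_bdd_flow:
  assumes "loc_bdd h" "\<bar>s\<bar> \<le> 1"
  shows "loc_bdd (\<lambda>p. h (flow b c s p))"
  unfolding loc_bdd_def
proof (intro allI)
  fix R
  obtain K where K: "K > 0" "\<And>s p. \<bar>s\<bar> \<le> 1 \<Longrightarrow> norm (flow b c s p) \<le> K * (1 + norm p)"
    using norm_flow_le by blast
  obtain C where C: "\<And>p. p \<in> half_space \<Longrightarrow> norm p < K * (1 + R) \<Longrightarrow> \<bar>h p\<bar> \<le> C"
    using assms(1) unfolding loc_bdd_def by blast
  have "norm (flow b c s p) < K * (1 + R)" if "norm p < R" for p
  proof -
    have "norm (flow b c s p) \<le> K * (1 + norm p)" using K(2) assms(2) by simp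
    also have "\<dots> < K * (1 + R)" using that K(1) by (intro mult_strict_left_mono) auto
    finally show ?thesis .
  qed
  then show "\<exists>C. \<forall>p\<in>half_space. norm p < R \<longrightarrow> \<bar>h (flow b c s p)\<bar> \<le> C"
    using C by (meson flow_half_space)
qed

lemma loc_bdd_add: assumes "loc_bdd f" "loc_bdd g" shows "loc_bdd (\<lambda>p. f p + g p)"
  unfolding loc_bdd_def
proof
  fix R
  obtain C D where "\<And>p. p \<in> half_space \<Longrightarrow> norm p < R \<Longrightarrow> \<bar>f p\<bar> \<le> C"
    "\<And>p. p \<in> half_space \<Longrightarrow> norm p < R \<Longrightarrow> \<bar>g p\<bar> \<le> D"
    using assms unfolding loc_bdd_def by metis
  then show "\<exists>C. \<forall>p\<in>half_space. norm p < R \<longrightarrow> \<bar>f p + g p\<bar> \<le> C"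
    by (intro exI[of _ "C + D"]) (metis abs_triangle_ineq add_mono order_trans)
qed

lemma loc_bdd_mult: assumes "loc_bdd f" "loc_bdd g" shows "loc_bdd (\<lambda>p. f p * g p)"
  unfolding loc_bdd_def
proof
  fix R
  obtain C D where "\<And>p. p \<in> half_space \<Longrightarrow> norm p < R \<Longrightarrow> \<bar>f p\<bar> \<le> C"
    "\<And>p. p \<in> half_space \<Longrightarrow> norm p < R \<Longrightarrow> \<bar>g p\<bar> \<le> D"
    using assms unfolding loc_bdd_def by metis
  then show "\<exists>C. \<forall>p\<in>half_space. norm p < R \<longrightarrow> \<bar>f p * g p\<bar> \<le> C"
    unfolding abs_mult by (intro exI[of _ "C * D"]) (metis abs_ge_zero mult_mono order_trans)
qed

lemma loc_bdd_const: "loc_bdd (\<lambda>_. c)" unfolding loc_bdd_def by blast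

lemma loc_bdd_cmult: "loc_bdd f \<Longrightarrow> loc_bdd (\<lambda>p. c * f p)"
  using loc_bdd_mult[OF loc_bdd_const] by blast

lemma loc_bdd_bounded: "(\<And>p. p \<in> half_space \<Longrightarrow> \<bar>f p\<bar> \<le> C) \<Longrightarrow> loc_bdd f"
  unfolding loc_bdd_def by blast

lemma loc_bdd_coord: "loc_bdd (\<lambda>p. fst p $ i)"
  unfolding loc_bdd_def
proof
  fix R :: real
  have "\<bar>fst p $ i\<bar> \<le> norm p" for p :: point
    using order_trans[OF component_le_norm_cart norm_fst_le[of "fst p" "snd p"], of i] by simp
  then show "\<exists>C. \<forall>p\<in>half_space. norm p < R \<longrightarrow> \<bar>fst p $ i\<bar> \<le> C"
    by (intro exI[of _ R]) (meson less_imp_le order_trans)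
qed

subsection \<open>Local Sobolev functions and test functions\<close>

definition C1_bdd :: "(point \<Rightarrow> real) \<Rightarrow> bool" where
  "C1_bdd K \<longleftrightarrow> C1 K \<and> loc_bdd K \<and> (\<forall>k. loc_bdd (G k K))"

definition Hloc :: "(point \<Rightarrow> real) \<Rightarrow> bool" where
  "Hloc F \<longleftrightarrow> C1 F \<and> loc_int (\<lambda>p. (F p)\<^sup>2) \<and> (\<forall>k. loc_int (\<lambda>p. (G k F p)\<^sup>2))"

lemma C1_measurable: "C1 F \<Longrightarrow> F \<in> borel_measurable M"
  by (intro measurable_wM_continuous C1_continuous)

lemma G_measurable: "C1 F \<Longrightarrow> G k F \<in> borel_measurable M"
  by (intro measurable_wM_continuous C1_G_continuous)

lemma vf_measurable: "C1 F \<Longrightarrow> dV (vf b c) F \<in> borel_measurable M"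
  by (intro measurable_wM_continuous C1_vf_continuous)

lemma loc_int_cong: assumes "loc_int f" "\<And>p. p \<in> half_space \<Longrightarrow> f p = g p" shows "loc_int g"
proof -
  have m: "f \<in> borel_measurable M" "\<And>R. integrable M (\<lambda>p. indicator (ball 0 R) p * f p)"
    using assms(1) by (auto simp: loc_int_def)
  have "g \<in> borel_measurable M"
    by (rule measurable_cong[THEN iffD1, OF _ m(1)]) (use assms(2) in auto)
  moreover have "integrable M (\<lambda>p. indicator (ball 0 R) p * g p)" for R
    by (rule Bochner_Integration.integrable_cong[THEN iffD1, OF refl _ m(2)]) (use assms(2) in auto)
  ultimately show ?thesis by (simp add: loc_int_def)
qed

lemma loc_bdd_cong: "loc_bdd f \<Longrightarrow> (\<And>p. p \<in> half_space \<Longrightarrow> f p = g p) \<Longrightarrow> loc_bdd g"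
  unfolding loc_bdd_def by (metis (no_types, lifting))

lemma Hloc_C1: "Hloc F \<Longrightarrow> C1 F" by (simp add: Hloc_def)

lemma C1_bdd_C1: "C1_bdd F \<Longrightarrow> C1 F" by (simp add: C1_bdd_def)

lemma Hloc_add: assumes "Hloc F" "Hloc K" shows "Hloc (\<lambda>p. F p + K p)"
  unfolding Hloc_def
proof (intro conjI allI)
  have 1: "C1 F" "C1 K" using assms by (auto simp: Hloc_def)
  show "C1 (\<lambda>p. F p + K p)" by (rule C1_add[OF 1])
  show "loc_int (\<lambda>p. (F p + K p)\<^sup>2)"
    using assms by (intro loc_int_sq_add C1_measurable 1) (auto simp: Hloc_def)
  fix k
  have "loc_int (\<lambda>p. (G k F p + G k K p)\<^sup>2)"
    using assms by (intro loc_int_sq_add G_measurable 1) (auto simp: Hloc_def)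
  then show "loc_int (\<lambda>p. (G k (\<lambda>p. F p + K p) p)\<^sup>2)"
    by (rule loc_int_cong) (simp add: dV_add 1)
qed

lemma C1_bdd_mult: assumes "C1_bdd F" "C1_bdd K" shows "C1_bdd (\<lambda>p. F p * K p)"
  unfolding C1_bdd_def
proof (intro conjI allI)
  have 1: "C1 F" "C1 K" using assms by (auto simp: C1_bdd_def)
  show "C1 (\<lambda>p. F p * K p)" by (rule C1_mult[OF 1])
  show "loc_bdd (\<lambda>p. F p * K p)" using assms by (intro loc_bdd_mult) (auto simp: C1_bdd_def)
  fix k
  have "loc_bdd (\<lambda>p. F p * G k K p + G k F p * K p)"
    using assms by (intro loc_bdd_mult loc_bdd_add) (auto simp: C1_bdd_def)
  then show "loc_bdd (G k (\<lambda>p. F p * K p))"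
    by (rule loc_bdd_cong) (simp add: dV_mult 1)
qed

lemma C1_bdd_const: "C1_bdd (\<lambda>_. c)"
  unfolding C1_bdd_def
proof (intro conjI allI loc_bdd_const C1_const)
  show "loc_bdd (G k (\<lambda>_. c))" for k by (rule loc_bdd_cong[OF loc_bdd_const[of 0]]) simp
qed

lemma C1_bdd_coord: "C1_bdd (\<lambda>p. fst p $ i)"
  unfolding C1_bdd_def
proof (intro conjI allI C1_coord loc_bdd_coord)
  fix k
  have "loc_bdd (\<lambda>p. fst (fr k p) $ i)"
  proof -
    have l: "loc_bdd (\<lambda>p. 2 * (c * fst p $ 2 + d * fst p $ 1))" for c d
      by (intro loc_bdd_cmult loc_bdd_add loc_bdd_coord)
    have "k = 1 \<or> k = 2 \<or> k = 3" "i = 1 \<or> i = 2 \<or> i = 3" using exhaust_3 by blast+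
    then show ?thesis
      using l[of 1 0] l[of 0 "-1"] by (auto simp: fr_def vf_def loc_bdd_const)
  qed
  then show "loc_bdd (G k (\<lambda>p. fst p $ i))" by (rule loc_bdd_cong) simp
qed

lemma Hloc_C1_bdd_mult: assumes "Hloc F" "C1_bdd K" shows "Hloc (\<lambda>p. F p * K p)"
  unfolding Hloc_def
proof (intro conjI allI)
  have 1: "C1 F" "C1 K" using assms by (auto simp: C1_bdd_def Hloc_def)
  have F: "loc_int (\<lambda>p. (F p)\<^sup>2)" "\<And>k. loc_int (\<lambda>p. (G k F p)\<^sup>2)" using assms by (auto simp: Hloc_def)
  have K: "loc_bdd (\<lambda>p. (K p)\<^sup>2)" "\<And>k. loc_bdd (\<lambda>p. (G k K p)\<^sup>2)"
    using assms unfolding power2_eq_square by (auto simp: C1_bdd_def intro: loc_bdd_mult)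
  note m [measurable] = C1_measurable[OF 1(1)] C1_measurable[OF 1(2)] G_measurable[OF 1(1)] G_measurable[OF 1(2)]
  show "C1 (\<lambda>p. F p * K p)" by (rule C1_mult[OF 1])
  show "loc_int (\<lambda>p. (F p * K p)\<^sup>2)"
    unfolding power_mult_distrib by (intro loc_int_loc_bdd_mult F K) measurable
  fix k
  have "loc_int (\<lambda>p. (F p * G k K p + G k F p * K p)\<^sup>2)"
  proof (rule loc_int_sq_add)
    show "loc_int (\<lambda>p. (F p * G k K p)\<^sup>2)" "loc_int (\<lambda>p. (G k F p * K p)\<^sup>2)"
      unfolding power_mult_distrib by (intro loc_int_loc_bdd_mult F K; measurable)+
  qed measurable
  then show "loc_int (\<lambda>p. (G k (\<lambda>p. F p * K p) p)\<^sup>2)"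
    by (rule loc_int_cong) (simp add: dV_mult 1)
qed

lemma C1_bdd_Hloc: assumes "C1_bdd F" shows "Hloc F"
proof -
  have "loc_bdd (\<lambda>p. (F p)\<^sup>2)" "\<And>k. loc_bdd (\<lambda>p. (G k F p)\<^sup>2)"
    using assms unfolding power2_eq_square by (auto simp: C1_bdd_def intro: loc_bdd_mult)
  then show ?thesis
    using assms C1_measurable[of F] G_measurable[of F] by (auto simp: Hloc_def C1_bdd_def intro!: loc_int_loc_bdd)
qed

lemma Hloc_cmult: "Hloc F \<Longrightarrow> Hloc (\<lambda>p. c * F p)"
  using Hloc_C1_bdd_mult[OF _ C1_bdd_const[of c], of F] by (simp add: mult.commute)

lemma Hloc_diff: "Hloc F \<Longrightarrow> Hloc K \<Longrightarrow> Hloc (\<lambda>p. F p - K p)"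
  using Hloc_add[OF _ Hloc_cmult[of K "-1"], of F] by simp

lemma Hloc_flow: assumes "Hloc F" "\<bar>s\<bar> \<le> 1" shows "Hloc (\<lambda>p. F (flow b (-2) s p))"
  unfolding Hloc_def
proof (intro conjI allI)
  have 1: "C1 F" using assms by (auto simp: Hloc_def)
  show "C1 (\<lambda>p. F (flow b (-2) s p))" by (rule C1_flow[OF 1])
  show "loc_int (\<lambda>p. (F (flow b (-2) s p))\<^sup>2)"
    using loc_int_flow[of "\<lambda>p. (F p)\<^sup>2"] assms by (simp add: Hloc_def)
  fix k
  have "loc_int (\<lambda>p. (G k F (flow b (-2) s p))\<^sup>2)"
    using loc_int_flow[of "\<lambda>p. (G k F p)\<^sup>2"] assms by (simp add: Hloc_def)
  then show "loc_int (\<lambda>p. (G k (\<lambda>p. F (flow b (-2) s p)) p)\<^sup>2)"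
    by (rule loc_int_cong) (simp add: G_flow 1)
qed

definition cut :: "(point \<Rightarrow> real) \<Rightarrow> bool" where
  "cut \<phi> \<longleftrightarrow> C1_bdd \<phi> \<and> (\<exists>R. supp R \<phi>)"

text \<open>The admissible functions that occur. Unlike cutoffs they have merely square integrable
  derivatives, since products such as X u phi^2 have to be allowed.\<close>

definition test :: "(point \<Rightarrow> real) \<Rightarrow> bool" where
  "test \<xi> \<longleftrightarrow> Hloc \<xi> \<and> loc_bdd \<xi> \<and> (\<exists>R. supp R \<xi>)"

lemma cut_mult: "cut \<phi> \<Longrightarrow> C1_bdd K \<Longrightarrow> cut (\<lambda>p. \<phi> p * K p)"
  unfolding cut_def supp_def by (auto intro!: C1_bdd_mult)

lemma supp_mono: "supp R F \<Longrightarrow> R \<le> S \<Longrightarrow> supp S F"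
  unfolding supp_def by auto

lemma supp_G:
  assumes "supp R F" "p \<in> half_space" "R < norm p"
  shows "dV V F p = 0"
proof -
  have "(F has_derivative (\<lambda>_. 0)) (at p)"
  proof (rule has_derivative_transform_within_open[OF has_derivative_const])
    show "open (half_space \<inter> {q. R < norm q})"
      by (intro open_Int open_half_space open_Collect_less continuous_intros)
  qed (use assms in \<open>auto simp: supp_def\<close>)
  then show ?thesis by (rule dV_eq)
qed

text \<open>By \<open>supp_G\<close> the derivative vanishes on the open exterior |p| > R; the
  larger radius turns this into the closed condition of \<open>supp\<close>.\<close>

lemma supp_dV: "supp R F \<Longrightarrow> supp (R + 1) (dV V F)"
  using supp_G[of R F] by (auto simp: supp_def)

lemma test_mult: "Hloc F \<Longrightarrow> loc_bdd F \<Longrightarrow> cut \<phi> \<Longrightarrow> test (\<lambda>p. F p * \<phi> p)"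
  unfolding test_def cut_def supp_def C1_bdd_def
  by (auto intro: loc_bdd_mult Hloc_C1_bdd_mult simp: C1_bdd_def)

text \<open>On a compact ball inside the half-space the sum of the absolute partial derivatives is
  bounded, and this sum bounds the operator norm.\<close>

lemma C1_lipschitz: assumes "C1 F" shows "loc_lipschitz_on half_space F"
  unfolding loc_lipschitz_on_def
proof
  fix p :: point assume p: "p \<in> half_space"
  obtain r where r: "r > 0" "cball p r \<subseteq> half_space"
    using open_half_space p open_contains_cball by blast
  let ?g = "\<lambda>q. \<Sum>e\<in>Basis. \<bar>dV (\<lambda>_. e) F q\<bar>"
  have "continuous_on (cball p r) ?g"
    using r by (intro continuous_intros continuous_on_subset[OF C1_continuous_dV[OF assms]]) auto
  then have "compact (?g ` cball p r)" by (intro compact_continuous_image) auto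
  then obtain B where B: "\<And>q. q \<in> cball p r \<Longrightarrow> ?g q \<le> B"
    using bounded_imp_bdd_above[OF compact_imp_bounded] by (meson bdd_above.unfold imageI)
  have B0: "B \<ge> 0" using B[of p] r by (auto intro: order_trans[OF sum_nonneg])
  have bd: "norm (F x - F y) \<le> B * norm (x - y)" if "x \<in> ball p r" "y \<in> ball p r" for x y
  proof (rule differentiable_bound[OF convex_ball _ _ that(1,2)])
    fix q assume q: "q \<in> ball p r"
    then have qH: "q \<in> half_space" using r by auto
    show "(F has_derivative (\<lambda>v. dV (\<lambda>_. v) F q)) (at q within ball p r)"
      using C1_has_derivative[OF assms qH] by (rule has_derivative_at_withinI)
    show "onorm (\<lambda>v. dV (\<lambda>_. v) F q) \<le> B"
    proof (rule onorm_bound[OF B0])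
      fix v
      have "norm (dV (\<lambda>_. v) F q) \<le> (\<Sum>e\<in>Basis. \<bar>v \<bullet> e\<bar> * \<bar>dV (\<lambda>_. e) F q\<bar>)"
        unfolding dV_Basis[OF assms qH, of "\<lambda>_. v"] real_norm_def
        by (rule order_trans[OF sum_abs]) (simp add: abs_mult)
      also have "\<dots> \<le> (\<Sum>e\<in>Basis. norm v * \<bar>dV (\<lambda>_. e) F q\<bar>)"
        by (intro sum_mono mult_right_mono Basis_le_norm) auto
      also have "\<dots> = norm v * ?g q" by (simp add: sum_distrib_left)
      also have "\<dots> \<le> norm v * B" using B[of q] q by (intro mult_left_mono) auto
      finally show "norm (dV (\<lambda>_. v) F q) \<le> B * norm v" by (simp add: mult.commute)
    qed
  qed
  have "B-lipschitz_on (ball p r \<inter> half_space) F"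
    using bd B0 by (auto intro!: lipschitz_onI simp: dist_norm)
  then show "\<exists>r>0. \<exists>L. L-lipschitz_on (ball p r \<inter> half_space) F" using r by blast
qed

lemma test_admissible: assumes "test \<xi>" shows "admissible a \<xi>"
  unfolding admissible_def
proof (intro conjI)
  have H: "Hloc \<xi>" "loc_bdd \<xi>" "C1 \<xi>" using assms by (auto simp: test_def Hloc_def)
  obtain R0 where R0: "supp R0 \<xi>" using assms by (auto simp: test_def)
  \<comment> \<open>Admissibility asks for a positive radius.\<close>
  define R where "R = max R0 1"
  have R: "supp R \<xi>" "R > 0" using supp_mono[OF R0, of R] by (auto simp: R_def)
  obtain C where C: "\<And>p. p \<in> half_space \<Longrightarrow> norm p < R \<Longrightarrow> \<bar>\<xi> p\<bar> \<le> C"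
    using H(2) unfolding loc_bdd_def by blast
  have "\<bar>\<xi> p\<bar> \<le> \<bar>C\<bar>" if "p \<in> half_space" for p
    using C[OF that] R(1) that unfolding supp_def by (cases "norm p < R") fastforce+
  then show "bounded (\<xi> ` half_space)" unfolding bounded_iff by (intro exI[of _ "\<bar>C\<bar>"]) auto
  show "loc_lipschitz_on half_space \<xi>" by (rule C1_lipschitz[OF H(3)])
  have "loc_int (\<lambda>p. \<Sum>k\<in>UNIV. (G k \<xi> p)\<^sup>2)"
    unfolding sum_3 using H(1) by (intro loc_int_add) (auto simp: Hloc_def)
  then have "loc_int (\<lambda>p. (norm (grad_ext \<xi> p))\<^sup>2)"
    by (rule loc_int_cong) (simp add: grad_ext_norm2[OF H(3)])
  then have i: "integrable M (\<lambda>p. indicator (ball 0 R) p * (norm (grad_ext \<xi> p))\<^sup>2)"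
    by (simp add: loc_int_def)
  then have "set_integrable lebesgue half_space (\<lambda>p. snd p powr a * (indicator (ball 0 R) p * (norm (grad_ext \<xi> p))\<^sup>2))"
    by (subst integral_wM(1)[symmetric]) auto
  then have "set_integrable lebesgue (half_ball R) (\<lambda>p. snd p powr a * (norm (grad_ext \<xi> p))\<^sup>2)"
    unfolding set_integrable_def half_ball_def
    by (rule Bochner_Integration.integrable_cong[OF refl, THEN iffD1, rotated]) (auto simp: indicator_def)
  with R show "\<exists>R>0. (\<forall>p\<in>half_space - ball 0 R. \<xi> p = 0) \<and>
      set_integrable lebesgue (half_ball R) (\<lambda>p. snd p powr a * (norm (grad_ext \<xi> p))\<^sup>2)"
    by (intro exI[of _ R]) (auto simp: supp_def)
qed

end

text \<open>Boundedness in L^2 and pointwise convergence imply weak convergence to the pointwise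
  limit. The first two claims are Fatou's lemma. For the third, |f n - h| is compared with K |g|:
  below it dominated convergence applies, above it the integral is at most that of (f n - h)^2 /
  K.\<close>

lemma weak_convergence_L2:
  fixes f :: "nat \<Rightarrow> 'a \<Rightarrow> real"
  assumes [measurable]: "\<And>n. f n \<in> borel_measurable N" "h \<in> borel_measurable N" "g \<in> borel_measurable N"
    and g: "integrable N (\<lambda>x. (g x)\<^sup>2)"
    and fi: "\<And>n. integrable N (\<lambda>x. (f n x)\<^sup>2)" and C: "\<And>n. (\<integral>x. (f n x)\<^sup>2 \<partial>N) \<le> C"
    and lim: "AE x in N. (\<lambda>n. f n x) \<longlonglongrightarrow> h x"
  shows "integrable N (\<lambda>x. (h x)\<^sup>2)" "(\<integral>x. (h x)\<^sup>2 \<partial>N) \<le> C"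
    "(\<lambda>n. \<integral>x. f n x * g x \<partial>N) \<longlonglongrightarrow> (\<integral>x. h x * g x \<partial>N)"
proof -
  have C0: "C \<ge> 0" by (rule order_trans[OF _ C[of 0]]) simp
  have "(\<integral>\<^sup>+x. ennreal ((h x)\<^sup>2) \<partial>N) = (\<integral>\<^sup>+x. liminf (\<lambda>n. ennreal ((f n x)\<^sup>2)) \<partial>N)"
  proof (rule nn_integral_cong_AE, use lim in eventually_elim)
    case (elim x)
    then have "(\<lambda>n. ennreal ((f n x)\<^sup>2)) \<longlonglongrightarrow> ennreal ((h x)\<^sup>2)"
      by (intro tendsto_ennrealI tendsto_intros)
    then show ?case by (intro lim_imp_Liminf[symmetric]) simp
  qed
  also have "\<dots> \<le> liminf (\<lambda>n. \<integral>\<^sup>+x. ennreal ((f n x)\<^sup>2) \<partial>N)"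
    by (rule nn_integral_liminf) simp
  also have "\<dots> \<le> liminf (\<lambda>n::nat. ennreal C)"
  proof (intro Liminf_mono always_eventually allI)
    fix n
    show "(\<integral>\<^sup>+x. ennreal ((f n x)\<^sup>2) \<partial>N) \<le> ennreal C"
      using nn_integral_eq_integral[OF fi[of n]] C[of n] by (simp add: ennreal_leI)
  qed
  also have "\<dots> = ennreal C" by (simp add: Liminf_const)
  finally have nn: "(\<integral>\<^sup>+x. ennreal ((h x)\<^sup>2) \<partial>N) \<le> ennreal C" .
  show hi: "integrable N (\<lambda>x. (h x)\<^sup>2)"
    using nn by (intro integrableI_nonneg) (auto simp: le_less_trans)
  show hC: "(\<integral>x. (h x)\<^sup>2 \<partial>N) \<le> C"
    using nn nn_integral_eq_integral[OF hi] C0 by (simp add: ennreal_le_iff)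
  have prod: "integrable N (\<lambda>x. u x * g x)"
    if [measurable]: "u \<in> borel_measurable N" and u: "integrable N (\<lambda>x. (u x)\<^sup>2)" for u
  proof (rule Bochner_Integration.integrable_bound)
    show "integrable N (\<lambda>x. (u x)\<^sup>2 + (g x)\<^sup>2)" using u g by simp
    have "\<bar>u x * g x\<bar> \<le> (u x)\<^sup>2 + (g x)\<^sup>2" for x
      using sum_squares_bound[of "\<bar>u x\<bar>" "\<bar>g x\<bar>"] mult_nonneg_nonneg[OF abs_ge_zero[of "u x"] abs_ge_zero[of "g x"]]
      unfolding abs_mult power2_abs by linarith
    then show "AE x in N. norm (u x * g x) \<le> norm ((u x)\<^sup>2 + (g x)\<^sup>2)" by simp
  qed simp
  have di: "integrable N (\<lambda>x. (f n x - h x)\<^sup>2)" "(\<integral>x. (f n x - h x)\<^sup>2 \<partial>N) \<le> 4 * C" for n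
  proof -
    have le: "(f n x - h x)\<^sup>2 \<le> 2 * (f n x)\<^sup>2 + 2 * (h x)\<^sup>2" for x
      using sum_squares_bound[of "f n x" "- h x"] by (simp add: power2_diff)
    show i: "integrable N (\<lambda>x. (f n x - h x)\<^sup>2)"
      by (rule Bochner_Integration.integrable_bound[of _ "\<lambda>x. 2 * (f n x)\<^sup>2 + 2 * (h x)\<^sup>2"])
        (use fi hi le in auto)
    have "(\<integral>x. (f n x - h x)\<^sup>2 \<partial>N) \<le> (\<integral>x. 2 * (f n x)\<^sup>2 + 2 * (h x)\<^sup>2 \<partial>N)"
      using fi hi le by (intro Bochner_Integration.integral_mono i) auto
    also have "\<dots> \<le> 4 * C" using fi[of n] hi C[of n] hC by simp
    finally show "(\<integral>x. (f n x - h x)\<^sup>2 \<partial>N) \<le> 4 * C" .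
  qed
  show "(\<lambda>n. \<integral>x. f n x * g x \<partial>N) \<longlonglongrightarrow> (\<integral>x. h x * g x \<partial>N)"
  proof (rule LIMSEQ_I)
    fix e :: real assume e: "e > 0"
    \<comment> \<open>Chosen so that 4 C / K is at most e / 2, where 4 C bounds the integral of (f n
      - h)^2; the 1 keeps K positive when C = 0.\<close>
    define K where "K = 8 * C / e + 1"
    have K: "K > 0" using C0 e by (simp add: K_def add_nonneg_pos)
    have KC: "4 * C / K \<le> e / 2" using e C0 K by (simp add: K_def field_simps)
    let ?m = "\<lambda>n x. min (\<bar>f n x - h x\<bar> * \<bar>g x\<bar>) (K * (g x)\<^sup>2)"
    have "(\<lambda>n. \<integral>x. ?m n x \<partial>N) \<longlonglongrightarrow> (\<integral>x. 0 \<partial>N)"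
    proof (rule integral_dominated_convergence)
      show "integrable N (\<lambda>x. K * (g x)\<^sup>2)" using g by simp
      show "AE x in N. (\<lambda>n. ?m n x) \<longlonglongrightarrow> 0"
        using lim
      proof eventually_elim
        case (elim x)
        have "(\<lambda>n. ?m n x) \<longlonglongrightarrow> min (\<bar>h x - h x\<bar> * \<bar>g x\<bar>) (K * (g x)\<^sup>2)"
          by (intro tendsto_intros elim)
        then show ?case using K by simp
      qed
      show "AE x in N. norm (?m n x) \<le> K * (g x)\<^sup>2" for n using K by simp
    qed simp_all
    then have "(\<lambda>n. \<integral>x. ?m n x \<partial>N) \<longlonglongrightarrow> 0" by simp
    then obtain n0 where n0: "\<And>n. n \<ge> n0 \<Longrightarrow> norm ((\<integral>x. ?m n x \<partial>N) - 0) < e / 2"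
      using LIMSEQ_D[of "\<lambda>n. \<integral>x. ?m n x \<partial>N" 0 "e / 2"] e by (meson half_gt_zero)
    have "norm ((\<integral>x. f n x * g x \<partial>N) - (\<integral>x. h x * g x \<partial>N)) < e" if n: "n \<ge> n0" for n
    proof -
      have mi: "integrable N (\<lambda>x. ?m n x)"
      proof (rule Bochner_Integration.integrable_bound)
        show "integrable N (\<lambda>x. K * (g x)\<^sup>2)" using g by simp
        show "AE x in N. norm (?m n x) \<le> norm (K * (g x)\<^sup>2)"
          using K by (intro AE_I2) (simp add: min.coboundedI2 abs_of_nonneg)
      qed measurable
      \<comment> \<open>If |f n - h| is at most K |g|, the minimum is the product itself. Otherwise
        |g| is below |f n - h| / K and the second summand alone suffices.\<close>
      have pw: "\<bar>f n x - h x\<bar> * \<bar>g x\<bar> \<le> ?m n x + (f n x - h x)\<^sup>2 / K" for x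
      proof (cases "\<bar>f n x - h x\<bar> \<le> K * \<bar>g x\<bar>")
        case True
        then have "\<bar>f n x - h x\<bar> * \<bar>g x\<bar> \<le> K * \<bar>g x\<bar> * \<bar>g x\<bar>" by (rule mult_right_mono) simp
        then have "?m n x = \<bar>f n x - h x\<bar> * \<bar>g x\<bar>"
          by (intro min_absorb1) (simp only: power2_eq_square mult.assoc abs_mult_self_eq)
        moreover have "0 \<le> (f n x - h x)\<^sup>2 / K" using K by (intro divide_nonneg_pos) auto
        ultimately show ?thesis by linarith
      next
        case False
        then have "\<bar>g x\<bar> \<le> \<bar>f n x - h x\<bar> / K"
          using K by (simp only: pos_le_divide_eq mult.commute[of K] not_le less_imp_le)
        then have "\<bar>f n x - h x\<bar> * \<bar>g x\<bar> \<le> \<bar>f n x - h x\<bar> * (\<bar>f n x - h x\<bar> / K)"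
          by (rule mult_left_mono) simp
        also have "\<dots> = (f n x - h x)\<^sup>2 / K" by (simp add: power2_eq_square)
        also have "\<dots> \<le> ?m n x + (f n x - h x)\<^sup>2 / K"
        proof -
          have "0 \<le> ?m n x" using K by (intro min.boundedI mult_nonneg_nonneg) auto
          then show ?thesis by linarith
        qed
        finally show ?thesis .
      qed
      have pdi: "integrable N (\<lambda>x. (f n x - h x) * g x)" by (rule prod) (use di in auto)
      have "(\<integral>x. f n x * g x \<partial>N) - (\<integral>x. h x * g x \<partial>N) = (\<integral>x. (f n x - h x) * g x \<partial>N)"
        using prod[OF _ fi[of n]] prod[OF _ hi] by (simp add: left_diff_distrib)
      then have "norm ((\<integral>x. f n x * g x \<partial>N) - (\<integral>x. h x * g x \<partial>N)) \<le> (\<integral>x. \<bar>(f n x - h x) * g x\<bar> \<partial>N)"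
        using integral_norm_bound[of N "\<lambda>x. (f n x - h x) * g x"] by simp
      also have "\<dots> \<le> (\<integral>x. ?m n x + (f n x - h x)\<^sup>2 / K \<partial>N)"
        by (intro Bochner_Integration.integral_mono Bochner_Integration.integrable_add
            integrable_abs[OF pdi] mi integrable_divide_zero di) (simp only: abs_mult pw)
      also have "\<dots> = (\<integral>x. ?m n x \<partial>N) + (\<integral>x. (f n x - h x)\<^sup>2 \<partial>N) / K"
        using mi di[of n] by simp
      also have "\<dots> \<le> (\<integral>x. ?m n x \<partial>N) + 4 * C / K"
        using di(2)[of n] K by (intro add_left_mono divide_right_mono) auto
      also have "\<dots> < e" using n0[OF n] KC by simp
      finally show ?thesis .
    qed
    then show "\<exists>no. \<forall>n\<ge>no. norm ((\<integral>x. f n x * g x \<partial>N) - (\<integral>x. h x * g x \<partial>N)) < e" by blast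
  qed
qed

subsection \<open>Traces on the boundary\<close>

lemma le_half_sum: "d \<le> (A + d) / 2 \<Longrightarrow> d \<le> A" for A d :: real
  by simp

lemma ennreal_two_mult: "0 \<le> A \<Longrightarrow> 0 \<le> E \<Longrightarrow> ennreal (2 * A * E) = 2 * ennreal A * ennreal E"
  by (simp add: ennreal_mult)

definition convg :: "(point \<Rightarrow> real) \<Rightarrow> real^3 \<Rightarrow> bool" where
  "convg F x \<longleftrightarrow> (\<exists>l. ((\<lambda>y. F (x, y)) \<longlongrightarrow> l) (at_right 0))"

text \<open>Agrees with \<open>trace0\<close> wherever the limit exists; the limit along a fixed sequence has the advantage
  of being Borel measurable in \<open>x\<close> for every \<open>F\<close> of class \<open>C\<^sup>1\<close>.\<close>

definition tr :: "(point \<Rightarrow> real) \<Rightarrow> real^3 \<Rightarrow> real" where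
  "tr F x = lim (\<lambda>n. F (x, inverse (real (Suc n))))"

lemma at_right_seq: "filterlim (\<lambda>n. inverse (real (Suc n))) (at_right 0) sequentially"
proof -
  have "inverse (real (Suc n)) \<in> {0<..} \<and> inverse (real (Suc n)) \<noteq> 0" for n by simp
  then show ?thesis unfolding filterlim_at
    by (intro conjI always_eventually LIMSEQ_inverse_real_of_nat) blast
qed

lemma tr_eqI: assumes "((\<lambda>y. F (x, y)) \<longlongrightarrow> l) (at_right 0)" shows "tr F x = l" "trace0 F x = l"
  unfolding tr_def trace0_def
  using filterlim_compose[OF assms at_right_seq] assms
  by (auto intro: limI tendsto_Lim)

lemma tr_tendsto: "convg F x \<Longrightarrow> ((\<lambda>y. F (x, y)) \<longlongrightarrow> tr F x) (at_right 0)"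
  unfolding convg_def using tr_eqI by metis

lemma trace0_eq: "convg F x \<Longrightarrow> trace0 F x = tr F x"
  using tr_tendsto tr_eqI(2) by blast

lemma convgI: "((\<lambda>y. F (x, y)) \<longlongrightarrow> l) (at_right 0) \<Longrightarrow> convg F x"
  unfolding convg_def by blast

lemma tr_diff: assumes "convg F x" "convg K x"
  shows "convg (\<lambda>p. F p - K p) x" "tr (\<lambda>p. F p - K p) x = tr F x - tr K x"
  using tendsto_diff[OF tr_tendsto[OF assms(1)] tr_tendsto[OF assms(2)]]
  by (auto intro: convgI tr_eqI)

lemma tr_mult: assumes "convg F x" "convg K x"
  shows "convg (\<lambda>p. F p * K p) x" "tr (\<lambda>p. F p * K p) x = tr F x * tr K x"
  using tendsto_mult[OF tr_tendsto[OF assms(1)] tr_tendsto[OF assms(2)]]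
  by (auto intro: convgI tr_eqI)

lemma tr_const [simp]: "convg (\<lambda>_. c) x" "tr (\<lambda>_. c) x = c"
  using tendsto_const by (auto intro: convgI tr_eqI)

lemma tr_coord [simp]: "convg (\<lambda>p. fst p $ i) x" "tr (\<lambda>p. fst p $ i) x = x $ i"
  by (auto intro!: convgI[where l="x $ i"] tr_eqI[where l="x $ i"])

lemma tr_cmult: "convg F x \<Longrightarrow> convg (\<lambda>p. c * F p) x \<and> tr (\<lambda>p. c * F p) x = c * tr F x"
  using tr_mult[of "\<lambda>_. c" x F] by simp

lemma tr_power: "convg F x \<Longrightarrow> convg (\<lambda>p. F p ^ n) x \<and> tr (\<lambda>p. F p ^ n) x = tr F x ^ n"
  by (induction n) (auto simp: tr_mult)

lemma C1_slice_continuous: assumes "continuous_on half_space F" "y > 0"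
  shows "continuous_on UNIV (\<lambda>x. F (x, y))"
  by (rule continuous_on_compose2[OF assms(1), of _ "\<lambda>x. (x, y)"])
     (use assms(2) in \<open>auto intro!: continuous_intros simp: half_space_def\<close>)

lemma tr_measurable: assumes "C1 F" shows "tr F \<in> borel_measurable borel"
  unfolding tr_def
  by (intro borel_measurable_lim_metric borel_measurable_continuous_onI
      C1_slice_continuous C1_continuous assms) auto

context weight begin

text \<open>Cauchy-Schwarz with the weights t^a and t^(-a); the integral of t^(-a) over (0, y] is
  y^(1-a) / (1-a). It is carried out as Young's inequality with a free parameter l, which is
  optimised afterwards.\<close>

lemma slice_bound:
  fixes g g' :: "real \<Rightarrow> real"
  assumes der: "\<And>y. y > 0 \<Longrightarrow> (g has_real_derivative g' y) (at y)"
    and cont: "continuous_on {0<..} g'"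
    and E: "(\<integral>\<^sup>+t. ennreal (t powr a * (g' t)\<^sup>2) * indicator {0<..Y} t \<partial>lborel) \<le> ennreal E" "E \<ge> 0"
    and zy: "0 < z" "z \<le> y" "y \<le> Y"
  shows "(g y - g z)\<^sup>2 \<le> E * (y powr (1 - a) / (1 - a))"
proof -
  define I where "I = y powr (1 - a) / (1 - a)"
  have I: "I \<ge> 0" using a_lt by (simp add: I_def)
  have key: "\<bar>g y - g z\<bar> \<le> l / 2 * E + I / (2 * l)" if l: "l > 0" for l
  proof -
    have hb: "has_bochner_integral lborel (\<lambda>x. g' x * indicator {z..y} x) (g y - g z)"
    proof (rule has_bochner_integral_FTC_Icc_real[OF zy(2)])
      fix t assume "z \<le> t" "t \<le> y"
      then have t: "t > 0" using zy by simp
      then show "(g has_real_derivative g' t) (at t)" by (rule der)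
      show "isCont g' t" using cont t by (simp add: continuous_on_eq_continuous_at)
    qed
    have pw: "\<bar>x\<bar> \<le> l / 2 * (t powr a * x\<^sup>2) + 1 / (2 * l) * t powr (- a)" if "t > 0" for t x
    proof -
      define c where "c = t powr a"
      have c: "c > 0" using that by (simp add: c_def)
      define k where "k = l * c"
      have k: "k > 0" using l c by (simp add: k_def)
      have "0 \<le> (k * \<bar>x\<bar> - 1)\<^sup>2 / (2 * k)" using k by simp
      also have "\<dots> = (k * k * x\<^sup>2 - 2 * k * \<bar>x\<bar> + 1) / (2 * k)"
        by (simp add: power2_eq_square algebra_simps)
      also have "\<dots> = k / 2 * x\<^sup>2 + 1 / (2 * k) - \<bar>x\<bar>"
        using k by (simp add: add_divide_distrib diff_divide_distrib)
      also have "\<dots> = l / 2 * (c * x\<^sup>2) + 1 / (2 * l) * (1 / c) - \<bar>x\<bar>"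
        by (simp add: k_def)
      finally show ?thesis by (simp add: c_def powr_minus_divide)
    qed
    have [measurable]: "(\<lambda>t. indicator {0<..Y} t * g' t) \<in> borel_measurable borel"
    proof -
      have "(\<lambda>t. indicator {0<..} t *\<^sub>R g' t) \<in> borel_measurable borel"
        by (rule borel_measurable_continuous_on_indicator) (use cont in auto)
      then have "(\<lambda>t. indicator {0<..Y} t * (indicator {0<..} t *\<^sub>R g' t)) \<in> borel_measurable borel"
        by measurable
      moreover have "(\<lambda>t. indicator {0<..Y} t * (indicator {0<..} t *\<^sub>R g' t)) = (\<lambda>t. indicator {0<..Y} t * g' t)"
        by (auto simp: fun_eq_iff indicator_def)
      ultimately show ?thesis by simp
    qed
    have m: "(\<lambda>t. ennreal (t powr a * (g' t)\<^sup>2) * indicator {0<..Y} t) \<in> borel_measurable lborel"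
    proof -
      have "(\<lambda>t. ennreal (t powr a * (g' t)\<^sup>2) * indicator {0<..Y} t)
        = (\<lambda>t. ennreal (t powr a * (indicator {0<..Y} t * g' t)\<^sup>2))"
        by (auto simp: fun_eq_iff indicator_def)
      then show ?thesis by simp
    qed
    have "ennreal \<bar>g y - g z\<bar> \<le> (\<integral>\<^sup>+t. ennreal (norm (g' t * indicator {z..y} t)) \<partial>lborel)"
      using integral_norm_bound_ennreal[of lborel "\<lambda>t. g' t * indicator {z..y} t"] hb
      by (simp add: has_bochner_integral_iff)
    also have "\<dots> \<le> (\<integral>\<^sup>+t. ennreal (l / 2) * (ennreal (t powr a * (g' t)\<^sup>2) * indicator {0<..Y} t)
        + ennreal (1 / (2 * l)) * (ennreal (t powr (- a)) * indicator {0<..y} t) \<partial>lborel)"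
    proof (intro nn_integral_mono)
      fix t
      show "ennreal (norm (g' t * indicator {z..y} t)) \<le> ennreal (l / 2) * (ennreal (t powr a * (g' t)\<^sup>2) * indicator {0<..Y} t)
        + ennreal (1 / (2 * l)) * (ennreal (t powr (- a)) * indicator {0<..y} t)"
      proof (cases "t \<in> {z..y}")
        case True
        then have "t > 0" using zy by simp
        from pw[OF this, of "g' t"] show ?thesis
          using True zy l by (simp add: ennreal_mult[symmetric] ennreal_plus[symmetric] indicator_def del: ennreal_plus)
      qed simp
    qed
    also have "\<dots> = ennreal (l / 2) * (\<integral>\<^sup>+t. ennreal (t powr a * (g' t)\<^sup>2) * indicator {0<..Y} t \<partial>lborel)
        + ennreal (1 / (2 * l)) * (\<integral>\<^sup>+t. ennreal (t powr (- a)) * indicator {0<..y} t \<partial>lborel)"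
      using m by (subst nn_integral_add) (auto simp: nn_integral_cmult)
    also have "\<dots> \<le> ennreal (l / 2) * ennreal E + ennreal (1 / (2 * l)) * ennreal I"
      using nn_integral_powr[of "- a" y] a_lt zy
      by (intro add_mono mult_left_mono E) (auto simp: I_def add.commute)
    also have "\<dots> = ennreal (l / 2 * E + I / (2 * l))"
      using l E(2) I by (simp add: ennreal_mult[symmetric] ennreal_plus[symmetric] del: ennreal_plus)
    finally show ?thesis using l E(2) I by (subst (asm) ennreal_le_iff) (auto intro!: add_nonneg_nonneg)
  qed
  let ?d = "\<bar>g y - g z\<bar>"
  show ?thesis
  proof (cases "?d = 0")
    case True
    then show ?thesis using E(2) a_lt by simp
  next
    case False
    then have d: "?d > 0" by simp
    have "I > 0" using zy a_lt by (simp add: I_def)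
    \<comment> \<open>With l = I / ?d the second summand is exactly ?d / 2, so half of ?d can be
      absorbed.\<close>
    then have "?d \<le> I / ?d / 2 * E + I / (2 * (I / ?d))"
      using d by (intro key) simp
    also have "\<dots> = (I * E / ?d + ?d) / 2" using \<open>I > 0\<close> by (simp add: add_divide_distrib)
    finally have "?d \<le> I * E / ?d" by (rule le_half_sum)
    then have "?d * ?d \<le> I * E"
      using d by (simp only: pos_le_divide_eq)
    then show ?thesis unfolding I_def[symmetric] power2_abs[of "g y - g z", symmetric]
      by (simp only: power2_eq_square mult.commute[of E])
  qed
qed

text \<open>The bound of \<open>slice_bound\<close> does not depend on the lower point z and tends
  to 0 with y. Hence the values along a sequence tending to 0 are Cauchy, and letting z tend to 0
  compares g y with the limit.\<close>

lemma slice_limit: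
  fixes g g' :: "real \<Rightarrow> real"
  assumes der: "\<And>y. y > 0 \<Longrightarrow> (g has_real_derivative g' y) (at y)"
    and cont: "continuous_on {0<..} g'"
    and E: "(\<integral>\<^sup>+t. ennreal (t powr a * (g' t)\<^sup>2) * indicator {0<..Y} t \<partial>lborel) \<le> ennreal E" "E \<ge> 0"
    and Y: "Y > 0"
  obtains l where "(g \<longlongrightarrow> l) (at_right 0)"
    "\<And>y. 0 < y \<Longrightarrow> y \<le> Y \<Longrightarrow> (g y - l)\<^sup>2 \<le> E * (y powr (1 - a) / (1 - a))"
proof -
  have sb: "(g y - g z)\<^sup>2 \<le> E * (y powr (1 - a) / (1 - a))" if "0 < z" "z \<le> y" "y \<le> Y" for y z
    by (rule slice_bound[where g=g and g'=g', OF _ cont E that]) (rule der)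
  let ?J = "\<lambda>y. sqrt (E * (y powr (1 - a) / (1 - a)))"
  have sb': "dist (g y) (g z) \<le> ?J y" if "0 < z" "z \<le> y" "y \<le> Y" for y z
    using real_sqrt_le_mono[OF sb[OF that]] by (simp add: dist_real_def)
  have J0: "(?J \<longlongrightarrow> 0) (at_right 0)"
  proof -
    have "((\<lambda>y::real. y powr (1 - a)) \<longlongrightarrow> 0) (at_right 0)"
      using a_lt by (intro tendsto_zero_powrI[of _ _ _ "1 - a"] tendsto_const tendsto_ident_at
        eventually_mono[OF eventually_at_right_less[of 0]]) auto
    from tendsto_real_sqrt[OF tendsto_mult[OF tendsto_const[of E] tendsto_divide[OF this tendsto_const[of "1 - a"]]]]
    show ?thesis using a_lt by simp
  qed
  \<comment> \<open>The factor Y keeps the sequence in (0, Y], where the energy bound is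
    assumed.\<close>
  define s where "s = (\<lambda>n. Y * inverse (real (Suc n)))"
  have s: "0 < s n" "s n \<le> Y" for n
  proof -
    show "0 < s n" using Y by (simp add: s_def)
    have "inverse (real (Suc n)) \<le> 1" by (simp add: inverse_le_1_iff)
    then show "s n \<le> Y" using Y mult_left_mono[of "inverse (real (Suc n))" 1 Y] by (simp add: s_def)
  qed
  have s0: "filterlim s (at_right 0) sequentially"
    proof -
    have "s \<longlonglongrightarrow> Y * 0" unfolding s_def by (intro tendsto_intros LIMSEQ_inverse_real_of_nat)
    moreover have "s n \<in> {0<..} \<and> s n \<noteq> 0" for n using s(1)[of n] by auto
    ultimately show ?thesis unfolding filterlim_at by (simp only: mult_zero_right always_eventually simp_thms)
  qed
  have smono: "s n \<le> s m" if "m \<le> n" for m n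
    unfolding s_def using that Y by (intro mult_left_mono le_imp_inverse_le) auto
  have "Cauchy (\<lambda>n. g (s n))"
  proof (rule metric_CauchyI)
    fix e :: real assume e: "e > 0"
    have "eventually (\<lambda>n. ?J (s n) < e) sequentially"
      using order_tendstoD(2)[OF filterlim_compose[OF J0 s0]] e by simp
    then obtain N where N: "\<And>n. n \<ge> N \<Longrightarrow> ?J (s n) < e" unfolding eventually_sequentially by blast
    have "dist (g (s m)) (g (s n)) < e" if "m \<ge> N" "n \<ge> N" for m n
    proof (cases "m \<le> n")
      case True
      then show ?thesis using sb'[OF s(1) smono s(2), of m n] N[of m] that by simp
    next
      case False
      then show ?thesis using sb'[OF s(1) smono s(2), of n m] N[of n] that by (simp add: dist_commute)
    qed
    then show "\<exists>M. \<forall>m\<ge>M. \<forall>n\<ge>M. dist (g (s m)) (g (s n)) < e" by blast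
  qed
  then obtain l where l: "(\<lambda>n. g (s n)) \<longlonglongrightarrow> l"
    unfolding Cauchy_convergent_iff convergent_def by blast
  have bd: "(g y - l)\<^sup>2 \<le> E * (y powr (1 - a) / (1 - a))" if y: "0 < y" "y \<le> Y" for y
  proof (rule LIMSEQ_le_const2)
    show "(\<lambda>n. (g y - g (s n))\<^sup>2) \<longlonglongrightarrow> (g y - l)\<^sup>2" by (intro tendsto_intros l)
    have "eventually (\<lambda>n. s n < y) sequentially"
      using s0 y unfolding filterlim_at by (auto intro: order_tendstoD(2))
    then obtain N where "\<And>n. n \<ge> N \<Longrightarrow> s n < y" unfolding eventually_sequentially by blast
    then show "\<exists>N. \<forall>n\<ge>N. (g y - g (s n))\<^sup>2 \<le> E * (y powr (1 - a) / (1 - a))"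
      using sb[OF s(1) less_imp_le y(2)] by blast
  qed
  have "(g \<longlongrightarrow> l) (at_right 0)"
  proof (rule Lim_transform_bound[OF _ J0, of "\<lambda>y. g y - l", THEN LIM_zero_cancel])
    show "\<forall>\<^sub>F y in at_right 0. norm (g y - l) \<le> norm (?J y)"
      using eventually_at_right_less[of 0] eventually_at_right_real[OF Y]
    proof eventually_elim
      case (elim y)
      then show ?case using order_trans[OF real_sqrt_le_mono[OF bd[of y]] abs_ge_self] by simp
    qed
  qed
  then show ?thesis using bd that by blast
qed

lemma slice_C1:
  assumes "C1 F"
  shows "\<And>y. y > 0 \<Longrightarrow> ((\<lambda>y. F (x, y)) has_real_derivative G 3 F (x, y)) (at y)"
    "continuous_on {0<..} (\<lambda>y. G 3 F (x, y))"
proof -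
  show "((\<lambda>y. F (x, y)) has_real_derivative G 3 F (x, y)) (at y)" if "y > 0" for y
    using dy_has_derivative[OF assms, of "(x, y)"] that by (simp add: half_space_def)
  show "continuous_on {0<..} (\<lambda>y. G 3 F (x, y))"
    by (rule continuous_on_compose2[OF C1_G_continuous[OF assms]])
       (auto intro!: continuous_intros simp: half_space_def)
qed

definition slE :: "(point \<Rightarrow> real) \<Rightarrow> real^3 \<Rightarrow> ennreal" where
  "slE F x = (\<integral>\<^sup>+y. ennreal (y powr a) * ennreal ((F (x, y))\<^sup>2) * indicator {0<..} y \<partial>lborel)"

lemma nn_integral_slE:
  assumes "F \<in> borel_measurable M"
  shows "(\<integral>\<^sup>+x. slE F x \<partial>lborel) = (\<integral>\<^sup>+p. ennreal ((F p)\<^sup>2) \<partial>M)"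
  unfolding slE_def using assms by (subst nn_integral_wM_Fubini) auto

lemma slE_measurable:
  assumes "F \<in> borel_measurable M"
  shows "slE F \<in> borel_measurable lborel"
proof -
  have m: "(\<lambda>p. indicator half_space p * F p) \<in> borel_measurable borel"
    using assms by (simp add: measurable_wM_iff)
  have "(\<lambda>p. ennreal (snd p powr a) * ennreal ((indicator half_space p * F p)\<^sup>2)) \<in> borel_measurable (lborel \<Otimes>\<^sub>M lborel)"
    unfolding lborel_prod using m measurable_snd_powr
    by (simp add: borel_measurable_times_ennreal measurable_compose[OF _ measurable_ennreal])
  from lborel.borel_measurable_nn_integral_fst[OF this]
  show ?thesis unfolding slE_def
    by (rule measurable_cong[THEN iffD1, rotated])
       (auto intro!: nn_integral_cong simp: half_space_def indicator_def)
qed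

lemma slE_finite_AE:
  assumes "F \<in> borel_measurable M" "integrable M (\<lambda>p. (F p)\<^sup>2)"
  shows "AE x in lborel. slE F x < \<infinity>"
proof -
  have "(\<integral>\<^sup>+x. slE F x \<partial>lborel) \<noteq> \<infinity>"
    unfolding nn_integral_slE[OF assms(1)] using nn_integral_eq_integral[OF assms(2)] by simp
  from nn_integral_PInf_AE[OF slE_measurable[OF assms(1)] this] show ?thesis
    by (simp add: less_top)
qed

text \<open>By Fubini almost every vertical segment has finite weighted energy, and on such a
  segment \<open>slice_limit\<close> applies. Countably many balls exhaust the half-space, so one
  null set serves for all of them.\<close>

lemma Hloc_convg:
  assumes "Hloc F"
  shows "AE x in lborel. convg F x"
proof -
  have C: "C1 F" and l: "loc_int (\<lambda>p. (G 3 F p)\<^sup>2)" using assms by (auto simp: Hloc_def)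
  let ?g = "\<lambda>n p. indicator (ball 0 (real n)) p * G 3 F p"
  have m: "?g n \<in> borel_measurable M" for n
    by (rule ball_ind_measurable[OF G_measurable[OF C]])
  have "AE x in lborel. slE (?g n) x < \<infinity>" for n
  proof (rule slE_finite_AE[OF m])
    have "(\<lambda>p. (?g n p)\<^sup>2) = (\<lambda>p. indicator (ball 0 (real n)) p * (G 3 F p)\<^sup>2)"
      by (auto simp: fun_eq_iff indicator_def)
    then show "integrable M (\<lambda>p. (?g n p)\<^sup>2)" using l by (simp add: loc_int_def)
  qed
  then have "AE x in lborel. \<forall>n. slE (?g n) x < \<infinity>" by (simp add: AE_all_countable)
  then show ?thesis
  proof eventually_elim
    case (elim x)
    \<comment> \<open>The segment above x up to height 1 then lies in the ball of radius n.\<close>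
    obtain n where n: "norm x + 1 < real n" using reals_Archimedean2 by blast
    have "(\<integral>\<^sup>+t. ennreal (t powr a * (G 3 F (x, t))\<^sup>2) * indicator {0<..1} t \<partial>lborel) \<le> slE (?g n) x"
      unfolding slE_def
    proof (intro nn_integral_mono)
      fix t :: real
      have "norm (x, t) < real n" if "0 < t" "t \<le> 1"
      proof -
        have "norm (x, t) \<le> norm x + norm t" by (rule norm_Pair_le)
        then show ?thesis using n that by simp
      qed
      then show "ennreal (t powr a * (G 3 F (x, t))\<^sup>2) * indicator {0<..1} t
        \<le> ennreal (t powr a) * ennreal ((?g n (x, t))\<^sup>2) * indicator {0<..} t"
        by (auto simp: indicator_def ennreal_mult)
    qed
    also have "\<dots> \<le> ennreal (enn2real (slE (?g n) x))"
      using elim[rule_format, of n] by simp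
    finally have E: "(\<integral>\<^sup>+t. ennreal (t powr a * (G 3 F (x, t))\<^sup>2) * indicator {0<..1} t \<partial>lborel)
      \<le> ennreal (enn2real (slE (?g n) x))" .
    obtain l where "((\<lambda>y. F (x, y)) \<longlongrightarrow> l) (at_right 0)"
      by (rule slice_limit[OF slice_C1[OF C] E]) auto
    then show ?case by (rule convgI)
  qed
qed

text \<open>The trace differs from F (x, y) by at most the bound of \<open>slice_limit\<close>. The
  exceptional set consists of the x with infinite vertical energy and does not depend on y, so all
  heights are treated at once.\<close>

lemma trace_pointwise:
  assumes "Hloc F" "supp R F"
  shows "AE x in lborel. \<forall>y>0. ennreal ((tr F x)\<^sup>2) \<le>
    2 * ennreal ((F (x, y))\<^sup>2) + 2 * ennreal (y powr (1 - a) / (1 - a)) * slE (G 3 F) x"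
proof -
  have C: "C1 F" and l: "loc_int (\<lambda>p. (G 3 F p)\<^sup>2)" using assms by (auto simp: Hloc_def)
  have "integrable M (\<lambda>p. (G 3 F p)\<^sup>2)"
    by (rule loc_int_integrable[OF l, of "R + 1"]) (use supp_dV[OF assms(2)] in \<open>auto simp: supp_def\<close>)
  from slE_finite_AE[OF G_measurable[OF C] this]
  show ?thesis
  proof eventually_elim
    case (elim x)
    let ?E = "enn2real (slE (G 3 F) x)"
    have E: "slE (G 3 F) x = ennreal ?E" using elim by simp
    show ?case
    proof (intro allI impI)
      fix y :: real assume y: "y > 0"
      have "(\<integral>\<^sup>+t. ennreal (t powr a * (G 3 F (x, t))\<^sup>2) * indicator {0<..y} t \<partial>lborel) \<le> slE (G 3 F) x"
        unfolding slE_def by (intro nn_integral_mono) (auto simp: indicator_def ennreal_mult)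
      then have E': "(\<integral>\<^sup>+t. ennreal (t powr a * (G 3 F (x, t))\<^sup>2) * indicator {0<..y} t \<partial>lborel) \<le> ennreal ?E"
        using E by simp
      obtain l where l: "((\<lambda>y. F (x, y)) \<longlongrightarrow> l) (at_right 0)"
        "\<And>t. 0 < t \<Longrightarrow> t \<le> y \<Longrightarrow> (F (x, t) - l)\<^sup>2 \<le> ?E * (t powr (1 - a) / (1 - a))"
        by (rule slice_limit[OF slice_C1[OF C] E' _ y]) auto
      have "(tr F x)\<^sup>2 = l\<^sup>2" using tr_eqI(1)[OF l(1)] by simp
      also have "\<dots> \<le> 2 * (F (x, y))\<^sup>2 + 2 * (F (x, y) - l)\<^sup>2"
        using zero_le_power2[of "2 * F (x, y) - l"] by (simp add: power2_eq_square algebra_simps)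
      also have "\<dots> \<le> 2 * (F (x, y))\<^sup>2 + 2 * (y powr (1 - a) / (1 - a)) * ?E"
        using l(2)[of y] y by (simp add: mult_ac)
      finally have "ennreal ((tr F x)\<^sup>2) \<le> ennreal (2 * (F (x, y))\<^sup>2 + 2 * (y powr (1 - a) / (1 - a)) * ?E)"
        by (rule ennreal_leI)
      also have "\<dots> = ennreal (2 * (F (x, y))\<^sup>2) + ennreal (2 * (y powr (1 - a) / (1 - a)) * ?E)"
        using a_lt by (intro ennreal_plus) auto
      also have "\<dots> = 2 * ennreal ((F (x, y))\<^sup>2) + 2 * ennreal (y powr (1 - a) / (1 - a)) * slE (G 3 F) x"
        using ennreal_two_mult[of "y powr (1 - a) / (1 - a)" ?E] a_lt
        unfolding E[symmetric] by (simp add: ennreal_mult)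
      finally show "ennreal ((tr F x)\<^sup>2) \<le>
        2 * ennreal ((F (x, y))\<^sup>2) + 2 * ennreal (y powr (1 - a) / (1 - a)) * slE (G 3 F) x" .
    qed
  qed
qed

end

context weight begin

lemma Hloc_supp_integrable:
  assumes "Hloc F" "supp R F"
  shows "integrable M (\<lambda>p. (F p)\<^sup>2)" "integrable M (\<lambda>p. (G k F p)\<^sup>2)"
proof -
  show "integrable M (\<lambda>p. (F p)\<^sup>2)"
    by (rule loc_int_integrable[of _ R]) (use assms in \<open>auto simp: Hloc_def supp_def\<close>)
  show "integrable M (\<lambda>p. (G k F p)\<^sup>2)"
    by (rule loc_int_integrable[of _ "R + 1"]) (use assms supp_dV[of R F "fr k"] in \<open>auto simp: Hloc_def supp_def\<close>)
qed

lemma nn_square_eq: "integrable N (\<lambda>p. (F p)\<^sup>2) \<Longrightarrow> (\<integral>\<^sup>+p. ennreal ((F p)\<^sup>2) \<partial>N) = ennreal (\<integral>p. (F p)\<^sup>2 \<partial>N)"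
  for F :: "'a \<Rightarrow> real"
  by (rule nn_integral_eq_integral) auto

lemma slice_measurable: "C1 F \<Longrightarrow> y > 0 \<Longrightarrow> (\<lambda>x. F (x, y)) \<in> borel_measurable borel"
  by (intro borel_measurable_continuous_onI C1_slice_continuous C1_continuous)

text \<open>The comparison at one fixed height d. For convergence of traces this is the useful form:
  the energy term carries a factor that is small with d, while at height d > 0 convergence can be
  checked pointwise.\<close>

lemma trace_slice:
  assumes F: "Hloc F" "supp R F" and d: "d > 0"
  shows "(\<integral>\<^sup>+x. ennreal ((tr F x)\<^sup>2) \<partial>lborel) \<le>
    2 * (\<integral>\<^sup>+x. ennreal ((F (x, d))\<^sup>2) \<partial>lborel)
    + 2 * ennreal (d powr (1 - a) / (1 - a)) * (\<integral>\<^sup>+p. ennreal ((G 3 F p)\<^sup>2) \<partial>M)"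
proof -
  note C = Hloc_C1[OF F(1)]
  note m = slE_measurable[OF G_measurable[OF C]]
  have "(\<integral>\<^sup>+x. ennreal ((tr F x)\<^sup>2) \<partial>lborel) \<le>
    (\<integral>\<^sup>+x. 2 * ennreal ((F (x, d))\<^sup>2) + 2 * ennreal (d powr (1 - a) / (1 - a)) * slE (G 3 F) x \<partial>lborel)"
    by (rule nn_integral_mono_AE, use trace_pointwise[OF F] in eventually_elim) (use d in auto)
  also have "\<dots> = (\<integral>\<^sup>+x. 2 * ennreal ((F (x, d))\<^sup>2) \<partial>lborel)
      + (\<integral>\<^sup>+x. 2 * ennreal (d powr (1 - a) / (1 - a)) * slE (G 3 F) x \<partial>lborel)"
    using slice_measurable[OF C d] m by (intro nn_integral_add) auto
  also have "\<dots> = 2 * (\<integral>\<^sup>+x. ennreal ((F (x, d))\<^sup>2) \<partial>lborel)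
    + 2 * ennreal (d powr (1 - a) / (1 - a)) * (\<integral>\<^sup>+x. slE (G 3 F) x \<partial>lborel)"
    using slice_measurable[OF C d] m by (subst (1 2) nn_integral_cmult) auto
  finally show ?thesis unfolding nn_integral_slE[OF G_measurable[OF C]] .
qed

text \<open>A trace inequality with an arbitrarily small constant at the energy, so that boundary
  terms can be absorbed. It is the average of \<open>trace_pointwise\<close> over heights in (0, d]
  with the weight y^a.\<close>

lemma trace_bound:
  assumes e: "e > 0"
  obtains C where "C > 0" "\<And>F R. Hloc F \<Longrightarrow> supp R F \<Longrightarrow>
    integrable lborel (\<lambda>x. (tr F x)\<^sup>2) \<and>
    (\<integral>x. (tr F x)\<^sup>2 \<partial>lborel) \<le> e * (\<integral>p. (G 3 F p)\<^sup>2 \<partial>M) + C * (\<integral>p. (F p)\<^sup>2 \<partial>M)"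
proof -
  \<comment> \<open>The solution of 2 d^(1-a) / (1-a) = e, the energy coefficient of
    \<open>trace_pointwise\<close> at height d.\<close>
  define d where "d = (e * (1 - a) / 2) powr (1 / (1 - a))"
  have d: "d > 0" using e a_lt by (simp add: d_def)
  have dp: "d powr (1 - a) = e * (1 - a) / 2"
    unfolding d_def powr_powr using e a_lt by simp
  \<comment> \<open>The integral of y^a over (0, d], by which the average is normalised.\<close>
  define m where "m = d powr (a + 1) / (a + 1)"
  have m: "m > 0" using d a_gt by (simp add: m_def)
  have mI: "(\<integral>\<^sup>+y. ennreal (y powr a) * indicator {0<..d} y \<partial>lborel) = ennreal m"
    unfolding m_def using nn_integral_powr[OF a_gt] d by simp
  have "integrable lborel (\<lambda>x. (tr F x)\<^sup>2) \<and>
    (\<integral>x. (tr F x)\<^sup>2 \<partial>lborel) \<le> e * (\<integral>p. (G 3 F p)\<^sup>2 \<partial>M) + (2 / m) * (\<integral>p. (F p)\<^sup>2 \<partial>M)"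
    if F: "Hloc F" "supp R F" for F R
  proof -
    note C = Hloc_C1[OF F(1)]
    note ms = slE_measurable[OF G_measurable[OF C]] slE_measurable[OF C1_measurable[OF C]]
    have "AE x in lborel. ennreal ((tr F x)\<^sup>2) \<le> ennreal (2 / m) * slE F x + ennreal e * slE (G 3 F) x"
      using trace_pointwise[OF F]
    proof eventually_elim
      case (elim x)
      let ?t = "ennreal ((tr F x)\<^sup>2)" and ?E = "slE (G 3 F) x"
      have mf: "(\<lambda>y. ennreal (y powr a) * ennreal ((F (x, y))\<^sup>2) * indicator {0<..} y) \<in> borel_measurable lborel"
      proof -
        have "continuous_on {0<..} (\<lambda>y. F (x, y))"
          by (rule continuous_on_compose2[OF C1_continuous[OF C]])
             (auto intro!: continuous_intros simp: half_space_def)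
        then have "(\<lambda>y. indicator {0<..} y *\<^sub>R F (x, y)) \<in> borel_measurable borel"
          by (intro borel_measurable_continuous_on_indicator) auto
        then have "(\<lambda>y. ennreal (y powr a) * ennreal ((indicator {0<..} y *\<^sub>R F (x, y))\<^sup>2)) \<in> borel_measurable lborel"
          by measurable
        then show ?thesis
          by (rule measurable_cong[THEN iffD1, rotated]) (auto simp: indicator_def)
      qed
      have pw: "?t \<le> 2 * ennreal ((F (x, y))\<^sup>2) + ennreal e * ?E" if y: "0 < y" "y \<le> d" for y
      proof -
        have "2 * ennreal (y powr (1 - a) / (1 - a)) = ennreal (2 * (y powr (1 - a) / (1 - a)))"
          using a_lt by (subst ennreal_mult) auto
        also have "\<dots> \<le> ennreal e"
        proof (rule ennreal_leI)
          have "y powr (1 - a) \<le> e * (1 - a) / 2"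
            unfolding dp[symmetric] using y a_lt by (intro powr_mono2) auto
          then show "2 * (y powr (1 - a) / (1 - a)) \<le> e"
            using a_lt by (simp add: divide_le_eq)
        qed
        finally have "2 * ennreal (y powr (1 - a) / (1 - a)) * ?E \<le> ennreal e * ?E"
          by (rule mult_right_mono) simp
        then show ?thesis using elim y(1) by (meson add_left_mono order_trans)
      qed
      have "?t * ennreal m = (\<integral>\<^sup>+y. ?t * (ennreal (y powr a) * indicator {0<..d} y) \<partial>lborel)"
        unfolding mI[symmetric] by (subst nn_integral_cmult) auto
      also have "\<dots> \<le> (\<integral>\<^sup>+y. 2 * (ennreal (y powr a) * ennreal ((F (x, y))\<^sup>2) * indicator {0<..} y)
          + ennreal e * ?E * (ennreal (y powr a) * indicator {0<..d} y) \<partial>lborel)"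
      proof (intro nn_integral_mono)
        fix y :: real
        show "?t * (ennreal (y powr a) * indicator {0<..d} y) \<le>
           2 * (ennreal (y powr a) * ennreal ((F (x, y))\<^sup>2) * indicator {0<..} y)
          + ennreal e * ?E * (ennreal (y powr a) * indicator {0<..d} y)"
        proof (cases "y \<in> {0<..d}")
          case True
          then have "?t * ennreal (y powr a) \<le> (2 * ennreal ((F (x, y))\<^sup>2) + ennreal e * ?E) * ennreal (y powr a)"
            by (intro mult_right_mono pw) auto
          then show ?thesis using True by (simp add: distrib_left mult_ac)
        qed simp
      qed
      also have "\<dots> = 2 * slE F x + ennreal e * ?E * ennreal m"
        using mf unfolding slE_def[of F] mI[symmetric]
        by (subst nn_integral_add) (auto simp: nn_integral_cmult)
      finally have 1: "?t * ennreal m \<le> 2 * slE F x + ennreal e * ?E * ennreal m" .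
      have mm: "ennreal m * ennreal (1 / m) = 1" using m by (simp add: ennreal_mult[symmetric])
      have "?t = ?t * ennreal m * ennreal (1 / m)" by (simp add: mult.assoc mm)
      also have "\<dots> \<le> (2 * slE F x + ennreal e * ?E * ennreal m) * ennreal (1 / m)"
        by (intro mult_right_mono 1) simp
      also have "\<dots> = 2 * ennreal (1 / m) * slE F x + ennreal e * ?E"
        by (simp add: distrib_right mult.assoc mm) (simp add: mult.commute)
      also have "2 * ennreal (1 / m) = ennreal (2 / m)"
        using m ennreal_mult[of 2 "1 / m"] by simp
      finally show "?t \<le> ennreal (2 / m) * slE F x + ennreal e * ?E" .
    qed
    then have "(\<integral>\<^sup>+x. ennreal ((tr F x)\<^sup>2) \<partial>lborel) \<le>
       (\<integral>\<^sup>+x. ennreal (2 / m) * slE F x + ennreal e * slE (G 3 F) x \<partial>lborel)"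
      by (rule nn_integral_mono_AE)
    also have "\<dots> = ennreal (2 / m) * (\<integral>\<^sup>+x. slE F x \<partial>lborel) + ennreal e * (\<integral>\<^sup>+x. slE (G 3 F) x \<partial>lborel)"
      using ms by (simp add: nn_integral_add nn_integral_cmult)
    also have "\<dots> = ennreal (2 / m) * ennreal (\<integral>p. (F p)\<^sup>2 \<partial>M) + ennreal e * ennreal (\<integral>p. (G 3 F p)\<^sup>2 \<partial>M)"
      by (simp add: nn_integral_slE C1_measurable[OF C] G_measurable[OF C] nn_square_eq Hloc_supp_integrable[OF F])
    also have "\<dots> = ennreal (e * (\<integral>p. (G 3 F p)\<^sup>2 \<partial>M) + (2 / m) * (\<integral>p. (F p)\<^sup>2 \<partial>M))"
      using e m by (simp add: ennreal_mult[symmetric] ennreal_plus[symmetric] add.commute del: ennreal_plus)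
    finally have nn: "(\<integral>\<^sup>+x. ennreal ((tr F x)\<^sup>2) \<partial>lborel) \<le>
      ennreal (e * (\<integral>p. (G 3 F p)\<^sup>2 \<partial>M) + (2 / m) * (\<integral>p. (F p)\<^sup>2 \<partial>M))" .
    have i: "integrable lborel (\<lambda>x. (tr F x)\<^sup>2)"
      using nn tr_measurable[OF C] by (intro integrableI_nonneg) (auto simp: le_less_trans)
    have "0 \<le> e * (\<integral>p. (G 3 F p)\<^sup>2 \<partial>M) + (2 / m) * (\<integral>p. (F p)\<^sup>2 \<partial>M)"
      using e m by (intro add_nonneg_nonneg mult_nonneg_nonneg) auto
    then show ?thesis using nn i by (simp add: nn_square_eq ennreal_le_iff)
  qed
  then show ?thesis using m that[of "2 / m"] by simp
qed

lemma trace_square_integrable: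
  assumes "Hloc F" "supp R F"
  shows "integrable lborel (\<lambda>x. (tr F x)\<^sup>2)"
  by (rule trace_bound[of 1]) (use assms in auto)

definition bflow :: "real^3 \<Rightarrow> real \<Rightarrow> real \<Rightarrow> real^3 \<Rightarrow> real^3" where
  "bflow b c s x = x + s *\<^sub>R (b + (c * (b$1 * x$2 - b$2 * x$1)) *\<^sub>R axis 3 1)"

lemma flow_bflow: "flow b c s (x, y) = (bflow b c s x, y)"
  by (simp add: flow_alt bflow_def)

lemma tr_flow: "tr (\<lambda>p. F (flow b c s p)) x = tr F (bflow b c s x)"
  by (simp add: tr_def flow_bflow)

lemma distr_bflow: "distr lborel borel (bflow b c s) = lborel"
  using lborel_shear[of s b c] by (simp add: bflow_def[abs_def])

lemma measurable_bflow: "bflow b c s \<in> borel_measurable borel"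
  unfolding bflow_def by (intro borel_measurable_continuous_onI continuous_intros)

lemma integral_bflow:
  fixes h :: "real^3 \<Rightarrow> real"
  assumes "h \<in> borel_measurable borel"
  shows "(\<integral>x. h (bflow b c s x) \<partial>lborel) = (\<integral>x. h x \<partial>lborel)"
  using integral_distr[of "bflow b c s" lborel borel h] measurable_bflow assms
  by (simp add: distr_bflow)

text \<open>The inverse flow obeys the same growth bound: a point of norm at least K (1 + R) cannot
  be moved into the ball of radius R.\<close>

lemma supp_flow:
  assumes "supp R F" "\<bar>s\<bar> \<le> 1"
  obtains R' where "supp R' (\<lambda>p. F (flow b c s p))"
proof -
  obtain K where K: "K > 0" "\<And>s p. \<bar>s\<bar> \<le> 1 \<Longrightarrow> norm (flow b c s p) \<le> K * (1 + norm p)"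
    using norm_flow_le by blast
  have "R \<le> norm (flow b c s p)" if "K * (1 + R) \<le> norm p" for p
  proof -
    have "norm p = norm (flow b c (- s) (flow b c s p))" by simp
    also have "\<dots> \<le> K * (1 + norm (flow b c s p))" using assms(2) by (intro K) simp
    finally have "K * (1 + R) \<le> K * (1 + norm (flow b c s p))" using that by simp
    then show ?thesis using K(1) by simp
  qed
  then have "supp (K * (1 + R)) (\<lambda>p. F (flow b c s p))"
    using assms(1) unfolding supp_def by simp
  then show ?thesis by (rule that)
qed

lemma test_flow: assumes "test \<xi>" "\<bar>s\<bar> \<le> 1" shows "test (\<lambda>p. \<xi> (flow b (-2) s p))"
proof -
  obtain R where "supp R \<xi>" using assms by (auto simp: test_def)
  then obtain R' where "supp R' (\<lambda>p. \<xi> (flow b (-2) s p))" using supp_flow assms(2) by blast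
  then show ?thesis using assms unfolding test_def by (auto intro: Hloc_flow loc_bdd_flow)
qed

lemma test_bounded:
  assumes "test \<xi>"
  obtains R C where "R > 0" "C \<ge> 0" "supp R \<xi>" "\<And>p. p \<in> half_space \<Longrightarrow> \<bar>\<xi> p\<bar> \<le> C"
proof -
  obtain R0 where R0: "supp R0 \<xi>" using assms by (auto simp: test_def)
  define R where "R = max R0 1"
  have R: "supp R \<xi>" "R > 0" using supp_mono[OF R0, of R] by (auto simp: R_def)
  obtain C where C: "\<And>p. p \<in> half_space \<Longrightarrow> norm p < R \<Longrightarrow> \<bar>\<xi> p\<bar> \<le> C"
    using assms unfolding loc_bdd_def test_def by blast
  have "\<bar>\<xi> p\<bar> \<le> \<bar>C\<bar>" if "p \<in> half_space" for p
    using C[OF that] R(1) that unfolding supp_def by (cases "norm p < R") fastforce+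
  then show ?thesis using that[of R "\<bar>C\<bar>"] R by auto
qed

lemma tr_bound:
  assumes "\<And>p. p \<in> half_space \<Longrightarrow> \<bar>F p\<bar> \<le> C" "convg F x"
  shows "\<bar>tr F x\<bar> \<le> C"
proof -
  have "((\<lambda>y. \<bar>F (x, y)\<bar>) \<longlongrightarrow> \<bar>tr F x\<bar>) (at_right 0)"
    by (intro tendsto_rabs tr_tendsto assms)
  moreover have "eventually (\<lambda>y. \<bar>F (x, y)\<bar> \<le> C) (at_right 0)"
    using eventually_at_right_less[of 0] by (rule eventually_mono) (auto intro!: assms simp: half_space_def)
  ultimately show ?thesis by (intro tendsto_upperbound) auto
qed

lemma tr_supp:
  assumes "supp R F" "R \<le> norm x"
  shows "convg F x" "tr F x = 0"
proof -
  have "F (x, y) = 0" if "y > 0" for y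
    using assms that norm_fst_le[of x y] unfolding supp_def half_space_def by auto
  then have "((\<lambda>y. F (x, y)) \<longlongrightarrow> 0) (at_right 0)"
    by (intro tendsto_eventually eventually_mono[OF eventually_at_right_less[of 0]]) auto
  then show "convg F x" "tr F x = 0" by (auto intro: convgI tr_eqI)
qed

lemma tr_integrable:
  fixes h :: "real^3 \<Rightarrow> real"
  assumes "test \<xi>" and [measurable]: "h \<in> borel_measurable borel" and h: "AE x in lborel. \<bar>h x\<bar> \<le> B"
  shows "integrable lborel (\<lambda>x. h x * tr \<xi> x)"
proof -
  obtain R C where RC: "R > 0" "C \<ge> 0" "supp R \<xi>" "\<And>p. p \<in> half_space \<Longrightarrow> \<bar>\<xi> p\<bar> \<le> C"
    using test_bounded[OF assms(1)] by blast
  have H: "Hloc \<xi>" using assms by (simp add: test_def)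
  note [measurable] = tr_measurable[OF Hloc_C1[OF H]]
  show ?thesis
  proof (rule Bochner_Integration.integrable_bound)
    show "integrable lborel (\<lambda>x::real^3. indicator (cball 0 R) x * (\<bar>B\<bar> * C))"
      using emeasure_lborel_cball_finite[of "0::real^3" R]
      by (intro integrable_mult_left integrable_real_indicator) auto
    show "AE x in lborel. norm (h x * tr \<xi> x) \<le> norm (indicator (cball 0 R) x * (\<bar>B\<bar> * C))"
      using h Hloc_convg[OF H]
    proof eventually_elim
      case (elim x)
      have "\<bar>h x\<bar> * \<bar>tr \<xi> x\<bar> \<le> \<bar>B\<bar> * C"
        using elim tr_bound[OF RC(4) elim(2)] by (intro mult_mono) auto
      then show ?case using tr_supp(2)[OF RC(3), of x] RC(2)
        by (cases "norm x \<le> R") (auto simp: abs_mult)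
    qed
  qed measurable
qed

end

subsection \<open>Commutators of the invariant fields\<close>

abbreviation pd :: "3 \<Rightarrow> (point \<Rightarrow> real) \<Rightarrow> point \<Rightarrow> real" where
  "pd i \<equiv> dV (\<lambda>_. (axis i 1, 0))"

lemma vf_expand:
  assumes "C1 F" "p \<in> half_space"
  shows "dV (vf b c) F p = b$1 * pd 1 F p + b$2 * pd 2 F p
    + (b$3 + c * (b$1 * fst p$2 - b$2 * fst p$1)) * pd 3 F p"
proof -
  note l = dV_linear[OF assms]
  have "vf b c p = b$1 *\<^sub>R (axis 1 1, 0) + b$2 *\<^sub>R (axis 2 1, 0)
     + (b$3 + c * (b$1 * fst p$2 - b$2 * fst p$1)) *\<^sub>R (axis 3 1, 0)"
    by (simp add: vf_def vec_eq_iff forall_3 axis_def)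
  then show ?thesis
    unfolding dV_frozen[of "vf b c"] by (simp only: linear_add[OF l] linear_cmul[OF l] real_scaleR_def)
qed

lemma G3_eq: "G 3 = dV (\<lambda>_. (0, 1))"
  by (simp add: fun_eq_iff dV_def fr_def)

lemma G1_expand:
  assumes "C2 u" "p \<in> half_space"
  shows "dV V (G 1 u) p = dV V (pd 1 u) p + 2 * (fst p$2 * dV V (pd 3 u) p + fst (V p)$2 * pd 3 u p)"
proof -
  note c = C1_add[OF C2_dV[OF assms(1)] C1_mult[OF C1_cmult[OF C1_coord] C2_dV[OF assms(1)]]]
  have "dV V (G 1 u) p = dV V (\<lambda>p. pd 1 u p + 2 * fst p$2 * pd 3 u p) p"
    by (rule dV_cong[OF c assms(2)]) (simp add: dV_fr_cases[OF C2_C1[OF assms(1)]])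
  also have "\<dots> = dV V (pd 1 u) p + (2 * fst p$2 * dV V (pd 3 u) p + 2 * fst (V p)$2 * pd 3 u p)"
    by (simp add: dV_add dV_mult dV_cmult C1_mult C1_cmult C1_coord C2_dV assms)
  finally show ?thesis by (simp add: algebra_simps)
qed

lemma G2_expand:
  assumes "C2 u" "p \<in> half_space"
  shows "dV V (G 2 u) p = dV V (pd 2 u) p - 2 * (fst p$1 * dV V (pd 3 u) p + fst (V p)$1 * pd 3 u p)"
proof -
  note c = C1_diff[OF C2_dV[OF assms(1)] C1_mult[OF C1_cmult[OF C1_coord] C2_dV[OF assms(1)]]]
  have "dV V (G 2 u) p = dV V (\<lambda>p. pd 2 u p - 2 * fst p$1 * pd 3 u p) p"
    by (rule dV_cong[OF c assms(2)]) (simp add: dV_fr_cases[OF C2_C1[OF assms(1)]])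
  also have "\<dots> = dV V (pd 2 u) p - (2 * fst p$1 * dV V (pd 3 u) p + 2 * fst (V p)$1 * pd 3 u p)"
    by (simp add: dV_diff dV_mult dV_cmult C1_mult C1_cmult C1_coord C2_dV assms)
  finally show ?thesis by (simp add: algebra_simps)
qed

lemma fst_fr: "fst (fr 1 p) $ 2 = 0" "fst (fr 1 p) $ 1 = 1" "fst (fr 2 p) $ 1 = 0" "fst (fr 2 p) $ 2 = 1"
  "fst (fr 3 p) $ i = 0"
  by (simp_all add: fr_def vf_def)

text \<open>The second derivatives cancel by symmetry. What remains are the derivatives of the
  coefficients 2 x_2 and -2 x_1, each contributing -2 times the derivative in x_3.\<close>

lemma commutator:
  assumes "C2 u" "p \<in> half_space"
  shows "G 1 (G 2 u) p - G 2 (G 1 u) p = - 4 * pd 3 u p"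
  unfolding G1_expand[OF assms] G2_expand[OF assms] fst_fr
    dV_fr_cases[OF C2_dV[OF assms(1)] assms(2)]
    dV_commute[OF assms, of "(axis 2 1, 0)" "(axis 1 1, 0)"]
    dV_commute[OF assms, of "(axis 3 1, 0)" "(axis 1 1, 0)"]
    dV_commute[OF assms, of "(axis 3 1, 0)" "(axis 2 1, 0)"]
  by (simp add: algebra_simps)

lemma dV_vf_expand:
  assumes "C2 u" "p \<in> half_space"
  shows "dV V (dV (vf b c) u) p = b$1 * dV V (pd 1 u) p + b$2 * dV V (pd 2 u) p
    + (b$3 + c * (b$1 * fst p$2 - b$2 * fst p$1)) * dV V (pd 3 u) p
    + c * (b$1 * fst (V p)$2 - b$2 * fst (V p)$1) * pd 3 u p"
proof -
  have co: "C1 (\<lambda>p. b$3 + c * (b$1 * fst p$2 - b$2 * fst p$1))"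
    by (intro C1_add C1_diff C1_cmult C1_const C1_coord)
  have dco: "dV V (\<lambda>p. b$3 + c * (b$1 * fst p$2 - b$2 * fst p$1)) p
    = c * (b$1 * fst (V p)$2 - b$2 * fst (V p)$1)"
    by (simp add: dV_add dV_diff dV_cmult C1_add C1_diff C1_cmult C1_coord assms)
  have cc: "C1 (\<lambda>p. b$1 * pd 1 u p + b$2 * pd 2 u p
    + (b$3 + c * (b$1 * fst p$2 - b$2 * fst p$1)) * pd 3 u p)"
    by (intro C1_add[OF C1_add] C1_cmult C1_mult[OF co] C2_dV assms)
  have "dV V (dV (vf b c) u) p = dV V (\<lambda>p. b$1 * pd 1 u p + b$2 * pd 2 u p
    + (b$3 + c * (b$1 * fst p$2 - b$2 * fst p$1)) * pd 3 u p) p"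
    by (rule dV_cong[OF cc assms(2)]) (simp add: vf_expand[OF C2_C1[OF assms(1)]])
  also have "\<dots> = (b$1 * dV V (pd 1 u) p + b$2 * dV V (pd 2 u) p)
    + ((b$3 + c * (b$1 * fst p$2 - b$2 * fst p$1)) * dV V (pd 3 u) p
    + c * (b$1 * fst (V p)$2 - b$2 * fst (V p)$1) * pd 3 u p)"
    by (simp only: dV_add dV_mult dV_cmult C1_add C1_mult co C1_cmult C2_dV assms dco)
  finally show ?thesis by simp
qed

text \<open>Infinitesimal form of the fact that left and right translations commute. The x_3
  coefficients of the two fields differentiate each other equally, as their skew parts have opposite
  signs.\<close>

lemma vf_G_commute:
  assumes "C2 u" "p \<in> half_space"
  shows "dV (vf b (-2)) (G k u) p = G k (dV (vf b (-2)) u) p"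
proof -
  note comm = dV_commute[OF assms, of "(axis 2 1, 0)" "(axis 1 1, 0)"]
    dV_commute[OF assms, of "(axis 3 1, 0)" "(axis 1 1, 0)"]
    dV_commute[OF assms, of "(axis 3 1, 0)" "(axis 2 1, 0)"]
  note d = C2_dV[OF assms(1)]
  have fv: "fst (vf b (-2) p) $ 1 = b$1" "fst (vf b (-2) p) $ 2 = b$2" by (simp_all add: vf_def)
  consider "k = 1" | "k = 2" | "k = 3" using exhaust_3 by blast
  then show ?thesis
  proof cases
    case 1
    then show ?thesis
      unfolding 1 G1_expand[OF assms] dV_vf_expand[OF assms] fst_fr fv
        dV_fr_cases[OF d assms(2)] vf_expand[OF d assms(2)] comm
      by (simp add: algebra_simps)
  next
    case 2
    then show ?thesis
      unfolding 2 G2_expand[OF assms] dV_vf_expand[OF assms] fst_fr fv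
        dV_fr_cases[OF d assms(2)] vf_expand[OF d assms(2)] comm
      by (simp add: algebra_simps)
  next
    case 3
    have c3: "pd i (dV (\<lambda>_. (0, 1)) u) p = dV (\<lambda>_. (0, 1)) (pd i u) p" for i
      by (rule dV_commute[OF assms])
    show ?thesis
      unfolding 3 G3_eq vf_expand[OF d assms(2)] dV_vf_expand[OF assms] c3 by simp
  qed
qed

section \<open>The gradient inner product and integration by parts away from y = 0\<close>

definition grad_ip :: "(point \<Rightarrow> real) \<Rightarrow> (point \<Rightarrow> real) \<Rightarrow> point \<Rightarrow> real" where
  "grad_ip F K p = (\<Sum>k\<in>UNIV. G k F p * G k K p)"

lemma grad_ip_nonneg: "0 \<le> grad_ip F F p"
  unfolding grad_ip_def by (intro sum_nonneg) simp

lemma grad_ip_commute: "grad_ip F K p = grad_ip K F p"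
  unfolding grad_ip_def by (simp add: mult.commute)

lemma grad_ip_ge: "(G k F p)\<^sup>2 \<le> grad_ip F F p"
  unfolding grad_ip_def power2_eq_square
  by (rule member_le_sum[of k UNIV "\<lambda>k. G k F p * G k F p"]) auto

lemma grad_ip_add: "C1 F \<Longrightarrow> C1 K \<Longrightarrow> p \<in> half_space \<Longrightarrow> grad_ip (\<lambda>p. F p + K p) L p = grad_ip F L p + grad_ip K L p"
  unfolding grad_ip_def by (simp add: dV_add distrib_right sum.distrib)

lemma grad_ip_mult: "C1 F \<Longrightarrow> C1 K \<Longrightarrow> p \<in> half_space \<Longrightarrow>
    grad_ip L (\<lambda>p. F p * K p) p = F p * grad_ip L K p + K p * grad_ip L F p"
  unfolding grad_ip_def by (simp add: dV_mult distrib_left sum.distrib sum_distrib_left mult_ac)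

lemma grad_ip_cmult: "C1 F \<Longrightarrow> p \<in> half_space \<Longrightarrow> grad_ip L (\<lambda>p. c * F p) p = c * grad_ip L F p"
  unfolding grad_ip_def by (simp add: dV_cmult sum_distrib_left mult_ac)

text \<open>The squared length of s grad F + t grad K, where s and t may themselves be values of
  functions at p.\<close>

lemma grad_ip_square: "0 \<le> s\<^sup>2 * grad_ip F F p + 2 * s * t * grad_ip F K p + t\<^sup>2 * grad_ip K K p"
proof -
  have "0 \<le> (\<Sum>k\<in>UNIV. (s * G k F p + t * G k K p)\<^sup>2)" by (intro sum_nonneg) simp
  also have "\<dots> = s\<^sup>2 * grad_ip F F p + 2 * s * t * grad_ip F K p + t\<^sup>2 * grad_ip K K p"
    unfolding grad_ip_def by (simp add: power2_sum sum.distrib sum_distrib_left power_mult_distrib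
        power2_eq_square[of "dV _ _ _"] mult_ac)
  finally show ?thesis .
qed

context weight begin

lemma loc_int_grad_ip:
  assumes "Hloc F" "Hloc K"
  shows "loc_int (grad_ip F K)"
  unfolding grad_ip_def sum_3 using assms
  by (intro loc_int_add loc_int_mult G_measurable) (auto simp: Hloc_def)

lemma grad_ip_integrable:
  assumes "Hloc F" "Hloc K" "supp R K"
  shows "integrable M (grad_ip F K)"
proof (rule loc_int_integrable[OF loc_int_grad_ip[OF assms(1,2)]])
  show "supp (R + 1) (grad_ip F K)"
    unfolding supp_def grad_ip_def using supp_dV[OF assms(3), of "fr _"]
    by (auto simp: supp_def intro!: sum.neutral)
qed

text \<open>The flows of X and Y keep y fixed, so the sharp cutoff is constant along them and no
  boundary term appears at y = d.\<close>

lemma chi_ibp: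
  assumes k: "k = 1 \<or> k = 2" and F: "C1 F"
    and i1: "integrable M (\<lambda>p. indicator {p. d < snd p} p * F p)"
    and i2: "integrable M (\<lambda>p. indicator {p. d < snd p} p * G k F p)"
  shows "(\<integral>p. indicator {p. d < snd p} p * G k F p \<partial>M) = 0"
proof -
  obtain b where b: "fr k = vf b 2"
  proof (cases "k = 1")
    case True
    then have "fr k = vf (vector [1, 0, 0]) 2" by (rule_tac ext) (simp add: fr_def)
    then show ?thesis by (rule that)
  next
    case False
    then have "fr k = vf (vector [0, 1, 0]) 2" using k by (rule_tac ext) (simp add: fr_def)
    then show ?thesis by (rule that)
  qed
  show ?thesis
  proof (rule integral_by_parts[OF i1 i2, of b 2])
    fix p :: point and s assume p: "p \<in> half_space"
    show "((\<lambda>s. indicator {p. d < snd p} (flow b 2 s p) * F (flow b 2 s p)) has_real_derivative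
        indicator {p. d < snd p} (flow b 2 s p) * G k F (flow b 2 s p)) (at s)"
      using flow_derivative[OF F p, of b 2 s] unfolding b by (auto simp: indicator_def)
  next
    fix p :: point assume p: "p \<in> half_space"
    have "continuous_on UNIV (\<lambda>s. G k F (flow b 2 s p))"
      by (rule continuous_on_compose2[OF C1_G_continuous[OF F]]) (use p in \<open>auto intro!: continuous_intros\<close>)
    then show "continuous_on UNIV (\<lambda>s. indicator {p. d < snd p} (flow b 2 s p) * G k F (flow b 2 s p))"
      by (auto simp: indicator_def)
  qed
qed

lemma ibp:
  assumes "k = 1 \<or> k = 2" "C1 F" "integrable M F" "integrable M (G k F)"
  shows "(\<integral>p. G k F p \<partial>M) = 0"
proof -
  have e: "integrable M (\<lambda>p. indicator {p. 0 < snd p} p * h p) = integrable M h"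
    "(\<integral>p. indicator {p. 0 < snd p} p * h p \<partial>M) = (\<integral>p. h p \<partial>M)" for h :: "point \<Rightarrow> real"
    by (auto intro!: Bochner_Integration.integrable_cong Bochner_Integration.integral_cong simp: half_space_def)
  show ?thesis using chi_ibp[OF assms(1,2), of 0] assms(3,4) by (simp only: e)
qed

text \<open>Away from y = 0, bounded sets are relatively compact in the half-space and continuity
  suffices. In this way quantities without control near the boundary become integrable.\<close>

lemma loc_bdd_chi:
  assumes "continuous_on half_space h" "d > 0"
  shows "loc_bdd (\<lambda>p. indicator {p. d < snd p} p * h p)"
  unfolding loc_bdd_def
proof
  fix R :: real
  let ?K = "cball 0 R \<inter> {p::point. d \<le> snd p}"
  have "closed {p::point. d \<le> snd p}" by (intro closed_Collect_le continuous_intros)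
  then have "compact ?K" by (intro compact_Int_closed) auto
  moreover have "continuous_on ?K h"
    by (rule continuous_on_subset[OF assms(1)]) (use assms(2) in \<open>auto simp: half_space_def\<close>)
  ultimately have "bounded (h ` ?K)" by (intro compact_imp_bounded compact_continuous_image)
  then obtain C where C: "\<And>p. p \<in> ?K \<Longrightarrow> \<bar>h p\<bar> \<le> C" unfolding bounded_iff real_norm_def by blast
  have "\<bar>indicator {p. d < snd p} p * h p\<bar> \<le> \<bar>C\<bar>" if "norm p < R" for p
    using C[of p] that by (auto simp: indicator_def)
  then show "\<exists>C. \<forall>p\<in>half_space. norm p < R \<longrightarrow> \<bar>indicator {p. d < snd p} p * h p\<bar> \<le> C" by blast
qed

lemma chi_measurable: "h \<in> borel_measurable M \<Longrightarrow> (\<lambda>p. indicator {p. d < snd p} p * h p) \<in> borel_measurable M"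
  for h :: "point \<Rightarrow> real"
proof -
  have "open {p::point. d < snd p}" by (intro open_Collect_less continuous_intros)
  then have "(indicator {p. d < snd p} :: point \<Rightarrow> real) \<in> borel_measurable M"
    by (intro measurable_wM_borel borel_measurable_indicator) auto
  then show "h \<in> borel_measurable M \<Longrightarrow> ?thesis" by (rule borel_measurable_times)
qed

end

subsection \<open>Difference quotients along left translations\<close>

text \<open>The hypotheses of the theorem in the calculus of \<open>wM\<close>, \<open>tr\<close>
  and \<open>grad_ip\<close>, with the equation and stability restricted to C^1 test functions.
  \<open>Lf\<close> bounds f' on [-Mu, Mu], which contains the values of u and almost all its
  traces.\<close>

locale sol = weight +
  fixes u :: "point \<Rightarrow> real" and f f' :: "real \<Rightarrow> real" and Mu Lf :: real
  assumes u2: "C2 u" and uH: "Hloc u" and ub: "\<And>p. p \<in> half_space \<Longrightarrow> \<bar>u p\<bar> \<le> Mu"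
    and Xlb: "loc_bdd (G 1 u)" "loc_bdd (G 2 u)"
    and fd: "\<And>r. (f has_real_derivative f' r) (at r)" and f'c: "continuous_on UNIV f'"
    and f'b: "\<And>r. \<bar>r\<bar> \<le> Mu \<Longrightarrow> \<bar>f' r\<bar> \<le> Lf"
    and weak: "\<And>\<xi>. test \<xi> \<Longrightarrow> (\<integral>p. grad_ip u \<xi> p \<partial>M) = (\<integral>x. f (tr u x) * tr \<xi> x \<partial>lborel)"
    and stable: "\<And>\<xi>. test \<xi> \<Longrightarrow> 0 \<le> (\<integral>p. grad_ip \<xi> \<xi> p \<partial>M) - (\<integral>x. f' (tr u x) * (tr \<xi> x)\<^sup>2 \<partial>lborel)"
begin

lemma Mu: "Mu \<ge> 0"
proof -
  have "(0, 1) \<in> half_space" by (simp add: half_space_def)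
  from ub[OF this] show ?thesis by linarith
qed

lemma Lf: "Lf \<ge> 0"
  using f'b[of 0] Mu by (metis abs_ge_zero abs_zero order_trans)

lemma f_lip: "\<bar>r\<bar> \<le> Mu \<Longrightarrow> \<bar>t\<bar> \<le> Mu \<Longrightarrow> \<bar>f r - f t\<bar> \<le> Lf * \<bar>r - t\<bar>"
proof -
  assume "\<bar>r\<bar> \<le> Mu" "\<bar>t\<bar> \<le> Mu"
  then have "norm (f r - f t) \<le> Lf * norm (r - t)"
    by (intro field_differentiable_bound[of "{-Mu..Mu}" f f' Lf])
       (auto intro!: f'b has_field_derivative_at_within[OF fd])
  then show ?thesis by simp
qed

lemma f_measurable [measurable]: "f \<in> borel_measurable borel" "f' \<in> borel_measurable borel"
  using f'c DERIV_continuous_on[of UNIV f f'] fd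
  by (auto intro!: borel_measurable_continuous_onI)

lemma f_bound: "\<bar>r\<bar> \<le> Mu \<Longrightarrow> \<bar>f r\<bar> \<le> \<bar>f 0\<bar> + Lf * Mu"
proof -
  assume r: "\<bar>r\<bar> \<le> Mu"
  have "\<bar>f r - f 0\<bar> \<le> Lf * \<bar>r\<bar>" using f_lip[of r 0] r Mu by simp
  also have "\<dots> \<le> Lf * Mu" using r Lf by (intro mult_left_mono) auto
  finally show ?thesis by linarith
qed

definition u_shift :: "real^3 \<Rightarrow> real \<Rightarrow> point \<Rightarrow> real" where
  "u_shift b s p = u (flow b (-2) s p)"

lemma u_shift_C2: "C2 (u_shift b s)"
  using C2_flow[OF u2, of b "-2" s] by (simp add: u_shift_def[abs_def])

lemma u_shift_G: "p \<in> half_space \<Longrightarrow> G k (u_shift b s) p = G k u (flow b (-2) s p)"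
  using G_flow[OF C2_C1[OF u2], of p k b s] by (simp add: u_shift_def[abs_def])

lemma u_shift_Hloc: "\<bar>s\<bar> \<le> 1 \<Longrightarrow> Hloc (u_shift b s)"
  using Hloc_flow[OF uH, of s b] by (simp add: u_shift_def[abs_def])

lemma u_shift_bound: "p \<in> half_space \<Longrightarrow> \<bar>u_shift b s p\<bar> \<le> Mu"
  by (simp add: u_shift_def ub)

lemma u_shift_0: "u_shift b 0 = u"
  by (simp add: u_shift_def fun_eq_iff)

lemma u_shift_tr_bound: "\<bar>s\<bar> \<le> 1 \<Longrightarrow> AE x in lborel. convg (u_shift b s) x \<and> \<bar>tr (u_shift b s) x\<bar> \<le> Mu"
  using Hloc_convg[OF u_shift_Hloc[of s b]]
  by (auto elim!: eventually_mono intro: tr_bound u_shift_bound)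

lemma u_shift_tr_measurable [measurable]: "tr (u_shift b s) \<in> borel_measurable borel"
  by (rule tr_measurable[OF C2_C1[OF u_shift_C2]])

text \<open>Left translations commute with the frame and preserve both measures, so a translate of u
  solves the same problem: the inverse translation is applied to the test function.\<close>

lemma u_shift_weak:
  assumes s: "\<bar>s\<bar> \<le> 1" and xi: "test \<xi>"
  shows "(\<integral>p. grad_ip (u_shift b s) \<xi> p \<partial>M) = (\<integral>x. f (tr (u_shift b s) x) * tr \<xi> x \<partial>lborel)"
    "integrable lborel (\<lambda>x. f (tr (u_shift b s) x) * tr \<xi> x)"
proof -
  define \<eta> where "\<eta> = (\<lambda>p. \<xi> (flow b (-2) (- s) p))"
  have eta: "test \<eta>" unfolding \<eta>_def using xi s by (intro test_flow) auto
  have C: "C1 \<eta>" "C1 \<xi>" "C1 u" using eta xi u2 by (auto simp: test_def Hloc_def C2_def)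
  have xe: "\<xi> = (\<lambda>p. \<eta> (flow b (-2) s p))" by (simp add: \<eta>_def fun_eq_iff)
  have "(\<integral>p. grad_ip (u_shift b s) \<xi> p \<partial>M) = (\<integral>p. grad_ip u \<eta> (flow b (-2) s p) \<partial>M)"
  proof (rule Bochner_Integration.integral_cong[OF refl])
    fix p assume "p \<in> space M"
    then have p: "p \<in> half_space" by simp
    show "grad_ip (u_shift b s) \<xi> p = grad_ip u \<eta> (flow b (-2) s p)"
      unfolding grad_ip_def u_shift_G[OF p] by (subst xe) (simp add: G_flow[OF C(1) p])
  qed
  also have "\<dots> = (\<integral>p. grad_ip u \<eta> p \<partial>M)"
    by (rule integral_flow(2)) (unfold grad_ip_def, intro borel_measurable_sum borel_measurable_times G_measurable C)
  also have "\<dots> = (\<integral>x. f (tr u x) * tr \<eta> x \<partial>lborel)" by (rule weak[OF eta])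
  also have "\<dots> = (\<integral>x. f (tr u (bflow b (-2) s x)) * tr \<eta> (bflow b (-2) s x) \<partial>lborel)"
    using tr_measurable[OF C(1)] tr_measurable[OF C(3)]
    by (intro integral_bflow[symmetric]) measurable
  also have "\<dots> = (\<integral>x. f (tr (u_shift b s) x) * tr \<xi> x \<partial>lborel)"
  proof -
    have "tr \<eta> (bflow b (-2) s x) = tr \<xi> x" for x
      unfolding tr_flow[of \<eta> b "-2" s x, symmetric] xe[symmetric] ..
    then show ?thesis by (simp add: u_shift_def[abs_def] tr_flow)
  qed
  finally show "(\<integral>p. grad_ip (u_shift b s) \<xi> p \<partial>M) = (\<integral>x. f (tr (u_shift b s) x) * tr \<xi> x \<partial>lborel)" .
  have "AE x in lborel. \<bar>f (tr (u_shift b s) x)\<bar> \<le> \<bar>f 0\<bar> + Lf * Mu"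
    using u_shift_tr_bound[OF s, of b] by eventually_elim (use f_bound in auto)
  then show "integrable lborel (\<lambda>x. f (tr (u_shift b s) x) * tr \<xi> x)"
    by (intro tr_integrable[OF xi]) measurable
qed

definition w :: "real^3 \<Rightarrow> real \<Rightarrow> point \<Rightarrow> real" where
  "w b h p = (1 / h) * (u_shift b h p - u p)"

definition q :: "real^3 \<Rightarrow> real \<Rightarrow> real^3 \<Rightarrow> real" where
  "q b h x = (f (tr (u_shift b h) x) - f (tr u x)) / h"

lemma u_C1: "C1 u" by (rule C2_C1[OF u2])

lemma w_C1: "C1 (w b h)"
  unfolding w_def[abs_def] by (intro C1_cmult C1_diff u_C1 C2_C1[OF u_shift_C2])

lemma w_Hloc: "0 < h \<Longrightarrow> h \<le> 1 \<Longrightarrow> Hloc (w b h)"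
  unfolding w_def[abs_def] by (intro Hloc_cmult Hloc_diff uH u_shift_Hloc) auto

lemma w_loc_bdd: "loc_bdd (w b h)"
proof (rule loc_bdd_bounded)
  fix p assume p: "p \<in> half_space"
  show "\<bar>w b h p\<bar> \<le> \<bar>1 / h\<bar> * (Mu + Mu)"
    unfolding w_def abs_mult using u_shift_bound[OF p, of b h] ub[OF p] by (intro mult_left_mono) auto
qed

lemma w_G: "p \<in> half_space \<Longrightarrow> G k (w b h) p = (G k u (flow b (-2) h p) - G k u p) / h"
  unfolding w_def[abs_def]
  by (simp only: dV_cmult dV_diff C1_diff u_C1 C2_C1[OF u_shift_C2] u_shift_G) simp

lemma w_grad_ip: "p \<in> half_space \<Longrightarrow> grad_ip (w b h) \<xi> p = (grad_ip (u_shift b h) \<xi> p - grad_ip u \<xi> p) / h"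
  unfolding grad_ip_def by (simp add: w_G u_shift_G sum_subtractf[symmetric] sum_divide_distrib left_diff_distrib)

lemma q_measurable [measurable]: "q b h \<in> borel_measurable borel"
  using tr_measurable[OF u_C1] unfolding q_def[abs_def] by measurable

lemma w_weak:
  assumes h: "0 < h" "h \<le> 1" and xi: "test \<xi>"
  shows "(\<integral>p. grad_ip (w b h) \<xi> p \<partial>M) = (\<integral>x. q b h x * tr \<xi> x \<partial>lborel)"
    "integrable lborel (\<lambda>x. q b h x * tr \<xi> x)"
proof -
  obtain R where R: "supp R \<xi>" "Hloc \<xi>" using xi by (auto simp: test_def)
  have h1: "\<bar>h\<bar> \<le> 1" using h by simp
  note i = u_shift_weak(2)[OF h1 xi, of b] u_shift_weak(2)[of 0 \<xi> b, OF _ xi, unfolded u_shift_0, simplified]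
  have q: "q b h x * tr \<xi> x = (f (tr (u_shift b h) x) * tr \<xi> x - f (tr u x) * tr \<xi> x) / h" for x
    by (simp add: q_def left_diff_distrib)
  have "(\<integral>p. grad_ip (w b h) \<xi> p \<partial>M) = (\<integral>p. (grad_ip (u_shift b h) \<xi> p - grad_ip u \<xi> p) / h \<partial>M)"
    by (rule Bochner_Integration.integral_cong) (auto simp: w_grad_ip)
  also have "\<dots> = ((\<integral>p. grad_ip (u_shift b h) \<xi> p \<partial>M) - (\<integral>p. grad_ip u \<xi> p \<partial>M)) / h"
    using grad_ip_integrable[OF u_shift_Hloc[OF h1] R(2,1), of b] grad_ip_integrable[OF uH R(2,1)] by simp
  also have "\<dots> = (\<integral>x. q b h x * tr \<xi> x \<partial>lborel)"
    unfolding q u_shift_weak(1)[OF h1 xi] weak[OF xi] using i by simp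
  finally show "(\<integral>p. grad_ip (w b h) \<xi> p \<partial>M) = (\<integral>x. q b h x * tr \<xi> x \<partial>lborel)" .
  show "integrable lborel (\<lambda>x. q b h x * tr \<xi> x)" unfolding q using i by simp
qed

text \<open>f is Lipschitz with constant \<open>Lf\<close> on the range of u and its translates, so
  the difference quotient of f of the traces is controlled by the trace of w.\<close>

lemma q_bound:
  assumes h: "0 < h" "h \<le> 1"
  shows "AE x in lborel. \<bar>q b h x\<bar> \<le> Lf * \<bar>tr (w b h) x\<bar>"
    "AE x in lborel. convg (w b h) x \<and> tr (w b h) x = (tr (u_shift b h) x - tr u x) / h"
proof -
  have h1: "\<bar>h\<bar> \<le> 1" using h by simp
  have *: "AE x in lborel. convg (u_shift b h) x \<and> \<bar>tr (u_shift b h) x\<bar> \<le> Mu"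
    "AE x in lborel. convg u x \<and> \<bar>tr u x\<bar> \<le> Mu"
    using u_shift_tr_bound[OF h1, of b] u_shift_tr_bound[of 0 b] by (auto simp: u_shift_0)
  show 1: "AE x in lborel. convg (w b h) x \<and> tr (w b h) x = (tr (u_shift b h) x - tr u x) / h"
    using *
  proof eventually_elim
    case (elim x)
    then have "convg (u_shift b h) x" "convg u x" by auto
    from tr_cmult[OF tr_diff(1)[OF this], of "1 / h"] tr_diff(2)[OF this]
    show ?case unfolding w_def[abs_def] by (simp only: times_divide_eq_left mult_1 simp_thms)
  qed
  show "AE x in lborel. \<bar>q b h x\<bar> \<le> Lf * \<bar>tr (w b h) x\<bar>"
    using * 1
  proof eventually_elim
    case (elim x)
    then have "\<bar>f (tr (u_shift b h) x) - f (tr u x)\<bar> / h \<le> Lf * \<bar>tr (u_shift b h) x - tr u x\<bar> / h"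
      using h by (intro divide_right_mono f_lip) auto
    then show ?case using elim h by (simp add: q_def abs_divide)
  qed
qed

end

section \<open>The Caccioppoli estimate for difference quotients\<close>

context weight begin

lemma C1_bdd_power: "C1_bdd K \<Longrightarrow> C1_bdd (\<lambda>p. K p ^ n)"
  by (induction n) (auto intro: C1_bdd_mult C1_bdd_const)

lemma cut_power: "cut \<zeta> \<Longrightarrow> 0 < n \<Longrightarrow> cut (\<lambda>p. \<zeta> p ^ n)"
  using cut_mult[of \<zeta> "\<lambda>p. \<zeta> p ^ (n - 1)"] C1_bdd_power[of \<zeta> "n - 1"]
  by (simp add: cut_def power_eq_if)

lemma cut_bounds:
  assumes "cut \<zeta>"
  obtains R D where "R > 0" "supp R \<zeta>" "D \<ge> 0" "\<And>p. p \<in> half_space \<Longrightarrow> \<bar>\<zeta> p\<bar> \<le> D"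
    "\<And>p k. p \<in> half_space \<Longrightarrow> \<bar>G k \<zeta> p\<bar> \<le> D"
proof -
  obtain R0 where R0: "supp R0 \<zeta>" and l: "C1_bdd \<zeta>" using assms by (auto simp: cut_def)
  define R where "R = max R0 1"
  have R: "supp R \<zeta>" "R > 0" using supp_mono[OF R0, of R] by (auto simp: R_def)
  have "\<exists>C. \<forall>p\<in>half_space. norm p < R + 1 \<longrightarrow> \<bar>\<zeta> p\<bar> \<le> C"
    using l unfolding C1_bdd_def loc_bdd_def by blast
  then obtain C0 where C0: "\<And>p. p \<in> half_space \<Longrightarrow> norm p < R + 1 \<Longrightarrow> \<bar>\<zeta> p\<bar> \<le> C0" by blast
  have "\<forall>k. \<exists>C. \<forall>p\<in>half_space. norm p < R + 1 \<longrightarrow> \<bar>G k \<zeta> p\<bar> \<le> C"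
    using l unfolding C1_bdd_def loc_bdd_def by blast
  then obtain C where C: "\<And>k p. p \<in> half_space \<Longrightarrow> norm p < R + 1 \<Longrightarrow> \<bar>G k \<zeta> p\<bar> \<le> C k" by metis
  define D where "D = \<bar>C0\<bar> + (\<Sum>k\<in>UNIV. \<bar>C k\<bar>)"
  have D: "D \<ge> 0" "\<bar>C0\<bar> \<le> D" "\<bar>C k\<bar> \<le> D" for k
    using member_le_sum[of k UNIV "\<lambda>k. \<bar>C k\<bar>"] sum_nonneg[of UNIV "\<lambda>k. \<bar>C k\<bar>"] by (auto simp: D_def)
  have z: "\<bar>\<zeta> p\<bar> \<le> D" if p: "p \<in> half_space" for p
  proof (cases "norm p < R + 1")
    case True then show ?thesis using C0[OF p] D(2) by linarith
  next
    case False then show ?thesis using R(1) p D(1) by (auto simp: supp_def)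
  qed
  have g: "\<bar>G k \<zeta> p\<bar> \<le> D" if p: "p \<in> half_space" for p k
  proof (cases "norm p < R + 1")
    case True then show ?thesis using C[OF p, of k] D(3)[of k] by linarith
  next
    case False then show ?thesis using supp_G[OF R(1) p] D(1) by simp
  qed
  show ?thesis by (rule that[OF R(2,1) D(1) z g])
qed

lemma cut_grad_ip_bound:
  assumes "D \<ge> 0" "\<And>k. \<bar>G k \<zeta> p\<bar> \<le> D"
  shows "grad_ip \<zeta> \<zeta> p \<le> 3 * D\<^sup>2"
proof -
  have "(G k \<zeta> p)\<^sup>2 \<le> D\<^sup>2" for k using assms by (simp add: abs_le_square_iff[symmetric])
  from this[of 1] this[of 2] this[of 3] show ?thesis
    unfolding grad_ip_def sum_3 by (simp add: power2_eq_square)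
qed

lemma grad_ip_power4:
  assumes "C1 \<zeta>" "p \<in> half_space"
  shows "grad_ip F (\<lambda>p. \<zeta> p ^ 4) p = 4 * \<zeta> p ^ 3 * grad_ip F \<zeta> p"
  unfolding grad_ip_def by (simp add: dV_power4 assms sum_distrib_left mult_ac)

lemma grad_ip_measurable: "C1 F \<Longrightarrow> C1 K \<Longrightarrow> grad_ip F K \<in> borel_measurable M"
  unfolding grad_ip_def by (intro borel_measurable_sum borel_measurable_times G_measurable)

lemma C1_bdd_loc_bdd_power: "C1_bdd \<zeta> \<Longrightarrow> loc_bdd (\<lambda>p. \<zeta> p ^ n)"
  using C1_bdd_power by (auto simp: C1_bdd_def)

lemma C1_bdd_measurable_power: "C1_bdd \<zeta> \<Longrightarrow> (\<lambda>p. \<zeta> p ^ n) \<in> borel_measurable M"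
  using C1_measurable[OF C1_power[OF C1_bdd_C1]] by blast

end

context sol begin

text \<open>The powers are matched: testing with w zeta^4 produces zeta^3 w grad w grad zeta, and
  Young's inequality splits zeta^3 into zeta^2 for the gradient and zeta for w. Hence zeta^2 here
  and zeta^4 in \<open>cut_energy\<close>.\<close>

definition cut_mass :: "(point \<Rightarrow> real) \<Rightarrow> real^3 \<Rightarrow> real \<Rightarrow> real" where
  "cut_mass \<zeta> b h = (\<integral>p. (w b h p)\<^sup>2 * (\<zeta> p)\<^sup>2 \<partial>M)"

definition cut_energy :: "(point \<Rightarrow> real) \<Rightarrow> real^3 \<Rightarrow> real \<Rightarrow> real" where
  "cut_energy \<zeta> b h = (\<integral>p. grad_ip (w b h) (w b h) p * (\<zeta> p) ^ 4 \<partial>M)"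

lemma cut_mass_int:
  assumes "cut \<zeta>" "0 < h" "h \<le> 1"
  shows "integrable M (\<lambda>p. (w b h p)\<^sup>2 * (\<zeta> p)\<^sup>2)"
proof -
  obtain R where R: "supp R \<zeta>" "C1_bdd \<zeta>" using assms by (auto simp: cut_def)
  have "loc_int (\<lambda>p. (w b h p)\<^sup>2 * (\<zeta> p)\<^sup>2)"
    using w_Hloc[OF assms(2,3)] R(2)
    by (intro loc_int_loc_bdd_mult C1_bdd_loc_bdd_power C1_bdd_measurable_power) (auto simp: Hloc_def)
  then show ?thesis by (rule loc_int_integrable[of _ R]) (use R in \<open>auto simp: supp_def\<close>)
qed

lemma cut_energy_int:
  assumes "cut \<zeta>" "0 < h" "h \<le> 1"
  shows "integrable M (\<lambda>p. grad_ip (w b h) (w b h) p * (\<zeta> p) ^ 4)"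
proof -
  obtain R where R: "supp R \<zeta>" "C1_bdd \<zeta>" using assms by (auto simp: cut_def)
  have "loc_int (\<lambda>p. grad_ip (w b h) (w b h) p * (\<zeta> p) ^ 4)"
    using w_Hloc[OF assms(2,3)] R(2)
    by (intro loc_int_loc_bdd_mult loc_int_grad_ip C1_bdd_loc_bdd_power C1_bdd_measurable_power) auto
  then show ?thesis by (rule loc_int_integrable[of _ R]) (use R in \<open>auto simp: supp_def\<close>)
qed

lemma cut_energy_nonneg: "0 \<le> cut_energy \<zeta> b h"
  unfolding cut_energy_def by (intro Bochner_Integration.integral_nonneg mult_nonneg_nonneg grad_ip_nonneg) simp

text \<open>The cross term 4 w zeta^3 grad w grad zeta is absorbed by completing a square, at the
  price of half the energy density.\<close>

lemma caccioppoli_pointwise: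
  assumes "C1 \<zeta>" "p \<in> half_space" "grad_ip \<zeta> \<zeta> p \<le> E"
  shows "grad_ip (w b h) (w b h) p * \<zeta> p ^ 4 / 2
     \<le> grad_ip (w b h) (\<lambda>p. w b h p * \<zeta> p ^ 4) p + 8 * E * ((w b h p)\<^sup>2 * (\<zeta> p)\<^sup>2)"
proof -
  let ?w = "w b h p" and ?z = "\<zeta> p"
  have 1: "grad_ip (w b h) (\<lambda>p. w b h p * \<zeta> p ^ 4) p = 4 * ?w * ?z ^ 3 * grad_ip (w b h) \<zeta> p + ?z ^ 4 * grad_ip (w b h) (w b h) p"
    using grad_ip_mult[OF w_C1 C1_power[OF assms(1)] assms(2)] by (simp add: grad_ip_power4 assms)
  \<comment> \<open>\<open>grad_ip_square\<close> with s = zeta^2 and t = 4 w zeta; the middle term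
    is twice the cross term.\<close>
  have "0 \<le> (?z\<^sup>2)\<^sup>2 * grad_ip (w b h) (w b h) p + 2 * ?z\<^sup>2 * (4 * ?w * ?z) * grad_ip (w b h) \<zeta> p + (4 * ?w * ?z)\<^sup>2 * grad_ip \<zeta> \<zeta> p"
    by (rule grad_ip_square)
  also have "\<dots> = ?z ^ 4 * grad_ip (w b h) (w b h) p + 8 * ?w * ?z ^ 3 * grad_ip (w b h) \<zeta> p + 16 * (?w\<^sup>2 * ?z\<^sup>2) * grad_ip \<zeta> \<zeta> p"
    by (simp add: power_mult_distrib power3_eq_cube power2_eq_square power4_eq_xxxx)
  finally have 2: "0 \<le> ?z ^ 4 * grad_ip (w b h) (w b h) p + 8 * ?w * ?z ^ 3 * grad_ip (w b h) \<zeta> p + 16 * (?w\<^sup>2 * ?z\<^sup>2) * grad_ip \<zeta> \<zeta> p" .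
  have "16 * (?w\<^sup>2 * ?z\<^sup>2) * grad_ip \<zeta> \<zeta> p \<le> 16 * (?w\<^sup>2 * ?z\<^sup>2) * E"
    by (rule mult_left_mono[OF assms(3)]) simp
  then show ?thesis using 2 unfolding 1 by (simp add: algebra_simps)
qed

text \<open>The trace inequality for w zeta^2, uniform in the increment h: its vertical derivative
  is controlled by the energy and mass densities.\<close>

lemma boundary_bound:
  assumes z: "cut \<zeta>" and z1: "\<And>p. p \<in> half_space \<Longrightarrow> \<bar>\<zeta> p\<bar> \<le> 1" and e: "e > 0"
  shows "\<exists>C\<ge>0. \<forall>b h. 0 < h \<longrightarrow> h \<le> 1 \<longrightarrow>
    integrable lborel (\<lambda>x. (tr (\<lambda>p. w b h p * (\<zeta> p)\<^sup>2) x)\<^sup>2) \<and>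
    (\<integral>x. (tr (\<lambda>p. w b h p * (\<zeta> p)\<^sup>2) x)\<^sup>2 \<partial>lborel) \<le> e * cut_energy \<zeta> b h + C * cut_mass \<zeta> b h"
proof -
  have lz: "C1_bdd \<zeta>" using z by (simp add: cut_def)
  note C1z = C1_bdd_C1[OF lz]
  obtain R D where RD: "R > 0" "supp R \<zeta>" "D \<ge> 0" "\<And>p. p \<in> half_space \<Longrightarrow> \<bar>\<zeta> p\<bar> \<le> D"
    "\<And>p k. p \<in> half_space \<Longrightarrow> \<bar>G k \<zeta> p\<bar> \<le> D" using cut_bounds[OF z] by blast
  \<comment> \<open>With e / 2, because the square of the vertical derivative of w zeta^2 costs
    twice the energy density.\<close>
  obtain C where C: "C > 0" "\<And>F R. Hloc F \<Longrightarrow> supp R F \<Longrightarrow> integrable lborel (\<lambda>x. (tr F x)\<^sup>2) \<and>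
    (\<integral>x. (tr F x)\<^sup>2 \<partial>lborel) \<le> e / 2 * (\<integral>p. (G 3 F p)\<^sup>2 \<partial>M) + C * (\<integral>p. (F p)\<^sup>2 \<partial>M)"
    using trace_bound[of "e / 2"] e by (metis half_gt_zero)
  have "integrable lborel (\<lambda>x. (tr (\<lambda>p. w b h p * (\<zeta> p)\<^sup>2) x)\<^sup>2) \<and>
    (\<integral>x. (tr (\<lambda>p. w b h p * (\<zeta> p)\<^sup>2) x)\<^sup>2 \<partial>lborel) \<le> e * cut_energy \<zeta> b h + (C + 4 * e * D\<^sup>2) * cut_mass \<zeta> b h"
    if h: "0 < h" "h \<le> 1" for b h
  proof -
    let ?F = "\<lambda>p. w b h p * (\<zeta> p)\<^sup>2"
    have F: "Hloc ?F" "supp R ?F"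
      using Hloc_C1_bdd_mult[OF w_Hloc[OF h] C1_bdd_power[OF lz]] RD(2) by (auto simp: supp_def)
    have G3: "(G 3 ?F p)\<^sup>2 \<le> 2 * (grad_ip (w b h) (w b h) p * \<zeta> p ^ 4) + 8 * D\<^sup>2 * ((w b h p)\<^sup>2 * (\<zeta> p)\<^sup>2)"
      if p: "p \<in> half_space" for p
    proof -
      have "G 3 ?F p = w b h p * (2 * \<zeta> p * G 3 \<zeta> p) + G 3 (w b h) p * (\<zeta> p)\<^sup>2"
        by (simp add: dV_mult w_C1 C1_power C1z p dV_power2)
      then have "(G 3 ?F p)\<^sup>2 \<le> 2 * (w b h p * (2 * \<zeta> p * G 3 \<zeta> p))\<^sup>2 + 2 * (G 3 (w b h) p * (\<zeta> p)\<^sup>2)\<^sup>2"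
        using sum_squares_bound[of "w b h p * (2 * \<zeta> p * G 3 \<zeta> p)" "G 3 (w b h) p * (\<zeta> p)\<^sup>2"]
        by (simp add: power2_sum)
      also have "\<dots> = 8 * ((w b h p)\<^sup>2 * (\<zeta> p)\<^sup>2) * (G 3 \<zeta> p)\<^sup>2 + 2 * ((G 3 (w b h) p)\<^sup>2 * \<zeta> p ^ 4)"
        by (simp add: power_mult_distrib flip: power_mult)
      also have "\<dots> \<le> 8 * ((w b h p)\<^sup>2 * (\<zeta> p)\<^sup>2) * D\<^sup>2 + 2 * (grad_ip (w b h) (w b h) p * \<zeta> p ^ 4)"
        using RD(3) RD(5)[OF p, of 3]
        by (intro add_mono mult_left_mono mult_right_mono grad_ip_ge) (auto simp: abs_le_square_iff[symmetric])
      finally show ?thesis by (simp add: mult_ac)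
    qed
    have "(\<integral>p. (G 3 ?F p)\<^sup>2 \<partial>M) \<le> (\<integral>p. 2 * (grad_ip (w b h) (w b h) p * \<zeta> p ^ 4) + 8 * D\<^sup>2 * ((w b h p)\<^sup>2 * (\<zeta> p)\<^sup>2) \<partial>M)"
      using cut_mass_int[OF z h] cut_energy_int[OF z h] Hloc_supp_integrable(2)[OF F] G3
      by (intro Bochner_Integration.integral_mono Bochner_Integration.integrable_add integrable_mult_right) auto
    also have "\<dots> = 2 * cut_energy \<zeta> b h + 8 * D\<^sup>2 * cut_mass \<zeta> b h"
      unfolding cut_mass_def cut_energy_def using cut_mass_int[OF z h, of b] cut_energy_int[OF z h, of b] by simp
    finally have g: "(\<integral>p. (G 3 ?F p)\<^sup>2 \<partial>M) \<le> 2 * cut_energy \<zeta> b h + 8 * D\<^sup>2 * cut_mass \<zeta> b h" .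
    have "(\<integral>p. (?F p)\<^sup>2 \<partial>M) \<le> cut_mass \<zeta> b h"
      unfolding cut_mass_def
    proof (intro Bochner_Integration.integral_mono cut_mass_int[OF z h] Hloc_supp_integrable(1)[OF F])
      fix p assume "p \<in> space M"
      then have p: "p \<in> half_space" by simp
      have "(\<zeta> p)\<^sup>2 \<le> 1" using z1[OF p] by (simp add: abs_square_le_1)
      then have "((w b h p)\<^sup>2 * (\<zeta> p)\<^sup>2) * (\<zeta> p)\<^sup>2 \<le> ((w b h p)\<^sup>2 * (\<zeta> p)\<^sup>2) * 1"
        by (intro mult_left_mono) auto
      then show "(?F p)\<^sup>2 \<le> (w b h p)\<^sup>2 * (\<zeta> p)\<^sup>2" by (simp add: power_mult_distrib power2_eq_square mult_ac)
    qed
    then have "C * (\<integral>p. (?F p)\<^sup>2 \<partial>M) \<le> C * cut_mass \<zeta> b h" using C(1) by (intro mult_left_mono) auto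
    moreover have "e / 2 * (\<integral>p. (G 3 ?F p)\<^sup>2 \<partial>M) \<le> e / 2 * (2 * cut_energy \<zeta> b h + 8 * D\<^sup>2 * cut_mass \<zeta> b h)"
      using e g by (intro mult_left_mono) auto
    ultimately show ?thesis using C(2)[OF F] by (auto simp: algebra_simps)
  qed
  then show ?thesis using C(1) e by (intro exI[of _ "C + 4 * e * D\<^sup>2"]) auto
qed

text \<open>The equation of w is tested with w zeta^4. By the Lipschitz bound on f the boundary term
  is at most \<open>Lf\<close> times the squared trace of w zeta^2, and
  \<open>boundary_bound\<close> turns this into a small part of the energy and a multiple of the
  mass.\<close>

lemma caccioppoli:
  assumes z: "cut \<zeta>" and z1: "\<And>p. p \<in> half_space \<Longrightarrow> \<bar>\<zeta> p\<bar> \<le> 1"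
  shows "\<exists>C\<ge>0. \<forall>b h. 0 < h \<longrightarrow> h \<le> 1 \<longrightarrow> cut_energy \<zeta> b h \<le> C * cut_mass \<zeta> b h"
proof -
  have lz: "C1_bdd \<zeta>" using z by (simp add: cut_def)
  note C1z = C1_bdd_C1[OF lz]
  obtain R D where RD: "R > 0" "supp R \<zeta>" "D \<ge> 0" "\<And>p. p \<in> half_space \<Longrightarrow> \<bar>\<zeta> p\<bar> \<le> D"
    "\<And>p k. p \<in> half_space \<Longrightarrow> \<bar>G k \<zeta> p\<bar> \<le> D" using cut_bounds[OF z] by blast
  \<comment> \<open>Then the boundary takes at most a quarter of the energy, and another quarter is
    left after the half lost in \<open>caccioppoli_pointwise\<close>.\<close>
  define e where "e = 1 / (4 * (Lf + 1))"
  have e: "e > 0" and Le: "Lf * e \<le> 1 / 4" using Lf by (simp_all add: e_def divide_simps)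
  obtain C where C: "C \<ge> 0" "\<And>b h. 0 < h \<Longrightarrow> h \<le> 1 \<Longrightarrow>
    integrable lborel (\<lambda>x. (tr (\<lambda>p. w b h p * (\<zeta> p)\<^sup>2) x)\<^sup>2) \<and>
    (\<integral>x. (tr (\<lambda>p. w b h p * (\<zeta> p)\<^sup>2) x)\<^sup>2 \<partial>lborel) \<le> e * cut_energy \<zeta> b h + C * cut_mass \<zeta> b h"
    using boundary_bound[OF z z1 e] by blast
  have "cut_energy \<zeta> b h \<le> 4 * (Lf * C + 24 * D\<^sup>2) * cut_mass \<zeta> b h" if h: "0 < h" "h \<le> 1" for b h
  proof -
    let ?F = "\<lambda>p. w b h p * (\<zeta> p)\<^sup>2" and ?xi = "\<lambda>p. w b h p * \<zeta> p ^ 4"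
    have xi: "test ?xi" by (intro test_mult w_Hloc w_loc_bdd cut_power z h) simp
    have ixi: "integrable M (grad_ip (w b h) ?xi)"
    proof -
      have "supp R ?xi" using RD(2) by (auto simp: supp_def)
      then show ?thesis using xi by (intro grad_ip_integrable w_Hloc h) (auto simp: test_def)
    qed
    have "cut_energy \<zeta> b h / 2 = (\<integral>p. grad_ip (w b h) (w b h) p * \<zeta> p ^ 4 / 2 \<partial>M)" by (simp add: cut_energy_def)
    also have "\<dots> \<le> (\<integral>p. grad_ip (w b h) ?xi p + 8 * (3 * D\<^sup>2) * ((w b h p)\<^sup>2 * (\<zeta> p)\<^sup>2) \<partial>M)"
    proof (intro Bochner_Integration.integral_mono Bochner_Integration.integrable_add integrable_mult_right
        ixi cut_mass_int[OF z h] integrable_divide_zero cut_energy_int[OF z h])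
      fix p assume "p \<in> space M"
      then have p: "p \<in> half_space" by simp
      show "grad_ip (w b h) (w b h) p * \<zeta> p ^ 4 / 2 \<le> grad_ip (w b h) ?xi p + 8 * (3 * D\<^sup>2) * ((w b h p)\<^sup>2 * (\<zeta> p)\<^sup>2)"
        by (rule caccioppoli_pointwise[OF C1z p cut_grad_ip_bound[OF RD(3) RD(5)[OF p]]])
    qed
    also have "\<dots> = (\<integral>p. grad_ip (w b h) ?xi p \<partial>M) + 24 * D\<^sup>2 * cut_mass \<zeta> b h"
      unfolding cut_mass_def using ixi cut_mass_int[OF z h, of b] by simp
    also have "(\<integral>p. grad_ip (w b h) ?xi p \<partial>M) = (\<integral>x. q b h x * tr ?xi x \<partial>lborel)"
      by (rule w_weak(1)[OF h xi])
    also have "\<dots> \<le> (\<integral>x. Lf * (tr ?F x)\<^sup>2 \<partial>lborel)"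
    proof (rule integral_mono_AE)
      show "integrable lborel (\<lambda>x. q b h x * tr ?xi x)" by (rule w_weak(2)[OF h xi])
      show "integrable lborel (\<lambda>x. Lf * (tr ?F x)\<^sup>2)" using C(2)[OF h] by auto
      show "AE x in lborel. q b h x * tr ?xi x \<le> Lf * (tr ?F x)\<^sup>2"
        using q_bound[OF h, of b] Hloc_convg[OF C1_bdd_Hloc[OF lz]]
      proof eventually_elim
        case (elim x)
        then have c: "convg (w b h) x" "convg \<zeta> x" by auto
        have t: "tr ?xi x = tr (w b h) x * tr \<zeta> x ^ 4" "tr ?F x = tr (w b h) x * (tr \<zeta> x)\<^sup>2"
          using tr_mult(2)[OF c(1)] tr_power[OF c(2)] by auto
        have "q b h x * tr ?xi x \<le> \<bar>q b h x\<bar> * \<bar>tr ?xi x\<bar>" by (simp only: abs_mult[symmetric] abs_ge_self)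
        also have "\<dots> \<le> Lf * \<bar>tr (w b h) x\<bar> * \<bar>tr ?xi x\<bar>" using elim by (intro mult_right_mono) auto
        also have "\<dots> = Lf * (tr ?F x)\<^sup>2"
          unfolding t abs_mult by (simp add: power_mult_distrib power2_eq_square[of "tr (w b h) x"] flip: power_mult)
        finally show ?case .
      qed
    qed
    also have "\<dots> = Lf * (\<integral>x. (tr ?F x)\<^sup>2 \<partial>lborel)" by simp
    also have "\<dots> \<le> Lf * (e * cut_energy \<zeta> b h + C * cut_mass \<zeta> b h)" using C(2)[OF h] Lf by (intro mult_left_mono) auto
    also have "\<dots> = Lf * e * cut_energy \<zeta> b h + Lf * C * cut_mass \<zeta> b h" by (simp add: algebra_simps)
    also have "\<dots> \<le> 1 / 4 * cut_energy \<zeta> b h + Lf * C * cut_mass \<zeta> b h"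
      by (intro add_right_mono mult_right_mono Le cut_energy_nonneg)
    finally show ?thesis by (simp add: algebra_simps)
  qed
  then show ?thesis using C(1) Lf by (intro exI[of _ "4 * (Lf * C + 24 * D\<^sup>2)"]) auto
qed

text \<open>W and b_1 X + b_2 Y + b_3 d/dx_3 differ in the skew coefficient, -2 against 2, whence
  the 4. The remaining derivative in x_3 is -1/4 times the commutator, so only X and Y
  occur.\<close>

lemma W_expand:
  assumes "C2 U" "p \<in> half_space"
  shows "dV (vf b (-2)) U p = b$1 * G 1 U p + b$2 * G 2 U p
     - (1/4) * (b$3 - 4 * (b$1 * fst p$2 - b$2 * fst p$1)) * (G 1 (G 2 U) p - G 2 (G 1 U) p)"
  unfolding commutator[OF assms] vf_expand[OF C2_C1[OF assms(1)] assms(2)] dV_fr_cases[OF C2_C1[OF assms(1)] assms(2)]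
  by (simp add: algebra_simps)

lemma chi_integrable:
  assumes "continuous_on half_space h" "supp R h" "d > 0"
  shows "integrable M (\<lambda>p. indicator {p. d < snd p} p * h p)"
  by (rule loc_int_integrable[OF loc_int_loc_bdd[OF loc_bdd_chi[OF assms(1,3)] chi_measurable[OF measurable_wM_continuous[OF assms(1)]]], of R])
     (use assms(2) in \<open>auto simp: supp_def\<close>)

lemma u_shift_G_bound:
  obtains K where "K \<ge> 0" "\<And>s p k. \<bar>s\<bar> \<le> 1 \<Longrightarrow> p \<in> half_space \<Longrightarrow> norm p < R \<Longrightarrow> k = 1 \<or> k = 2 \<Longrightarrow> \<bar>G k (u_shift b s) p\<bar> \<le> K"
proof -
  obtain K where K: "K > 0" "\<And>s p. \<bar>s\<bar> \<le> 1 \<Longrightarrow> norm (flow b (-2) s p) \<le> K * (1 + norm p)"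
    using norm_flow_le by blast
  obtain C1' where C1': "\<And>p. p \<in> half_space \<Longrightarrow> norm p < K * (1 + R) \<Longrightarrow> \<bar>G 1 u p\<bar> \<le> C1'"
    using Xlb(1) unfolding loc_bdd_def by blast
  obtain C2' where C2': "\<And>p. p \<in> half_space \<Longrightarrow> norm p < K * (1 + R) \<Longrightarrow> \<bar>G 2 u p\<bar> \<le> C2'"
    using Xlb(2) unfolding loc_bdd_def by blast
  have "\<bar>G k (u_shift b s) p\<bar> \<le> \<bar>C1'\<bar> + \<bar>C2'\<bar>"
    if "\<bar>s\<bar> \<le> 1" "p \<in> half_space" "norm p < R" "k = 1 \<or> k = 2" for s p k
  proof -
    have "norm (flow b (-2) s p) \<le> K * (1 + norm p)" by (rule K(2)[OF that(1)])
    also have "\<dots> < K * (1 + R)" using that(3) K(1) by (intro mult_strict_left_mono) auto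
    finally have n: "norm (flow b (-2) s p) < K * (1 + R)" .
    have "flow b (-2) s p \<in> half_space" using that(2) by simp
    from C1'[OF this n] C2'[OF this n] that(4) show ?thesis
      unfolding u_shift_G[OF that(2)] by auto
  qed
  then show ?thesis using that[of "\<bar>C1'\<bar> + \<bar>C2'\<bar>"] by auto
qed

lemma abs_combination:
  "\<bar>x\<bar> \<le> A \<Longrightarrow> \<bar>y\<bar> \<le> B \<Longrightarrow> \<bar>z\<bar> \<le> C \<Longrightarrow> \<bar>x + (1/4) * (y - z)\<bar> \<le> A + (1/4) * (B + C)"
  for x y z A B C :: real
proof -
  assume "\<bar>x\<bar> \<le> A" "\<bar>y\<bar> \<le> B" "\<bar>z\<bar> \<le> C"
  then have "x \<le> A" "- x \<le> A" "y \<le> B" "- y \<le> B" "z \<le> C" "- z \<le> C" by (auto simp: abs_le_iff)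
  then have "4 * x + (y - z) \<le> 4 * A + (B + C)" "- (4 * x + (y - z)) \<le> 4 * A + (B + C)" by linarith+
  then show ?thesis by (intro abs_leI) (simp_all add: field_simps)
qed

text \<open>In \<open>W_expand\<close> the outer X or Y of each second derivative is moved onto
  theta psi, which leaves products of X u, Y u with psi and its horizontal derivatives. The cutoff y
  > d makes the intermediate terms integrable; the bound K depends on neither d nor s nor
  psi.\<close>

lemma W_dual:
  "\<exists>K\<ge>0. \<forall>\<psi> s d. C1 \<psi> \<longrightarrow> supp R \<psi> \<longrightarrow> \<bar>s\<bar> \<le> 1 \<longrightarrow> d > 0 \<longrightarrow>
     integrable M (\<lambda>p. \<bar>\<psi> p\<bar> + \<bar>G 1 \<psi> p\<bar> + \<bar>G 2 \<psi> p\<bar>) \<longrightarrow>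
     (\<integral>p. indicator {p. d < snd p} p * (dV (vf b (-2)) (u_shift b s) p * \<psi> p) \<partial>M)
       \<le> K * (\<integral>p. \<bar>\<psi> p\<bar> + \<bar>G 1 \<psi> p\<bar> + \<bar>G 2 \<psi> p\<bar> \<partial>M)"
proof -
  \<comment> \<open>The coefficient of the commutator in \<open>W_expand\<close>, up to the factor
    -1/4.\<close>
  define \<theta> where "\<theta> = (\<lambda>p::point. b$3 - 4 * (b$1 * fst p$2 - b$2 * fst p$1))"
  have th: "C1 \<theta>" unfolding \<theta>_def by (intro C1_diff C1_cmult C1_const C1_coord)
  have thG: "G 1 \<theta> p = 4 * b$2" "G 2 \<theta> p = - 4 * b$1" if "p \<in> half_space" for p
    unfolding \<theta>_def using that
    by (simp_all add: dV_diff dV_cmult C1_diff C1_cmult C1_coord fst_fr)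
  have "loc_bdd \<theta>" unfolding \<theta>_def
    using loc_bdd_add[OF loc_bdd_const[of "b$3"] loc_bdd_add[OF loc_bdd_cmult[OF loc_bdd_coord, of "- 4 * b$1" 2] loc_bdd_cmult[OF loc_bdd_coord, of "4 * b$2" 1]]]
    by (rule loc_bdd_cong) (simp add: algebra_simps)
  then obtain K2 where K2: "\<And>p. p \<in> half_space \<Longrightarrow> norm p < R + 1 \<Longrightarrow> \<bar>\<theta> p\<bar> \<le> K2"
    unfolding loc_bdd_def by blast
  obtain K1 where K1: "K1 \<ge> 0" "\<And>s p k. \<bar>s\<bar> \<le> 1 \<Longrightarrow> p \<in> half_space \<Longrightarrow> norm p < R + 1 \<Longrightarrow> k = 1 \<or> k = 2 \<Longrightarrow> \<bar>G k (u_shift b s) p\<bar> \<le> K1"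
    using u_shift_G_bound by blast
  \<comment> \<open>The first-order part of W and the derivatives of theta each contribute |b_1| +
    |b_2|; the terms with derivatives of psi contribute |K2| / 4, rounded up.\<close>
  define K where "K = K1 * (2 * (\<bar>b$1\<bar> + \<bar>b$2\<bar>) + \<bar>K2\<bar>)"
  have "(\<integral>p. indicator {p. d < snd p} p * (dV (vf b (-2)) (u_shift b s) p * \<psi> p) \<partial>M)
       \<le> K * (\<integral>p. \<bar>\<psi> p\<bar> + \<bar>G 1 \<psi> p\<bar> + \<bar>G 2 \<psi> p\<bar> \<partial>M)"
    if psi: "C1 \<psi>" "supp R \<psi>" and s: "\<bar>s\<bar> \<le> 1" and d: "d > 0"
      and int: "integrable M (\<lambda>p. \<bar>\<psi> p\<bar> + \<bar>G 1 \<psi> p\<bar> + \<bar>G 2 \<psi> p\<bar>)" for \<psi> s d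
  proof -
    let ?\<chi> = "indicator {p. d < snd p} :: point \<Rightarrow> real"
    let ?U = "u_shift b s"
    define \<eta> where "\<eta> = (\<lambda>p. \<theta> p * \<psi> p)"
    have eta: "C1 \<eta>" "supp R \<eta>" using psi th by (auto simp: \<eta>_def supp_def intro: C1_mult)
    have GU: "C1 (G k ?U)" for k by (rule C2_G[OF u_shift_C2])
    \<comment> \<open>What remains once the total derivatives X (Y U eta) and Y (X U eta) are split
      off, which \<open>chi_ibp\<close> integrates to 0.\<close>
    define \<Phi> where "\<Phi> = (\<lambda>p. (b$1 * G 1 ?U p + b$2 * G 2 ?U p) * \<psi> p
      + (1/4) * (G 2 ?U p * G 1 \<eta> p - G 1 ?U p * G 2 \<eta> p))"
    have P: "?\<chi> p * (dV (vf b (-2)) ?U p * \<psi> p) = ?\<chi> p * \<Phi> p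
      - (1/4) * (?\<chi> p * G 1 (\<lambda>p. G 2 ?U p * \<eta> p) p) + (1/4) * (?\<chi> p * G 2 (\<lambda>p. G 1 ?U p * \<eta> p) p)"
      if p: "p \<in> half_space" for p
    proof -
      have "dV (vf b (-2)) ?U p * \<psi> p = \<Phi> p
        - (1/4) * G 1 (\<lambda>p. G 2 ?U p * \<eta> p) p + (1/4) * G 2 (\<lambda>p. G 1 ?U p * \<eta> p) p"
        unfolding W_expand[OF u_shift_C2 p] \<Phi>_def dV_mult[OF GU eta(1) p]
        by (simp add: \<eta>_def \<theta>_def algebra_simps)
      then show ?thesis by (cases "d < snd p") simp_all
    qed
    have iPhi: "integrable M (\<lambda>p. ?\<chi> p * \<Phi> p)"
    proof (rule chi_integrable[OF _ _ d, of _ "R + 1"])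
      show "continuous_on half_space \<Phi>" unfolding \<Phi>_def
        by (intro continuous_intros C1_G_continuous C1_continuous GU psi eta C2_C1[OF u_shift_C2])
      show "supp (R + 1) \<Phi>"
        using psi(2) supp_dV[OF eta(2)] unfolding \<Phi>_def supp_def by auto
    qed
    have iG: "integrable M (\<lambda>p. ?\<chi> p * (G j ?U p * \<eta> p))" "integrable M (\<lambda>p. ?\<chi> p * G k (\<lambda>p. G j ?U p * \<eta> p) p)" for j k
    proof -
      have C: "C1 (\<lambda>p. G j ?U p * \<eta> p)" by (intro C1_mult GU eta)
      have S: "supp R (\<lambda>p. G j ?U p * \<eta> p)" using eta(2) by (auto simp: supp_def)
      show "integrable M (\<lambda>p. ?\<chi> p * (G j ?U p * \<eta> p))"
        by (rule chi_integrable[OF C1_continuous[OF C] S d])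
      show "integrable M (\<lambda>p. ?\<chi> p * G k (\<lambda>p. G j ?U p * \<eta> p) p)"
        by (rule chi_integrable[OF C1_G_continuous[OF C] supp_dV[OF S] d])
    qed
    have z: "(\<integral>p. ?\<chi> p * G 1 (\<lambda>p. G 2 ?U p * \<eta> p) p \<partial>M) = 0" "(\<integral>p. ?\<chi> p * G 2 (\<lambda>p. G 1 ?U p * \<eta> p) p \<partial>M) = 0"
      by (rule chi_ibp[OF _ C1_mult[OF GU eta(1)] iG]; simp)+
    have "(\<integral>p. ?\<chi> p * (dV (vf b (-2)) ?U p * \<psi> p) \<partial>M) = (\<integral>p. ?\<chi> p * \<Phi> p
      - (1/4) * (?\<chi> p * G 1 (\<lambda>p. G 2 ?U p * \<eta> p) p) + (1/4) * (?\<chi> p * G 2 (\<lambda>p. G 1 ?U p * \<eta> p) p) \<partial>M)"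
      by (intro Bochner_Integration.integral_cong refl P) simp
    also have "\<dots> = (\<integral>p. ?\<chi> p * \<Phi> p \<partial>M)"
      using iPhi iG z by simp
    also have "\<dots> \<le> (\<integral>p. K * (\<bar>\<psi> p\<bar> + \<bar>G 1 \<psi> p\<bar> + \<bar>G 2 \<psi> p\<bar>) \<partial>M)"
    proof (intro Bochner_Integration.integral_mono iPhi integrable_mult_right int)
      fix p assume "p \<in> space M"
      then have p: "p \<in> half_space" by simp
      have K0: "K \<ge> 0" using K1(1) by (simp add: K_def)
      have "\<bar>\<Phi> p\<bar> \<le> K * (\<bar>\<psi> p\<bar> + \<bar>G 1 \<psi> p\<bar> + \<bar>G 2 \<psi> p\<bar>)"
      proof (cases "norm p < R + 1")
        case True
        note k1 = K1(2)[OF s p True, of 1, simplified] K1(2)[OF s p True, of 2, simplified]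
        have k2: "\<bar>\<theta> p\<bar> \<le> \<bar>K2\<bar>" using K2[OF p True] by linarith
        have ge: "\<bar>G 1 \<eta> p\<bar> \<le> \<bar>K2\<bar> * \<bar>G 1 \<psi> p\<bar> + 4 * \<bar>b$2\<bar> * \<bar>\<psi> p\<bar>"
          "\<bar>G 2 \<eta> p\<bar> \<le> \<bar>K2\<bar> * \<bar>G 2 \<psi> p\<bar> + 4 * \<bar>b$1\<bar> * \<bar>\<psi> p\<bar>"
        proof -
          have "\<bar>G 1 \<eta> p\<bar> \<le> \<bar>\<theta> p * G 1 \<psi> p\<bar> + \<bar>4 * b$2 * \<psi> p\<bar>"
            unfolding \<eta>_def dV_mult[OF th psi(1) p] thG[OF p] by (rule abs_triangle_ineq)
          also have "\<dots> \<le> \<bar>K2\<bar> * \<bar>G 1 \<psi> p\<bar> + 4 * \<bar>b$2\<bar> * \<bar>\<psi> p\<bar>"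
            unfolding abs_mult using k2 by (intro add_mono mult_right_mono) auto
          finally show "\<bar>G 1 \<eta> p\<bar> \<le> \<bar>K2\<bar> * \<bar>G 1 \<psi> p\<bar> + 4 * \<bar>b$2\<bar> * \<bar>\<psi> p\<bar>" .
          have "\<bar>G 2 \<eta> p\<bar> \<le> \<bar>\<theta> p * G 2 \<psi> p\<bar> + \<bar>- 4 * b$1 * \<psi> p\<bar>"
            unfolding \<eta>_def dV_mult[OF th psi(1) p] thG[OF p] by (rule abs_triangle_ineq)
          also have "\<dots> \<le> \<bar>K2\<bar> * \<bar>G 2 \<psi> p\<bar> + 4 * \<bar>b$1\<bar> * \<bar>\<psi> p\<bar>"
            unfolding abs_mult using k2 by (intro add_mono mult_right_mono) auto
          finally show "\<bar>G 2 \<eta> p\<bar> \<le> \<bar>K2\<bar> * \<bar>G 2 \<psi> p\<bar> + 4 * \<bar>b$1\<bar> * \<bar>\<psi> p\<bar>" .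
        qed
        have t1: "\<bar>b$1 * G 1 ?U p + b$2 * G 2 ?U p\<bar> \<le> \<bar>b$1\<bar> * K1 + \<bar>b$2\<bar> * K1"
          by (rule order_trans[OF abs_triangle_ineq]) (unfold abs_mult, intro add_mono mult_left_mono k1; simp)
        have t2: "\<bar>(b$1 * G 1 ?U p + b$2 * G 2 ?U p) * \<psi> p\<bar> \<le> (\<bar>b$1\<bar> * K1 + \<bar>b$2\<bar> * K1) * \<bar>\<psi> p\<bar>"
          unfolding abs_mult by (rule mult_right_mono[OF t1]) simp
        have t3: "\<bar>G 2 ?U p * G 1 \<eta> p\<bar> \<le> K1 * (\<bar>K2\<bar> * \<bar>G 1 \<psi> p\<bar> + 4 * \<bar>b$2\<bar> * \<bar>\<psi> p\<bar>)"
          unfolding abs_mult by (rule mult_mono[OF k1(2) ge(1) K1(1)]) simp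
        have t4: "\<bar>G 1 ?U p * G 2 \<eta> p\<bar> \<le> K1 * (\<bar>K2\<bar> * \<bar>G 2 \<psi> p\<bar> + 4 * \<bar>b$1\<bar> * \<bar>\<psi> p\<bar>)"
          unfolding abs_mult by (rule mult_mono[OF k1(1) ge(2) K1(1)]) simp
        have "\<bar>\<Phi> p\<bar> \<le> (\<bar>b$1\<bar> * K1 + \<bar>b$2\<bar> * K1) * \<bar>\<psi> p\<bar> + (1/4) * (K1 * (\<bar>K2\<bar> * \<bar>G 1 \<psi> p\<bar> + 4 * \<bar>b$2\<bar> * \<bar>\<psi> p\<bar>)
           + K1 * (\<bar>K2\<bar> * \<bar>G 2 \<psi> p\<bar> + 4 * \<bar>b$1\<bar> * \<bar>\<psi> p\<bar>))"
          unfolding \<Phi>_def by (rule abs_combination[OF t2 t3 t4])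
        also have "\<dots> = K1 * (2 * (\<bar>b$1\<bar> + \<bar>b$2\<bar>)) * \<bar>\<psi> p\<bar> + K1 * \<bar>K2\<bar> / 4 * (\<bar>G 1 \<psi> p\<bar> + \<bar>G 2 \<psi> p\<bar>)"
          by (simp add: algebra_simps)
        also have "\<dots> \<le> K * \<bar>\<psi> p\<bar> + K * (\<bar>G 1 \<psi> p\<bar> + \<bar>G 2 \<psi> p\<bar>)"
        proof (intro add_mono mult_right_mono)
          have x: "0 \<le> K1 * \<bar>K2\<bar>" "0 \<le> K1 * (2 * (\<bar>b$1\<bar> + \<bar>b$2\<bar>))" using K1(1) by auto
          have y: "K = K1 * (2 * (\<bar>b$1\<bar> + \<bar>b$2\<bar>)) + K1 * \<bar>K2\<bar>" by (simp add: K_def distrib_left)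
          show "K1 * (2 * (\<bar>b$1\<bar> + \<bar>b$2\<bar>)) \<le> K" "K1 * \<bar>K2\<bar> / 4 \<le> K" using x y by linarith+
        qed auto
        finally show ?thesis by (simp add: algebra_simps)
      next
        case False
        then have "\<Phi> p = 0"
          using psi(2) supp_dV[OF eta(2)] p unfolding \<Phi>_def supp_def by auto
        then show ?thesis using K0 by simp
      qed
      then have "?\<chi> p * \<Phi> p \<le> \<bar>\<Phi> p\<bar>" by (auto simp: indicator_def)
      then show "?\<chi> p * \<Phi> p \<le> K * (\<bar>\<psi> p\<bar> + \<bar>G 1 \<psi> p\<bar> + \<bar>G 2 \<psi> p\<bar>)"
        using \<open>\<bar>\<Phi> p\<bar> \<le> _\<close> by linarith
    qed
    also have "\<dots> = K * (\<integral>p. \<bar>\<psi> p\<bar> + \<bar>G 1 \<psi> p\<bar> + \<bar>G 2 \<psi> p\<bar> \<partial>M)" by simp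
    finally show ?thesis .
  qed
  moreover have "K \<ge> 0" using K1(1) by (simp add: K_def)
  ultimately show ?thesis by blast
qed

end

context sol begin

text \<open>Dominated convergence removes the cutoff at height d.\<close>

lemma chi_limit:
  fixes h :: "point \<Rightarrow> real"
  assumes "integrable M h"
  shows "(\<lambda>n. \<integral>p. indicator {p. inverse (real (Suc n)) < snd p} p * h p \<partial>M) \<longlonglongrightarrow> (\<integral>p. h p \<partial>M)"
proof (rule integral_dominated_convergence)
  show "integrable M (\<lambda>p. \<bar>h p\<bar>)" using assms by simp
  show "AE p in M. (\<lambda>n. indicator {p. inverse (real (Suc n)) < snd p} p * h p) \<longlonglongrightarrow> h p"
  proof (rule AE_I2)
    fix p assume "p \<in> space M"
    then have "0 < snd p" by (simp add: half_space_def)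
    then have "eventually (\<lambda>n. inverse (real (Suc n)) < snd p) sequentially"
      using LIMSEQ_inverse_real_of_nat by (rule order_tendstoD(2)[rotated])
    then show "(\<lambda>n. indicator {p. inverse (real (Suc n)) < snd p} p * h p) \<longlonglongrightarrow> h p"
      by (intro tendsto_eventually) (rule eventually_mono, auto simp: indicator_def simp del: of_nat_Suc)
  qed
  show "AE p in M. norm (indicator {p. inverse (real (Suc n)) < snd p} p * h p) \<le> \<bar>h p\<bar>" for n
    by (rule AE_I2) (auto simp: indicator_def)
qed (use assms chi_measurable borel_measurable_integrable[OF assms] in auto)

text \<open>Integrating \<open>W u\<close> along the flow of \<open>W\<close> and moving the derivatives onto the test function
  bounds \<open>w\<close> in duality with \<open>\<psi>\<close>, uniformly in the increment; only the bounds on \<open>X u\<close> and \<open>Y u\<close>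
  enter, since \<open>T\<close> is a commutator of \<open>X\<close> and \<open>Y\<close>.\<close>

lemma w_dual:
  "\<exists>K\<ge>0. \<forall>\<psi> h. C1 \<psi> \<longrightarrow> supp R \<psi> \<longrightarrow> 0 < h \<longrightarrow> h \<le> 1 \<longrightarrow>
     integrable M (\<lambda>p. \<bar>\<psi> p\<bar> + \<bar>G 1 \<psi> p\<bar> + \<bar>G 2 \<psi> p\<bar>) \<longrightarrow> integrable M (\<lambda>p. w b h p * \<psi> p) \<longrightarrow>
     (\<integral>p. w b h p * \<psi> p \<partial>M) \<le> K * (\<integral>p. \<bar>\<psi> p\<bar> + \<bar>G 1 \<psi> p\<bar> + \<bar>G 2 \<psi> p\<bar> \<partial>M)"
proof -
  obtain K where K: "K \<ge> 0" "\<And>\<psi> s d. C1 \<psi> \<Longrightarrow> supp R \<psi> \<Longrightarrow> \<bar>s\<bar> \<le> 1 \<Longrightarrow> d > 0 \<Longrightarrow>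
     integrable M (\<lambda>p. \<bar>\<psi> p\<bar> + \<bar>G 1 \<psi> p\<bar> + \<bar>G 2 \<psi> p\<bar>) \<Longrightarrow>
     (\<integral>p. indicator {p. d < snd p} p * (dV (vf b (-2)) (u_shift b s) p * \<psi> p) \<partial>M)
       \<le> K * (\<integral>p. \<bar>\<psi> p\<bar> + \<bar>G 1 \<psi> p\<bar> + \<bar>G 2 \<psi> p\<bar> \<partial>M)" using W_dual[of R b] by blast
  have "(\<integral>p. w b h p * \<psi> p \<partial>M) \<le> K * (\<integral>p. \<bar>\<psi> p\<bar> + \<bar>G 1 \<psi> p\<bar> + \<bar>G 2 \<psi> p\<bar> \<partial>M)"
    if psi: "C1 \<psi>" "supp R \<psi>" and h: "0 < h" "h \<le> 1"
      and int: "integrable M (\<lambda>p. \<bar>\<psi> p\<bar> + \<bar>G 1 \<psi> p\<bar> + \<bar>G 2 \<psi> p\<bar>)"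
      and iw: "integrable M (\<lambda>p. w b h p * \<psi> p)" for \<psi> h
  proof (rule LIMSEQ_le_const2[OF chi_limit[OF iw]], intro exI allI impI)
    fix n :: nat
    define d where "d = inverse (real (Suc n))"
    have d: "d > 0" by (simp add: d_def)
    let ?\<chi> = "indicator {p. d < snd p} :: point \<Rightarrow> real"
    let ?W = "dV (vf b (-2)) u"
    let ?I = "\<integral>p. \<bar>\<psi> p\<bar> + \<bar>G 1 \<psi> p\<bar> + \<bar>G 2 \<psi> p\<bar> \<partial>M"
    have cW: "continuous_on half_space ?W" by (rule C1_vf_continuous[OF u_C1])
    \<comment> \<open>The cutoff is constant along the flow, and W u at the translated point is W of
      the translate, which is the form that \<open>W_dual\<close> bounds.\<close>
    have WE: "(?\<chi> (flow b (-2) s p) * ?W (flow b (-2) s p)) * \<psi> p = ?\<chi> p * (dV (vf b (-2)) (u_shift b s) p * \<psi> p)"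
      if "p \<in> half_space" for s p
      using vf_comp_flow[OF u_C1 that, of b "-2" s] by (simp add: u_shift_def[abs_def] indicator_def)
    have iW: "integrable M (\<lambda>p. ?\<chi> p * (dV (vf b (-2)) (u_shift b s) p * \<psi> p))" for s
    proof (rule chi_integrable[OF _ _ d, of _ R])
      show "continuous_on half_space (\<lambda>p. dV (vf b (-2)) (u_shift b s) p * \<psi> p)"
        by (intro continuous_intros C1_vf_continuous C1_continuous psi C2_C1[OF u_shift_C2])
      show "supp R (\<lambda>p. dV (vf b (-2)) (u_shift b s) p * \<psi> p)" using psi(2) by (auto simp: supp_def)
    qed
    have iWs: "integrable M (\<lambda>p. (?\<chi> (flow b (-2) s p) * ?W (flow b (-2) s p)) * \<psi> p)" for s
      by (rule Bochner_Integration.integrable_cong[THEN iffD2, OF refl _ iW[of s]]) (use WE in auto)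
    obtain Kf where Kf: "Kf > 0" "\<And>s p. \<bar>s\<bar> \<le> 1 \<Longrightarrow> norm (flow b (-2) s p) \<le> Kf * (1 + norm p)"
      using norm_flow_le by blast
    \<comment> \<open>This bound depends on d. It only justifies Fubini; the final estimate uses K
      from \<open>W_dual\<close>.\<close>
    obtain CW where CW: "\<And>p. p \<in> half_space \<Longrightarrow> norm p < Kf * (1 + R) \<Longrightarrow> \<bar>?\<chi> p * ?W p\<bar> \<le> CW"
      using loc_bdd_chi[OF cW d] unfolding loc_bdd_def by blast
    have ipsi: "integrable M \<psi>"
      by (rule Bochner_Integration.integrable_bound[OF int C1_measurable[OF psi(1)]]) (auto intro!: AE_I2)
    have bd: "(\<integral>p. \<bar>(?\<chi> (flow b (-2) s p) * ?W (flow b (-2) s p)) * \<psi> p\<bar> \<partial>M) \<le> \<bar>CW\<bar> * (\<integral>p. \<bar>\<psi> p\<bar> \<partial>M)"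
      if s: "0 \<le> s" "s \<le> h" for s
    proof -
      have "(\<integral>p. \<bar>(?\<chi> (flow b (-2) s p) * ?W (flow b (-2) s p)) * \<psi> p\<bar> \<partial>M) \<le> (\<integral>p. \<bar>CW\<bar> * \<bar>\<psi> p\<bar> \<partial>M)"
      proof (intro Bochner_Integration.integral_mono integrable_abs iWs integrable_mult_right ipsi)
        fix p assume "p \<in> space M"
        then have p: "p \<in> half_space" by simp
        show "\<bar>(?\<chi> (flow b (-2) s p) * ?W (flow b (-2) s p)) * \<psi> p\<bar> \<le> \<bar>CW\<bar> * \<bar>\<psi> p\<bar>"
        proof (cases "norm p < R")
          case True
          have "norm (flow b (-2) s p) \<le> Kf * (1 + norm p)" using s h by (intro Kf) simp
          also have "\<dots> < Kf * (1 + R)" using True Kf(1) by (intro mult_strict_left_mono) auto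
          finally have "\<bar>?\<chi> (flow b (-2) s p) * ?W (flow b (-2) s p)\<bar> \<le> CW"
            using p by (intro CW) simp
          then have "\<bar>?\<chi> (flow b (-2) s p) * ?W (flow b (-2) s p)\<bar> \<le> \<bar>CW\<bar>" by linarith
          then show ?thesis unfolding abs_mult[of _ "\<psi> p"] by (rule mult_right_mono) simp
        next
          case False
          then show ?thesis using psi(2) p by (simp add: supp_def)
        qed
      qed
      then show ?thesis by simp
    qed
    have "(\<integral>p. (?\<chi> (flow b (-2) h p) * u (flow b (-2) h p) - ?\<chi> p * u p) * \<psi> p \<partial>M) \<le> h * (K * ?I)"
    proof (rule flow_FTC_bound[where F = "\<lambda>p. ?\<chi> p * u p" and F' = "\<lambda>p. ?\<chi> p * ?W p" and b = b and c = "-2",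
          OF chi_measurable[OF vf_measurable[OF u_C1]] C1_measurable[OF psi(1)] _ _ _ iWs bd])
      show "((\<lambda>s. ?\<chi> (flow b (-2) s p) * u (flow b (-2) s p)) has_real_derivative
          ?\<chi> (flow b (-2) s p) * ?W (flow b (-2) s p)) (at s)" if "p \<in> half_space" for p s
        using flow_derivative[OF u_C1 that, of b "-2" s] by (auto simp: indicator_def)
      show "continuous_on UNIV (\<lambda>s. ?\<chi> (flow b (-2) s p) * ?W (flow b (-2) s p))" if "p \<in> half_space" for p
      proof -
        have "continuous_on UNIV (\<lambda>s. ?W (flow b (-2) s p))"
          by (rule continuous_on_compose2[OF cW]) (use that in \<open>auto intro!: continuous_intros\<close>)
        then show ?thesis by (auto simp: indicator_def)
      qed
      show "(\<integral>p. (?\<chi> (flow b (-2) s p) * ?W (flow b (-2) s p)) * \<psi> p \<partial>M) \<le> K * ?I" if s: "0 \<le> s" "s \<le> h" for s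
      proof -
        have "(\<integral>p. (?\<chi> (flow b (-2) s p) * ?W (flow b (-2) s p)) * \<psi> p \<partial>M)
          = (\<integral>p. ?\<chi> p * (dV (vf b (-2)) (u_shift b s) p * \<psi> p) \<partial>M)"
          by (intro Bochner_Integration.integral_cong refl WE) simp
        also have "\<dots> \<le> K * ?I" using s h by (intro K psi d int) simp
        finally show ?thesis .
      qed
    qed (use h in auto)
    moreover have "(\<integral>p. (?\<chi> (flow b (-2) h p) * u (flow b (-2) h p) - ?\<chi> p * u p) * \<psi> p \<partial>M)
       = (\<integral>p. h * (?\<chi> p * (w b h p * \<psi> p)) \<partial>M)"
      using h by (intro Bochner_Integration.integral_cong refl) (auto simp: w_def u_shift_def indicator_def)
    ultimately have "h * (\<integral>p. ?\<chi> p * (w b h p * \<psi> p) \<partial>M) \<le> h * (K * ?I)" by simp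
    then show "(\<integral>p. indicator {p. inverse (real (Suc n)) < snd p} p * (w b h p * \<psi> p) \<partial>M) \<le> K * ?I"
      using h unfolding d_def by simp
  qed
  then show ?thesis using K(1) by blast
qed

lemma scaled_am_gm: "e > 0 \<Longrightarrow> c * x \<le> e * x\<^sup>2 + c\<^sup>2 / (4 * e)" for c x e :: real
proof -
  assume e: "e > 0"
  have "0 \<le> (2 * e * x - c)\<^sup>2 / (4 * e)" using e by simp
  also have "\<dots> = (4 * e * (e * x\<^sup>2) - 4 * e * (c * x) + c\<^sup>2) / (4 * e)"
    by (simp add: power2_eq_square algebra_simps)
  also have "\<dots> = e * x\<^sup>2 - c * x + c\<^sup>2 / (4 * e)"
    using e by (simp add: add_divide_distrib diff_divide_distrib)
  finally show ?thesis by simp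
qed

lemma G_w_cut:
  "C1 \<zeta> \<Longrightarrow> p \<in> half_space \<Longrightarrow> G k (\<lambda>p. w b h p * (\<zeta> p)\<^sup>2) p
    = w b h p * (2 * \<zeta> p * G k \<zeta> p) + G k (w b h) p * (\<zeta> p)\<^sup>2"
  by (simp add: dV_mult w_C1 C1_power dV_power2)

text \<open>\<open>w_dual\<close> with psi = w zeta^2, for which the pairing is the mass. The right
  hand side is linear in w and its gradient, so Young's inequality converts it into a small multiple
  of mass and energy plus a constant that does not depend on h.\<close>

lemma cut_mass_absorb:
  assumes z: "cut \<zeta>" and z1: "\<And>p. p \<in> half_space \<Longrightarrow> \<bar>\<zeta> p\<bar> \<le> 1" and e: "e > 0"
  shows "\<exists>K. \<forall>h. 0 < h \<longrightarrow> h \<le> 1 \<longrightarrow> cut_mass \<zeta> b h \<le> e * (cut_mass \<zeta> b h + cut_energy \<zeta> b h) + K"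
proof -
  have lz: "C1_bdd \<zeta>" using z by (simp add: cut_def)
  note C1z = C1_bdd_C1[OF lz]
  obtain R D where RD: "R > 0" "supp R \<zeta>" "D \<ge> 0" "\<And>p. p \<in> half_space \<Longrightarrow> \<bar>\<zeta> p\<bar> \<le> D"
    "\<And>p k. p \<in> half_space \<Longrightarrow> \<bar>G k \<zeta> p\<bar> \<le> D" using cut_bounds[OF z] by blast
  obtain K where K: "K \<ge> 0" "\<And>\<psi> h. C1 \<psi> \<Longrightarrow> supp R \<psi> \<Longrightarrow> 0 < h \<Longrightarrow> h \<le> 1 \<Longrightarrow>
     integrable M (\<lambda>p. \<bar>\<psi> p\<bar> + \<bar>G 1 \<psi> p\<bar> + \<bar>G 2 \<psi> p\<bar>) \<Longrightarrow> integrable M (\<lambda>p. w b h p * \<psi> p) \<Longrightarrow>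
     (\<integral>p. w b h p * \<psi> p \<partial>M) \<le> K * (\<integral>p. \<bar>\<psi> p\<bar> + \<bar>G 1 \<psi> p\<bar> + \<bar>G 2 \<psi> p\<bar> \<partial>M)"
    using w_dual[of R b] by blast
  \<comment> \<open>The coefficient of |w zeta|: 1 from psi itself, and 2 D from differentiating
    zeta^2 in each of X psi and Y psi.\<close>
  define c where "c = K * (1 + 4 * D)"
  \<comment> \<open>The remainders of three uses of \<open>scaled_am_gm\<close>. The two gradient
    terms get e / 2 each, since each is afterwards bounded by the full energy density.\<close>
  define L where "L = c\<^sup>2 / (4 * e) + 2 * (K\<^sup>2 / (4 * (e / 2)))"
  define m where "m = (\<integral>p. indicator (ball 0 R) p * L \<partial>M)"
  have "cut_mass \<zeta> b h \<le> e * (cut_mass \<zeta> b h + cut_energy \<zeta> b h) + m" if h: "0 < h" "h \<le> 1" for h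
  proof -
    let ?w = "w b h"
    define \<psi> where "\<psi> = (\<lambda>p. ?w p * (\<zeta> p)\<^sup>2)"
    have psi: "C1 \<psi>" "supp R \<psi>" "Hloc \<psi>"
      using Hloc_C1_bdd_mult[OF w_Hloc[OF h] C1_bdd_power[OF lz]] RD(2)
      by (auto simp: supp_def \<psi>_def Hloc_def)
    have ii: "integrable M F" if "supp R F" "F \<in> borel_measurable M" "integrable M (\<lambda>p. (F p)\<^sup>2)" for F :: "point \<Rightarrow> real"
    proof (rule Bochner_Integration.integrable_bound)
      show "integrable M (\<lambda>p. indicator (ball 0 R) p * 1 + (F p)\<^sup>2)"
        by (intro Bochner_Integration.integrable_add integrable_ball that)
      show "AE p in M. norm (F p) \<le> norm (indicator (ball 0 R) p * 1 + (F p)\<^sup>2)"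
      proof (rule AE_I2)
        fix p assume p: "p \<in> space M"
        show "norm (F p) \<le> norm (indicator (ball 0 R) p * 1 + (F p)\<^sup>2)"
        proof (cases "norm p < R")
          case True
          have "\<bar>F p\<bar> \<le> 1 + (F p)\<^sup>2" using scaled_am_gm[of 1 1 "\<bar>F p\<bar>"] by simp
          then show ?thesis using True by simp
        next
          case False
          then show ?thesis using that(1) p by (simp add: supp_def)
        qed
      qed
    qed (rule that(2))
    \<comment> \<open>The radius stays R because each term of the derivative keeps a factor
      zeta.\<close>
    have sG: "supp R (G k \<psi>)" for k
      unfolding supp_def
    proof (intro ballI impI)
      fix p assume p: "p \<in> half_space" "R \<le> norm p"
      have "G k \<psi> p = ?w p * (2 * \<zeta> p * G k \<zeta> p) + G k ?w p * (\<zeta> p)\<^sup>2"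
        unfolding \<psi>_def by (rule G_w_cut[OF C1z p(1)])
      moreover have "\<zeta> p = 0" using RD(2) p by (simp add: supp_def)
      ultimately show "G k \<psi> p = 0" by simp
    qed
    note ip = ii[OF psi(2) C1_measurable[OF psi(1)] Hloc_supp_integrable(1)[OF psi(3,2)]]
      ii[OF sG G_measurable[OF psi(1)] Hloc_supp_integrable(2)[OF psi(3,2)]]
    have int: "integrable M (\<lambda>p. \<bar>\<psi> p\<bar> + \<bar>G 1 \<psi> p\<bar> + \<bar>G 2 \<psi> p\<bar>)"
      by (intro Bochner_Integration.integrable_add integrable_abs ip)
    have wp: "w b h p * \<psi> p = (w b h p)\<^sup>2 * (\<zeta> p)\<^sup>2" for p
      by (simp add: \<psi>_def power2_eq_square)
    have "cut_mass \<zeta> b h \<le> K * (\<integral>p. \<bar>\<psi> p\<bar> + \<bar>G 1 \<psi> p\<bar> + \<bar>G 2 \<psi> p\<bar> \<partial>M)"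
      using K(2)[OF psi(1,2) h int] cut_mass_int[OF z h, of b] unfolding wp cut_mass_def by simp
    also have "\<dots> = (\<integral>p. K * (\<bar>\<psi> p\<bar> + \<bar>G 1 \<psi> p\<bar> + \<bar>G 2 \<psi> p\<bar>) \<partial>M)" by simp
    also have "\<dots> \<le> (\<integral>p. e * ((?w p)\<^sup>2 * (\<zeta> p)\<^sup>2) + e * (grad_ip ?w ?w p * \<zeta> p ^ 4) + indicator (ball 0 R) p * L \<partial>M)"
    proof (intro Bochner_Integration.integral_mono Bochner_Integration.integrable_add integrable_mult_right
        integrable_abs ip cut_mass_int[OF z h] cut_energy_int[OF z h] integrable_ball)
      fix p assume "p \<in> space M"
      then have p: "p \<in> half_space" by simp
      show "K * (\<bar>\<psi> p\<bar> + \<bar>G 1 \<psi> p\<bar> + \<bar>G 2 \<psi> p\<bar>)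
         \<le> e * ((?w p)\<^sup>2 * (\<zeta> p)\<^sup>2) + e * (grad_ip ?w ?w p * \<zeta> p ^ 4) + indicator (ball 0 R) p * L"
      proof (cases "norm p < R")
        case True
        let ?x = "\<bar>?w p\<bar> * \<bar>\<zeta> p\<bar>" and ?y = "\<lambda>k. \<bar>G k ?w p\<bar> * (\<zeta> p)\<^sup>2"
        have zz: "(\<zeta> p)\<^sup>2 \<le> \<bar>\<zeta> p\<bar>"
          using mult_left_le[of "\<bar>\<zeta> p\<bar>" "\<bar>\<zeta> p\<bar>"] z1[OF p] by (simp add: power2_eq_square)
        have a1: "\<bar>\<psi> p\<bar> \<le> ?x"
          unfolding \<psi>_def abs_mult using zz by (intro mult_left_mono) auto
        have a2: "\<bar>G k \<psi> p\<bar> \<le> 2 * D * ?x + ?y k" for k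
        proof -
          have "G k \<psi> p = ?w p * (2 * \<zeta> p * G k \<zeta> p) + G k ?w p * (\<zeta> p)\<^sup>2"
            unfolding \<psi>_def by (rule G_w_cut[OF C1z p])
          then have "\<bar>G k \<psi> p\<bar> \<le> \<bar>?w p * (2 * \<zeta> p * G k \<zeta> p)\<bar> + \<bar>G k ?w p * (\<zeta> p)\<^sup>2\<bar>"
            by (simp only: abs_triangle_ineq)
          also have "\<dots> = 2 * ?x * \<bar>G k \<zeta> p\<bar> + ?y k" by (simp add: abs_mult mult_ac)
          also have "\<dots> \<le> 2 * ?x * D + ?y k" by (intro add_right_mono mult_left_mono RD(5) p) simp
          finally show ?thesis by (simp add: mult_ac)
        qed
        have "K * (\<bar>\<psi> p\<bar> + \<bar>G 1 \<psi> p\<bar> + \<bar>G 2 \<psi> p\<bar>) \<le> K * (?x + (2 * D * ?x + ?y 1) + (2 * D * ?x + ?y 2))"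
          by (intro mult_left_mono K(1) add_mono a1 a2)
        also have "\<dots> = c * ?x + K * ?y 1 + K * ?y 2" by (simp add: c_def algebra_simps)
        also have "\<dots> \<le> (e * ?x\<^sup>2 + c\<^sup>2 / (4 * e)) + (e / 2 * (?y 1)\<^sup>2 + K\<^sup>2 / (4 * (e / 2))) + (e / 2 * (?y 2)\<^sup>2 + K\<^sup>2 / (4 * (e / 2)))"
          using e by (intro add_mono scaled_am_gm) auto
        also have "\<dots> = e * ?x\<^sup>2 + e / 2 * ((?y 1)\<^sup>2 + (?y 2)\<^sup>2) + L" by (simp add: L_def algebra_simps)
        also have "\<dots> \<le> e * ?x\<^sup>2 + e / 2 * (grad_ip ?w ?w p * \<zeta> p ^ 4 + grad_ip ?w ?w p * \<zeta> p ^ 4) + L"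
        proof -
          have "(?y k)\<^sup>2 \<le> grad_ip ?w ?w p * \<zeta> p ^ 4" for k
          proof -
            have "(?y k)\<^sup>2 = (G k ?w p)\<^sup>2 * \<zeta> p ^ 4" by (simp add: power_mult_distrib flip: power_mult)
            also have "\<dots> \<le> grad_ip ?w ?w p * \<zeta> p ^ 4" by (intro mult_right_mono grad_ip_ge) simp
            finally show ?thesis .
          qed
          then show ?thesis using e by (intro add_mono mult_left_mono order_refl) auto
        qed
        finally show ?thesis using True by (simp add: power_mult_distrib mult_ac)
      next
        case False
        then have "\<psi> p = 0" "G 1 \<psi> p = 0" "G 2 \<psi> p = 0" using psi(2) sG p by (auto simp: supp_def)
        then show ?thesis using False e grad_ip_nonneg[of ?w p] by simp
      qed
    qed
    also have "\<dots> = e * (cut_mass \<zeta> b h + cut_energy \<zeta> b h) + m"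
      unfolding cut_mass_def cut_energy_def m_def
      using cut_mass_int[OF z h, of b] cut_energy_int[OF z h, of b] integrable_ball[of R L] by (simp add: distrib_left)
    finally show ?thesis .
  qed
  then show ?thesis by blast
qed

lemma uniform_energy:
  assumes z: "cut \<zeta>" and z1: "\<And>p. p \<in> half_space \<Longrightarrow> \<bar>\<zeta> p\<bar> \<le> 1"
  shows "\<exists>K\<ge>0. \<forall>h. 0 < h \<longrightarrow> h \<le> 1 \<longrightarrow> cut_mass \<zeta> b h \<le> K \<and> cut_energy \<zeta> b h \<le> K"
proof -
  obtain C where C: "C \<ge> 0" "\<And>b h. 0 < h \<Longrightarrow> h \<le> 1 \<Longrightarrow> cut_energy \<zeta> b h \<le> C * cut_mass \<zeta> b h"
    using caccioppoli[OF z z1] by blast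
  \<comment> \<open>With energy at most C times mass, half of the mass is absorbed.\<close>
  define e where "e = 1 / (2 * (1 + C))"
  have e: "e > 0" "e * (1 + C) = 1 / 2" using C(1) by (simp_all add: e_def)
  obtain K where K: "\<And>h. 0 < h \<Longrightarrow> h \<le> 1 \<Longrightarrow> cut_mass \<zeta> b h \<le> e * (cut_mass \<zeta> b h + cut_energy \<zeta> b h) + K"
    using cut_mass_absorb[OF z z1 e(1)] by blast
  have A: "cut_mass \<zeta> b h \<le> 2 * \<bar>K\<bar>" if h: "0 < h" "h \<le> 1" for h
  proof -
    have "cut_mass \<zeta> b h \<le> e * (cut_mass \<zeta> b h + cut_energy \<zeta> b h) + K" by (rule K[OF h])
    also have "\<dots> \<le> e * (cut_mass \<zeta> b h + C * cut_mass \<zeta> b h) + K" using C(2)[OF h, of b] e(1) by simp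
    also have "\<dots> = e * (1 + C) * cut_mass \<zeta> b h + K" by (simp add: algebra_simps)
    finally show ?thesis unfolding e(2) by linarith
  qed
  have B: "cut_energy \<zeta> b h \<le> C * (2 * \<bar>K\<bar>)" if h: "0 < h" "h \<le> 1" for h
    using order_trans[OF C(2)[OF h, of b] mult_left_mono[OF A[OF h] C(1)]] .
  have "cut_mass \<zeta> b h \<le> 2 * \<bar>K\<bar> + C * (2 * \<bar>K\<bar>) \<and> cut_energy \<zeta> b h \<le> 2 * \<bar>K\<bar> + C * (2 * \<bar>K\<bar>)" if h: "0 < h" "h \<le> 1" for h
  proof -
    have "0 \<le> 2 * \<bar>K\<bar>" "0 \<le> C * (2 * \<bar>K\<bar>)" using C(1) by (simp_all add: mult_nonneg_nonneg)
    then show ?thesis using A[OF h] B[OF h] by linarith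
  qed
  then show ?thesis using C(1) by (intro exI[of _ "2 * \<bar>K\<bar> + C * (2 * \<bar>K\<bar>)"]) auto
qed

end

section \<open>A bump function of class C^1 and cutoffs\<close>

definition bump :: "real \<Rightarrow> real" where
  "bump t = (max 0 (1 - (max 0 t)\<^sup>2))\<^sup>2"

definition bump' :: "real \<Rightarrow> real" where
  "bump' t = - 4 * max 0 (1 - (max 0 t)\<^sup>2) * max 0 t"

text \<open>The square of the positive part is C^1 although the positive part is not; at 0 the
  difference quotient is at most |h|. \<open>bump\<close> is built from two such squares to make its
  derivative explicit and continuous.\<close>

lemma max_square_derivative: "((\<lambda>t::real. (max 0 t)\<^sup>2) has_real_derivative 2 * max 0 t) (at t)"
proof -
  consider "t < 0" | "t = 0" | "t > 0" by linarith
  then show ?thesis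
  proof cases
    case 1
    have "((\<lambda>t::real. 0) has_real_derivative 0) (at t)" by simp
    then have "((\<lambda>t::real. (max 0 t)\<^sup>2) has_real_derivative 0) (at t)"
      by (rule has_field_derivative_transform_within_open[of _ _ _ "{..<0}"]) (use 1 in auto)
    then show ?thesis using 1 by simp
  next
    case 3
    have "((\<lambda>t::real. t\<^sup>2) has_real_derivative 2 * t) (at t)" by (auto intro!: derivative_eq_intros)
    then have "((\<lambda>t::real. (max 0 t)\<^sup>2) has_real_derivative 2 * t) (at t)"
      by (rule has_field_derivative_transform_within_open[of _ _ _ "{0<..}"]) (use 3 in auto)
    then show ?thesis using 3 by simp
  next
    case 2
    have "((\<lambda>h::real. (max 0 h)\<^sup>2 / h) \<longlongrightarrow> 0) (at 0)"
    proof (rule Lim_null_comparison[of _ "\<lambda>h. \<bar>h\<bar>"])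
      have "norm ((max 0 h)\<^sup>2 / h) \<le> \<bar>h\<bar>" for h :: real
        by (cases "h > 0") (auto simp: power2_eq_square max_def)
      then show "\<forall>\<^sub>F h in at 0. norm ((max 0 h)\<^sup>2 / h) \<le> \<bar>h::real\<bar>" by (rule always_eventually[OF allI])
      show "((\<lambda>h::real. \<bar>h\<bar>) \<longlongrightarrow> 0) (at 0)" by (rule tendsto_rabs_zero[OF tendsto_ident_at])
    qed
    then show ?thesis unfolding DERIV_def 2 by simp
  qed
qed

lemma bump_derivative: "(bump has_real_derivative bump' t) (at t)"
proof -
  have 1: "((\<lambda>t. 1 - (max 0 t)\<^sup>2) has_real_derivative 0 - 2 * max 0 t) (at t)"
    by (intro DERIV_diff DERIV_const max_square_derivative)
  have "(bump has_real_derivative (2 * max 0 (1 - (max 0 t)\<^sup>2)) * (0 - 2 * max 0 t)) (at t)"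
    unfolding bump_def[abs_def] by (rule DERIV_chain2[OF max_square_derivative 1])
  then show ?thesis by (simp add: bump'_def mult_ac)
qed

lemma bump'_continuous: "continuous_on S bump'"
  unfolding bump'_def[abs_def] by (intro continuous_intros)

lemma bump_le: "t \<le> 0 \<Longrightarrow> bump t = 1" and bump_ge: "t \<ge> 1 \<Longrightarrow> bump t = 0"
  and bump_range: "0 \<le> bump t" "bump t \<le> 1"
proof -
  show "t \<le> 0 \<Longrightarrow> bump t = 1" by (simp add: bump_def)
  show "bump t = 0" if "t \<ge> 1"
  proof -
    have "1 \<le> (max 0 t)\<^sup>2" using that by (intro one_le_power) simp
    then show ?thesis by (simp add: bump_def)
  qed
  show "0 \<le> bump t" by (simp add: bump_def)
  have "max 0 (1 - (max 0 t)\<^sup>2) \<le> 1" by simp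
  then show "bump t \<le> 1" unfolding bump_def by (rule power_le_one[rotated]) simp
qed

lemma bump'_zero: "t \<le> 0 \<Longrightarrow> bump' t = 0" "t \<ge> 1 \<Longrightarrow> bump' t = 0"
proof -
  show "bump' t = 0" if "t \<le> 0" using that by (simp add: bump'_def)
  show "bump' t = 0" if "t \<ge> 1"
  proof -
    have "1 \<le> (max 0 t)\<^sup>2" using that by (intro one_le_power) simp
    then show ?thesis by (simp add: bump'_def)
  qed
qed

lemma bump'_bound: "\<bar>bump' t\<bar> \<le> 4"
proof (cases "0 < t \<and> t < 1")
  case True
  have "max 0 (1 - (max 0 t)\<^sup>2) * max 0 t \<le> 1 * 1" using True by (intro mult_mono) auto
  then show ?thesis by (simp add: bump'_def abs_mult)
next
  case False
  then have "bump' t = 0" using bump'_zero by (cases "t \<le> 0") auto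
  then show ?thesis by simp
qed

lemma C1_inner_self: "C1 (\<lambda>p. p \<bullet> p)"
  by (rule C1I[where F'="\<lambda>p v. p \<bullet> v + v \<bullet> p"]) (auto intro!: derivative_eq_intros continuous_intros)

lemma dV_inner_self: "dV V (\<lambda>p. p \<bullet> p) p = 2 * (p \<bullet> V p)"
  by (rule trans[OF dV_eq[where F'="\<lambda>v. p \<bullet> v + v \<bullet> p"]])
     (auto intro!: derivative_eq_intros simp: inner_commute)

context weight begin

lemma loc_bdd_continuous:
  assumes "continuous_on UNIV h"
  shows "loc_bdd h"
  unfolding loc_bdd_def
proof
  fix R :: real
  have "compact (h ` cball 0 R)"
    by (intro compact_continuous_image continuous_on_subset[OF assms]) auto
  then have "bounded (h ` cball 0 R)" by (rule compact_imp_bounded)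
  then obtain C where "\<forall>y\<in>h ` cball 0 R. norm y \<le> C" unfolding bounded_iff ..
  then have C: "\<bar>h p\<bar> \<le> C" if "norm p \<le> R" for p using that by simp
  then show "\<exists>C. \<forall>p\<in>half_space. norm p < R \<longrightarrow> \<bar>h p\<bar> \<le> C"
    by (intro exI[of _ C] ballI impI) (rule C, simp)
qed

text \<open>The profile \<open>bump\<close> applied to |p|^2 - R^2, whose derivatives along the
  frame are continuous and thus locally bounded.\<close>

lemma cutoff_exists:
  obtains \<zeta> where "cut \<zeta>" "\<And>p. p \<in> half_space \<Longrightarrow> \<bar>\<zeta> p\<bar> \<le> 1" "\<And>p. norm p < R \<Longrightarrow> \<zeta> p = 1"
proof -
  let ?g = "\<lambda>p::point. p \<bullet> p + (- R\<^sup>2)"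
  define \<zeta> where "\<zeta> = (\<lambda>p. bump (?g p))"
  have g: "C1 ?g" by (intro C1_add C1_inner_self C1_const)
  have C: "C1 \<zeta>" unfolding \<zeta>_def by (rule C1_comp[OF g bump_derivative bump'_continuous])
  have "loc_bdd (G k \<zeta>)" for k
  proof -
    have "loc_bdd (\<lambda>p. bump' (?g p) * (2 * (p \<bullet> fr k p)))"
    proof (rule loc_bdd_mult)
      show "loc_bdd (\<lambda>p. bump' (?g p))" by (rule loc_bdd_bounded[OF bump'_bound])
      show "loc_bdd (\<lambda>p. 2 * (p \<bullet> fr k p))" by (intro loc_bdd_continuous continuous_intros)
    qed
    moreover have "bump' (?g p) * (2 * (p \<bullet> fr k p)) = G k \<zeta> p" if p: "p \<in> half_space" for p
    proof -
      have "G k ?g p = G k (\<lambda>p. p \<bullet> p) p + G k (\<lambda>_. - R\<^sup>2) p"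
        by (rule dV_add[OF C1_inner_self C1_const p])
      then have 1: "G k ?g p = 2 * (p \<bullet> fr k p)" unfolding dV_inner_self dV_const by simp
      have "G k \<zeta> p = bump' (?g p) * G k ?g p"
        unfolding \<zeta>_def by (rule dV_comp[OF g p bump_derivative])
      then show ?thesis unfolding 1 ..
    qed
    ultimately show ?thesis by (rule loc_bdd_cong)
  qed
  moreover have "loc_bdd \<zeta>" unfolding \<zeta>_def by (rule loc_bdd_bounded[of _ 1]) (simp add: bump_range)
  moreover have "supp (\<bar>R\<bar> + 1) \<zeta>"
    unfolding supp_def
  proof (intro ballI impI)
    fix p :: point assume "\<bar>R\<bar> + 1 \<le> norm p"
    \<comment> \<open>This gives |p|^2 - R^2 at least 1 for R of either sign.\<close>
    then have "(\<bar>R\<bar> + 1)\<^sup>2 \<le> (norm p)\<^sup>2" by (intro power_mono) auto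
    then have "1 \<le> ?g p" by (simp add: power2_sum power2_norm_eq_inner)
    then show "\<zeta> p = 0" unfolding \<zeta>_def by (rule bump_ge)
  qed
  ultimately have "cut \<zeta>" using C unfolding cut_def C1_bdd_def by blast
  moreover have "\<zeta> p = 1" if "norm p < R" for p
  proof -
    have "(norm p)\<^sup>2 \<le> R\<^sup>2" using that by (intro power_mono) auto
    then show ?thesis unfolding \<zeta>_def by (intro bump_le) (simp add: power2_norm_eq_inner)
  qed
  ultimately show ?thesis using that by (simp add: \<zeta>_def bump_range)
qed

end

section \<open>The limit of the difference quotients\<close>

context sol begin

definition hn :: "nat \<Rightarrow> real" where "hn n = inverse (real (Suc n))"

lemma hn: "0 < hn n" "hn n \<le> 1"
  by (simp_all add: hn_def inverse_le_1_iff)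

lemma hn_at_right: "filterlim hn (at_right 0) sequentially"
  unfolding hn_def[abs_def] by (rule at_right_seq)

lemma hn_tendsto: "hn \<longlonglongrightarrow> 0"
  unfolding hn_def[abs_def] by (rule LIMSEQ_inverse_real_of_nat)

lemma flow_quotient_limit:
  assumes "C1 F" "p \<in> half_space"
  shows "(\<lambda>n. (F (flow b c (hn n) p) - F p) / hn n) \<longlonglongrightarrow> dV (vf b c) F p"
proof -
  have "((\<lambda>h. (F (flow b c (0 + h) p) - F (flow b c 0 p)) / h) \<longlongrightarrow> dV (vf b c) F (flow b c 0 p)) (at 0)"
    using flow_derivative[OF assms, of b c 0] unfolding DERIV_def .
  then have "((\<lambda>h. (F (flow b c h p) - F p) / h) \<longlongrightarrow> dV (vf b c) F p) (at_right 0)"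
    by (simp add: filterlim_at_split)
  from filterlim_compose[OF this hn_at_right] show ?thesis .
qed

definition z :: "real^3 \<Rightarrow> point \<Rightarrow> real" where
  "z b = dV (vf b (-2)) u"

lemma z_C1: "C1 (z b)"
  unfolding z_def by (rule C2_vf[OF u2])

text \<open>A frame derivative of w is the difference quotient of a frame derivative of u. Its limit
  is W of that derivative, and W commutes with the frame.\<close>

lemma w_limit:
  assumes "p \<in> half_space"
  shows "(\<lambda>n. w b (hn n) p) \<longlonglongrightarrow> z b p" "(\<lambda>n. G k (w b (hn n)) p) \<longlonglongrightarrow> G k (z b) p"
proof -
  show "(\<lambda>n. w b (hn n) p) \<longlonglongrightarrow> z b p"
    using flow_quotient_limit[OF u_C1 assms, of b "-2"] by (simp only: w_def u_shift_def z_def divide_inverse mult.commute inverse_inverse_eq mult_1_left mult_1_right)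
  show "(\<lambda>n. G k (w b (hn n)) p) \<longlonglongrightarrow> G k (z b) p"
    using flow_quotient_limit[OF C2_G[OF u2] assms, of k b "-2"]
    unfolding w_G[OF assms] z_def vf_G_commute[OF u2 assms] .
qed

text \<open>The uniform bounds of \<open>uniform_energy\<close> and the pointwise limits of
  \<open>w_limit\<close> are the input of \<open>weak_convergence_L2\<close>.\<close>

lemma z_cut_energy:
  assumes "cut \<zeta>" "\<And>p. p \<in> half_space \<Longrightarrow> \<bar>\<zeta> p\<bar> \<le> 1"
  shows "integrable M (\<lambda>p. (z b p * \<zeta> p)\<^sup>2)" "integrable M (\<lambda>p. (G k (z b) p * (\<zeta> p)\<^sup>2)\<^sup>2)"
    "test \<xi> \<Longrightarrow> (\<lambda>n. \<integral>p. (G k (w b (hn n)) p * (\<zeta> p)\<^sup>2) * G k \<xi> p \<partial>M) \<longlonglongrightarrow> (\<integral>p. (G k (z b) p * (\<zeta> p)\<^sup>2) * G k \<xi> p \<partial>M)"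
proof -
  note cz = C1_bdd_C1[OF assms(1)[unfolded cut_def, THEN conjunct1]]
  note mz = C1_measurable[OF cz]
  obtain K where K: "\<And>h. 0 < h \<Longrightarrow> h \<le> 1 \<Longrightarrow> cut_mass \<zeta> b h \<le> K \<and> cut_energy \<zeta> b h \<le> K"
    using uniform_energy[OF assms, of b] by blast
  have 1: "(w b h p * \<zeta> p)\<^sup>2 = (w b h p)\<^sup>2 * (\<zeta> p)\<^sup>2" for h p by (rule power_mult_distrib)
  show "integrable M (\<lambda>p. (z b p * \<zeta> p)\<^sup>2)"
  \<comment> \<open>Only the Fatou part is used here, so the test function is taken to be 0.\<close>
  proof (rule weak_convergence_L2(1)[of "\<lambda>n p. w b (hn n) p * \<zeta> p" M _ "\<lambda>_. 0" K])
    show "(\<lambda>p. w b (hn n) p * \<zeta> p) \<in> borel_measurable M" for n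
      by (intro borel_measurable_times C1_measurable w_C1 mz)
    show "(\<lambda>p. z b p * \<zeta> p) \<in> borel_measurable M"
      by (intro borel_measurable_times C1_measurable z_C1 mz)
    show "integrable M (\<lambda>p. (w b (hn n) p * \<zeta> p)\<^sup>2)" for n
      unfolding 1 by (rule cut_mass_int[OF assms(1) hn])
    show "(\<integral>p. (w b (hn n) p * \<zeta> p)\<^sup>2 \<partial>M) \<le> K" for n
      unfolding 1 using K[OF hn[of n]] by (simp add: cut_mass_def)
    show "AE p in M. (\<lambda>n. w b (hn n) p * \<zeta> p) \<longlonglongrightarrow> z b p * \<zeta> p"
      by (intro AE_I2 tendsto_mult w_limit tendsto_const) simp
  qed auto
  let ?f = "\<lambda>n p. G k (w b (hn n)) p * (\<zeta> p)\<^sup>2"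
  have sq: "(?f n p)\<^sup>2 \<le> grad_ip (w b (hn n)) (w b (hn n)) p * \<zeta> p ^ 4" for n p
  proof -
    have "(?f n p)\<^sup>2 = (G k (w b (hn n)) p)\<^sup>2 * \<zeta> p ^ 4" by (simp add: power_mult_distrib flip: power_mult)
    also have "\<dots> \<le> grad_ip (w b (hn n)) (w b (hn n)) p * \<zeta> p ^ 4" by (intro mult_right_mono grad_ip_ge) simp
    finally show ?thesis .
  qed
  have m: "?f n \<in> borel_measurable M" for n
    by (intro borel_measurable_times G_measurable w_C1 borel_measurable_power mz)
  have mzz: "(\<lambda>p. G k (z b) p * (\<zeta> p)\<^sup>2) \<in> borel_measurable M"
    by (intro borel_measurable_times G_measurable z_C1 borel_measurable_power mz)
  have i: "integrable M (\<lambda>p. (?f n p)\<^sup>2)" for n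
    by (rule Bochner_Integration.integrable_bound[OF cut_energy_int[OF assms(1) hn, of b n] borel_measurable_power[OF m]])
       (use sq in \<open>auto intro!: AE_I2 order_trans[OF _ abs_ge_self]\<close>)
  have b: "(\<integral>p. (?f n p)\<^sup>2 \<partial>M) \<le> K" for n
  proof -
    have "(\<integral>p. (?f n p)\<^sup>2 \<partial>M) \<le> cut_energy \<zeta> b (hn n)"
      unfolding cut_energy_def by (intro Bochner_Integration.integral_mono i cut_energy_int[OF assms(1) hn] sq)
    then show ?thesis using K[OF hn[of n]] by simp
  qed
  have l: "AE p in M. (\<lambda>n. ?f n p) \<longlonglongrightarrow> G k (z b) p * (\<zeta> p)\<^sup>2"
    by (intro AE_I2 tendsto_mult w_limit tendsto_const) simp
  show "integrable M (\<lambda>p. (G k (z b) p * (\<zeta> p)\<^sup>2)\<^sup>2)"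
    by (rule weak_convergence_L2(1)[OF m mzz _ _ i b l, of "\<lambda>_. 0"]) auto
  show "(\<lambda>n. \<integral>p. ?f n p * G k \<xi> p \<partial>M) \<longlonglongrightarrow> (\<integral>p. (G k (z b) p * (\<zeta> p)\<^sup>2) * G k \<xi> p \<partial>M)" if t: "test \<xi>"
  proof -
    obtain R where "supp R \<xi>" "Hloc \<xi>" using t by (auto simp: test_def)
    then show ?thesis
      by (intro weak_convergence_L2(3)[OF m mzz _ _ i b l] G_measurable Hloc_C1 Hloc_supp_integrable)
  qed
qed

text \<open>Square integrability against cutoffs is local square integrability, since cutoffs equal
  to 1 on a given ball exist. The exponent m is 1 for z and 2 for its gradient, as in
  \<open>z_cut_energy\<close>.\<close>

lemma z_Hloc: "Hloc (z b)"
proof -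
  have *: "loc_int (\<lambda>p. (F p)\<^sup>2)"
    if m: "F \<in> borel_measurable M" and int: "\<And>\<zeta>. cut \<zeta> \<Longrightarrow> (\<And>p. p \<in> half_space \<Longrightarrow> \<bar>\<zeta> p\<bar> \<le> 1) \<Longrightarrow> integrable M (\<lambda>p. (F p * \<zeta> p ^ m)\<^sup>2)"
    for F :: "point \<Rightarrow> real" and m
    unfolding loc_int_def
  proof (intro conjI allI borel_measurable_power m)
    fix R
    obtain \<zeta> where z: "cut \<zeta>" "\<And>p. p \<in> half_space \<Longrightarrow> \<bar>\<zeta> p\<bar> \<le> 1" "\<And>p. norm p < R \<Longrightarrow> \<zeta> p = 1"
      using cutoff_exists[of R] by blast
    show "integrable M (\<lambda>p. indicator (ball 0 R) p * (F p)\<^sup>2)"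
      by (rule Bochner_Integration.integrable_bound[OF int[OF z(1,2)] ball_ind_measurable[OF borel_measurable_power[OF m]]])
         (auto intro!: AE_I2 simp: indicator_def z(3))
  qed
  show ?thesis
    unfolding Hloc_def
  proof (intro conjI allI z_C1)
    show "loc_int (\<lambda>p. (z b p)\<^sup>2)"
      by (rule *[OF C1_measurable[OF z_C1], where m=1]) (simp add: z_cut_energy(1))
    show "loc_int (\<lambda>p. (G k (z b) p)\<^sup>2)" for k
      by (rule *[OF G_measurable[OF z_C1], where m=2]) (rule z_cut_energy(2))
  qed
qed

end

subsection \<open>The linearised equation\<close>

context sol begin

lemma sq_sum4: "(p + q - (r + s))\<^sup>2 \<le> 4 * (p\<^sup>2 + q\<^sup>2 + r\<^sup>2 + s\<^sup>2)" for p q r s :: real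
proof -
  have 1: "(x + y)\<^sup>2 \<le> 2 * (x\<^sup>2 + y\<^sup>2)" "(x - y)\<^sup>2 \<le> 2 * (x\<^sup>2 + y\<^sup>2)" for x y :: real
    using sum_squares_bound[of x y] sum_squares_bound[of x "- y"] by (simp_all add: power2_sum power2_diff)
  have "(p + q - (r + s))\<^sup>2 \<le> 2 * ((p + q)\<^sup>2 + (r + s)\<^sup>2)" by (rule 1)
  also have "\<dots> \<le> 2 * (2 * (p\<^sup>2 + q\<^sup>2) + 2 * (r\<^sup>2 + s\<^sup>2))" by (intro mult_left_mono add_mono 1) auto
  finally show ?thesis by simp
qed

lemma mvt_flow:
  assumes "p \<in> half_space" "0 < h"
  obtains s where "0 < s" "s < h" "w b h p = z b (flow b (-2) s p)"
proof -
  have "\<exists>s>0. s < h \<and> u (flow b (-2) h p) - u (flow b (-2) 0 p) = (h - 0) * dV (vf b (-2)) u (flow b (-2) s p)"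
    using assms(2) by (rule MVT2) (rule flow_derivative[OF u_C1 assms(1)])
  then obtain s where s: "s > 0" "s < h" "u (flow b (-2) h p) - u p = h * z b (flow b (-2) s p)"
    by (auto simp: z_def)
  then have "w b h p = z b (flow b (-2) s p)" using assms(2) by (simp add: w_def u_shift_def)
  with s show ?thesis by (intro that)
qed

text \<open>By the mean value theorem w is a value of z on a flow line at the same height d, where z
  is bounded on bounded sets. This supplies the dominating function for the pointwise limit.\<close>

lemma slice_limit_zero:
  assumes z: "cut \<zeta>" and d: "d > 0"
  shows "(\<lambda>n. \<integral>\<^sup>+x. ennreal (((w b (hn n) (x, d) - z b (x, d)) * (\<zeta> (x, d))\<^sup>2)\<^sup>2) \<partial>lborel) \<longlonglongrightarrow> 0"
proof -
  obtain R D where RD: "R > 0" "supp R \<zeta>" "D \<ge> 0" "\<And>p. p \<in> half_space \<Longrightarrow> \<bar>\<zeta> p\<bar> \<le> D"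
    "\<And>p k. p \<in> half_space \<Longrightarrow> \<bar>G k \<zeta> p\<bar> \<le> D" using cut_bounds[OF z] by blast
  note cz = C1_bdd_C1[OF z[unfolded cut_def, THEN conjunct1]]
  let ?F = "\<lambda>n x. ((w b (hn n) (x, d) - z b (x, d)) * (\<zeta> (x, d))\<^sup>2)\<^sup>2"
  have H: "(x, d) \<in> half_space" for x using d by (simp add: half_space_def)
  obtain K where K: "K > 0" "\<And>s p. \<bar>s\<bar> \<le> 1 \<Longrightarrow> norm (flow b (-2) s p) \<le> K * (1 + norm p)"
    using norm_flow_le by blast
  have "loc_bdd (\<lambda>p. indicator {p. d / 2 < snd p} p * z b p)"
    by (rule loc_bdd_chi[OF C1_continuous[OF z_C1] half_gt_zero[OF d]])
  from this[unfolded loc_bdd_def, THEN spec, of "K * (1 + R)"]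
  obtain C where C: "\<forall>p\<in>half_space. norm p < K * (1 + R) \<longrightarrow> \<bar>indicator {p. d / 2 < snd p} p * z b p\<bar> \<le> C" ..
  have zb: "\<bar>z b (flow b (-2) s (x, d))\<bar> \<le> C" if "norm (x, d) < R" "0 \<le> s" "s \<le> 1" for s x
  proof -
    have "norm (flow b (-2) s (x, d)) \<le> K * (1 + norm (x, d))" using that by (intro K) simp
    also have "\<dots> < K * (1 + R)" using that(1) K(1) by (intro mult_strict_left_mono) auto
    finally have "\<bar>indicator {p. d / 2 < snd p} (flow b (-2) s (x, d)) * z b (flow b (-2) s (x, d))\<bar> \<le> C"
      using C H by simp
    then show ?thesis using d by simp
  qed
  have bd: "?F n x \<le> indicator (cball 0 R) x * ((2 * \<bar>C\<bar> * D\<^sup>2)\<^sup>2)" for n x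
  proof (cases "norm (x, d) < R")
    case True
    have nx: "norm x \<le> R" using True norm_fst_le[of x d] by simp
    obtain s where s: "0 < s" "s < hn n" "w b (hn n) (x, d) = z b (flow b (-2) s (x, d))"
      using mvt_flow[OF H hn(1)] by blast
    have s1: "s \<le> 1" using s(2) hn(2)[of n] by linarith
    have "\<bar>w b (hn n) (x, d)\<bar> \<le> \<bar>C\<bar>" "\<bar>z b (x, d)\<bar> \<le> \<bar>C\<bar>"
      using zb[OF True less_imp_le[OF s(1)] s1] zb[OF True, of 0] unfolding s(3) by auto
    then have 1: "\<bar>w b (hn n) (x, d) - z b (x, d)\<bar> \<le> 2 * \<bar>C\<bar>" by linarith
    have "(\<zeta> (x, d))\<^sup>2 \<le> D\<^sup>2" using RD(3) RD(4)[OF H, of x] by (simp add: abs_le_square_iff[symmetric])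
    then have "\<bar>(w b (hn n) (x, d) - z b (x, d)) * (\<zeta> (x, d))\<^sup>2\<bar> \<le> 2 * \<bar>C\<bar> * D\<^sup>2"
      unfolding abs_mult by (intro mult_mono 1) auto
    then have "\<bar>(w b (hn n) (x, d) - z b (x, d)) * (\<zeta> (x, d))\<^sup>2\<bar> \<le> \<bar>2 * \<bar>C\<bar> * D\<^sup>2\<bar>" by (rule order_trans[OF _ abs_ge_self])
    then have "?F n x \<le> (2 * \<bar>C\<bar> * D\<^sup>2)\<^sup>2" by (simp only: abs_le_square_iff)
    then show ?thesis using nx by simp
  next
    case False
    then have "\<zeta> (x, d) = 0" using RD(2) H[of x] by (simp add: supp_def)
    then show ?thesis by simp
  qed
  have m: "(\<lambda>x. ?F n x) \<in> borel_measurable lborel" for n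
    using slice_measurable[OF w_C1 d, of b "hn n"] slice_measurable[OF z_C1 d, of b] slice_measurable[OF cz d]
    by simp
  have "(\<lambda>n. \<integral>\<^sup>+x. ennreal (?F n x) \<partial>lborel) \<longlonglongrightarrow> (\<integral>\<^sup>+(x::real^3). 0 \<partial>lborel)"
  proof (rule nn_integral_dominated_convergence)
    show "(\<lambda>x::real^3. ennreal (indicator (cball 0 R) x * ((2 * \<bar>C\<bar> * D\<^sup>2)\<^sup>2))) \<in> borel_measurable lborel"
      using borel_measurable_indicator[OF borel_closed[OF closed_cball], of "0::real^3" R, where 'b=real] by simp
    show "(\<integral>\<^sup>+(x::real^3). ennreal (indicator (cball 0 R) x * ((2 * \<bar>C\<bar> * D\<^sup>2)\<^sup>2)) \<partial>lborel) < \<infinity>"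
    proof -
      have "(\<integral>\<^sup>+(x::real^3). ennreal (indicator (cball 0 R) x * ((2 * \<bar>C\<bar> * D\<^sup>2)\<^sup>2)) \<partial>lborel)
        = (\<integral>\<^sup>+(x::real^3). indicator (cball 0 R) x * ennreal ((2 * \<bar>C\<bar> * D\<^sup>2)\<^sup>2) \<partial>lborel)"
        by (intro nn_integral_cong) (simp add: indicator_def)
      also have "\<dots> < \<infinity>" using emeasure_lborel_cball_finite[of "0::real^3" R]
        by (subst nn_integral_multc) (auto simp: ennreal_mult_less_top intro!: borel_measurable_indicator)
      finally show ?thesis .
    qed
    show "AE x in lborel. (\<lambda>n. ennreal (?F n x)) \<longlonglongrightarrow> 0"
    proof (rule AE_I2)
      fix x
      have "(\<lambda>n. ?F n x) \<longlonglongrightarrow> ((z b (x, d) - z b (x, d)) * (\<zeta> (x, d))\<^sup>2)\<^sup>2"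
        by (intro tendsto_power tendsto_mult tendsto_diff tendsto_const w_limit H)
      then show "(\<lambda>n. ennreal (?F n x)) \<longlonglongrightarrow> 0" by (simp add: tendsto_ennrealI[where x=0, simplified])
    qed
    show "AE x in lborel. ennreal (?F n x) \<le> ennreal (indicator (cball 0 R) x * ((2 * \<bar>C\<bar> * D\<^sup>2)\<^sup>2))" for n
      by (intro AE_I2 ennreal_leI bd)
  qed (use m in auto)
  then show ?thesis by simp
qed

text \<open>The vertical derivative of (w - z) zeta^2 has four terms, two for w and two for z. The
  former are bounded uniformly in n by \<open>uniform_energy\<close>, the latter by
  \<open>z_cut_energy\<close>.\<close>

lemma energy_difference:
  assumes zc: "cut \<zeta>" and z1: "\<And>p. p \<in> half_space \<Longrightarrow> \<bar>\<zeta> p\<bar> \<le> 1"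
  obtains L where "L \<ge> 0" "\<And>n. (\<integral>\<^sup>+p. ennreal ((G 3 (\<lambda>p. (w b (hn n) p - z b p) * (\<zeta> p)\<^sup>2) p)\<^sup>2) \<partial>M) \<le> ennreal L"
proof -
  have lz: "C1_bdd \<zeta>" using zc by (simp add: cut_def)
  note cz = C1_bdd_C1[OF lz]
  obtain R D where RD: "R > 0" "supp R \<zeta>" "D \<ge> 0" "\<And>p. p \<in> half_space \<Longrightarrow> \<bar>\<zeta> p\<bar> \<le> D"
    "\<And>p k. p \<in> half_space \<Longrightarrow> \<bar>G k \<zeta> p\<bar> \<le> D" using cut_bounds[OF zc] by blast
  obtain K where K: "\<And>h. 0 < h \<Longrightarrow> h \<le> 1 \<Longrightarrow> cut_mass \<zeta> b h \<le> K \<and> cut_energy \<zeta> b h \<le> K"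
    using uniform_energy[OF zc z1, of b] by blast
  let ?Z = "\<lambda>p. 4 * ((2 * D)\<^sup>2 * (z b p * \<zeta> p)\<^sup>2 + (G 3 (z b) p * (\<zeta> p)\<^sup>2)\<^sup>2)"
  let ?W = "\<lambda>n p. 4 * ((2 * D)\<^sup>2 * ((w b (hn n) p)\<^sup>2 * (\<zeta> p)\<^sup>2) + grad_ip (w b (hn n)) (w b (hn n)) p * \<zeta> p ^ 4)"
  have iZ: "integrable M ?Z"
    by (intro integrable_mult_right Bochner_Integration.integrable_add z_cut_energy(1,2)[OF zc z1])
  have iW: "integrable M (?W n)" for n
    by (intro integrable_mult_right Bochner_Integration.integrable_add cut_mass_int cut_energy_int zc hn)
  have pw: "(G 3 (\<lambda>p. (w b (hn n) p - z b p) * (\<zeta> p)\<^sup>2) p)\<^sup>2 \<le> ?W n p + ?Z p" if p: "p \<in> half_space" for n p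
  proof -
    let ?w = "w b (hn n)"
    have "G 3 (\<lambda>p. (?w p - z b p) * (\<zeta> p)\<^sup>2) p = (?w p - z b p) * (2 * \<zeta> p * G 3 \<zeta> p) + (G 3 ?w p - G 3 (z b) p) * (\<zeta> p)\<^sup>2"
      by (simp add: dV_mult dV_diff C1_diff w_C1 z_C1 C1_power dV_power2 cz p)
    also have "\<dots> = ?w p * \<zeta> p * (2 * G 3 \<zeta> p) + G 3 ?w p * (\<zeta> p)\<^sup>2 - (z b p * \<zeta> p * (2 * G 3 \<zeta> p) + G 3 (z b) p * (\<zeta> p)\<^sup>2)"
      by (simp add: algebra_simps)
    finally have "(G 3 (\<lambda>p. (?w p - z b p) * (\<zeta> p)\<^sup>2) p)\<^sup>2 \<le>
      4 * ((?w p * \<zeta> p * (2 * G 3 \<zeta> p))\<^sup>2 + (G 3 ?w p * (\<zeta> p)\<^sup>2)\<^sup>2 + (z b p * \<zeta> p * (2 * G 3 \<zeta> p))\<^sup>2 + (G 3 (z b) p * (\<zeta> p)\<^sup>2)\<^sup>2)"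
      by (simp only: sq_sum4)
    also have "\<dots> \<le> 4 * ((2 * D)\<^sup>2 * ((?w p)\<^sup>2 * (\<zeta> p)\<^sup>2) + grad_ip ?w ?w p * \<zeta> p ^ 4 + (2 * D)\<^sup>2 * (z b p * \<zeta> p)\<^sup>2 + (G 3 (z b) p * (\<zeta> p)\<^sup>2)\<^sup>2)"
    proof (intro mult_left_mono add_mono order_refl)
      have g: "(2 * G 3 \<zeta> p)\<^sup>2 \<le> (2 * D)\<^sup>2"
        using RD(3) RD(5)[OF p, of 3] by (intro abs_le_square_iff[THEN iffD1]) (auto simp: abs_mult)
      have "(?w p * \<zeta> p * (2 * G 3 \<zeta> p))\<^sup>2 = ((?w p)\<^sup>2 * (\<zeta> p)\<^sup>2) * (2 * G 3 \<zeta> p)\<^sup>2" by (simp only: power_mult_distrib)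
      also have "\<dots> \<le> ((?w p)\<^sup>2 * (\<zeta> p)\<^sup>2) * (2 * D)\<^sup>2" by (intro mult_left_mono g) auto
      finally show "(?w p * \<zeta> p * (2 * G 3 \<zeta> p))\<^sup>2 \<le> (2 * D)\<^sup>2 * ((?w p)\<^sup>2 * (\<zeta> p)\<^sup>2)" by (simp only: mult.commute)
      have "(z b p * \<zeta> p * (2 * G 3 \<zeta> p))\<^sup>2 = (z b p * \<zeta> p)\<^sup>2 * (2 * G 3 \<zeta> p)\<^sup>2" by (simp only: power_mult_distrib)
      also have "\<dots> \<le> (z b p * \<zeta> p)\<^sup>2 * (2 * D)\<^sup>2" by (intro mult_left_mono g) auto
      finally show "(z b p * \<zeta> p * (2 * G 3 \<zeta> p))\<^sup>2 \<le> (2 * D)\<^sup>2 * (z b p * \<zeta> p)\<^sup>2" by (simp only: mult.commute)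
      have "(G 3 ?w p * (\<zeta> p)\<^sup>2)\<^sup>2 = (G 3 ?w p)\<^sup>2 * \<zeta> p ^ 4" by (simp add: power_mult_distrib flip: power_mult)
      also have "\<dots> \<le> grad_ip ?w ?w p * \<zeta> p ^ 4" by (intro mult_right_mono grad_ip_ge) simp
      finally show "(G 3 ?w p * (\<zeta> p)\<^sup>2)\<^sup>2 \<le> grad_ip ?w ?w p * \<zeta> p ^ 4" .
    qed simp
    also have "\<dots> = ?W n p + ?Z p" by (simp only: distrib_left add.assoc)
    finally show ?thesis .
  qed
  define L where "L = \<bar>4 * ((2 * D)\<^sup>2 * K + K) + (\<integral>p. ?Z p \<partial>M)\<bar>"
  have "(\<integral>\<^sup>+p. ennreal ((G 3 (\<lambda>p. (w b (hn n) p - z b p) * (\<zeta> p)\<^sup>2) p)\<^sup>2) \<partial>M) \<le> ennreal L" for n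
  proof -
    have "(\<integral>\<^sup>+p. ennreal ((G 3 (\<lambda>p. (w b (hn n) p - z b p) * (\<zeta> p)\<^sup>2) p)\<^sup>2) \<partial>M) \<le> (\<integral>\<^sup>+p. ennreal (?W n p + ?Z p) \<partial>M)"
      by (intro nn_integral_mono ennreal_leI pw) simp
    also have "\<dots> = ennreal (\<integral>p. ?W n p + ?Z p \<partial>M)"
      by (rule nn_integral_eq_integral[OF Bochner_Integration.integrable_add[OF iW iZ]])
         (intro AE_I2 add_nonneg_nonneg mult_nonneg_nonneg grad_ip_nonneg, auto)
    also have "(\<integral>p. ?W n p + ?Z p \<partial>M) = 4 * ((2 * D)\<^sup>2 * cut_mass \<zeta> b (hn n) + cut_energy \<zeta> b (hn n)) + (\<integral>p. ?Z p \<partial>M)"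
      unfolding Bochner_Integration.integral_add[OF iW iZ] cut_mass_def cut_energy_def
      using cut_mass_int[OF zc hn, of b n] cut_energy_int[OF zc hn, of b n] by simp
    also have "\<dots> \<le> 4 * ((2 * D)\<^sup>2 * K + K) + (\<integral>p. ?Z p \<partial>M)"
      using K[OF hn[of n]] by (intro add_right_mono mult_left_mono add_mono) auto
    also have "\<dots> \<le> L" unfolding L_def by (rule abs_ge_self)
    finally show ?thesis by (simp add: ennreal_leI)
  qed
  then show ?thesis by (intro that[of L]) (simp add: L_def)
qed

text \<open>In \<open>trace_slice\<close> the height d is chosen first, so small that the uniformly
  bounded energy contributes little; then n is chosen large for the slice at that height.\<close>

lemma trace_convergence:
  assumes zc: "cut \<zeta>" and z1: "\<And>p. p \<in> half_space \<Longrightarrow> \<bar>\<zeta> p\<bar> \<le> 1"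
  shows "(\<lambda>n. \<integral>x. (tr (\<lambda>p. (w b (hn n) p - z b p) * (\<zeta> p)\<^sup>2) x)\<^sup>2 \<partial>lborel) \<longlonglongrightarrow> 0"
proof -
  have lz: "C1_bdd \<zeta>" using zc by (simp add: cut_def)
  obtain R where R: "supp R \<zeta>" using zc by (auto simp: cut_def)
  let ?v = "\<lambda>n p. (w b (hn n) p - z b p) * (\<zeta> p)\<^sup>2"
  have v: "Hloc (?v n)" "supp R (?v n)" for n
    using Hloc_C1_bdd_mult[OF Hloc_diff[OF w_Hloc[OF hn] z_Hloc] C1_bdd_power[OF lz]] R by (auto simp: supp_def)
  obtain L where L: "L \<ge> 0" "\<And>n. (\<integral>\<^sup>+p. ennreal ((G 3 (?v n) p)\<^sup>2) \<partial>M) \<le> ennreal L"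
    using energy_difference[OF zc z1, of b] by blast
  have i: "integrable lborel (\<lambda>x. (tr (?v n) x)\<^sup>2)" for n by (rule trace_square_integrable[OF v])
  show ?thesis
  proof (rule LIMSEQ_I)
    fix e :: real assume e: "e > 0"
    \<comment> \<open>Then 2 k L is at most e / 4, and together with 2 (e / 8) from the slice the
      sum is at most e / 2.\<close>
    define k where "k = e / (8 * (L + 1))"
    have k: "k > 0" "k * L \<le> e / 8" using e L(1) by (auto simp: k_def field_simps)
    \<comment> \<open>The height with d^(1-a) / (1-a) = k.\<close>
    define d where "d = (k * (1 - a)) powr (1 / (1 - a))"
    have d: "d > 0" "d powr (1 - a) / (1 - a) = k" using k(1) a_lt by (simp_all add: d_def powr_powr)
    let ?I = "\<lambda>n. \<integral>\<^sup>+x. ennreal ((?v n (x, d))\<^sup>2) \<partial>lborel"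
    have "eventually (\<lambda>n. ?I n < ennreal (e / 8)) sequentially"
      using slice_limit_zero[OF zc d(1), of b] e by (intro order_tendstoD(2)[of _ 0]) auto
    then obtain N where N: "\<And>n. n \<ge> N \<Longrightarrow> ?I n < ennreal (e / 8)" unfolding eventually_sequentially by blast
    have "norm ((\<integral>x. (tr (?v n) x)\<^sup>2 \<partial>lborel) - 0) < e" if n: "n \<ge> N" for n
    proof -
      have "ennreal (\<integral>x. (tr (?v n) x)\<^sup>2 \<partial>lborel) = (\<integral>\<^sup>+x. ennreal ((tr (?v n) x)\<^sup>2) \<partial>lborel)"
        by (rule nn_square_eq[OF i, symmetric])
      also have "\<dots> \<le> 2 * ?I n + 2 * ennreal k * (\<integral>\<^sup>+p. ennreal ((G 3 (?v n) p)\<^sup>2) \<partial>M)"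
        using trace_slice[OF v d(1), of n] unfolding d(2) .
      also have "\<dots> \<le> 2 * ennreal (e / 8) + 2 * ennreal k * ennreal L"
        using N[OF n] by (intro add_mono mult_left_mono L(2)) auto
      also have "\<dots> = ennreal (2 * (e / 8) + 2 * k * L)"
        using ennreal_mult[of 2 "e / 8"] ennreal_two_mult[of k L] e k(1) L(1)
        by (subst ennreal_plus) auto
      also have "\<dots> \<le> ennreal (e / 2)" using k(2) by (intro ennreal_leI) simp
      finally have "(\<integral>x. (tr (?v n) x)\<^sup>2 \<partial>lborel) \<le> e / 2" using e by (simp add: ennreal_le_iff)
      moreover have "0 \<le> (\<integral>x. (tr (?v n) x)\<^sup>2 \<partial>lborel)" by simp
      ultimately show ?thesis using e by simp
    qed
    then show "\<exists>no. \<forall>n\<ge>no. norm ((\<integral>x. (tr (?v n) x)\<^sup>2 \<partial>lborel) - 0) < e" by blast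
  qed
qed

text \<open>The chain rule along a sequence. Caratheodory's slope function covers the indices with t
  n = t0 without a case distinction.\<close>

lemma difference_quotient_f:
  assumes d: "(\<lambda>n. (t n - t0) / h n) \<longlonglongrightarrow> l" and h: "h \<longlonglongrightarrow> 0" "\<And>n. h n \<noteq> 0"
  shows "(\<lambda>n. (f (t n) - f t0) / h n) \<longlonglongrightarrow> f' t0 * l"
proof -
  obtain g where g: "\<And>s. f s - f t0 = g s * (s - t0)" "isCont g t0" "g t0 = f' t0"
    using fd[of t0] unfolding CARAT_DERIV by blast
  have "(\<lambda>n. (t n - t0) / h n * h n) \<longlonglongrightarrow> l * 0" by (rule tendsto_mult[OF d h(1)])
  then have "(\<lambda>n. (t n - t0) + t0) \<longlonglongrightarrow> 0 + t0"
    using h(2) by (intro tendsto_add tendsto_const) simp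
  then have "t \<longlonglongrightarrow> t0" by simp
  then have "(\<lambda>n. g (t n)) \<longlonglongrightarrow> f' t0" using isCont_tendsto_compose[OF g(2)] g(3) by simp
  then have "(\<lambda>n. g (t n) * ((t n - t0) / h n)) \<longlonglongrightarrow> f' t0 * l" by (rule tendsto_mult[OF _ d])
  then show ?thesis by (simp add: g(1))
qed

text \<open>The limit of \<open>w_weak\<close>. In the interior the gradients converge weakly in
  L^2. On the boundary the quotients q are bounded in L^2 and converge almost everywhere, hence
  weakly, the pointwise limit coming from convergence of the traces of w.\<close>

theorem z_weak:
  assumes xi: "test \<xi>"
  shows "(\<integral>p. grad_ip (z b) \<xi> p \<partial>M) = (\<integral>x. f' (tr u x) * tr (z b) x * tr \<xi> x \<partial>lborel)"
proof -
  obtain R where R: "supp R \<xi>" "Hloc \<xi>" using xi by (auto simp: test_def)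
  \<comment> \<open>The cutoff is 1 wherever xi or its gradient may be nonzero, so inserting it
    changes none of the integrals.\<close>
  obtain \<zeta> where zc: "cut \<zeta>" "\<And>p. p \<in> half_space \<Longrightarrow> \<bar>\<zeta> p\<bar> \<le> 1" "\<And>p. norm p < R + 2 \<Longrightarrow> \<zeta> p = 1"
    using cutoff_exists[of "R + 2"] by blast
  have lz: "C1_bdd \<zeta>" using zc by (simp add: cut_def)
  have Gx: "F p * (\<zeta> p)\<^sup>2 * G k \<xi> p = F p * G k \<xi> p" if "p \<in> half_space" for F p k
    using zc(3)[of p] supp_G[OF R(1) that, of "fr k"] by (cases "norm p < R + 2") auto
  have gie: "(\<integral>p. grad_ip F \<xi> p \<partial>M) = (\<Sum>k\<in>UNIV. \<integral>p. (G k F p * (\<zeta> p)\<^sup>2) * G k \<xi> p \<partial>M)" if F: "Hloc F" for F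
  proof -
    have i: "integrable M (\<lambda>p. (G k F p * (\<zeta> p)\<^sup>2) * G k \<xi> p)" for k
    proof -
      have "integrable M (\<lambda>p. G k F p * G k \<xi> p)"
        using F R by (intro loc_int_integrable[of _ "R + 1"] loc_int_mult G_measurable)
          (auto simp: Hloc_def supp_def supp_dV[unfolded supp_def])
      then show ?thesis
        by (rule Bochner_Integration.integrable_cong[THEN iffD2, OF refl, rotated]) (simp add: Gx)
    qed
    have "(\<integral>p. grad_ip F \<xi> p \<partial>M) = (\<integral>p. (\<Sum>k\<in>UNIV. (G k F p * (\<zeta> p)\<^sup>2) * G k \<xi> p) \<partial>M)"
      by (intro Bochner_Integration.integral_cong refl) (simp add: grad_ip_def Gx)
    also have "\<dots> = (\<Sum>k\<in>UNIV. \<integral>p. (G k F p * (\<zeta> p)\<^sup>2) * G k \<xi> p \<partial>M)"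
      by (rule Bochner_Integration.integral_sum[OF i])
    finally show ?thesis .
  qed
  have lhs: "(\<lambda>n. \<integral>p. grad_ip (w b (hn n)) \<xi> p \<partial>M) \<longlonglongrightarrow> (\<integral>p. grad_ip (z b) \<xi> p \<partial>M)"
    unfolding gie[OF w_Hloc[OF hn]] gie[OF z_Hloc]
    by (intro tendsto_sum z_cut_energy(3)[OF zc(1,2) xi])
  let ?v = "\<lambda>n p. (w b (hn n) p - z b p) * (\<zeta> p)\<^sup>2"
  have vH: "Hloc (?v n)" for n
    by (rule Hloc_C1_bdd_mult[OF Hloc_diff[OF w_Hloc[OF hn] z_Hloc] C1_bdd_power[OF lz]])
  have vs: "\<exists>R. supp R (?v n)" for n using zc(1) by (auto simp: cut_def supp_def)
  \<comment> \<open>Convergence in mean yields pointwise convergence along a subsequence only. This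
    is enough because the interior integrals converge along the whole sequence.\<close>
  obtain r where r: "strict_mono r" "AE x in lborel. (\<lambda>n. (tr (?v (r n)) x)\<^sup>2) \<longlonglongrightarrow> 0"
  proof -
    have "integrable lborel (\<lambda>x. (tr (?v n) x)\<^sup>2)" for n using vs[of n] trace_square_integrable[OF vH] by blast
    moreover have "(\<lambda>n. \<integral>x. norm ((tr (?v n) x)\<^sup>2) \<partial>lborel) \<longlonglongrightarrow> 0"
      using trace_convergence[OF zc(1,2), of b] by simp
    ultimately have "\<exists>r. strict_mono r \<and> (AE x in lborel. (\<lambda>n. (tr (?v (r n)) x)\<^sup>2) \<longlonglongrightarrow> 0)"
      by (intro tendsto_L1_AE_subseq)
    then show ?thesis using that by blast
  qed
  obtain C where C: "C \<ge> 0" "\<And>h. 0 < h \<Longrightarrow> h \<le> 1 \<Longrightarrow>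
    integrable lborel (\<lambda>x. (tr (\<lambda>p. w b h p * (\<zeta> p)\<^sup>2) x)\<^sup>2) \<and>
    (\<integral>x. (tr (\<lambda>p. w b h p * (\<zeta> p)\<^sup>2) x)\<^sup>2 \<partial>lborel) \<le> 1 * cut_energy \<zeta> b h + C * cut_mass \<zeta> b h"
    using boundary_bound[OF zc(1,2) zero_less_one] by blast
  obtain K where K: "K \<ge> 0" "\<And>h. 0 < h \<Longrightarrow> h \<le> 1 \<Longrightarrow> cut_mass \<zeta> b h \<le> K \<and> cut_energy \<zeta> b h \<le> K"
    using uniform_energy[OF zc(1,2), of b] by blast
  have cv: "AE x in lborel. convg u x \<and> convg \<zeta> x \<and> convg (z b) x \<and> convg \<xi> x"
    using Hloc_convg[OF uH] Hloc_convg[OF C1_bdd_Hloc[OF lz]] Hloc_convg[OF z_Hloc[of b]] Hloc_convg[OF R(2)]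
    by eventually_elim blast
  have "AE x in lborel. \<forall>n. \<bar>q b (hn n) x\<bar> \<le> Lf * \<bar>tr (w b (hn n)) x\<bar>"
    unfolding AE_all_countable by (rule allI, rule q_bound(1)[OF hn])
  moreover have "AE x in lborel. \<forall>n. convg (w b (hn n)) x \<and> tr (w b (hn n)) x = (tr (u_shift b (hn n)) x - tr u x) / hn n"
    unfolding AE_all_countable by (rule allI, rule q_bound(2)[OF hn])
  ultimately have cw: "AE x in lborel. (\<forall>n. \<bar>q b (hn n) x\<bar> \<le> Lf * \<bar>tr (w b (hn n)) x\<bar>) \<and>
    (\<forall>n. convg (w b (hn n)) x \<and> tr (w b (hn n)) x = (tr (u_shift b (hn n)) x - tr u x) / hn n)"
    by eventually_elim blast
  let ?q = "\<lambda>n x. q b (hn (r n)) x * (tr \<zeta> x)\<^sup>2"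
  have [measurable]: "tr \<zeta> \<in> borel_measurable borel" "tr u \<in> borel_measurable borel" "tr (z b) \<in> borel_measurable borel"
    "tr \<xi> \<in> borel_measurable borel"
    using C1_bdd_C1[OF lz] u_C1 z_C1 Hloc_C1[OF R(2)] by (auto intro: tr_measurable)
  have wt: "tr (\<lambda>p. w b h p * (\<zeta> p)\<^sup>2) x = tr (w b h) x * (tr \<zeta> x)\<^sup>2" if "convg (w b h) x" "convg \<zeta> x" for h x
    using tr_mult(2)[OF that(1)] tr_power[OF that(2)] by simp
  have sqle: "AE x in lborel. (?q n x)\<^sup>2 \<le> Lf\<^sup>2 * (tr (\<lambda>p. w b (hn (r n)) p * (\<zeta> p)\<^sup>2) x)\<^sup>2" for n
    using cv cw
  proof eventually_elim
    case (elim x)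
    then have "\<bar>q b (hn (r n)) x\<bar> \<le> Lf * \<bar>tr (w b (hn (r n))) x\<bar>" by blast
    then have "\<bar>q b (hn (r n)) x\<bar> \<le> \<bar>Lf * tr (w b (hn (r n))) x\<bar>" using Lf by (simp only: abs_mult abs_of_nonneg)
    then have "(q b (hn (r n)) x)\<^sup>2 \<le> (Lf * tr (w b (hn (r n))) x)\<^sup>2" by (simp only: abs_le_square_iff)
    then have "(q b (hn (r n)) x)\<^sup>2 * ((tr \<zeta> x)\<^sup>2)\<^sup>2 \<le> (Lf * tr (w b (hn (r n))) x)\<^sup>2 * ((tr \<zeta> x)\<^sup>2)\<^sup>2"
      by (rule mult_right_mono) simp
    moreover have "tr (\<lambda>p. w b (hn (r n)) p * (\<zeta> p)\<^sup>2) x = tr (w b (hn (r n))) x * (tr \<zeta> x)\<^sup>2"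
      using elim by (intro wt) auto
    ultimately show ?case by (simp add: power_mult_distrib mult.assoc)
  qed
  have qi: "integrable lborel (\<lambda>x. (?q n x)\<^sup>2)" for n
  proof (rule Bochner_Integration.integrable_bound)
    show "integrable lborel (\<lambda>x. Lf\<^sup>2 * (tr (\<lambda>p. w b (hn (r n)) p * (\<zeta> p)\<^sup>2) x)\<^sup>2)"
      using C(2)[OF hn[of "r n"]] by (intro integrable_mult_right) blast
    show "AE x in lborel. norm ((?q n x)\<^sup>2) \<le> norm (Lf\<^sup>2 * (tr (\<lambda>p. w b (hn (r n)) p * (\<zeta> p)\<^sup>2) x)\<^sup>2)"
      using sqle[of n] by eventually_elim simp
  qed measurable
  have qb: "(\<integral>x. (?q n x)\<^sup>2 \<partial>lborel) \<le> Lf\<^sup>2 * (K + C * K)" for n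
  proof -
    have "(\<integral>x. (?q n x)\<^sup>2 \<partial>lborel) \<le> (\<integral>x. Lf\<^sup>2 * (tr (\<lambda>p. w b (hn (r n)) p * (\<zeta> p)\<^sup>2) x)\<^sup>2 \<partial>lborel)"
      using C(2)[OF hn[of "r n"]] by (intro integral_mono_AE qi sqle integrable_mult_right) blast
    also have "\<dots> = Lf\<^sup>2 * (\<integral>x. (tr (\<lambda>p. w b (hn (r n)) p * (\<zeta> p)\<^sup>2) x)\<^sup>2 \<partial>lborel)" by simp
    also have "\<dots> \<le> Lf\<^sup>2 * (1 * cut_energy \<zeta> b (hn (r n)) + C * cut_mass \<zeta> b (hn (r n)))"
      using C(2)[OF hn[of "r n"]] by (intro mult_left_mono) auto
    also have "\<dots> \<le> Lf\<^sup>2 * (K + C * K)"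
      using K(2)[OF hn[of "r n"]] C(1) by (intro mult_left_mono add_mono) auto
    finally show ?thesis .
  qed
  have ql: "AE x in lborel. (\<lambda>n. ?q n x) \<longlonglongrightarrow> f' (tr u x) * tr (z b) x * (tr \<zeta> x)\<^sup>2"
    using cv cw r(2)
  proof eventually_elim
    case (elim x)
    show ?case
    \<comment> \<open>Where the trace of zeta vanishes both sides are 0; elsewhere it can be divided
      out of the trace of (w - z) zeta^2.\<close>
    proof (cases "tr \<zeta> x = 0")
      case False
      have tv: "tr (?v n) x = (tr (w b (hn n)) x - tr (z b) x) * (tr \<zeta> x)\<^sup>2" for n
        using elim tr_mult(2)[OF tr_diff(1)[of "w b (hn n)" x "z b"], of "\<lambda>p. (\<zeta> p)\<^sup>2"] tr_diff(2)[of "w b (hn n)" x "z b"]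
          tr_power[of \<zeta> x 2] by simp
      have "(\<lambda>n. \<bar>tr (?v (r n)) x\<bar>) \<longlonglongrightarrow> 0"
        using tendsto_real_sqrt[OF elim(3)] by simp
      then have "(\<lambda>n. tr (?v (r n)) x) \<longlonglongrightarrow> 0" by (rule tendsto_rabs_zero_cancel)
      then have "(\<lambda>n. tr (?v (r n)) x / (tr \<zeta> x)\<^sup>2 + tr (z b) x) \<longlonglongrightarrow> 0 / (tr \<zeta> x)\<^sup>2 + tr (z b) x"
        using False by (intro tendsto_add tendsto_divide tendsto_const) auto
      then have "(\<lambda>n. tr (w b (hn (r n))) x) \<longlonglongrightarrow> tr (z b) x"
        unfolding tv using False by simp
      then have "(\<lambda>n. (tr (u_shift b (hn (r n))) x - tr u x) / hn (r n)) \<longlonglongrightarrow> tr (z b) x"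
        using elim(2) by simp
      moreover have "(\<lambda>n. hn (r n)) \<longlonglongrightarrow> 0"
        using LIMSEQ_subseq_LIMSEQ[OF hn_tendsto r(1)] by (simp add: o_def)
      ultimately have "(\<lambda>n. q b (hn (r n)) x) \<longlonglongrightarrow> f' (tr u x) * tr (z b) x"
        unfolding q_def by (rule difference_quotient_f) (rule less_imp_neq[OF hn(1), symmetric])
      then show ?thesis by (rule tendsto_mult[OF _ tendsto_const])
    qed simp
  qed
  have xt: "AE x in lborel. (tr \<zeta> x)\<^sup>2 * tr \<xi> x = tr \<xi> x"
    using cv
  proof eventually_elim
    case (elim x)
    have "(\<lambda>p. (\<zeta> p)\<^sup>2 * \<xi> p) (x, y) = \<xi> (x, y)" if "y > 0" for y
      using zc(3)[of "(x, y)"] R(1) that by (cases "norm (x, y) < R + 2") (auto simp: supp_def half_space_def)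
    then have "((\<lambda>y. (\<lambda>p. (\<zeta> p)\<^sup>2 * \<xi> p) (x, y)) \<longlongrightarrow> tr \<xi> x) (at_right 0)"
      using elim by (intro Lim_transform_eventually[OF tr_tendsto[of \<xi> x]] eventually_mono[OF eventually_at_right_less[of 0]]) auto
    from tr_eqI(1)[OF this] have "tr (\<lambda>p. (\<zeta> p)\<^sup>2 * \<xi> p) x = tr \<xi> x" .
    moreover have "tr (\<lambda>p. (\<zeta> p)\<^sup>2 * \<xi> p) x = (tr \<zeta> x)\<^sup>2 * tr \<xi> x"
      using elim tr_mult(2)[of "\<lambda>p. (\<zeta> p)\<^sup>2" x \<xi>] tr_power[of \<zeta> x 2] by simp
    ultimately show ?case by simp
  qed
  have rhs: "(\<lambda>n. \<integral>x. ?q n x * tr \<xi> x \<partial>lborel) \<longlonglongrightarrow> (\<integral>x. f' (tr u x) * tr (z b) x * (tr \<zeta> x)\<^sup>2 * tr \<xi> x \<partial>lborel)"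
    by (rule weak_convergence_L2(3)[OF _ _ _ trace_square_integrable[OF R(2,1)] qi qb ql]) measurable
  have "(\<integral>x. ?q n x * tr \<xi> x \<partial>lborel) = (\<integral>p. grad_ip (w b (hn (r n))) \<xi> p \<partial>M)" for n
    unfolding w_weak(1)[OF hn xi]
    by (rule integral_cong_AE) (measurable, use xt in eventually_elim, simp add: mult.assoc)
  moreover have "(\<integral>x. f' (tr u x) * tr (z b) x * (tr \<zeta> x)\<^sup>2 * tr \<xi> x \<partial>lborel) = (\<integral>x. f' (tr u x) * tr (z b) x * tr \<xi> x \<partial>lborel)"
    by (rule integral_cong_AE) (measurable, use xt in eventually_elim, simp add: mult.assoc)
  ultimately have "(\<lambda>n. \<integral>p. grad_ip (w b (hn (r n))) \<xi> p \<partial>M) \<longlonglongrightarrow> (\<integral>x. f' (tr u x) * tr (z b) x * tr \<xi> x \<partial>lborel)"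
    using rhs by simp
  moreover have "(\<lambda>n. \<integral>p. grad_ip (w b (hn (r n))) \<xi> p \<partial>M) \<longlonglongrightarrow> (\<integral>p. grad_ip (z b) \<xi> p \<partial>M)"
    using LIMSEQ_subseq_LIMSEQ[OF lhs r(1)] by (simp add: o_def)
  ultimately show ?thesis using LIMSEQ_unique by blast
qed

end

section \<open>The equations of X u and Y u\<close>

context weight begin

lemma Hloc_cong:
  assumes "Hloc F" "\<And>p. p \<in> half_space \<Longrightarrow> F p = K p"
  shows "Hloc K"
  unfolding Hloc_def
proof (intro conjI allI)
  note c = Hloc_C1[OF assms(1)]
  show "C1 K" by (rule C1_cong[OF c assms(2)])
  show "loc_int (\<lambda>p. (K p)\<^sup>2)"
    by (rule loc_int_cong[of "\<lambda>p. (F p)\<^sup>2"]) (use assms in \<open>auto simp: Hloc_def\<close>)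
  show "loc_int (\<lambda>p. (G k K p)\<^sup>2)" for k
  proof (rule loc_int_cong[of "\<lambda>p. (G k F p)\<^sup>2"])
    show "loc_int (\<lambda>p. (G k F p)\<^sup>2)" using assms(1) by (simp add: Hloc_def)
    show "(G k F p)\<^sup>2 = (G k K p)\<^sup>2" if "p \<in> half_space" for p
      using dV_cong[OF c that assms(2)] by simp
  qed
qed

lemma grad_ip_cong:
  assumes "C1 F" "p \<in> half_space" "\<And>q. q \<in> half_space \<Longrightarrow> F q = K q"
  shows "grad_ip K L p = grad_ip F L p"
  unfolding grad_ip_def using dV_cong[OF assms] by simp

lemma grad_ip_coord:
  assumes "i = 1 \<or> i = 2"
  shows "grad_ip (\<lambda>p. fst p $ i) \<xi> p = G i \<xi> p"
  unfolding grad_ip_def sum_3 dV_coord using assms by (auto simp: fst_fr)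

lemma product_integrable:
  fixes g h :: "'a \<Rightarrow> real"
  assumes [measurable]: "g \<in> borel_measurable N" "h \<in> borel_measurable N"
    and "integrable N (\<lambda>x. (g x)\<^sup>2)" "integrable N (\<lambda>x. (h x)\<^sup>2)"
  shows "integrable N (\<lambda>x. g x * h x)"
proof (rule Bochner_Integration.integrable_bound[OF Bochner_Integration.integrable_add[OF assms(3,4)]])
  have "\<bar>g x * h x\<bar> \<le> (g x)\<^sup>2 + (h x)\<^sup>2" for x
    using sum_squares_bound[of "\<bar>g x\<bar>" "\<bar>h x\<bar>"] mult_nonneg_nonneg[OF abs_ge_zero[of "g x"] abs_ge_zero[of "h x"]]
    unfolding abs_mult power2_abs by linarith
  then show "AE x in N. norm (g x * h x) \<le> norm ((g x)\<^sup>2 + (h x)\<^sup>2)" by (intro AE_I2) simp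
qed measurable

end

context sol begin

text \<open>F need not have bounded support, so its trace is first localised by a cutoff that is 1
  near the support of xi; then both traces are square integrable.\<close>

lemma boundary_integrable:
  assumes F: "Hloc F" and xi: "Hloc \<xi>" "supp R \<xi>"
  shows "integrable lborel (\<lambda>x. f' (tr u x) * tr F x * tr \<xi> x)"
proof -
  \<comment> \<open>Above |x| < R + 1 all points of height below 1 have norm below R + 2, so the
    trace of zeta is 1 there; for larger |x| the trace of xi is 0.\<close>
  obtain \<zeta> where zc: "cut \<zeta>" "\<And>p. p \<in> half_space \<Longrightarrow> \<bar>\<zeta> p\<bar> \<le> 1" "\<And>p. norm p < R + 2 \<Longrightarrow> \<zeta> p = 1"
    using cutoff_exists[of "R + 2"] by blast
  have lz: "C1_bdd \<zeta>" using zc by (simp add: cut_def)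
  obtain R' where R': "supp R' \<zeta>" using zc by (auto simp: cut_def)
  let ?F = "\<lambda>p. F p * \<zeta> p"
  have H: "Hloc ?F" "supp R' ?F" using Hloc_C1_bdd_mult[OF F lz] R' by (auto simp: supp_def)
  have [measurable]: "tr ?F \<in> borel_measurable borel" "tr \<xi> \<in> borel_measurable borel" "tr F \<in> borel_measurable borel" "tr u \<in> borel_measurable borel"
    using Hloc_C1[OF H(1)] Hloc_C1[OF xi(1)] Hloc_C1[OF F] u_C1 by (auto intro: tr_measurable)
  have i: "integrable lborel (\<lambda>x. tr ?F x * tr \<xi> x)"
    by (intro product_integrable trace_square_integrable[OF H] trace_square_integrable[OF xi]) measurable
  have ut: "AE x in lborel. convg u x \<and> \<bar>tr u x\<bar> \<le> Mu"
    using u_shift_tr_bound[of 0] by (simp add: u_shift_0)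
  show ?thesis
  proof (rule Bochner_Integration.integrable_bound[OF integrable_mult_right[OF i, of Lf]])
    show "AE x in lborel. norm (f' (tr u x) * tr F x * tr \<xi> x) \<le> norm (Lf * (tr ?F x * tr \<xi> x))"
      using Hloc_convg[OF F] Hloc_convg[OF C1_bdd_Hloc[OF lz]] ut
    proof eventually_elim
      case (elim x)
      have 1: "tr F x * tr \<xi> x = tr ?F x * tr \<xi> x"
      proof (cases "norm x < R + 1")
        case True
        have "eventually (\<lambda>y. \<zeta> (x, y) = 1) (at_right 0)"
          using eventually_at_right_real[of 0 1]
        proof (rule eventually_mono)
          fix y :: real assume "y \<in> {0<..<1}"
          then have "norm (x, y) < R + 2" using norm_Pair_le[of x y] True by simp
          then show "\<zeta> (x, y) = 1" by (rule zc(3))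
        qed simp
        then have "tr \<zeta> x = 1" by (intro tr_eqI(1) tendsto_eventually)
        then show ?thesis using tr_mult(2)[of F x \<zeta>] elim by simp
      next
        case False
        then show ?thesis using tr_supp(2)[OF xi(2), of x] by simp
      qed
      have "\<bar>f' (tr u x)\<bar> \<le> \<bar>Lf\<bar>" using f'b[of "tr u x"] elim by fastforce
      then show ?case unfolding mult.assoc 1 real_norm_def abs_mult[of _ "tr ?F x * tr \<xi> x"] by (rule mult_right_mono) simp
    qed
  qed measurable
qed

definition z1 :: "point \<Rightarrow> real" where "z1 = z (axis 1 1)"
definition z2 :: "point \<Rightarrow> real" where "z2 = z (axis 2 1)"
definition z3 :: "point \<Rightarrow> real" where "z3 = z (axis 3 1)"

lemma z_simps: assumes "p \<in> half_space"
  shows "z1 p = pd 1 u p - 2 * fst p $ 2 * pd 3 u p" "z2 p = pd 2 u p + 2 * fst p $ 1 * pd 3 u p" "z3 p = pd 3 u p"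
  unfolding z1_def z2_def z3_def z_def vf_expand[OF u_C1 assms] by (simp_all add: axis_def)

text \<open>X and the corresponding generator of left translations have x_3 coefficients 2 x_2 and
  -2 x_2; for Y the signs are reversed.\<close>

lemma Xu_eq: "p \<in> half_space \<Longrightarrow> z1 p + 4 * (fst p $ 2 * z3 p) = G 1 u p"
  and Yu_eq: "p \<in> half_space \<Longrightarrow> z2 p + (- 4) * (fst p $ 1 * z3 p) = G 2 u p"
  by (simp_all add: z_simps dV_fr_cases u_C1)

lemma zi_Hloc: "Hloc z1" "Hloc z2" "Hloc z3"
  unfolding z1_def z2_def z3_def by (rule z_Hloc)+

lemma coord_z3_Hloc: "Hloc (\<lambda>p. fst p $ i * z3 p)"
  using Hloc_C1_bdd_mult[OF zi_Hloc(3) C1_bdd_coord[of i]] by (simp add: mult.commute)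

lemma XYu_Hloc: "Hloc (G 1 u)" "Hloc (G 2 u)"
  by (rule Hloc_cong[OF Hloc_add[OF zi_Hloc(1) Hloc_cmult[OF coord_z3_Hloc]] Xu_eq], assumption)
     (rule Hloc_cong[OF Hloc_add[OF zi_Hloc(2) Hloc_cmult[OF coord_z3_Hloc]] Yu_eq])

text \<open>The coordinate x_i is moved from z3 to the test function. Its gradient is the i-th frame
  vector, so the difference is z3 G_i xi - xi G_i z3; up to the total derivative G_i (z3 xi), which
  integrates to 0, this is -2 xi G_i z3.\<close>

lemma coord_z3_weak:
  assumes xi: "test \<xi>" and i: "i = 1 \<or> i = 2"
  shows "(\<integral>p. grad_ip (\<lambda>p. fst p $ i * z3 p) \<xi> p \<partial>M)
     = (\<integral>x. f' (tr u x) * tr (\<lambda>p. fst p $ i * z3 p) x * tr \<xi> x \<partial>lborel) - 2 * (\<integral>p. \<xi> p * G i z3 p \<partial>M)"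
proof -
  obtain R where R: "supp R \<xi>" "Hloc \<xi>" using xi by (auto simp: test_def)
  note c = Hloc_C1[OF zi_Hloc(3)] Hloc_C1[OF R(2)] C1_coord[of i]
  let ?x = "\<lambda>p::point. fst p $ i"
  have xx: "test (\<lambda>p. ?x p * \<xi> p)"
    using xi Hloc_C1_bdd_mult[OF R(2) C1_bdd_coord[of i]] loc_bdd_mult[OF loc_bdd_coord[of i], of \<xi>]
    unfolding test_def by (auto simp: mult.commute supp_def)
  have sup: "supp R (\<lambda>p. ?x p * \<xi> p)" using R(1) by (auto simp: supp_def)
  have pw: "grad_ip (\<lambda>p. ?x p * z3 p) \<xi> p = grad_ip z3 (\<lambda>p. ?x p * \<xi> p) p + G i (\<lambda>p. z3 p * \<xi> p) p - 2 * (\<xi> p * G i z3 p)"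
    if p: "p \<in> half_space" for p
  proof -
    have "grad_ip (\<lambda>p. ?x p * z3 p) \<xi> p = ?x p * grad_ip z3 \<xi> p + z3 p * G i \<xi> p"
      using grad_ip_mult[OF c(3,1) p, of \<xi>] by (simp add: grad_ip_commute[of _ \<xi>] grad_ip_coord[OF i, symmetric])
    moreover have "grad_ip z3 (\<lambda>p. ?x p * \<xi> p) p = ?x p * grad_ip z3 \<xi> p + \<xi> p * G i z3 p"
      using grad_ip_mult[OF c(3,2) p, of z3] by (simp add: grad_ip_commute[of z3 ?x] grad_ip_coord[OF i])
    ultimately show ?thesis by (simp add: dV_mult c p)
  qed
  have i1: "integrable M (grad_ip z3 (\<lambda>p. ?x p * \<xi> p))"
    using xx by (intro grad_ip_integrable[OF zi_Hloc(3) _ sup]) (simp add: test_def)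
  have l: "loc_int (\<lambda>p. z3 p * \<xi> p)" "loc_int (\<lambda>p. z3 p * G k \<xi> p)" "loc_int (\<lambda>p. G k z3 p * \<xi> p)" for k
    using zi_Hloc(3) R(2) c unfolding Hloc_def
    by (auto intro!: loc_int_mult C1_measurable[OF c(1)] C1_measurable[OF c(2)] G_measurable[OF c(1)] G_measurable[OF c(2)])
  have i2: "integrable M (\<lambda>p. z3 p * \<xi> p)" by (rule loc_int_integrable[OF l(1), of R]) (use R in \<open>auto simp: supp_def\<close>)
  have i4: "integrable M (\<lambda>p. G i z3 p * \<xi> p)" by (rule loc_int_integrable[OF l(3), of R]) (use R in \<open>auto simp: supp_def\<close>)
  have i5: "integrable M (\<lambda>p. z3 p * G i \<xi> p)"
    by (rule loc_int_integrable[OF l(2), of "R + 1"]) (use supp_dV[OF R(1)] in \<open>auto simp: supp_def\<close>)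
  have i3: "integrable M (G i (\<lambda>p. z3 p * \<xi> p))"
    by (rule Bochner_Integration.integrable_cong[THEN iffD2, OF refl _ Bochner_Integration.integrable_add[OF i5 i4]])
       (simp add: dV_mult c)
  have "(\<integral>p. grad_ip (\<lambda>p. ?x p * z3 p) \<xi> p \<partial>M) = (\<integral>p. grad_ip z3 (\<lambda>p. ?x p * \<xi> p) p + G i (\<lambda>p. z3 p * \<xi> p) p - 2 * (\<xi> p * G i z3 p) \<partial>M)"
    by (intro Bochner_Integration.integral_cong refl pw) simp
  also have "\<dots> = (\<integral>p. grad_ip z3 (\<lambda>p. ?x p * \<xi> p) p \<partial>M) + (\<integral>p. G i (\<lambda>p. z3 p * \<xi> p) p \<partial>M) - 2 * (\<integral>p. \<xi> p * G i z3 p \<partial>M)"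
    using i1 i3 i4 by (simp add: mult.commute)
  also have "(\<integral>p. G i (\<lambda>p. z3 p * \<xi> p) p \<partial>M) = 0"
    by (rule ibp[OF i C1_mult[OF c(1,2)] i2 i3])
  also have "(\<integral>p. grad_ip z3 (\<lambda>p. ?x p * \<xi> p) p \<partial>M) = (\<integral>x. f' (tr u x) * tr z3 x * tr (\<lambda>p. ?x p * \<xi> p) x \<partial>lborel)"
    unfolding z3_def by (rule z_weak[OF xx])
  also have "\<dots> = (\<integral>x. f' (tr u x) * tr (\<lambda>p. ?x p * z3 p) x * tr \<xi> x \<partial>lborel)"
  proof (rule integral_cong_AE)
    have [measurable]: "tr u \<in> borel_measurable borel" "tr z3 \<in> borel_measurable borel" "tr \<xi> \<in> borel_measurable borel"
      "tr (\<lambda>p. ?x p * \<xi> p) \<in> borel_measurable borel" "tr (\<lambda>p. ?x p * z3 p) \<in> borel_measurable borel"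
      using u_C1 c by (auto intro!: tr_measurable C1_mult)
    show "(\<lambda>x. f' (tr u x) * tr z3 x * tr (\<lambda>p. ?x p * \<xi> p) x) \<in> borel_measurable lborel"
      "(\<lambda>x. f' (tr u x) * tr (\<lambda>p. ?x p * z3 p) x * tr \<xi> x) \<in> borel_measurable lborel" by measurable
    show "AE x in lborel. f' (tr u x) * tr z3 x * tr (\<lambda>p. ?x p * \<xi> p) x = f' (tr u x) * tr (\<lambda>p. ?x p * z3 p) x * tr \<xi> x"
      using Hloc_convg[OF zi_Hloc(3)] Hloc_convg[OF R(2)]
      by eventually_elim (simp add: tr_mult(2)[of ?x] tr_coord)
  qed
  finally show ?thesis by simp
qed

lemma linear_weak:
  assumes xi: "test \<xi>" and F: "Hloc F" "Hloc K" and E: "\<And>p. p \<in> half_space \<Longrightarrow> F p + c * K p = L p"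
    and Fw: "(\<integral>p. grad_ip F \<xi> p \<partial>M) = (\<integral>x. f' (tr u x) * tr F x * tr \<xi> x \<partial>lborel)"
    and Kw: "(\<integral>p. grad_ip K \<xi> p \<partial>M) = (\<integral>x. f' (tr u x) * tr K x * tr \<xi> x \<partial>lborel) - r"
  shows "(\<integral>p. grad_ip L \<xi> p \<partial>M) = (\<integral>x. f' (tr u x) * tr L x * tr \<xi> x \<partial>lborel) - c * r"
proof -
  obtain R where R: "supp R \<xi>" "Hloc \<xi>" using xi by (auto simp: test_def)
  note c1 = Hloc_C1[OF F(1)] Hloc_C1[OF F(2)]
  have LC: "C1 L" by (rule C1_cong[OF C1_add[OF c1(1) C1_cmult[OF c1(2)]] E])
  have "(\<integral>p. grad_ip L \<xi> p \<partial>M) = (\<integral>p. grad_ip F \<xi> p + c * grad_ip K \<xi> p \<partial>M)"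
  proof (intro Bochner_Integration.integral_cong refl)
    fix p assume "p \<in> space M"
    then have p: "p \<in> half_space" by simp
    have "grad_ip L \<xi> p = grad_ip (\<lambda>p. F p + c * K p) \<xi> p"
      by (rule grad_ip_cong[OF C1_add[OF c1(1) C1_cmult[OF c1(2)]] p E])
    also have "\<dots> = grad_ip F \<xi> p + grad_ip (\<lambda>p. c * K p) \<xi> p" by (rule grad_ip_add[OF c1(1) C1_cmult[OF c1(2)] p])
    also have "grad_ip (\<lambda>p. c * K p) \<xi> p = c * grad_ip K \<xi> p"
      using grad_ip_cmult[OF c1(2) p, of \<xi> c] by (simp only: grad_ip_commute[of _ \<xi>])
    finally show "grad_ip L \<xi> p = grad_ip F \<xi> p + c * grad_ip K \<xi> p" .
  qed
  also have "\<dots> = (\<integral>p. grad_ip F \<xi> p \<partial>M) + c * (\<integral>p. grad_ip K \<xi> p \<partial>M)"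
    using grad_ip_integrable[OF F(1) R(2,1)] grad_ip_integrable[OF F(2) R(2,1)] by simp
  also have "\<dots> = (\<integral>x. f' (tr u x) * tr F x * tr \<xi> x \<partial>lborel) + c * (\<integral>x. f' (tr u x) * tr K x * tr \<xi> x \<partial>lborel) - c * r"
    unfolding Fw Kw by (simp add: algebra_simps)
  also have "(\<integral>x. f' (tr u x) * tr F x * tr \<xi> x \<partial>lborel) + c * (\<integral>x. f' (tr u x) * tr K x * tr \<xi> x \<partial>lborel)
     = (\<integral>x. f' (tr u x) * tr F x * tr \<xi> x + c * (f' (tr u x) * tr K x * tr \<xi> x) \<partial>lborel)"
    using boundary_integrable[OF F(1) R(2,1)] boundary_integrable[OF F(2) R(2,1)] by simp
  also have "\<dots> = (\<integral>x. f' (tr u x) * tr L x * tr \<xi> x \<partial>lborel)"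
  proof (rule integral_cong_AE)
    have [measurable]: "tr u \<in> borel_measurable borel" "tr F \<in> borel_measurable borel" "tr K \<in> borel_measurable borel"
      "tr L \<in> borel_measurable borel" "tr \<xi> \<in> borel_measurable borel"
      using u_C1 c1 LC Hloc_C1[OF R(2)] by (auto intro!: tr_measurable)
    show "(\<lambda>x. f' (tr u x) * tr F x * tr \<xi> x + c * (f' (tr u x) * tr K x * tr \<xi> x)) \<in> borel_measurable lborel"
      "(\<lambda>x. f' (tr u x) * tr L x * tr \<xi> x) \<in> borel_measurable lborel" by measurable
    show "AE x in lborel. f' (tr u x) * tr F x * tr \<xi> x + c * (f' (tr u x) * tr K x * tr \<xi> x) = f' (tr u x) * tr L x * tr \<xi> x"
      using Hloc_convg[OF F(1)] Hloc_convg[OF F(2)]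
    proof eventually_elim
      case (elim x)
      have "((\<lambda>y. F (x, y) + c * K (x, y)) \<longlongrightarrow> tr F x + c * tr K x) (at_right 0)"
        by (intro tendsto_intros tr_tendsto elim)
      then have "((\<lambda>y. L (x, y)) \<longlongrightarrow> tr F x + c * tr K x) (at_right 0)"
        by (rule Lim_transform_eventually) (rule eventually_mono[OF eventually_at_right_less[of 0]], simp add: E half_space_def)
      then have "tr L x = tr F x + c * tr K x" by (rule tr_eqI)
      then show ?case by (simp add: algebra_simps)
    qed
  qed
  finally show ?thesis .
qed

text \<open>The commutator term has coefficient 8 = 4 * 2: the 4 of \<open>Xu_eq\<close> and the 2
  of \<open>coord_z3_weak\<close>.\<close>

lemma Xu_weak:
  assumes xi: "test \<xi>"
  shows "(\<integral>p. grad_ip (G 1 u) \<xi> p \<partial>M) = (\<integral>x. f' (tr u x) * tr (G 1 u) x * tr \<xi> x \<partial>lborel) - 8 * (\<integral>p. \<xi> p * G 2 z3 p \<partial>M)"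
  using linear_weak[OF xi zi_Hloc(1) coord_z3_Hloc Xu_eq z_weak[OF xi, of "axis 1 1", folded z1_def] coord_z3_weak[OF xi, of 2]]
  by simp

lemma Yu_weak:
  assumes xi: "test \<xi>"
  shows "(\<integral>p. grad_ip (G 2 u) \<xi> p \<partial>M) = (\<integral>x. f' (tr u x) * tr (G 2 u) x * tr \<xi> x \<partial>lborel) + 8 * (\<integral>p. \<xi> p * G 1 z3 p \<partial>M)"
  using linear_weak[OF xi zi_Hloc(2) coord_z3_Hloc Yu_eq z_weak[OF xi, of "axis 2 1", folded z2_def] coord_z3_weak[OF xi, of 1]]
  by simp

end

subsection \<open>The geometric inequality\<close>

text \<open>Lagrange's identity: |w|^2 |a|^2 is the sum of the squares of the inner product and of
  the determinant of w and a. Adding e^2 to a denominator only decreases the subtracted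
  quotient.\<close>

lemma lagrange_bound:
  fixes a1 a2 w1 w2 e :: real
  shows "(w1 * a2 - w2 * a1)\<^sup>2 / (w1\<^sup>2 + w2\<^sup>2) \<le> a1\<^sup>2 + a2\<^sup>2 - (w1 * a1 + w2 * a2)\<^sup>2 / (w1\<^sup>2 + w2\<^sup>2 + e\<^sup>2)"
    and "e \<noteq> 0 \<Longrightarrow> (w1 * a1 + w2 * a2)\<^sup>2 / (w1\<^sup>2 + w2\<^sup>2 + e\<^sup>2) \<le> a1\<^sup>2 + a2\<^sup>2"
proof -
  have id: "(w1\<^sup>2 + w2\<^sup>2) * (a1\<^sup>2 + a2\<^sup>2) = (w1 * a1 + w2 * a2)\<^sup>2 + (w1 * a2 - w2 * a1)\<^sup>2"
    by (simp add: power2_eq_square algebra_simps)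
  show 1: "(w1 * a2 - w2 * a1)\<^sup>2 / (w1\<^sup>2 + w2\<^sup>2) \<le> a1\<^sup>2 + a2\<^sup>2 - (w1 * a1 + w2 * a2)\<^sup>2 / (w1\<^sup>2 + w2\<^sup>2 + e\<^sup>2)"
  proof (cases "w1\<^sup>2 + w2\<^sup>2 = 0")
    \<comment> \<open>The left side is 0 by division by zero, and so is the numerator subtracted on
      the right.\<close>
    case True
    then have "w1 = 0" "w2 = 0" by (simp_all add: sum_power2_eq_zero_iff)
    then show ?thesis by simp
  next
    case False
    then have g: "w1\<^sup>2 + w2\<^sup>2 > 0" by (simp add: sum_power2_gt_zero_iff sum_power2_eq_zero_iff)
    have "(w1 * a1 + w2 * a2)\<^sup>2 / (w1\<^sup>2 + w2\<^sup>2 + e\<^sup>2) \<le> (w1 * a1 + w2 * a2)\<^sup>2 / (w1\<^sup>2 + w2\<^sup>2)"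
      by (rule frac_le) (use g in auto)
    moreover have "a1\<^sup>2 + a2\<^sup>2 = (w1 * a1 + w2 * a2)\<^sup>2 / (w1\<^sup>2 + w2\<^sup>2) + (w1 * a2 - w2 * a1)\<^sup>2 / (w1\<^sup>2 + w2\<^sup>2)"
      unfolding add_divide_distrib[symmetric] id[symmetric] using False by simp
    ultimately show ?thesis by linarith
  qed
  have "0 \<le> (w1 * a2 - w2 * a1)\<^sup>2 / (w1\<^sup>2 + w2\<^sup>2)" by simp
  then show "(w1 * a1 + w2 * a2)\<^sup>2 / (w1\<^sup>2 + w2\<^sup>2 + e\<^sup>2) \<le> a1\<^sup>2 + a2\<^sup>2" using 1 by linarith
qed

context sol begin

text \<open>The excess of \<open>\<bar>\<nabla>Xu\<bar>\<^sup>2 + \<bar>\<nabla>Yu\<bar>\<^sup>2\<close> over \<open>\<bar>\<nabla>\<bar>\<nabla>\<^sub>H u\<bar>\<bar>\<^sup>2\<close>. It is \<open>0\<close> where \<open>\<nabla>\<^sub>H u = 0\<close>, by division by zero.\<close>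

definition curv_term :: "point \<Rightarrow> real" where
  "curv_term p = (\<Sum>k\<in>UNIV. (G 1 u p * G k (G 2 u) p - G 2 u p * G k (G 1 u) p)\<^sup>2 / ((G 1 u p)\<^sup>2 + (G 2 u p)\<^sup>2))"

text \<open>\<open>2 \<bar>\<nabla>\<^sub>H u\<bar>\<^sup>2 \<langle>T \<nu>, v\<rangle>\<close>, arising from the commutators in the equations of \<open>Xu\<close> and \<open>Yu\<close>.\<close>

definition sign_term :: "point \<Rightarrow> real" where
  "sign_term p = 8 * (G 1 u p * G 2 z3 p - G 2 u p * G 1 z3 p)"

text \<open>\<open>\<bar>\<nabla>\<^sub>H u\<bar>\<close>, regularised to be of class \<open>C\<^sup>1\<close> at its zeros, where it need not be differentiable.\<close>

definition grad_reg :: "real \<Rightarrow> point \<Rightarrow> real" where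
  "grad_reg e p = sqrt ((G 1 u p)\<^sup>2 + (G 2 u p)\<^sup>2 + e\<^sup>2)"

lemma XYu_C1: "C1 (G 1 u)" "C1 (G 2 u)"
  by (rule C2_G[OF u2])+

lemma grad_reg_arg_pos: "e \<noteq> 0 \<Longrightarrow> 0 < (G 1 u p)\<^sup>2 + (G 2 u p)\<^sup>2 + e\<^sup>2"
  by (intro add_nonneg_pos) auto

lemma grad_reg_arg_C1: "C1 (\<lambda>p. (G 1 u p)\<^sup>2 + (G 2 u p)\<^sup>2 + e\<^sup>2)"
  by (intro C1_add C1_power XYu_C1 C1_const)

lemma grad_reg_C1: assumes "e \<noteq> 0" shows "C1 (grad_reg e)"
  unfolding grad_reg_def[abs_def]
proof (rule C1_comp[OF grad_reg_arg_C1, where h' = "\<lambda>x. inverse (sqrt x) / 2"])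
  fix p
  show "(sqrt has_real_derivative inverse (sqrt ((G 1 u p)\<^sup>2 + (G 2 u p)\<^sup>2 + e\<^sup>2)) / 2) (at ((G 1 u p)\<^sup>2 + (G 2 u p)\<^sup>2 + e\<^sup>2))"
    by (rule DERIV_real_sqrt[OF grad_reg_arg_pos[OF assms]])
  show "continuous_on ((\<lambda>p. (G 1 u p)\<^sup>2 + (G 2 u p)\<^sup>2 + e\<^sup>2) ` half_space) (\<lambda>x. inverse (sqrt x) / 2)"
    using grad_reg_arg_pos[OF assms] by (intro continuous_intros) (auto simp: less_le)
qed

lemma inverse_half_cancel: "r \<noteq> 0 \<Longrightarrow> r * (inverse r / 2 * (2 * x)) = x" for r x :: real
  by simp

lemma grad_reg_dV:
  assumes "e \<noteq> 0" "p \<in> half_space"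
  shows "grad_reg e p * dV V (grad_reg e) p = G 1 u p * dV V (G 1 u) p + G 2 u p * dV V (G 2 u) p"
proof -
  have "dV V (grad_reg e) p = inverse (grad_reg e p) / 2 * dV V (\<lambda>p. (G 1 u p)\<^sup>2 + (G 2 u p)\<^sup>2 + e\<^sup>2) p"
    unfolding grad_reg_def[abs_def] by (rule dV_comp[OF grad_reg_arg_C1 assms(2) DERIV_real_sqrt[OF grad_reg_arg_pos[OF assms(1)]]])
  also have "dV V (\<lambda>p. (G 1 u p)\<^sup>2 + (G 2 u p)\<^sup>2 + e\<^sup>2) p = 2 * (G 1 u p * dV V (G 1 u) p + G 2 u p * dV V (G 2 u) p)"
    by (simp add: dV_add dV_power2 C1_add C1_power XYu_C1 assms(2))
  finally have E: "dV V (grad_reg e) p = inverse (grad_reg e p) / 2 * (2 * (G 1 u p * dV V (G 1 u) p + G 2 u p * dV V (G 2 u) p))" .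
  have "grad_reg e p \<noteq> 0" using grad_reg_arg_pos[OF assms(1), of p] by (simp add: grad_reg_def)
  then show ?thesis unfolding E by (rule inverse_half_cancel)
qed

lemma grad_reg_sq: "(grad_reg e p)\<^sup>2 = (G 1 u p)\<^sup>2 + (G 2 u p)\<^sup>2 + e\<^sup>2"
  by (simp add: grad_reg_def)

lemma grad_reg_G_sq:
  assumes "e \<noteq> 0" "p \<in> half_space"
  shows "(G k (grad_reg e) p)\<^sup>2 = (G 1 u p * G k (G 1 u) p + G 2 u p * G k (G 2 u) p)\<^sup>2 / ((G 1 u p)\<^sup>2 + (G 2 u p)\<^sup>2 + e\<^sup>2)"
proof -
  have "(grad_reg e p)\<^sup>2 \<noteq> 0" unfolding grad_reg_sq using grad_reg_arg_pos[OF assms(1), of p] by (rule less_imp_neq[symmetric])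
  then show ?thesis
    unfolding grad_reg_dV[OF assms, symmetric] grad_reg_sq[symmetric] power_mult_distrib
    by (rule nonzero_mult_div_cancel_left[symmetric])
qed

lemma grad_reg_Hloc: assumes "e \<noteq> 0" shows "Hloc (grad_reg e)"
  unfolding Hloc_def
proof (intro conjI allI grad_reg_C1[OF assms])
  show "loc_int (\<lambda>p. (grad_reg e p)\<^sup>2)"
    unfolding grad_reg_sq using XYu_Hloc by (intro loc_int_add loc_int_const) (auto simp: Hloc_def)
  fix k
  have "loc_int (\<lambda>p. (G k (G 1 u) p)\<^sup>2 + (G k (G 2 u) p)\<^sup>2)" using XYu_Hloc by (intro loc_int_add) (auto simp: Hloc_def)
  then show "loc_int (\<lambda>p. (G k (grad_reg e) p)\<^sup>2)"
  proof (rule loc_intI_bound[rotated])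
    show "(\<lambda>p. (G k (grad_reg e) p)\<^sup>2) \<in> borel_measurable M"
      by (intro borel_measurable_power G_measurable grad_reg_C1 assms)
    show "\<bar>(G k (grad_reg e) p)\<^sup>2\<bar> \<le> (G k (G 1 u) p)\<^sup>2 + (G k (G 2 u) p)\<^sup>2" if "p \<in> half_space" for p
    proof -
      have "(G k (grad_reg e) p)\<^sup>2 \<le> (G k (G 1 u) p)\<^sup>2 + (G k (G 2 u) p)\<^sup>2"
        unfolding grad_reg_G_sq[OF assms that] by (rule lagrange_bound(2)[OF assms])
      then show ?thesis by simp
    qed
  qed
qed

lemma grad_reg_loc_bdd: "loc_bdd (grad_reg e)"
  unfolding loc_bdd_def
proof
  fix R
  have "loc_bdd (\<lambda>p. (grad_reg e p)\<^sup>2)" unfolding grad_reg_sq unfolding power2_eq_square by (intro loc_bdd_add loc_bdd_mult Xlb loc_bdd_const)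
  then obtain C where C: "\<forall>p\<in>half_space. norm p < R \<longrightarrow> \<bar>(grad_reg e p)\<^sup>2\<bar> \<le> C" unfolding loc_bdd_def by blast
  have "\<bar>grad_reg e p\<bar> \<le> sqrt C" if "p \<in> half_space" "norm p < R" for p
    using C that by (intro real_le_rsqrt) simp
  then show "\<exists>C. \<forall>p\<in>half_space. norm p < R \<longrightarrow> \<bar>grad_reg e p\<bar> \<le> C" by blast
qed

text \<open>For each frame direction the terms with phi times its derivative coincide on both sides,
  by \<open>grad_reg_dV\<close>. What remains is \<open>lagrange_bound\<close> multiplied by
  phi^2.\<close>

lemma geometric_pointwise:
  assumes e: "e \<noteq> 0" and p: "p \<in> half_space" and phi: "C1 \<phi>"
  shows "grad_ip (\<lambda>p. grad_reg e p * \<phi> p) (\<lambda>p. grad_reg e p * \<phi> p) p + curv_term p * (\<phi> p)\<^sup>2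
    \<le> grad_ip (G 1 u) (\<lambda>p. G 1 u p * (\<phi> p)\<^sup>2) p + grad_ip (G 2 u) (\<lambda>p. G 2 u p * (\<phi> p)\<^sup>2) p
      + ((G 1 u p)\<^sup>2 + (G 2 u p)\<^sup>2 + e\<^sup>2) * grad_ip \<phi> \<phi> p"
proof -
  let ?w1 = "G 1 u" and ?w2 = "G 2 u" and ?N = "grad_reg e"
  have pt: "(G k (\<lambda>p. ?N p * \<phi> p) p)\<^sup>2 + (?w1 p * G k ?w2 p - ?w2 p * G k ?w1 p)\<^sup>2 / ((?w1 p)\<^sup>2 + (?w2 p)\<^sup>2) * (\<phi> p)\<^sup>2
     \<le> G k ?w1 p * G k (\<lambda>p. ?w1 p * (\<phi> p)\<^sup>2) p + G k ?w2 p * G k (\<lambda>p. ?w2 p * (\<phi> p)\<^sup>2) p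
       + ((?w1 p)\<^sup>2 + (?w2 p)\<^sup>2 + e\<^sup>2) * (G k \<phi> p)\<^sup>2" for k
  proof -
    have 1: "G k (\<lambda>p. ?N p * \<phi> p) p = ?N p * G k \<phi> p + G k ?N p * \<phi> p" by (rule dV_mult[OF grad_reg_C1[OF e] phi p])
    have 2: "(G k (\<lambda>p. ?N p * \<phi> p) p)\<^sup>2 = (?N p)\<^sup>2 * (G k \<phi> p)\<^sup>2 + 2 * \<phi> p * G k \<phi> p * (?N p * G k ?N p) + (G k ?N p)\<^sup>2 * (\<phi> p)\<^sup>2"
      unfolding 1 by (simp add: power2_eq_square algebra_simps)
    have 3: "G k (\<lambda>p. ?w1 p * (\<phi> p)\<^sup>2) p = ?w1 p * (2 * \<phi> p * G k \<phi> p) + G k ?w1 p * (\<phi> p)\<^sup>2"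
      "G k (\<lambda>p. ?w2 p * (\<phi> p)\<^sup>2) p = ?w2 p * (2 * \<phi> p * G k \<phi> p) + G k ?w2 p * (\<phi> p)\<^sup>2"
      using dV_mult[OF XYu_C1(1) C1_power[OF phi, of 2] p, of "fr k"] dV_mult[OF XYu_C1(2) C1_power[OF phi, of 2] p, of "fr k"]
      unfolding dV_power2[OF phi p] .
    have "(?w1 p * G k ?w2 p - ?w2 p * G k ?w1 p)\<^sup>2 / ((?w1 p)\<^sup>2 + (?w2 p)\<^sup>2) + (G k ?N p)\<^sup>2 \<le> (G k ?w1 p)\<^sup>2 + (G k ?w2 p)\<^sup>2"
      using lagrange_bound(1)[of "?w1 p" "G k ?w2 p" "?w2 p" "G k ?w1 p" e] unfolding grad_reg_G_sq[OF e p] by linarith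
    then have "((?w1 p * G k ?w2 p - ?w2 p * G k ?w1 p)\<^sup>2 / ((?w1 p)\<^sup>2 + (?w2 p)\<^sup>2) + (G k ?N p)\<^sup>2) * (\<phi> p)\<^sup>2
       \<le> ((G k ?w1 p)\<^sup>2 + (G k ?w2 p)\<^sup>2) * (\<phi> p)\<^sup>2" by (rule mult_right_mono) simp
    then show ?thesis unfolding 2 3 grad_reg_dV[OF e p] grad_reg_sq by (simp add: power2_eq_square algebra_simps)
  qed
  have "(\<Sum>k\<in>UNIV. (G k (\<lambda>p. ?N p * \<phi> p) p)\<^sup>2 + (?w1 p * G k ?w2 p - ?w2 p * G k ?w1 p)\<^sup>2 / ((?w1 p)\<^sup>2 + (?w2 p)\<^sup>2) * (\<phi> p)\<^sup>2)
     \<le> (\<Sum>k\<in>UNIV. G k ?w1 p * G k (\<lambda>p. ?w1 p * (\<phi> p)\<^sup>2) p + G k ?w2 p * G k (\<lambda>p. ?w2 p * (\<phi> p)\<^sup>2) p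
       + ((?w1 p)\<^sup>2 + (?w2 p)\<^sup>2 + e\<^sup>2) * (G k \<phi> p)\<^sup>2)" by (intro sum_mono pt)
  then show ?thesis unfolding grad_ip_def curv_term_def sum.distrib sum_distrib_left sum_distrib_right
    by (simp only: power2_eq_square)
qed

lemma curv_term_nonneg: "0 \<le> curv_term p"
  unfolding curv_term_def by (intro sum_nonneg divide_nonneg_nonneg) auto

lemma curv_term_le: "curv_term p \<le> grad_ip (G 1 u) (G 1 u) p + grad_ip (G 2 u) (G 2 u) p"
proof -
  have "curv_term p \<le> (\<Sum>k\<in>UNIV. (G k (G 1 u) p)\<^sup>2 + (G k (G 2 u) p)\<^sup>2)"
    unfolding curv_term_def
  proof (intro sum_mono)
    fix k :: 3
    have "0 \<le> (G 1 u p * G k (G 1 u) p + G 2 u p * G k (G 2 u) p)\<^sup>2 / ((G 1 u p)\<^sup>2 + (G 2 u p)\<^sup>2 + 0\<^sup>2)" by simp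
    then show "(G 1 u p * G k (G 2 u) p - G 2 u p * G k (G 1 u) p)\<^sup>2 / ((G 1 u p)\<^sup>2 + (G 2 u p)\<^sup>2) \<le> (G k (G 1 u) p)\<^sup>2 + (G k (G 2 u) p)\<^sup>2"
      using lagrange_bound(1)[of "G 1 u p" "G k (G 2 u) p" "G 2 u p" "G k (G 1 u) p" 0] by linarith
  qed
  then show ?thesis by (simp add: grad_ip_def sum.distrib power2_eq_square)
qed

lemma curv_term_measurable: "curv_term \<in> borel_measurable M"
  unfolding curv_term_def[abs_def]
  by (intro borel_measurable_sum borel_measurable_divide borel_measurable_power borel_measurable_diff
      borel_measurable_add borel_measurable_times C1_measurable G_measurable XYu_C1)

lemma curv_term_sign_term_integrable:
  assumes phi: "cut \<phi>"
  shows "integrable M (\<lambda>p. curv_term p * (\<phi> p)\<^sup>2)" "integrable M (\<lambda>p. sign_term p * (\<phi> p)\<^sup>2)"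
    "integrable M (\<lambda>p. ((G 1 u p)\<^sup>2 + (G 2 u p)\<^sup>2) * grad_ip \<phi> \<phi> p)" "integrable M (grad_ip \<phi> \<phi>)"
    "integrable M (\<lambda>p. (\<phi> p)\<^sup>2 * (G 2 u p * G 1 z3 p))" "integrable M (\<lambda>p. (\<phi> p)\<^sup>2 * (G 1 u p * G 2 z3 p))"
proof -
  obtain R where R: "supp R \<phi>" "C1_bdd \<phi>" using phi by (auto simp: cut_def)
  have s: "supp R (\<lambda>p. h p * (\<phi> p)\<^sup>2)" for h using R(1) by (auto simp: supp_def)
  note lp = C1_bdd_loc_bdd_power[OF R(2), of 2] C1_bdd_measurable_power[OF R(2), of 2]
  have lG0: "loc_int curv_term"
    by (rule loc_intI_bound[OF curv_term_measurable loc_int_add[OF loc_int_grad_ip[OF XYu_Hloc(1,1)] loc_int_grad_ip[OF XYu_Hloc(2,2)]]])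
       (simp add: curv_term_le abs_of_nonneg[OF curv_term_nonneg])
  show "integrable M (\<lambda>p. curv_term p * (\<phi> p)\<^sup>2)" by (rule loc_int_integrable[OF loc_int_loc_bdd_mult[OF lG0 lp] s])
  have lz: "loc_int (\<lambda>p. G 2 u p * G 1 z3 p)" "loc_int (\<lambda>p. G 1 u p * G 2 z3 p)"
    using XYu_Hloc zi_Hloc(3)
    by (auto simp: Hloc_def intro!: loc_int_mult G_measurable[OF u_C1] G_measurable[OF Hloc_C1[OF zi_Hloc(3)]])
  from loc_int_integrable[OF loc_int_loc_bdd_mult[OF lz(1) lp] s] loc_int_integrable[OF loc_int_loc_bdd_mult[OF lz(2) lp] s]
  show i: "integrable M (\<lambda>p. (\<phi> p)\<^sup>2 * (G 2 u p * G 1 z3 p))" "integrable M (\<lambda>p. (\<phi> p)\<^sup>2 * (G 1 u p * G 2 z3 p))"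
    by (simp_all only: mult.commute)
  from integrable_mult_right[OF Bochner_Integration.integrable_diff[OF i(2,1)], of 8]
  show "integrable M (\<lambda>p. sign_term p * (\<phi> p)\<^sup>2)" by (simp add: sign_term_def algebra_simps)
  have g: "supp (R + 1) (\<lambda>p. h p * grad_ip \<phi> \<phi> p)" for h
    using supp_dV[OF R(1)] by (auto simp: supp_def grad_ip_def intro!: sum.neutral)
  have lbg: "loc_bdd (grad_ip \<phi> \<phi>)" "grad_ip \<phi> \<phi> \<in> borel_measurable M"
    using R(2) unfolding grad_ip_def sum_3 C1_bdd_def by (auto intro!: loc_bdd_add loc_bdd_mult borel_measurable_add borel_measurable_times G_measurable)
  have "loc_int (\<lambda>p. (G 1 u p)\<^sup>2 + (G 2 u p)\<^sup>2)" using XYu_Hloc by (intro loc_int_add) (auto simp: Hloc_def)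
  from loc_int_integrable[OF loc_int_loc_bdd_mult[OF this lbg] g]
  show "integrable M (\<lambda>p. ((G 1 u p)\<^sup>2 + (G 2 u p)\<^sup>2) * grad_ip \<phi> \<phi> p)" .
  from loc_int_integrable[OF loc_int_loc_bdd_mult[OF loc_int_const lbg] g, of 1]
  show "integrable M (grad_ip \<phi> \<phi>)" by simp
qed

text \<open>The equations of X u and Y u, tested with X u phi^2 and Y u phi^2, and stability, tested
  with \<open>grad_reg e\<close> times phi, have boundary terms differing by e^2 times a fixed
  integral. They are eliminated and e tends to 0.\<close>

theorem geometric_inequality:
  assumes phi: "cut \<phi>"
  shows "(\<integral>p. curv_term p * (\<phi> p)\<^sup>2 \<partial>M) + (\<integral>p. sign_term p * (\<phi> p)\<^sup>2 \<partial>M)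
    \<le> (\<integral>p. ((G 1 u p)\<^sup>2 + (G 2 u p)\<^sup>2) * grad_ip \<phi> \<phi> p \<partial>M)"
proof -
  obtain R where R: "supp R \<phi>" "C1_bdd \<phi>" using phi by (auto simp: cut_def)
  note phC = C1_bdd_C1[OF R(2)]
  have phH: "Hloc \<phi>" by (rule C1_bdd_Hloc[OF R(2)])
  let ?w1 = "G 1 u" and ?w2 = "G 2 u"
  define \<xi>1 where "\<xi>1 = (\<lambda>p. ?w1 p * (\<phi> p)\<^sup>2)"
  define \<xi>2 where "\<xi>2 = (\<lambda>p. ?w2 p * (\<phi> p)\<^sup>2)"
  have phi2: "cut (\<lambda>p. (\<phi> p)\<^sup>2)" by (rule cut_power[OF phi]) simp
  have t: "test \<xi>1" "test \<xi>2" unfolding \<xi>1_def \<xi>2_def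
    by (intro test_mult XYu_Hloc Xlb phi2)+
  have ts: "supp R \<xi>1" "supp R \<xi>2" "Hloc \<xi>1" "Hloc \<xi>2" using R(1) t by (auto simp: \<xi>1_def \<xi>2_def supp_def test_def)
  define I where "I = (\<lambda>F x. f' (tr u x) * tr F x * tr (\<lambda>p. F p * (\<phi> p)\<^sup>2) x)"
  \<comment> \<open>The boundary term caused by the regularisation, up to the factor e^2.\<close>
  define P where "P = (\<integral>x. f' (tr u x) * tr \<phi> x * tr \<phi> x \<partial>lborel)"
  have main: "(\<integral>p. curv_term p * (\<phi> p)\<^sup>2 \<partial>M) + (\<integral>p. sign_term p * (\<phi> p)\<^sup>2 \<partial>M)
    \<le> (\<integral>p. ((?w1 p)\<^sup>2 + (?w2 p)\<^sup>2) * grad_ip \<phi> \<phi> p \<partial>M) + e\<^sup>2 * ((\<integral>p. grad_ip \<phi> \<phi> p \<partial>M) - P)" if e: "e \<noteq> 0" for e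
  proof -
    let ?N = "\<lambda>p. grad_reg e p * \<phi> p"
    have Nt: "test ?N" by (intro test_mult grad_reg_Hloc[OF e] grad_reg_loc_bdd phi)
    have Ns: "supp R ?N" "Hloc ?N" using R(1) Nt by (auto simp: supp_def test_def)
    note gis = grad_ip_integrable[OF Ns(2,2,1)] grad_ip_integrable[OF XYu_Hloc(1) ts(3,1)] grad_ip_integrable[OF XYu_Hloc(2) ts(4,2)]
      curv_term_sign_term_integrable(1,3)[OF phi] integrable_mult_right[OF curv_term_sign_term_integrable(4)[OF phi], of "e\<^sup>2"]
    have "(\<integral>p. grad_ip ?N ?N p + curv_term p * (\<phi> p)\<^sup>2 \<partial>M)
      \<le> (\<integral>p. grad_ip ?w1 \<xi>1 p + grad_ip ?w2 \<xi>2 p + (((?w1 p)\<^sup>2 + (?w2 p)\<^sup>2) * grad_ip \<phi> \<phi> p + e\<^sup>2 * grad_ip \<phi> \<phi> p) \<partial>M)"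
    proof (intro Bochner_Integration.integral_mono Bochner_Integration.integrable_add gis)
      fix p assume "p \<in> space M"
      then have p: "p \<in> half_space" by simp
      show "grad_ip ?N ?N p + curv_term p * (\<phi> p)\<^sup>2 \<le> grad_ip ?w1 \<xi>1 p + grad_ip ?w2 \<xi>2 p + (((?w1 p)\<^sup>2 + (?w2 p)\<^sup>2) * grad_ip \<phi> \<phi> p + e\<^sup>2 * grad_ip \<phi> \<phi> p)"
        using geometric_pointwise[OF e p phC] unfolding \<xi>1_def \<xi>2_def by (simp add: distrib_right)
    qed
    then have 1: "(\<integral>p. grad_ip ?N ?N p \<partial>M) + (\<integral>p. curv_term p * (\<phi> p)\<^sup>2 \<partial>M)
      \<le> (\<integral>p. grad_ip ?w1 \<xi>1 p \<partial>M) + (\<integral>p. grad_ip ?w2 \<xi>2 p \<partial>M) + ((\<integral>p. ((?w1 p)\<^sup>2 + (?w2 p)\<^sup>2) * grad_ip \<phi> \<phi> p \<partial>M) + e\<^sup>2 * (\<integral>p. grad_ip \<phi> \<phi> p \<partial>M))"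
      using grad_ip_integrable[OF Ns(2,2,1)] grad_ip_integrable[OF XYu_Hloc(1) ts(3,1)] grad_ip_integrable[OF XYu_Hloc(2) ts(4,2)]
        curv_term_sign_term_integrable[OF phi] by simp
    have i: "integrable lborel (I ?w1)" "integrable lborel (I ?w2)" "integrable lborel (\<lambda>x. f' (tr u x) * tr \<phi> x * tr \<phi> x)"
      unfolding I_def using boundary_integrable[OF XYu_Hloc(1) ts(3,1)] boundary_integrable[OF XYu_Hloc(2) ts(4,2)]
        boundary_integrable[OF phH phH R(1)] by (simp_all only: \<xi>1_def \<xi>2_def)
    have SSi: "(\<integral>p. \<xi>2 p * G 1 z3 p \<partial>M) = (\<integral>p. (\<phi> p)\<^sup>2 * (?w2 p * G 1 z3 p) \<partial>M)"
      "(\<integral>p. \<xi>1 p * G 2 z3 p \<partial>M) = (\<integral>p. (\<phi> p)\<^sup>2 * (?w1 p * G 2 z3 p) \<partial>M)"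
      by (simp_all add: \<xi>1_def \<xi>2_def mult_ac)
    have SSe: "(\<integral>p. sign_term p * (\<phi> p)\<^sup>2 \<partial>M) = (\<integral>p. 8 * ((\<phi> p)\<^sup>2 * (?w1 p * G 2 z3 p)) - 8 * ((\<phi> p)\<^sup>2 * (?w2 p * G 1 z3 p)) \<partial>M)"
      by (intro Bochner_Integration.integral_cong refl) (simp add: sign_term_def algebra_simps)
    have SSe': "(\<integral>p. sign_term p * (\<phi> p)\<^sup>2 \<partial>M) = 8 * (\<integral>p. \<xi>1 p * G 2 z3 p \<partial>M) - 8 * (\<integral>p. \<xi>2 p * G 1 z3 p \<partial>M)"
      unfolding SSe SSi using curv_term_sign_term_integrable(5,6)[OF phi] by simp
    have 2: "(\<integral>p. grad_ip ?w1 \<xi>1 p \<partial>M) + (\<integral>p. grad_ip ?w2 \<xi>2 p \<partial>M) = (\<integral>x. I ?w1 x \<partial>lborel) + (\<integral>x. I ?w2 x \<partial>lborel) - (\<integral>p. sign_term p * (\<phi> p)\<^sup>2 \<partial>M)"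
      unfolding Xu_weak[OF t(1)] Yu_weak[OF t(2)] SSe' I_def \<xi>1_def[symmetric] \<xi>2_def[symmetric] by simp
    have "(\<integral>x. f' (tr u x) * (tr ?N x)\<^sup>2 \<partial>lborel) = (\<integral>x. I ?w1 x + I ?w2 x + e\<^sup>2 * (f' (tr u x) * tr \<phi> x * tr \<phi> x) \<partial>lborel)"
    proof (rule integral_cong_AE)
      have [measurable]: "tr u \<in> borel_measurable borel" "tr ?N \<in> borel_measurable borel"
        using u_C1 Hloc_C1[OF Ns(2)] by (auto intro!: tr_measurable)
      show "(\<lambda>x. f' (tr u x) * (tr ?N x)\<^sup>2) \<in> borel_measurable lborel" by measurable
      show "(\<lambda>x. I ?w1 x + I ?w2 x + e\<^sup>2 * (f' (tr u x) * tr \<phi> x * tr \<phi> x)) \<in> borel_measurable lborel"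
        by (intro borel_measurable_add borel_measurable_integrable[OF i(1)] borel_measurable_integrable[OF i(2)]
            borel_measurable_integrable[OF integrable_mult_right[OF i(3)]])
      show "AE x in lborel. f' (tr u x) * (tr ?N x)\<^sup>2 = I ?w1 x + I ?w2 x + e\<^sup>2 * (f' (tr u x) * tr \<phi> x * tr \<phi> x)"
        using Hloc_convg[OF XYu_Hloc(1)] Hloc_convg[OF XYu_Hloc(2)] Hloc_convg[OF phH]
      proof eventually_elim
        case (elim x)
        have "((\<lambda>y. ?N (x, y)) \<longlongrightarrow> sqrt ((tr ?w1 x)\<^sup>2 + (tr ?w2 x)\<^sup>2 + e\<^sup>2) * tr \<phi> x) (at_right 0)"
          unfolding grad_reg_def by (intro tendsto_mult tendsto_real_sqrt tendsto_add tendsto_power tendsto_const tr_tendsto elim)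
        then have N: "tr ?N x = sqrt ((tr ?w1 x)\<^sup>2 + (tr ?w2 x)\<^sup>2 + e\<^sup>2) * tr \<phi> x" by (rule tr_eqI)
        have wx: "tr (\<lambda>p. F p * (\<phi> p)\<^sup>2) x = tr F x * (tr \<phi> x)\<^sup>2" if "convg F x" for F
          using tr_mult(2)[OF that] tr_power[OF elim(3)] by simp
        show ?case unfolding I_def wx[OF elim(1)] wx[OF elim(2)] N power_mult_distrib
          by (simp add: power2_eq_square[of "tr _ x"] algebra_simps)
      qed
    qed
    also have "\<dots> = (\<integral>x. I ?w1 x \<partial>lborel) + (\<integral>x. I ?w2 x \<partial>lborel) + e\<^sup>2 * P"
      unfolding P_def using i by simp
    finally show ?thesis using stable[OF Nt] 1 2 by (simp add: right_diff_distrib)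
  qed
  show ?thesis
  proof (rule field_le_epsilon)
    fix d :: real assume d: "d > 0"
    let ?K = "(\<integral>p. grad_ip \<phi> \<phi> p \<partial>M) - P"
    \<comment> \<open>Makes e^2 (|?K| + 1) equal to d; the 1 keeps the quotient defined when ?K =
      0.\<close>
    define e where "e = sqrt (d / (\<bar>?K\<bar> + 1))"
    have e: "e \<noteq> 0" "e\<^sup>2 = d / (\<bar>?K\<bar> + 1)" using d by (auto simp: e_def)
    have "e\<^sup>2 * ?K \<le> e\<^sup>2 * (\<bar>?K\<bar> + 1)" by (intro mult_left_mono) auto
    also have "\<dots> = d" unfolding e(2) by simp
    finally show "(\<integral>p. curv_term p * (\<phi> p)\<^sup>2 \<partial>M) + (\<integral>p. sign_term p * (\<phi> p)\<^sup>2 \<partial>M)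
      \<le> (\<integral>p. ((?w1 p)\<^sup>2 + (?w2 p)\<^sup>2) * grad_ip \<phi> \<phi> p \<partial>M) + d"
      using main[OF e(1)] by linarith
  qed
qed

end

subsection \<open>The logarithmic cutoff\<close>

definition rad2 :: "point \<Rightarrow> real" where
  "rad2 p = (fst p $ 1)\<^sup>2 + (fst p $ 2)\<^sup>2 + (snd p)\<^sup>2"

text \<open>Comparable to the fourth power of the gauge norm, but polynomial.\<close>

definition quart :: "point \<Rightarrow> real" where
  "quart p = (rad2 p)\<^sup>2 + (fst p $ 3)\<^sup>2"

lemma rad2_C1: "C1 rad2"
  unfolding rad2_def[abs_def] by (intro C1_add C1_power C1_coord C1_snd)

lemma quart_C1: "C1 quart"
  unfolding quart_def[abs_def] by (intro C1_add C1_power rad2_C1 C1_coord)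

lemma rad2_nonneg: "0 \<le> rad2 p"
  by (simp add: rad2_def)

lemma rad2_pos: "p \<in> half_space \<Longrightarrow> 0 < rad2 p"
  unfolding rad2_def by (intro add_nonneg_pos) (auto simp: half_space_def)

lemma quart_pos: "p \<in> half_space \<Longrightarrow> 0 < quart p"
  using rad2_pos[of p] unfolding quart_def by (intro add_pos_nonneg) auto

lemma quart_dV:
  assumes "p \<in> half_space"
  shows "dV V quart p = 4 * rad2 p * (fst p $ 1 * fst (V p) $ 1 + fst p $ 2 * fst (V p) $ 2 + snd p * snd (V p))
     + 2 * fst p $ 3 * fst (V p) $ 3"
proof -
  have r: "dV V rad2 p = 2 * (fst p $ 1 * fst (V p) $ 1 + fst p $ 2 * fst (V p) $ 2 + snd p * snd (V p))"
    unfolding rad2_def[abs_def]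
    by (simp add: dV_add dV_power2 C1_add C1_power C1_coord C1_snd assms)
  have "dV V quart p = 2 * rad2 p * dV V rad2 p + 2 * fst p $ 3 * fst (V p) $ 3"
    unfolding quart_def[abs_def]
    by (simp add: dV_add dV_power2 C1_power C1_coord rad2_C1 assms)
  then show ?thesis unfolding r by simp
qed

text \<open>An exact computation: the mixed terms of the X and Y derivatives cancel, leaving 16 r q
  - 16 y^2 x_3^2 with r = \<open>rad2 p\<close> and q = \<open>quart p\<close>. The factor r is the
  one that appears in \<open>eta\<close>.\<close>

lemma quart_grad_ip:
  assumes "p \<in> half_space"
  shows "grad_ip quart quart p \<le> 16 * rad2 p * quart p"
proof -
  let ?x1 = "fst p $ 1" and ?x2 = "fst p $ 2" and ?x3 = "fst p $ 3" and ?y = "snd p" and ?r = "rad2 p"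
  have 1: "G 1 quart p = 4 * ?r * ?x1 + 4 * ?x2 * ?x3" "G 2 quart p = 4 * ?r * ?x2 - 4 * ?x1 * ?x3" "G 3 quart p = 4 * ?r * ?y"
    unfolding quart_dV[OF assms] by (simp_all add: fr_def vf_def)
  have r: "?x1\<^sup>2 + ?x2\<^sup>2 = ?r - ?y\<^sup>2" by (simp add: rad2_def)
  have "grad_ip quart quart p = (4 * ?r * ?x1 + 4 * ?x2 * ?x3)\<^sup>2 + (4 * ?r * ?x2 - 4 * ?x1 * ?x3)\<^sup>2 + (4 * ?r * ?y)\<^sup>2"
    unfolding grad_ip_def sum_3 1 by (simp add: power2_eq_square)
  also have "\<dots> = 16 * (?x1\<^sup>2 + ?x2\<^sup>2) * (?r\<^sup>2 + ?x3\<^sup>2) + 16 * ?r\<^sup>2 * ?y\<^sup>2"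
    by (simp add: power2_eq_square algebra_simps)
  also have "\<dots> = 16 * ?r * quart p - 16 * ?y\<^sup>2 * ?x3\<^sup>2"
    unfolding r by (simp add: quart_def algebra_simps)
  also have "\<dots> \<le> 16 * ?r * quart p" by simp
  finally show ?thesis .
qed

lemma heis_norm_sq: "(heis_norm x)\<^sup>2 = sqrt (((x $ 1)\<^sup>2 + (x $ 2)\<^sup>2)\<^sup>2 + (x $ 3)\<^sup>2)"
proof -
  let ?N = "((x $ 1)\<^sup>2 + (x $ 2)\<^sup>2)\<^sup>2 + (x $ 3)\<^sup>2"
  have "((heis_norm x)\<^sup>2)\<^sup>2 = ?N" unfolding heis_norm_def by (simp flip: power_mult)
  then show ?thesis by (metis real_sqrt_abs abs_power2)
qed

lemma gauge_norm_nonneg: "0 \<le> gauge_norm p"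
  by (simp add: gauge_norm_def)

lemma le_double_sum: "b \<le> n + c \<Longrightarrow> 0 \<le> d \<Longrightarrow> n + b + c \<le> 2 * (n + d + c)" for b c d n :: real
  by simp

text \<open>With N = |x|_H^2 and r = x_1^2 + x_2^2 the two quantities are N^2 + 2 N y^2 + y^4 and
  N^2 + 2 r y^2 + y^4. The first claim uses r at most N, the second 2 N y^2 at most N^2 +
  y^4.\<close>

lemma gauge_quart: "quart p \<le> gauge_norm p ^ 4" "gauge_norm p ^ 4 \<le> 2 * quart p"
proof -
  let ?r = "(fst p $ 1)\<^sup>2 + (fst p $ 2)\<^sup>2" and ?z = "(fst p $ 3)\<^sup>2" and ?y = "(snd p)\<^sup>2"
  define N where "N = sqrt (?r\<^sup>2 + ?z)"
  have N2: "N\<^sup>2 = ?r\<^sup>2 + ?z" unfolding N_def by simp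
  have Nr: "?r \<le> N" unfolding N_def by (rule real_le_rsqrt) simp
  have "(gauge_norm p)\<^sup>2 = N + ?y"
    unfolding gauge_norm_def heis_norm_sq N_def by simp
  moreover have "gauge_norm p ^ 4 = ((gauge_norm p)\<^sup>2)\<^sup>2" by (simp flip: power_mult)
  ultimately have g: "gauge_norm p ^ 4 = (N + ?y)\<^sup>2" by simp
  have q: "quart p = N\<^sup>2 + 2 * ?r * ?y + ?y\<^sup>2"
    unfolding quart_def rad2_def N2 by (simp add: power2_eq_square algebra_simps)
  have e: "(N + ?y)\<^sup>2 = N\<^sup>2 + 2 * N * ?y + ?y\<^sup>2" by (simp add: power2_sum)
  have "2 * ?r * ?y \<le> 2 * N * ?y" using Nr by (intro mult_right_mono) auto
  then show "quart p \<le> gauge_norm p ^ 4" unfolding g q e by simp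
  have "2 * N * ?y \<le> N\<^sup>2 + ?y\<^sup>2" by (rule sum_squares_bound)
  moreover have "0 \<le> 2 * ?r * ?y" by simp
  ultimately show "gauge_norm p ^ 4 \<le> 2 * quart p" unfolding g q e by (rule le_double_sum)
qed

lemma quart_le_norm: "quart p \<le> ((norm p)\<^sup>2)\<^sup>2 + (norm p)\<^sup>2"
proof -
  have n: "(norm p)\<^sup>2 = (fst p $ 1)\<^sup>2 + (fst p $ 2)\<^sup>2 + (fst p $ 3)\<^sup>2 + (snd p)\<^sup>2"
    unfolding power2_norm_eq_inner by (simp add: inner_prod_def inner_vec_def sum_3 power2_eq_square)
  have "rad2 p \<le> (norm p)\<^sup>2" "(fst p $ 3)\<^sup>2 \<le> (norm p)\<^sup>2" unfolding n rad2_def by auto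
  then show ?thesis unfolding quart_def by (intro add_mono power_mono[OF _ rad2_nonneg])
qed

text \<open>x_3 scales like the square of the gauge, hence the power 2 of B. The assumption B at
  least 1 lets B^4 dominate B^2.\<close>

lemma norm_le_quart: assumes "quart p \<le> B ^ 4" "1 \<le> B" shows "norm p \<le> 2 * B\<^sup>2"
proof -
  have n: "(norm p)\<^sup>2 = rad2 p + (fst p $ 3)\<^sup>2"
    unfolding power2_norm_eq_inner rad2_def by (simp add: inner_prod_def inner_vec_def sum_3 power2_eq_square)
  have B4: "B ^ 4 = (B\<^sup>2)\<^sup>2" by (simp flip: power_mult)
  have "(rad2 p)\<^sup>2 \<le> (B\<^sup>2)\<^sup>2" using assms(1) zero_le_power2[of "fst p $ 3"]
    unfolding quart_def B4 by linarith
  then have r: "rad2 p \<le> B\<^sup>2" by (rule power2_le_imp_le) simp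
  have "(fst p $ 3)\<^sup>2 \<le> B ^ 4" using assms(1) zero_le_power2[of "rad2 p"] unfolding quart_def by linarith
  moreover have "B\<^sup>2 \<le> B ^ 4" using assms(2) by (intro power_increasing) auto
  moreover have "0 \<le> B ^ 4" by simp
  ultimately have "(norm p)\<^sup>2 \<le> 4 * B ^ 4" unfolding n using r by linarith
  also have "\<dots> = (2 * B\<^sup>2)\<^sup>2" unfolding B4 by (simp add: power_mult_distrib)
  finally show ?thesis by (rule power2_le_imp_le) simp
qed

lemma gauge_measurable: "gauge_norm \<in> borel_measurable borel"
  unfolding gauge_norm_def[abs_def] heis_norm_sq
  by (intro borel_measurable_continuous_onI continuous_intros)

context weight begin

text \<open>Affine in ln q, where q is \<open>quart p\<close>, with value 0 at q = R^2 and 1 at q =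
  (R / 2)^4. Shrinking R to R / 2 makes room for the factor 2 between q and the fourth power of the
  gauge, so the transition takes place where the gauge norm is in [sqrt R, R).\<close>

definition logt :: "real \<Rightarrow> point \<Rightarrow> real" where
  "logt R p = (ln (quart p) - 2 * ln R) / (2 * ln R - 4 * ln 2)"

definition logcut :: "real \<Rightarrow> point \<Rightarrow> real" where
  "logcut R p = bump (logt R p)"

text \<open>The threshold is 16 = 2^4, so that 4 ln 2 is at most ln R.\<close>

lemma log_bounds:
  assumes "16 \<le> R"
  shows "0 < ln R" "ln R \<le> 2 * ln R - 4 * ln 2" "0 < 2 * ln R - 4 * ln (2::real)"
proof -
  show l: "0 < ln R" using assms by simp
  have "4 * ln 2 = ln ((2::real) ^ 4)" by (subst ln_realpow) auto
  also have "\<dots> \<le> ln R" using assms by simp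
  finally show "ln R \<le> 2 * ln R - 4 * ln 2" by simp
  then show "0 < 2 * ln R - 4 * ln (2::real)" using l by linarith
qed

lemma logt_C1:
  assumes "16 \<le> R"
  shows "C1 (logt R)" "p \<in> half_space \<Longrightarrow> dV V (logt R) p = dV V quart p / (quart p * (2 * ln R - 4 * ln 2))"
proof -
  let ?D = "2 * ln R - 4 * ln 2"
  have d: "((\<lambda>x. (ln x - 2 * ln R) / ?D) has_real_derivative inverse x / ?D) (at x)" if "x > 0" for x
    using DERIV_cdivide[OF DERIV_diff[OF DERIV_ln[OF that] DERIV_const], of "2 * ln R" ?D] by simp
  show "C1 (logt R)" unfolding logt_def[abs_def]
  proof (rule C1_comp[OF quart_C1, where h' = "\<lambda>x. inverse x / ?D"])
    show "continuous_on (quart ` half_space) (\<lambda>x. inverse x / ?D)"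
      using quart_pos log_bounds(3)[OF assms] by (intro continuous_intros) (force simp: less_le)+
  qed (rule d[OF quart_pos])
  show "dV V (logt R) p = dV V quart p / (quart p * ?D)" if p: "p \<in> half_space"
    using dV_comp[OF quart_C1 p d[OF quart_pos[OF p]], of V] unfolding logt_def[abs_def]
    by (simp add: divide_inverse mult_ac)
qed

lemma logt_ge:
  assumes "16 \<le> R" "p \<in> half_space"
  shows "quart p \<le> R\<^sup>2 \<Longrightarrow> logt R p \<le> 0" "(R / 2) ^ 4 \<le> quart p \<Longrightarrow> 1 \<le> logt R p"
proof -
  note l = log_bounds[OF assms(1)]
  have R: "R > 0" using assms by simp
  show "logt R p \<le> 0" if "quart p \<le> R\<^sup>2"
  proof -
    have "ln (quart p) \<le> ln (R\<^sup>2)" using that quart_pos[OF assms(2)] R by simp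
    also have "\<dots> = 2 * ln R" using R by (simp add: ln_realpow)
    finally show ?thesis unfolding logt_def using l(3) by (intro divide_nonpos_pos) auto
  qed
  show "1 \<le> logt R p" if "(R / 2) ^ 4 \<le> quart p"
  proof -
    have "ln ((R / 2) ^ 4) \<le> ln (quart p)" using that quart_pos[OF assms(2)] R by (subst ln_le_cancel_iff) auto
    moreover have "ln ((R / 2) ^ 4) = 4 * ln R - 4 * ln 2" using R by (subst ln_realpow) (auto simp: ln_div)
    ultimately show ?thesis unfolding logt_def using l(3) by (subst le_divide_eq_1_pos) auto
  qed
qed

lemma rescale_quotient: "q \<noteq> 0 \<Longrightarrow> (b / (q * D))\<^sup>2 * (16 * r * q) = 16 * (b\<^sup>2 / D\<^sup>2) * (r / q)"
  for b q D r :: real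
  by (simp add: power_divide power_mult_distrib power2_eq_square mult_ac)

text \<open>The constant is 512 = 16 * 4^2 * 2: from \<open>quart_grad_ip\<close>, from the bound 4
  on the derivative of \<open>bump\<close>, and from replacing \<open>quart\<close> by the fourth
  power of the gauge norm.\<close>

lemma logcut_grad_ip:
  assumes R: "16 \<le> R" and p: "p \<in> half_space"
  shows "grad_ip (logcut R) (logcut R) p \<le> 512 / (ln R)\<^sup>2 * (rad2 p * (indicator {sqrt R..<R} (gauge_norm p) / gauge_norm p ^ 4))"
proof -
  let ?D = "2 * ln R - 4 * ln 2" and ?b = "bump' (logt R p)"
  note l = log_bounds[OF R]
  have q: "quart p > 0" by (rule quart_pos[OF p])
  have Gk: "G k (logcut R) p = ?b / (quart p * ?D) * G k quart p" for k
  proof -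
    have "G k (logcut R) p = ?b * G k (logt R) p"
      unfolding logcut_def[abs_def] by (rule dV_comp[OF logt_C1(1)[OF R] p bump_derivative])
    then show ?thesis unfolding logt_C1(2)[OF R p] by simp
  qed
  have grad_ip: "grad_ip (logcut R) (logcut R) p = (?b / (quart p * ?D))\<^sup>2 * grad_ip quart quart p"
    unfolding grad_ip_def Gk sum_distrib_left by (simp add: power2_eq_square mult_ac)
  show ?thesis
  proof (cases "?b = 0")
    case True
    have "0 \<le> 512 / (ln R)\<^sup>2 * (rad2 p * (indicator {sqrt R..<R} (gauge_norm p) / gauge_norm p ^ 4))"
      using rad2_nonneg[of p] by (intro mult_nonneg_nonneg divide_nonneg_nonneg) auto
    then show ?thesis unfolding grad_ip True by simp
  next
    case False
    have t: "0 < logt R p" "logt R p < 1"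
    proof -
      show "0 < logt R p" by (rule ccontr) (use False bump'_zero(1)[of "logt R p"] in simp)
      show "logt R p < 1" by (rule ccontr) (use False bump'_zero(2)[of "logt R p"] in simp)
    qed
    have q1: "R\<^sup>2 < quart p" using logt_ge(1)[OF R p] t(1) by linarith
    have q2: "quart p < (R / 2) ^ 4" using logt_ge(2)[OF R p] t(2) by linarith
    have g4: "gauge_norm p ^ 4 > 0" using gauge_quart(1)[of p] q by linarith
    have "sqrt R ^ 4 \<le> gauge_norm p ^ 4"
    proof -
      have "sqrt R ^ 4 = ((sqrt R)\<^sup>2)\<^sup>2" by (simp flip: power_mult)
      also have "\<dots> = R\<^sup>2" using R by simp
      finally show ?thesis using q1 gauge_quart(1)[of p] by linarith
    qed
    then have g1: "sqrt R \<le> gauge_norm p" using R gauge_norm_nonneg[of p] by (subst (asm) power_mono_iff) auto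
    have "gauge_norm p ^ 4 < R ^ 4"
    proof -
      have "gauge_norm p ^ 4 \<le> 2 * (R / 2) ^ 4" using gauge_quart(2)[of p] q2 by linarith
      also have "\<dots> < R ^ 4" using R by (simp add: power_divide)
      finally show ?thesis .
    qed
    then have g2: "gauge_norm p < R" by (rule power_less_imp_less_base) (use R in simp)
    have ind: "indicator {sqrt R..<R} (gauge_norm p) = (1::real)" using g1 g2 by simp
    have "(?b / (quart p * ?D))\<^sup>2 * grad_ip quart quart p \<le> (?b / (quart p * ?D))\<^sup>2 * (16 * rad2 p * quart p)"
      by (rule mult_left_mono[OF quart_grad_ip[OF p]]) simp
    also have "\<dots> = 16 * (?b\<^sup>2 / ?D\<^sup>2) * (rad2 p / quart p)"
      using q by (intro rescale_quotient) simp
    also have "\<dots> \<le> 16 * (4\<^sup>2 / (ln R)\<^sup>2) * (rad2 p * (2 / gauge_norm p ^ 4))"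
    proof (intro mult_mono mult_left_mono)
      have "?b\<^sup>2 \<le> 4\<^sup>2" using bump'_bound[of "logt R p"] by (intro abs_le_square_iff[THEN iffD1]) simp
      moreover have "(ln R)\<^sup>2 \<le> ?D\<^sup>2" using l by (intro power_mono) auto
      ultimately show "?b\<^sup>2 / ?D\<^sup>2 \<le> 4\<^sup>2 / (ln R)\<^sup>2" using l(1) by (intro frac_le) auto
      have "1 / quart p \<le> 2 / gauge_norm p ^ 4" proof -
        have "2 / (2 * quart p) \<le> 2 / gauge_norm p ^ 4"
          by (rule divide_left_mono[OF gauge_quart(2) zero_le_numeral mult_pos_pos[OF _ g4]]) (use q in simp)
        then show ?thesis by simp
      qed
      from mult_left_mono[OF this rad2_nonneg[of p]]
      show "rad2 p / quart p \<le> rad2 p * (2 / gauge_norm p ^ 4)" by simp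
    qed (use rad2_nonneg[of p] q in auto)
    also have "\<dots> = 512 / (ln R)\<^sup>2 * (rad2 p * (indicator {sqrt R..<R} (gauge_norm p) / gauge_norm p ^ 4))"
      unfolding ind by simp
    finally show ?thesis unfolding grad_ip .
  qed
qed

text \<open>On the transition region the gauge norm is at least 1, so \<open>logcut_grad_ip\<close>
  bounds the squared gradient by a multiple of the polynomial \<open>rad2\<close>.\<close>

lemma logcut_cut:
  assumes R: "16 \<le> R"
  shows "cut (logcut R)"
proof -
  have C: "C1 (logcut R)"
    unfolding logcut_def[abs_def] by (rule C1_comp[OF logt_C1(1)[OF R] bump_derivative bump'_continuous])
  have "loc_bdd (logcut R)" unfolding logcut_def[abs_def]
    by (rule loc_bdd_bounded[of _ 1]) (simp add: bump_range)
  moreover have "loc_bdd (G k (logcut R))" for k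
  proof -
    have "loc_bdd rad2" unfolding rad2_def[abs_def] by (intro loc_bdd_continuous continuous_intros)
    then have "loc_bdd (\<lambda>p. 512 / (ln R)\<^sup>2 * rad2 p)" by (rule loc_bdd_cmult)
    have s: "(G k (logcut R) p)\<^sup>2 \<le> 512 / (ln R)\<^sup>2 * rad2 p" if p: "p \<in> half_space" for p
    proof -
      have "indicator {sqrt R..<R} (gauge_norm p) / gauge_norm p ^ 4 \<le> 1"
      proof (cases "gauge_norm p \<in> {sqrt R..<R}")
        case True
        have "1 \<le> sqrt R" using R by simp
        then have "1 \<le> gauge_norm p" using True by (meson atLeastLessThan_iff order_trans)
        then have "1 \<le> gauge_norm p ^ 4" by (rule one_le_power)
        then have "inverse (gauge_norm p ^ 4) \<le> 1" unfolding inverse_le_1_iff by (rule disjI2)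
        then show ?thesis using True by (simp add: divide_inverse)
      qed simp
      from mult_left_mono[OF this rad2_nonneg[of p]]
      have "rad2 p * (indicator {sqrt R..<R} (gauge_norm p) / gauge_norm p ^ 4) \<le> rad2 p" by simp
      then have "512 / (ln R)\<^sup>2 * (rad2 p * (indicator {sqrt R..<R} (gauge_norm p) / gauge_norm p ^ 4)) \<le> 512 / (ln R)\<^sup>2 * rad2 p"
        by (rule mult_left_mono) simp
      then show ?thesis using grad_ip_ge[of k "logcut R" p] logcut_grad_ip[OF R p] by linarith
    qed
    show ?thesis unfolding loc_bdd_def
    proof
      fix S
      from \<open>loc_bdd (\<lambda>p. 512 / (ln R)\<^sup>2 * rad2 p)\<close>[unfolded loc_bdd_def, THEN spec, of S]
      obtain C where C: "\<forall>p\<in>half_space. norm p < S \<longrightarrow> \<bar>512 / (ln R)\<^sup>2 * rad2 p\<bar> \<le> C" ..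
      have "\<bar>G k (logcut R) p\<bar> \<le> sqrt C" if "p \<in> half_space" "norm p < S" for p
      proof (rule real_le_rsqrt)
        have "\<bar>512 / (ln R)\<^sup>2 * rad2 p\<bar> \<le> C" using C that by blast
        then show "\<bar>G k (logcut R) p\<bar>\<^sup>2 \<le> C" unfolding power2_abs using s[OF that(1)] by linarith
      qed
      then show "\<exists>C. \<forall>p\<in>half_space. norm p < S \<longrightarrow> \<bar>G k (logcut R) p\<bar> \<le> C" by blast
    qed
  qed
  \<comment> \<open>By \<open>norm_le_quart\<close> a Euclidean norm above 2 R^2 forces
    \<open>quart\<close> above R^4, beyond the transition region.\<close>
  moreover have "supp (2 * R\<^sup>2 + 1) (logcut R)"
    unfolding supp_def
  proof (intro ballI impI)
    fix p assume p: "p \<in> half_space" and n: "2 * R\<^sup>2 + 1 \<le> norm p"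
    have "\<not> quart p \<le> R ^ 4" using norm_le_quart[of p R] n R by auto
    moreover have "(R / 2) ^ 4 \<le> R ^ 4" using R by (intro power_mono) auto
    ultimately have "(R / 2) ^ 4 \<le> quart p" by linarith
    then show "logcut R p = 0" unfolding logcut_def by (intro bump_ge logt_ge(2)[OF R p])
  qed
  ultimately show ?thesis using C unfolding cut_def C1_bdd_def by blast
qed

lemma logcut_one:
  assumes "16 \<le> R" "p \<in> half_space" "quart p \<le> R\<^sup>2"
  shows "logcut R p = 1"
  unfolding logcut_def by (intro bump_le logt_ge(1) assms)

end

section \<open>The growth condition and the energy of the cutoff\<close>

context sol begin

definition eta_density :: "point \<Rightarrow> real" where
  "eta_density p = 4 * ((G 1 u p)\<^sup>2 + (G 2 u p)\<^sup>2) * rad2 p"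

lemma eta_density_nonneg: "0 \<le> eta_density p"
  unfolding eta_density_def using rad2_nonneg[of p] by simp

lemma eta_density_measurable: "eta_density \<in> borel_measurable M"
  unfolding eta_density_def[abs_def]
  by (intro borel_measurable_times borel_measurable_add borel_measurable_power borel_measurable_const
      C1_measurable XYu_C1 rad2_C1)

lemma gauge_indicator_measurable: "(\<lambda>p. indicator {..<t} (gauge_norm p) :: real) \<in> borel_measurable M"
  by (intro measurable_wM_borel measurable_compose[OF gauge_measurable] borel_measurable_indicator) simp

lemma eta_density_integrable: "integrable M (\<lambda>p. indicator {..<t} (gauge_norm p) * eta_density p)"
proof -
  have "loc_bdd eta_density" unfolding eta_density_def[abs_def] power2_eq_square
    by (intro loc_bdd_mult loc_bdd_add loc_bdd_const Xlb loc_bdd_continuous[of rad2]) (unfold rad2_def[abs_def], intro continuous_intros)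
  then have lk: "loc_int eta_density" by (rule loc_int_loc_bdd[OF _ eta_density_measurable])
  have "loc_bdd (\<lambda>p. indicator {..<t} (gauge_norm p))" by (rule loc_bdd_bounded[of _ 1]) (simp add: indicator_def)
  from loc_int_loc_bdd_mult[OF lk this gauge_indicator_measurable]
  have "loc_int (\<lambda>p. eta_density p * indicator {..<t} (gauge_norm p))" .
  moreover have "supp (2 * (\<bar>t\<bar> + 1)\<^sup>2 + 1) (\<lambda>p. eta_density p * indicator {..<t} (gauge_norm p))"
    unfolding supp_def
  proof (intro ballI impI)
    fix p :: point assume n: "2 * (\<bar>t\<bar> + 1)\<^sup>2 + 1 \<le> norm p"
    have "\<not> gauge_norm p < t"
    proof
      assume "gauge_norm p < t"
      then have "gauge_norm p ^ 4 \<le> (\<bar>t\<bar> + 1) ^ 4"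
        by (intro power_mono gauge_norm_nonneg) simp
      then have "quart p \<le> (\<bar>t\<bar> + 1) ^ 4" using gauge_quart(1)[of p] by linarith
      then have "norm p \<le> 2 * (\<bar>t\<bar> + 1)\<^sup>2" by (rule norm_le_quart) simp
      then show False using n by linarith
    qed
    then show "eta_density p * indicator {..<t} (gauge_norm p) = 0" by simp
  qed
  ultimately have "integrable M (\<lambda>p. eta_density p * indicator {..<t} (gauge_norm p))" by (rule loc_int_integrable)
  then show ?thesis by (simp only: mult.commute)
qed

lemma eta_eq: "eta a u t = (\<integral>p. indicator {..<t} (gauge_norm p) * eta_density p \<partial>M)"
proof -
  have "(\<integral>p. indicator {..<t} (gauge_norm p) * eta_density p \<partial>M)
    = (LINT p:half_space|lebesgue. snd p powr a * (indicator {..<t} (gauge_norm p) * eta_density p))"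
    by (rule integral_wM(2)[OF borel_measurable_times[OF gauge_indicator_measurable eta_density_measurable]])
  also have "\<dots> = eta a u t"
    unfolding eta_def set_lebesgue_integral_def
    by (intro Bochner_Integration.integral_cong refl)
       (auto simp: gauge_ball_def indicator_def eta_density_def rad2_def grad_H_norm2[OF u_C1])
  finally show ?thesis by simp
qed

lemma eta_mono: "mono (eta a u)"
  unfolding mono_def eta_eq
  by (intro allI impI Bochner_Integration.integral_mono eta_density_integrable mult_right_mono eta_density_nonneg)
     (auto simp: indicator_def)

lemma eta_nonneg: "0 \<le> eta a u t"
  unfolding eta_eq by (intro Bochner_Integration.integral_nonneg mult_nonneg_nonneg eta_density_nonneg) simp

lemma eta_measurable: "eta a u \<in> borel_measurable borel"
  by (rule borel_measurable_mono[OF eta_mono])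

definition etaI :: "real \<Rightarrow> real" where
  "etaI R = (\<integral>t. indicator {sqrt R..R} t * (eta a u t / t ^ 5) \<partial>lborel)"

lemma etaI_integrable:
  assumes "1 \<le> R"
  shows "integrable lborel (\<lambda>t. indicator {sqrt R..R} t * (eta a u t / t ^ 5))"
proof (rule Bochner_Integration.integrable_bound)
  show "integrable lborel (\<lambda>t. eta a u R * indicator {sqrt R..R} t)"
    by (intro integrable_mult_right integrable_real_indicator) (auto simp: emeasure_lborel_Icc_eq)
  show "(\<lambda>t. indicator {sqrt R..R} t * (eta a u t / t ^ 5)) \<in> borel_measurable lborel"
    using eta_measurable by simp
  have "\<bar>eta a u t / t ^ 5\<bar> \<le> eta a u R" if t: "sqrt R \<le> t" "t \<le> R" for t
  proof -
    have "1 \<le> sqrt R" using assms by simp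
    then have t1: "1 \<le> t" using t(1) by linarith
    have "1 \<le> t ^ 5" using t1 by (rule one_le_power)
    then have "eta a u t / t ^ 5 \<le> eta a u t / 1"
      using t1 by (intro divide_left_mono eta_nonneg) (auto intro!: mult_pos_pos zero_less_power)
    also have "\<dots> \<le> eta a u R" using monoD[OF eta_mono t(2)] by simp
    finally show ?thesis using eta_nonneg[of t] t1 by (simp add: abs_of_nonneg)
  qed
  then show "AE t in lborel. norm (indicator {sqrt R..R} t * (eta a u t / t ^ 5)) \<le> norm (eta a u R * indicator {sqrt R..R} t)"
    using eta_nonneg[of R] by (intro AE_I2) (auto simp: indicator_def)
qed

lemma etaI_eq: "(LINT t:{sqrt R..R}|lebesgue. eta a u t / t ^ 5) = etaI R"
  unfolding set_lebesgue_integral_def etaI_def real_scaleR_def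
  by (rule integral_completion) (use eta_measurable in simp)

lemma inverse_power4_FTC:
  assumes "0 < r" "r \<le> R"
  shows "(\<integral>\<^sup>+t. ennreal (4 / t ^ 5) * indicator {r..R} t \<partial>lborel) = ennreal (1 / r ^ 4 - 1 / R ^ 4)"
proof -
  have "(\<integral>\<^sup>+t. ennreal (4 / t ^ 5) * indicator {r..R} t \<partial>lborel) = ennreal (- (1 / R ^ 4) - (- (1 / r ^ 4)))"
  proof (rule nn_integral_FTC_Icc)
    fix t assume "t \<in> {r..R}"
    then have t: "t > 0" using assms by simp
    have "((\<lambda>t. - inverse (t ^ 4)) has_real_derivative - (- (inverse (t ^ 4) * (4 * t ^ 3) * inverse (t ^ 4)))) (at t)"
      using t by (auto intro!: derivative_eq_intros)
    moreover have "inverse (t ^ 4) * (4 * t ^ 3) * inverse (t ^ 4) = 4 / t ^ 5"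
    proof -
      have "t ^ 4 * t ^ 4 = t ^ 3 * t ^ 5" by (simp flip: power_add)
      then have "inverse (t ^ 4) * inverse (t ^ 4) = inverse (t ^ 3) * inverse (t ^ 5)"
        by (metis inverse_mult_distrib)
      then show ?thesis using t by (simp add: divide_inverse mult_ac)
    qed
    ultimately show "((\<lambda>t. - (1 / t ^ 4)) has_real_derivative 4 / t ^ 5) (at t)"
      by (simp add: inverse_eq_divide)
    show "0 \<le> 4 / t ^ 5" using t by simp
  qed (use assms in auto)
  then show ?thesis by simp
qed

text \<open>A layer-cake argument: 1 / g^4 is 1 / R^4 plus the integral of 4 / t^5 over t in [g, R].
  Integrating the density over g < R and, after exchanging the integrals, over g < t gives the two
  terms with \<open>eta\<close>.\<close>

lemma annulus_bound:
  assumes R: "1 \<le> R"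
  shows "(\<integral>\<^sup>+p. ennreal (eta_density p * (indicator {sqrt R..<R} (gauge_norm p) / gauge_norm p ^ 4)) \<partial>M)
    \<le> ennreal (eta a u R / R ^ 4 + 4 * etaI R)"
proof -
  let ?g = gauge_norm
  let ?H = "\<lambda>t p. ennreal (4 / t ^ 5) * indicator {sqrt R..R} t * (ennreal (eta_density p) * indicator {..<t} (?g p))"
  have sR: "1 \<le> sqrt R" using R by simp
  have pw: "ennreal (eta_density p * (indicator {sqrt R..<R} (?g p) / ?g p ^ 4))
     \<le> ennreal (1 / R ^ 4) * ennreal (indicator {..<R} (?g p) * eta_density p) + (\<integral>\<^sup>+t. ?H t p \<partial>lborel)" for p
  proof (cases "?g p \<in> {sqrt R..<R}")
    case True
    let ?r = "?g p"
    have r: "sqrt R \<le> ?r" "?r < R" using True by auto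
    have r: "0 < ?r" "sqrt R \<le> ?r" "?r < R" using r less_le_trans[OF zero_less_one order_trans[OF sR r(1)]] by auto
    have m: "(\<lambda>t::real. ennreal (4 / t ^ 5) * indicator {?r..R} t) \<in> borel_measurable lborel" by measurable
    have "ennreal (eta_density p) * ennreal (1 / ?r ^ 4 - 1 / R ^ 4) = (\<integral>\<^sup>+t. ennreal (eta_density p) * (ennreal (4 / t ^ 5) * indicator {?r..R} t) \<partial>lborel)"
      unfolding inverse_power4_FTC[OF r(1) less_imp_le[OF r(3)], symmetric] by (rule nn_integral_cmult[OF m, symmetric])
    also have "\<dots> \<le> (\<integral>\<^sup>+t. ?H t p \<partial>lborel)"
    \<comment> \<open>The point t = ?r is excluded because the gauge ball of radius t is open while
      the interval is closed.\<close>
    proof (rule nn_integral_mono_AE, use AE_lborel_singleton[of ?r] in eventually_elim)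
      case (elim t)
      then show ?case using r by (auto simp: indicator_def mult.commute)
    qed
    finally have 1: "ennreal (eta_density p) * ennreal (1 / ?r ^ 4 - 1 / R ^ 4) \<le> (\<integral>\<^sup>+t. ?H t p \<partial>lborel)" .
    have le: "1 / R ^ 4 \<le> 1 / ?r ^ 4" using r by (intro divide_left_mono power_mono) auto
    have "ennreal (eta_density p * (indicator {sqrt R..<R} ?r / ?r ^ 4)) = ennreal (eta_density p * (1 / R ^ 4) + eta_density p * (1 / ?r ^ 4 - 1 / R ^ 4))"
      using True by (simp add: algebra_simps)
    also have "\<dots> = ennreal (eta_density p * (1 / R ^ 4)) + ennreal (eta_density p * (1 / ?r ^ 4 - 1 / R ^ 4))"
      using eta_density_nonneg[of p] le R by (intro ennreal_plus mult_nonneg_nonneg) auto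
    also have "\<dots> \<le> ennreal (1 / R ^ 4) * ennreal (indicator {..<R} ?r * eta_density p) + (\<integral>\<^sup>+t. ?H t p \<partial>lborel)"
    proof (rule add_mono)
      show "ennreal (eta_density p * (1 / R ^ 4)) \<le> ennreal (1 / R ^ 4) * ennreal (indicator {..<R} ?r * eta_density p)"
        using r(3) eta_density_nonneg[of p] R by (simp add: ennreal_mult[symmetric] mult.commute)
      show "ennreal (eta_density p * (1 / ?r ^ 4 - 1 / R ^ 4)) \<le> (\<integral>\<^sup>+t. ?H t p \<partial>lborel)"
        using 1 le by (subst ennreal_mult[OF eta_density_nonneg]) auto
    qed
    finally show ?thesis .
  qed simp
  have mk: "(\<lambda>p. ennreal (indicator {..<R} (?g p) * eta_density p)) \<in> borel_measurable M"
    using eta_density_integrable[of R] by (intro measurable_compose[OF _ measurable_ennreal]) auto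
  have mH: "(\<lambda>(t, p). ?H t p) \<in> borel_measurable (lborel \<Otimes>\<^sub>M M)"
  proof -
    have g: "(\<lambda>x. ?g (snd x)) \<in> borel_measurable (lborel \<Otimes>\<^sub>M M)"
      by (rule measurable_compose[OF measurable_snd measurable_wM_borel[OF gauge_measurable]])
    have k: "(\<lambda>x. eta_density (snd x)) \<in> borel_measurable (lborel \<Otimes>\<^sub>M M)"
      by (rule measurable_compose[OF measurable_snd eta_density_measurable])
    have f: "(\<lambda>x. fst x :: real) \<in> borel_measurable (lborel \<Otimes>\<^sub>M M)"
      using measurable_fst[of lborel M] by simp
    have i: "(\<lambda>x. indicator {..<fst x} (?g (snd x)) :: ennreal) \<in> borel_measurable (lborel \<Otimes>\<^sub>M M)"
    proof -
      have "{x \<in> space (lborel \<Otimes>\<^sub>M M). ?g (snd x) < fst x} \<in> sets (lborel \<Otimes>\<^sub>M M)"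
        by (rule borel_measurable_less[OF g f])
      then have "(\<lambda>x. indicator {x \<in> space (lborel \<Otimes>\<^sub>M M). ?g (snd x) < fst x} x :: ennreal) \<in> borel_measurable (lborel \<Otimes>\<^sub>M M)"
        by (rule borel_measurable_indicator)
      then show ?thesis by (rule measurable_cong[THEN iffD1, rotated]) (auto simp: indicator_def)
    qed
    have t: "(\<lambda>x. ennreal (4 / fst x ^ 5) * indicator {sqrt R..R} (fst x)) \<in> borel_measurable (lborel \<Otimes>\<^sub>M M)"
      by (rule measurable_compose[OF measurable_fst]) measurable
    show ?thesis unfolding case_prod_beta'
      by (intro borel_measurable_times_ennreal t i measurable_compose[OF k measurable_ennreal])
  qed
  have inner: "(\<integral>\<^sup>+p. ?H t p \<partial>M) = ennreal (4 * (indicator {sqrt R..R} t * (eta a u t / t ^ 5)))" for t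
  proof (cases "t \<in> {sqrt R..R}")
    case True
    then have "1 \<le> t" using order_trans[OF sR] by simp
    then have t: "t > 0" by linarith
    have mt: "(\<lambda>p. ennreal (eta_density p) * indicator {..<t} (?g p)) \<in> borel_measurable M"
    proof (rule measurable_cong[THEN iffD1])
      show "(\<lambda>p. ennreal (indicator {..<t} (?g p) * eta_density p)) \<in> borel_measurable M"
        using eta_density_integrable[of t] by (intro measurable_compose[OF _ measurable_ennreal]) auto
    qed (auto simp: indicator_def)
    have "(\<integral>\<^sup>+p. ?H t p \<partial>M) = ennreal (4 / t ^ 5) * (\<integral>\<^sup>+p. ennreal (eta_density p) * indicator {..<t} (?g p) \<partial>M)"
      using True by (simp add: nn_integral_cmult[OF mt])
    also have "(\<integral>\<^sup>+p. ennreal (eta_density p) * indicator {..<t} (?g p) \<partial>M) = (\<integral>\<^sup>+p. ennreal (indicator {..<t} (?g p) * eta_density p) \<partial>M)"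
      by (intro nn_integral_cong) (auto simp: indicator_def)
    also have "\<dots> = ennreal (eta a u t)"
      unfolding eta_eq by (rule nn_integral_eq_integral[OF eta_density_integrable]) (simp add: eta_density_nonneg)
    also have "ennreal (4 / t ^ 5) * ennreal (eta a u t) = ennreal (4 * (indicator {sqrt R..R} t * (eta a u t / t ^ 5)))"
      using True t eta_nonneg[of t] by (simp add: ennreal_mult[symmetric])
    finally show ?thesis .
  qed simp
  have "(\<integral>\<^sup>+p. ennreal (eta_density p * (indicator {sqrt R..<R} (?g p) / ?g p ^ 4)) \<partial>M)
    \<le> (\<integral>\<^sup>+p. ennreal (1 / R ^ 4) * ennreal (indicator {..<R} (?g p) * eta_density p) + (\<integral>\<^sup>+t. ?H t p \<partial>lborel) \<partial>M)"
    by (intro nn_integral_mono pw)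
  also have "\<dots> = ennreal (1 / R ^ 4) * (\<integral>\<^sup>+p. ennreal (indicator {..<R} (?g p) * eta_density p) \<partial>M) + (\<integral>\<^sup>+p. (\<integral>\<^sup>+t. ?H t p \<partial>lborel) \<partial>M)"
  proof -
    have "(\<lambda>p. \<integral>\<^sup>+t. ?H t p \<partial>lborel) \<in> borel_measurable M"
    proof -
      have "(\<lambda>(p, t). ?H t p) \<in> borel_measurable (M \<Otimes>\<^sub>M lborel)"
        using measurable_compose[OF measurable_pair_swap' mH] by (simp add: case_prod_beta')
      then show ?thesis by (rule lborel.borel_measurable_nn_integral)
    qed
    then show ?thesis using mk by (simp add: nn_integral_add nn_integral_cmult)
  qed
  also have "(\<integral>\<^sup>+p. ennreal (indicator {..<R} (?g p) * eta_density p) \<partial>M) = ennreal (eta a u R)"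
    unfolding eta_eq by (rule nn_integral_eq_integral[OF eta_density_integrable]) (simp add: eta_density_nonneg)
  also have "(\<integral>\<^sup>+p. (\<integral>\<^sup>+t. ?H t p \<partial>lborel) \<partial>M) = (\<integral>\<^sup>+t. (\<integral>\<^sup>+p. ?H t p \<partial>M) \<partial>lborel)"
    using Fubini[OF mH] by simp
  also have "\<dots> = (\<integral>\<^sup>+t. ennreal (4 * (indicator {sqrt R..R} t * (eta a u t / t ^ 5))) \<partial>lborel)"
    unfolding inner ..
  also have "\<dots> = ennreal (4 * etaI R)"
    unfolding etaI_def
  proof (subst nn_integral_eq_integral)
    show "integrable lborel (\<lambda>t. 4 * (indicator {sqrt R..R} t * (eta a u t / t ^ 5)))"
      by (rule integrable_mult_right[OF etaI_integrable[OF R]])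
    show "AE t in lborel. 0 \<le> 4 * (indicator {sqrt R..R} t * (eta a u t / t ^ 5))"
    proof (rule AE_I2)
      fix t :: real
      show "0 \<le> 4 * (indicator {sqrt R..R} t * (eta a u t / t ^ 5))"
        using eta_nonneg[of t] order_trans[OF sR, of t] by (cases "t \<in> {sqrt R..R}") (auto intro!: divide_nonneg_nonneg)
    qed
  qed (simp only: integral_mult_right_zero)
  also have "ennreal (1 / R ^ 4) * ennreal (eta a u R) + ennreal (4 * etaI R) = ennreal (eta a u R / R ^ 4 + 4 * etaI R)"
  proof -
    have "0 \<le> etaI R" unfolding etaI_def
    proof (rule Bochner_Integration.integral_nonneg)
      fix t :: real
      show "0 \<le> indicator {sqrt R..R} t * (eta a u t / t ^ 5)"
        using eta_nonneg[of t] order_trans[OF sR, of t] by (cases "t \<in> {sqrt R..R}") (auto intro!: divide_nonneg_nonneg)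
    qed
    then show ?thesis using eta_nonneg[of R] R by (simp add: ennreal_mult[symmetric] ennreal_plus[symmetric] del: ennreal_plus)
  qed
  finally show ?thesis .
qed

end

section \<open>Vanishing of the curvature term\<close>

context sol begin

text \<open>The 512 of \<open>logcut_grad_ip\<close> drops to 128 because \<open>eta_density\<close>
  contains a factor 4; the factor 4 of \<open>annulus_bound\<close> restores it.\<close>

lemma energy_small:
  assumes R: "16 \<le> R"
  shows "(\<integral>p. ((G 1 u p)\<^sup>2 + (G 2 u p)\<^sup>2) * grad_ip (logcut R) (logcut R) p \<partial>M)
    \<le> 512 * ((etaI R + eta a u R / R ^ 4) / (ln R)\<^sup>2)"
proof -
  let ?F = "\<lambda>p. ((G 1 u p)\<^sup>2 + (G 2 u p)\<^sup>2) * grad_ip (logcut R) (logcut R) p"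
  let ?E = "\<lambda>p. eta_density p * (indicator {sqrt R..<R} (gauge_norm p) / gauge_norm p ^ 4)"
  have pw: "?F p \<le> 128 / (ln R)\<^sup>2 * ?E p" if p: "p \<in> half_space" for p
  proof -
    have "?F p \<le> ((G 1 u p)\<^sup>2 + (G 2 u p)\<^sup>2) * (512 / (ln R)\<^sup>2 * (rad2 p * (indicator {sqrt R..<R} (gauge_norm p) / gauge_norm p ^ 4)))"
      by (rule mult_left_mono[OF logcut_grad_ip[OF R p]]) simp
    also have "\<dots> = 128 / (ln R)\<^sup>2 * ?E p" by (simp add: eta_density_def algebra_simps add_divide_distrib)
    finally show ?thesis .
  qed
  have i: "integrable M ?F" by (rule curv_term_sign_term_integrable(3)[OF logcut_cut[OF R]])
  have mE: "(\<lambda>p. ennreal (?E p)) \<in> borel_measurable M"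
  proof -
    have "gauge_norm \<in> borel_measurable M" by (rule measurable_wM_borel[OF gauge_measurable])
    moreover have "(\<lambda>p. indicator {sqrt R..<R} (gauge_norm p) :: real) \<in> borel_measurable M"
      by (intro measurable_wM_borel measurable_compose[OF gauge_measurable] borel_measurable_indicator) simp
    ultimately show ?thesis
      by (intro measurable_compose[OF _ measurable_ennreal] borel_measurable_times eta_density_measurable borel_measurable_divide borel_measurable_power)
  qed
  have e0: "0 \<le> eta a u R / R ^ 4" using eta_nonneg[of R] R by simp
  have e1: "0 \<le> etaI R" unfolding etaI_def
  proof (rule Bochner_Integration.integral_nonneg)
    fix t :: real
    have "0 \<le> sqrt R" using R by simp
    then show "0 \<le> indicator {sqrt R..R} t * (eta a u t / t ^ 5)"
      using eta_nonneg[of t] order_trans[of 0 "sqrt R" t] by (cases "t \<in> {sqrt R..R}") (auto intro!: divide_nonneg_nonneg zero_le_power)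
  qed
  have "ennreal (\<integral>p. ?F p \<partial>M) = (\<integral>\<^sup>+p. ennreal (?F p) \<partial>M)"
    by (rule nn_integral_eq_integral[OF i, symmetric]) (simp add: grad_ip_nonneg)
  also have "\<dots> \<le> (\<integral>\<^sup>+p. ennreal (128 / (ln R)\<^sup>2) * ennreal (?E p) \<partial>M)"
  proof (intro nn_integral_mono)
    fix p assume "p \<in> space M"
    then have "ennreal (?F p) \<le> ennreal (128 / (ln R)\<^sup>2 * ?E p)" by (intro ennreal_leI pw) simp
    also have "\<dots> = ennreal (128 / (ln R)\<^sup>2) * ennreal (?E p)"
      by (rule ennreal_mult) (simp_all add: eta_density_nonneg)
    finally show "ennreal (?F p) \<le> ennreal (128 / (ln R)\<^sup>2) * ennreal (?E p)" .
  qed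
  also have "\<dots> = ennreal (128 / (ln R)\<^sup>2) * (\<integral>\<^sup>+p. ennreal (?E p) \<partial>M)" by (rule nn_integral_cmult[OF mE])
  also have "\<dots> \<le> ennreal (128 / (ln R)\<^sup>2) * ennreal (eta a u R / R ^ 4 + 4 * etaI R)"
    using R by (intro mult_left_mono annulus_bound) auto
  also have "\<dots> = ennreal (128 / (ln R)\<^sup>2 * (eta a u R / R ^ 4 + 4 * etaI R))"
    using e0 e1 by (intro ennreal_mult[symmetric]) auto
  finally have "(\<integral>p. ?F p \<partial>M) \<le> 128 / (ln R)\<^sup>2 * (eta a u R / R ^ 4 + 4 * etaI R)"
    using e0 e1 by (subst (asm) ennreal_le_iff) (auto intro!: mult_nonneg_nonneg add_nonneg_nonneg)
  also have "\<dots> \<le> 128 / (ln R)\<^sup>2 * (4 * (etaI R + eta a u R / R ^ 4))"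
    using e0 by (intro mult_left_mono) auto
  finally show ?thesis by simp
qed

text \<open>The density is positive at every point of the half-space, so null sets of M inside it
  are Lebesgue null.\<close>

lemma measure_ball_pos:
  assumes "ball p r \<subseteq> half_space" "r > 0"
  shows "0 < measure M (ball p r)" "integrable M (\<lambda>q. indicator (ball p r) q * (c::real))"
proof -
  have B: "ball p r \<in> sets M" using assms(1) by (simp add: sets_wM_iff)
  have "ball p r \<subseteq> half_ball (norm p + r)"
  proof
    fix q assume q: "q \<in> ball p r"
    have "norm q \<le> norm p + norm (q - p)" by (metis add.commute diff_add_cancel norm_triangle_ineq)
    moreover have "norm (q - p) < r" using q by (simp add: dist_norm norm_minus_commute)
    ultimately show "q \<in> half_ball (norm p + r)" using q assms(1) by (auto simp: half_ball_def)
  qed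
  then have fin: "emeasure M (ball p r) < \<infinity>"
    using le_less_trans[OF emeasure_mono[OF _ half_ball_M, of "ball p r" "norm p + r"] emeasure_half_ball[of "norm p + r"]] by blast
  show "integrable M (\<lambda>q. indicator (ball p r) q * c)"
    using B fin by (intro integrable_mult_left integrable_real_indicator)
  have "emeasure M (ball p r) \<noteq> 0"
  proof
    assume z: "emeasure M (ball p r) = 0"
    have mi: "(\<lambda>q. indicator (ball p r) q :: ennreal) \<in> borel_measurable M" using B by (rule borel_measurable_indicator)
    have "(\<integral>\<^sup>+q. ennreal (snd q powr a) * indicator (ball p r) q * indicator half_space q \<partial>lborel) = 0"
      unfolding nn_integral_wM[OF mi, symmetric] using z B by simp
    then have "AE q in lborel. ennreal (snd q powr a) * indicator (ball p r) q * indicator half_space q = 0"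
    proof (subst (asm) nn_integral_0_iff_AE)
      show "(\<lambda>q. ennreal (snd q powr a) * indicator (ball p r) q * indicator half_space q) \<in> borel_measurable lborel"
        using measurable_snd_powr[of a]
        by (intro borel_measurable_times_ennreal borel_measurable_indicator measurable_compose[OF _ measurable_ennreal]) auto
    qed
    then have "AE q in lborel. q \<notin> ball p r"
    proof eventually_elim
      case (elim q)
      show ?case
      proof
        assume q: "q \<in> ball p r"
        then have "q \<in> half_space" using assms(1) by blast
        then show False using elim q by (auto simp: half_space_def)
      qed
    qed
    then have "emeasure lborel (ball p r) = 0" by (subst (asm) AE_iff_measurable[of "ball p r"]) auto
    then show False using content_ball_pos[OF assms(2), of p] by (simp add: measure_def)
  qed
  then show "0 < measure M (ball p r)"
    using fin by (simp add: measure_def enn2real_positive_iff zero_less_iff_neq_zero less_top)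
qed

text \<open>If positive at p0, the curvature term is bounded below by some c > 0 on a ball around
  p0. All large logarithmic cutoffs are 1 on this ball, so their energies are bounded below as well,
  although the growth condition makes them small for arbitrarily large R.\<close>

theorem curv_term_zero:
  assumes sign_term: "\<And>p. p \<in> half_space \<Longrightarrow> 0 \<le> sign_term p"
    and small: "\<And>d R0. d > 0 \<Longrightarrow> \<exists>R\<ge>R0. (etaI R + eta a u R / R ^ 4) / (ln R)\<^sup>2 < d"
    and p0: "p0 \<in> half_space" "(G 1 u p0)\<^sup>2 + (G 2 u p0)\<^sup>2 \<noteq> 0"
  shows "curv_term p0 = 0"
proof (rule ccontr)
  assume "curv_term p0 \<noteq> 0"
  then have c0: "curv_term p0 > 0" using curv_term_nonneg[of p0] by simp
  define c where "c = curv_term p0 / 2"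
  have c: "c > 0" using c0 by (simp add: c_def)
  let ?g = "\<lambda>p. (G 1 u p)\<^sup>2 + (G 2 u p)\<^sup>2"
  have cg: "continuous_on half_space ?g"
    by (intro continuous_intros C1_G_continuous u_C1)
  \<comment> \<open>The open set on which the quotients in \<open>curv_term\<close> are continuous;
    at zeros of the horizontal gradient division by zero could break continuity.\<close>
  define S where "S = half_space \<inter> ?g -` (- {0})"
  have S: "open S" "p0 \<in> S"
    unfolding S_def using p0 by (auto intro!: continuous_open_preimage[OF cg open_half_space])
  have "continuous_on S curv_term"
    unfolding curv_term_def[abs_def]
  proof (intro continuous_on_sum continuous_on_divide)
    fix k :: 3
    have "continuous_on half_space (\<lambda>p. (G 1 u p * G k (G 2 u) p - G 2 u p * G k (G 1 u) p)\<^sup>2)"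
      by (intro continuous_intros C1_G_continuous u_C1 XYu_C1)
    then show "continuous_on S (\<lambda>p. (G 1 u p * G k (G 2 u) p - G 2 u p * G k (G 1 u) p)\<^sup>2)"
      by (rule continuous_on_subset) (auto simp: S_def)
    show "continuous_on S ?g" by (rule continuous_on_subset[OF cg]) (auto simp: S_def)
    show "\<forall>p\<in>S. ?g p \<noteq> 0" by (auto simp: S_def)
  qed
  then have "isCont curv_term p0" using S by (simp add: continuous_on_eq_continuous_at)
  then obtain d1 where d1: "d1 > 0" "\<And>q. dist q p0 < d1 \<Longrightarrow> dist (curv_term q) (curv_term p0) < c"
    using c unfolding continuous_at_eps_delta by blast
  obtain d2 where d2: "d2 > 0" "ball p0 d2 \<subseteq> half_space" using open_half_space p0(1) openE by blast
  define r where "r = min d1 d2"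
  have r: "r > 0" "ball p0 r \<subseteq> half_space" using d1(1) d2 by (auto simp: r_def)
  have Gc: "c \<le> curv_term q" if "q \<in> ball p0 r" for q
  proof -
    have "dist q p0 < d1" using that by (simp add: r_def dist_commute)
    then have "\<bar>curv_term q - curv_term p0\<bar> < c" using d1(2)[of q] by (simp add: dist_real_def)
    then show ?thesis unfolding c_def by linarith
  qed
  note m = measure_ball_pos[OF r(2,1)]
  define K where "K = norm p0 + r"
  have cm: "0 < c * measure M (ball p0 r) / 512" using c m(1) by simp
  \<comment> \<open>Large enough for the cutoff lemmas, and such that points of norm at most K
    satisfy \<open>quart\<close> at most (K^2 + 1)^2, hence at most R^2, where the cutoff is
    1.\<close>
  obtain R where R: "R \<ge> 16 + (K\<^sup>2 + 1)" "(etaI R + eta a u R / R ^ 4) / (ln R)\<^sup>2 < c * measure M (ball p0 r) / 512"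
    using small[OF cm] by blast
  have R16: "16 \<le> R" using R(1) zero_le_power2[of K] by linarith
  let ?\<phi> = "logcut R"
  have one: "?\<phi> q = 1" if q: "q \<in> ball p0 r" for q
  proof (rule logcut_one[OF R16])
    show "q \<in> half_space" using q r(2) by blast
    have "norm q \<le> norm p0 + norm (q - p0)" by (metis add.commute diff_add_cancel norm_triangle_ineq)
    also have "\<dots> \<le> K" using q by (simp add: K_def dist_norm norm_minus_commute)
    finally have n: "(norm q)\<^sup>2 \<le> K\<^sup>2" by (intro power_mono) auto
    have "quart q \<le> ((norm q)\<^sup>2)\<^sup>2 + (norm q)\<^sup>2" by (rule quart_le_norm)
    also have "\<dots> \<le> (K\<^sup>2)\<^sup>2 + K\<^sup>2" using n by (intro add_mono power_mono[OF n]) auto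
    also have "\<dots> \<le> (K\<^sup>2 + 1)\<^sup>2" by (simp add: power2_sum)
    also have "\<dots> \<le> R\<^sup>2" using R(1) by (intro power_mono) auto
    finally show "quart q \<le> R\<^sup>2" .
  qed
  note cut = logcut_cut[OF R16]
  have "c * measure M (ball p0 r) = (\<integral>q. indicator (ball p0 r) q * c \<partial>M)"
    using r(2) by (simp add: Int_absorb2)
  also have "\<dots> \<le> (\<integral>q. curv_term q * (?\<phi> q)\<^sup>2 \<partial>M)"
  proof (intro Bochner_Integration.integral_mono m(2) curv_term_sign_term_integrable(1)[OF cut])
    fix q
    show "indicator (ball p0 r) q * c \<le> curv_term q * (?\<phi> q)\<^sup>2"
      using Gc[of q] one[of q] curv_term_nonneg[of q] by (cases "q \<in> ball p0 r") auto
  qed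
  also have "\<dots> \<le> (\<integral>q. curv_term q * (?\<phi> q)\<^sup>2 \<partial>M) + (\<integral>q. sign_term q * (?\<phi> q)\<^sup>2 \<partial>M)"
  proof -
    have "0 \<le> (\<integral>q. sign_term q * (?\<phi> q)\<^sup>2 \<partial>M)"
      by (rule integral_nonneg_AE) (intro AE_I2 mult_nonneg_nonneg sign_term, auto)
    then show ?thesis by simp
  qed
  also have "\<dots> \<le> 512 * ((etaI R + eta a u R / R ^ 4) / (ln R)\<^sup>2)"
    using geometric_inequality[OF cut] energy_small[OF R16] by (rule order_trans)
  also have "\<dots> < c * measure M (ball p0 r)" using R(2) by linarith
  finally show False by simp
qed

lemma curv_term_zeroD:
  assumes "curv_term p = 0" "(G 1 u p)\<^sup>2 + (G 2 u p)\<^sup>2 \<noteq> 0"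
  shows "G 1 u p * G k (G 2 u) p = G 2 u p * G k (G 1 u) p"
proof -
  have "(\<Sum>k\<in>UNIV. (G 1 u p * G k (G 2 u) p - G 2 u p * G k (G 1 u) p)\<^sup>2 / ((G 1 u p)\<^sup>2 + (G 2 u p)\<^sup>2)) = 0"
    using assms(1) by (simp add: curv_term_def)
  then have "(G 1 u p * G k (G 2 u) p - G 2 u p * G k (G 1 u) p)\<^sup>2 / ((G 1 u p)\<^sup>2 + (G 2 u p)\<^sup>2) = 0"
    by (subst (asm) sum_nonneg_eq_0_iff) (auto intro!: divide_nonneg_nonneg)
  then show ?thesis using assms(2) by auto
qed

end

subsection \<open>Curvatures of the level sets\<close>

lemma inverse_half_divide: "inverse n / 2 * (2 * x) = x / n" for n x :: real
  by (simp only: divide_inverse) simp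

lemma quotient_rule_cube: "- w * (inverse n * (x / n) * inverse n) + d / n = d / n - w * x / n ^ 3"
  for n w x d :: real
  by (cases "n = 0") (simp_all add: power3_eq_cube inverse_eq_divide)

lemma quotient_has_derivative:
  fixes w w1 w2 :: "'a::real_normed_vector \<Rightarrow> real"
  assumes w: "(w has_derivative D) (at p)" and w1: "(w1 has_derivative D1) (at p)"
    and w2: "(w2 has_derivative D2) (at p)"
    and n: "n = sqrt ((w1 p)\<^sup>2 + (w2 p)\<^sup>2)" "n \<noteq> 0"
  shows "((\<lambda>q. w q / sqrt ((w1 q)\<^sup>2 + (w2 q)\<^sup>2)) has_derivative
    (\<lambda>v. D v / n - w p * (w1 p * D1 v + w2 p * D2 v) / n ^ 3)) (at p)"
proof -
  have "(w1 p)\<^sup>2 + (w2 p)\<^sup>2 \<noteq> 0" using n(2) unfolding n(1) by simp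
  then have g: "0 < (w1 p)\<^sup>2 + (w2 p)\<^sup>2" using sum_power2_ge_zero order_le_less by metis
  have gd: "((\<lambda>q. (w1 q)\<^sup>2 + (w2 q)\<^sup>2) has_derivative (\<lambda>v. 2 * (w1 p * D1 v + w2 p * D2 v))) (at p)"
    using has_derivative_add[OF has_derivative_power[OF w1, of 2] has_derivative_power[OF w2, of 2]]
    by (simp add: algebra_simps)
  have "(sqrt has_derivative (\<lambda>x. inverse n / 2 * x)) (at ((w1 p)\<^sup>2 + (w2 p)\<^sup>2))"
    using DERIV_real_sqrt[OF g] unfolding n has_field_derivative_def .
  from has_derivative_compose[OF gd this]
  have sd: "((\<lambda>q. sqrt ((w1 q)\<^sup>2 + (w2 q)\<^sup>2)) has_derivative (\<lambda>v. (w1 p * D1 v + w2 p * D2 v) / n)) (at p)"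
    unfolding inverse_half_divide .
  have "sqrt ((w1 p)\<^sup>2 + (w2 p)\<^sup>2) \<noteq> 0" using n(2) unfolding n(1) .
  from has_derivative_divide[OF w sd this]
  show ?thesis unfolding n(1)[symmetric] quotient_rule_cube .
qed

lemma grad_H_eq: "C1 u \<Longrightarrow> p \<in> half_space \<Longrightarrow> grad_H u p = vector [G 1 u p, G 2 u p]"
  by (simp add: grad_H_def XYy_eq)

lemma norm_grad_H: "C1 u \<Longrightarrow> p \<in> half_space \<Longrightarrow> norm (grad_H u p) = sqrt ((G 1 u p)\<^sup>2 + (G 2 u p)\<^sup>2)"
  using grad_H_norm2[of u p] by (metis norm_ge_zero real_sqrt_unique)

lemma normal_H_eq:
  assumes "C1 u" "p \<in> half_space"
  shows "normal_H u p $ 1 = G 1 u p / sqrt ((G 1 u p)\<^sup>2 + (G 2 u p)\<^sup>2)"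
    "normal_H u p $ 2 = G 2 u p / sqrt ((G 1 u p)\<^sup>2 + (G 2 u p)\<^sup>2)"
  unfolding normal_H_def norm_grad_H[OF assms] by (simp_all add: grad_H_eq[OF assms])

lemma normal_H_has_derivative:
  assumes u: "C2 u" and p: "p \<in> half_space" and n: "n = norm (grad_H u p)" "n \<noteq> 0"
  shows "((\<lambda>q. normal_H u q $ 1) has_derivative (\<lambda>v. dV (\<lambda>_. v) (G 1 u) p / n
      - G 1 u p * (G 1 u p * dV (\<lambda>_. v) (G 1 u) p + G 2 u p * dV (\<lambda>_. v) (G 2 u) p) / n ^ 3)) (at p)" (is ?A)
    and "((\<lambda>q. normal_H u q $ 2) has_derivative (\<lambda>v. dV (\<lambda>_. v) (G 2 u) p / n
      - G 2 u p * (G 1 u p * dV (\<lambda>_. v) (G 1 u) p + G 2 u p * dV (\<lambda>_. v) (G 2 u) p) / n ^ 3)) (at p)" (is ?B)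
proof -
  note C = C2_C1[OF u]
  note d = C1_has_derivative[OF C2_G[OF u] p]
  have n': "n = sqrt ((G 1 u p)\<^sup>2 + (G 2 u p)\<^sup>2)" using n norm_grad_H[OF C p] by simp
  show ?A
    by (rule has_derivative_transform_within_open[OF quotient_has_derivative[OF d d d n' n(2)] open_half_space p])
       (simp add: normal_H_eq[OF C])
  show ?B
    by (rule has_derivative_transform_within_open[OF quotient_has_derivative[OF d d d n' n(2)] open_half_space p])
       (simp add: normal_H_eq[OF C])
qed

text \<open>Differentiating the factor 1 / |grad_H u| gives a multiple of grad_H u, which is
  orthogonal to the tangent, so only derivatives of the components survive.\<close>

lemma T_normal_inner_tangent:
  assumes u: "C2 u" and p: "p \<in> half_space" and n: "grad_H u p \<noteq> 0"
  shows "T_normal u p \<bullet> tangent_H u p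
    = 4 * (G 1 u p * pd 3 (G 2 u) p - G 2 u p * pd 3 (G 1 u) p) / (norm (grad_H u p))\<^sup>2"
proof -
  define n where "n = norm (grad_H u p)"
  have n0: "n \<noteq> 0" using n by (simp add: n_def)
  note N = normal_H_has_derivative[OF u p n_def n0]
  note T = XYT_has_derivative(3)[OF N(1)] XYT_has_derivative(3)[OF N(2)]
  define r where "r = (G 1 u p * pd 3 (G 1 u) p + G 2 u p * pd 3 (G 2 u) p) / n ^ 3"
  have T': "T_H (\<lambda>q. normal_H u q $ 1) p = - 4 * (pd 3 (G 1 u) p / n - G 1 u p * r)"
    "T_H (\<lambda>q. normal_H u q $ 2) p = - 4 * (pd 3 (G 2 u) p / n - G 2 u p * r)"
    unfolding T r_def by simp_all
  have "T_normal u p \<bullet> tangent_H u p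
    = - 4 * (pd 3 (G 1 u) p / n - G 1 u p * r) * (G 2 u p / n) + (- 4) * (pd 3 (G 2 u) p / n - G 2 u p * r) * (- G 1 u p / n)"
    unfolding T_normal_def T' tangent_H_def n_def[symmetric] XYy_eq[OF C2_C1[OF u] p]
    by (simp add: inner_vec_def sum_2)
  also have "\<dots> = 4 * (G 1 u p * pd 3 (G 2 u) p - G 2 u p * pd 3 (G 1 u) p) / n\<^sup>2"
    using n0 by (simp add: field_simps power2_eq_square)
  finally show ?thesis by (simp add: n_def)
qed

text \<open>Multiplied by n^3 and with n^2 = w1^2 + w2^2 inserted, the left side is w2 (w2 a - w1 c)
  + w1 (w1 d - w2 b), and both brackets vanish.\<close>

lemma mean_curv_algebra:
  fixes n w1 w2 a b c d :: real
  assumes n: "n \<noteq> 0" "n\<^sup>2 = w1\<^sup>2 + w2\<^sup>2" and *: "w1 * c = w2 * a" "w1 * d = w2 * b"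
  shows "a / n - w1 * (w1 * a + w2 * c) / n ^ 3 + (d / n - w2 * (w1 * b + w2 * d) / n ^ 3) = 0"
proof -
  have "n\<^sup>2 * a - w1 * (w1 * a + w2 * c) + (n\<^sup>2 * d - w2 * (w1 * b + w2 * d)) = w2 * (w2 * a - w1 * c) + w1 * (w1 * d - w2 * b)"
    unfolding n(2) by (simp add: algebra_simps power2_eq_square)
  also have "\<dots> = 0" using * by simp
  finally have 0: "n\<^sup>2 * a - w1 * (w1 * a + w2 * c) + (n\<^sup>2 * d - w2 * (w1 * b + w2 * d)) = 0" .
  have "x / n = n\<^sup>2 * x / n ^ 3" for x using n(1) by (simp add: power2_eq_square power3_eq_cube)
  then have "a / n - w1 * (w1 * a + w2 * c) / n ^ 3 + (d / n - w2 * (w1 * b + w2 * d) / n ^ 3)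
    = (n\<^sup>2 * a - w1 * (w1 * a + w2 * c) + (n\<^sup>2 * d - w2 * (w1 * b + w2 * d))) / n ^ 3"
    by (simp only: add_divide_distrib diff_divide_distrib)
  then show ?thesis unfolding 0 by simp
qed

text \<open>The relation \<open>par\<close> says that each frame derivative of grad_H u is parallel
  to grad_H u. Inserted into the quadratic form of the Hessian it leaves XYu - YXu, which is T
  u.\<close>

lemma curvature_eqs:
  assumes u: "C2 u" and p: "p \<in> half_space" and n: "grad_H u p \<noteq> 0"
    and par: "\<And>k. G 1 u p * G k (G 2 u) p = G 2 u p * G k (G 1 u) p"
  shows "mean_curv u p = 0"
    and "imag_curv u p = - ((hess_H u p *v tangent_H u p) \<bullet> normal_H u p) / norm (grad_H u p)"
proof -
  note C = C2_C1[OF u]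
  define n where "n = norm (grad_H u p)"
  have n0: "n \<noteq> 0" using n by (simp add: n_def)
  have n2: "n\<^sup>2 = (G 1 u p)\<^sup>2 + (G 2 u p)\<^sup>2" unfolding n_def by (rule grad_H_norm2[OF C p])
  note N = normal_H_has_derivative[OF u p n_def n0]
  have fr: "dV (\<lambda>_. fr k p) F p = G k F p" for k F by (rule dV_frozen[symmetric])
  show "mean_curv u p = 0"
    unfolding mean_curv_def div_H_def XYT_has_derivative(1)[OF N(1)] XYT_has_derivative(2)[OF N(2)] fr
    by (rule mean_curv_algebra[OF n0 n2 par[of 1] par[of 2]])
  have CX: "C1 (X_H u)" "C1 (Y_H u)"
    by (rule C1_cong[OF C2_G[OF u]], simp add: XYy_eq[OF C])+
  have GX: "G k (X_H u) p = G k (G 1 u) p" "G k (Y_H u) p = G k (G 2 u) p" for k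
    by (rule dV_cong[OF C2_G[OF u] p], simp add: XYy_eq[OF C])+
  define w1 w2 a b c d where "w1 = G 1 u p" and "w2 = G 2 u p" and "a = G 1 (G 1 u) p"
    and "b = G 2 (G 1 u) p" and "c = G 1 (G 2 u) p" and "d = G 2 (G 2 u) p"
  note defs = w1_def w2_def a_def b_def c_def d_def
  have e: "w1 * c = w2 * a" "w1 * d = w2 * b" using par[of 1] par[of 2] by (simp_all add: defs)
  \<comment> \<open>T was introduced by its first-order formula; here it is recognised as the
    commutator of X and Y.\<close>
  have T: "T_H u p = c - b"
    unfolding XYT_has_derivative(3)[OF C1_has_derivative[OF C p]] defs commutator[OF u p] by simp
  have nH: "normal_H u p = (1 / n) *\<^sub>R vector [w1, w2]"
    unfolding normal_H_def n_def defs grad_H_eq[OF C p] ..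
  have "(hess_H u p *v tangent_H u p) $ 1 = (a * w2 - b * w1) / n"
    "(hess_H u p *v tangent_H u p) $ 2 = (c * w2 - d * w1) / n"
    unfolding hess_H_def tangent_H_def n_def[symmetric] XYy_eq[OF C p]
      XYy_eq[OF CX(1) p] XYy_eq[OF CX(2) p] GX defs[symmetric]
    by (simp_all add: sum_2 matrix_vector_mult_def diff_divide_distrib)
  then have "(hess_H u p *v tangent_H u p) \<bullet> normal_H u p
    = (a * w2 - b * w1) / n * (w1 / n) + (c * w2 - d * w1) / n * (w2 / n)"
    unfolding nH by (simp add: inner_vec_def sum_2)
  also have "\<dots> = ((a * w2 - b * w1) * w1 + (c * w2 - d * w1) * w2) / n\<^sup>2"
    by (simp only: times_divide_times_eq add_divide_distrib power2_eq_square)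
  also have "(a * w2 - b * w1) * w1 + (c * w2 - d * w1) * w2
    = ((w2 * a) * w1 - b * w1\<^sup>2 + c * w2\<^sup>2 - (w1 * d) * w2)"
    by (simp add: algebra_simps power2_eq_square)
  also have "(w2 * a) * w1 - b * w1\<^sup>2 + c * w2\<^sup>2 - (w1 * d) * w2 = (c - b) * n\<^sup>2"
    unfolding e(1)[symmetric] e(2) n2 defs[symmetric] by (simp add: algebra_simps power2_eq_square)
  finally have "(hess_H u p *v tangent_H u p) \<bullet> normal_H u p = c - b" using n0 by simp
  then show "imag_curv u p = - ((hess_H u p *v tangent_H u p) \<bullet> normal_H u p) / norm (grad_H u p)"
    by (simp add: imag_curv_def T)
qed

subsection \<open>Stable weak solutions\<close>

text \<open>Measurability of F, which for \<open>trace0\<close> is not evident, follows from that of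
  K by completeness of Lebesgue measure.\<close>

lemma lebesgue_integral_AE_eq:
  fixes F K :: "'a::euclidean_space \<Rightarrow> real"
  assumes "AE x in lborel. F x = K x" "K \<in> borel_measurable borel"
  shows "(LINT x|lebesgue. F x) = (\<integral>x. K x \<partial>lborel)"
proof -
  have K: "K \<in> borel_measurable lborel" using assms(2) by simp
  then have Kl: "K \<in> borel_measurable lebesgue" by (rule measurable_completion)
  have ae: "AE x in lebesgue. F x = K x" by (rule AE_completion[OF assms(1)])
  then have "AE x in lebesgue. K x = F x" by eventually_elim simp
  then have "F \<in> borel_measurable lebesgue" by (rule borel_measurable_AE[OF Kl])
  then have "(LINT x|lebesgue. F x) = (LINT x|lebesgue. K x)" by (rule integral_cong_AE[OF _ Kl ae])
  also have "\<dots> = (\<integral>x. K x \<partial>lborel)" by (rule integral_completion[OF K])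
  finally show ?thesis .
qed

text \<open>The Hoelder condition on the closed interval of radius 1 about r gives continuity of the
  derivative at r, as the exponent is positive.\<close>

lemma C1_Hoelder_deriv:
  assumes "C1_Hoelder \<gamma> f" "0 < \<gamma>"
  shows "(f has_real_derivative deriv f r) (at r)" "continuous_on UNIV (deriv f)"
proof -
  show "(f has_real_derivative deriv f r) (at r)"
    using assms(1) by (simp add: C1_Hoelder_def DERIV_deriv_iff_real_differentiable)
  have "isCont (deriv f) r" for r
  proof -
    obtain C where C: "\<And>t. t \<in> cball r 1 \<Longrightarrow> \<bar>deriv f t - deriv f r\<bar> \<le> C * \<bar>t - r\<bar> powr \<gamma>"
      using assms(1) unfolding C1_Hoelder_def by (metis centre_in_cball compact_cball zero_le_one)
    have "((\<lambda>t. \<bar>t - r\<bar> powr \<gamma>) \<longlongrightarrow> 0) (at r)"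
    proof (rule tendsto_zero_powrI[OF _ tendsto_const _ assms(2)])
      show "((\<lambda>t. \<bar>t - r\<bar>) \<longlongrightarrow> 0) (at r)" by (auto intro!: tendsto_eq_intros)
    qed simp
    from tendsto_mult_right_zero[OF this, of C]
    have z: "((\<lambda>t. C * \<bar>t - r\<bar> powr \<gamma>) \<longlongrightarrow> 0) (at r)" .
    have "((\<lambda>t. deriv f t - deriv f r) \<longlongrightarrow> 0) (at r)"
    proof (rule Lim_null_comparison[OF _ z])
      have "\<forall>\<^sub>F t in at r. t \<in> ball r 1" by (rule eventually_at_in_open') auto
      then show "\<forall>\<^sub>F t in at r. norm (deriv f t - deriv f r) \<le> C * \<bar>t - r\<bar> powr \<gamma>"
        by eventually_elim (simp add: C)
    qed
    then show ?thesis by (simp add: isCont_def LIM_zero_iff)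
  qed
  then show "continuous_on UNIV (deriv f)" by (simp add: continuous_on_eq_continuous_at)
qed

text \<open>For a continuous function the set where an essential bound fails is open in U. Being
  negligible it is empty, so the bound holds everywhere on U.\<close>

lemma Linf_on_open_bound:
  assumes w: "continuous_on U w" "open U" and "U \<subseteq> A" "Linf_on A w"
  obtains C where "\<And>p. p \<in> U \<Longrightarrow> \<bar>w p\<bar> \<le> C"
proof -
  obtain C where C: "AE p in lebesgue. p \<in> A \<longrightarrow> \<bar>w p\<bar> \<le> C" using assms(4) by (auto simp: Linf_on_def)
  define N where "N = U \<inter> (\<lambda>p. \<bar>w p\<bar>) -` {C<..}"
  have N: "open N" unfolding N_def
    by (rule continuous_open_preimage[OF _ w(2)]) (auto intro!: continuous_intros w(1))
  have "AE p in lebesgue. p \<notin> N"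
    using C by eventually_elim (use assms(3) in \<open>auto simp: N_def\<close>)
  then have "negligible N"
    unfolding negligible_iff_null_sets using N by (subst (asm) AE_iff_null_sets[symmetric]) auto
  then have "N = {}" using open_not_negligible[OF N] by blast
  then have "\<bar>w p\<bar> \<le> C" if "p \<in> U" for p using that by (force simp: N_def)
  then show thesis by (rule that)
qed

context weight begin

lemma integral_grad_ip:
  assumes "C1 F" "C1 K"
  shows "(\<integral>p. grad_ip F K p \<partial>M) = (LINT p:half_space|lebesgue. snd p powr a * (grad_ext F p \<bullet> grad_ext K p))"
proof -
  have "(\<integral>p. grad_ip F K p \<partial>M) = (LINT p:half_space|lebesgue. snd p powr a * grad_ip F K p)"
    by (rule integral_wM(2)[OF grad_ip_measurable[OF assms]])
  also have "\<dots> = (LINT p:half_space|lebesgue. snd p powr a * (grad_ext F p \<bullet> grad_ext K p))"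
    unfolding set_lebesgue_integral_def
    by (intro Bochner_Integration.integral_cong refl) (simp add: grad_ext_inner[OF assms] grad_ip_def indicator_def)
  finally show ?thesis .
qed

lemma Hloc_weak_solution:
  assumes u: "C1 u" and b: "\<And>p. p \<in> half_space \<Longrightarrow> \<bar>u p\<bar> \<le> C" and w: "weak_solution a f u"
  shows "Hloc u"
proof -
  have mg: "grad_ip u u \<in> borel_measurable M" by (rule grad_ip_measurable[OF u u])
  have grad_ip: "(norm (grad_ext u p))\<^sup>2 = grad_ip u u p" if "p \<in> half_space" for p
    unfolding grad_ext_norm2[OF u that] by (simp add: grad_ip_def power2_eq_square)
  have "integrable M (\<lambda>p. indicator (ball 0 R) p * grad_ip u u p)" for R
  proof (cases "R > 0")
    case True
    then have "set_integrable lebesgue (half_ball R) (\<lambda>p. snd p powr a * (norm (grad_ext u p))\<^sup>2)"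
      using w by (simp add: weak_solution_def)
    then have "set_integrable lebesgue half_space (\<lambda>p. snd p powr a * (indicator (ball 0 R) p * grad_ip u u p))"
      unfolding set_integrable_def
      by (rule Bochner_Integration.integrable_cong[THEN iffD1, OF refl, rotated])
         (auto simp: indicator_def half_ball_def grad_ip)
    then show ?thesis
      by (subst integral_wM(1)[OF ball_ind_measurable[OF mg]])
  next
    case False
    then have "ball (0::point) R = {}" by simp
    then have "indicator (ball 0 R) p * grad_ip u u p = 0" for p by (simp only: indicator_def) simp
    then show ?thesis by (simp only: integrable_zero)
  qed
  then have lg: "loc_int (grad_ip u u)" using mg by (simp add: loc_int_def)
  show ?thesis unfolding Hloc_def
  proof (intro conjI allI u)
    show "loc_int (\<lambda>p. (u p)\<^sup>2)"
    proof (rule loc_int_loc_bdd)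
      have "loc_bdd u" by (rule loc_bdd_bounded[OF b])
      then show "loc_bdd (\<lambda>p. (u p)\<^sup>2)" unfolding power2_eq_square by (intro loc_bdd_mult)
      show "(\<lambda>p. (u p)\<^sup>2) \<in> borel_measurable M" by (intro borel_measurable_power C1_measurable u)
    qed
    show "loc_int (\<lambda>p. (G k u p)\<^sup>2)" for k
      by (rule loc_intI_bound[OF _ lg]) (auto intro!: borel_measurable_power G_measurable u grad_ip_ge)
  qed
qed

lemma loc_bdd_grad_H:
  assumes u: "C1 u" and g: "\<forall>R>0. Linf_on (closure (half_ball R)) (\<lambda>p. norm (grad_H u p))"
  shows "loc_bdd (G 1 u)" "loc_bdd (G 2 u)"
proof -
  have B: "\<exists>C. \<forall>p\<in>half_space. norm p < R \<longrightarrow> norm (grad_H u p) \<le> C" for R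
  proof -
    \<comment> \<open>The hypothesis speaks of positive radii only.\<close>
    define S where "S = max R 1"
    have c: "continuous_on half_space (\<lambda>p. norm (grad_H u p))"
    proof (rule continuous_on_eq)
      show "continuous_on half_space (\<lambda>p. sqrt ((G 1 u p)\<^sup>2 + (G 2 u p)\<^sup>2))"
        by (intro continuous_intros C1_G_continuous u)
    qed (simp add: norm_grad_H[OF u])
    have o: "open (half_ball S)" unfolding half_ball_def by (intro open_Int open_ball open_half_space)
    have L: "Linf_on (closure (half_ball S)) (\<lambda>p. norm (grad_H u p))" using g by (simp add: S_def)
    have "continuous_on (half_ball S) (\<lambda>p. norm (grad_H u p))"
      by (rule continuous_on_subset[OF c]) (simp add: half_ball_def)
    from Linf_on_open_bound[OF this o closure_subset L]
    obtain C where "\<And>p. p \<in> half_ball S \<Longrightarrow> \<bar>norm (grad_H u p)\<bar> \<le> C" by metis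
    then have "norm (grad_H u p) \<le> C" if "p \<in> half_space" "norm p < R" for p
      using that by (simp add: half_ball_def S_def)
    then show ?thesis by blast
  qed
  have le: "\<bar>G 1 u p\<bar> \<le> norm (grad_H u p)" "\<bar>G 2 u p\<bar> \<le> norm (grad_H u p)" if "p \<in> half_space" for p
    unfolding norm_grad_H[OF u that] by (simp_all add: real_le_rsqrt)
  show "loc_bdd (G 1 u)" "loc_bdd (G 2 u)" unfolding loc_bdd_def using B le by (meson order_trans)+
qed

end

text \<open>The bridge from the given notions to the locale: \<open>trace0\<close> and
  \<open>tr\<close> agree almost everywhere, test functions are admissible, and f' is bounded on the
  compact interval [-Mu, Mu].\<close>

lemma sol_of_stable:
  assumes a: "-1 < a" "a < 1" and \<gamma>: "\<gamma> > 0"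
    and f: "C1_Hoelder \<gamma> f" and u: "C2_on half_space u" and b: "bounded (u ` half_space)"
    and w: "weak_solution a f u" and s: "stable_solution a f u"
    and g: "\<forall>R>0. Linf_on (closure (half_ball R)) (\<lambda>p. norm (grad_H u p))"
  obtains Mu Lf where "sol a u f (deriv f) Mu Lf"
proof -
  interpret weight a by unfold_locales (rule a)+
  have u2: "C2 u" by (rule C2_on_imp_C2[OF u])
  note u1 = C2_C1[OF u2]
  note fd = C1_Hoelder_deriv[OF f \<gamma>]
  obtain Mu where Mu: "\<And>p. p \<in> half_space \<Longrightarrow> \<bar>u p\<bar> \<le> Mu"
    using b unfolding bounded_iff by (metis imageI real_norm_def)
  have uH: "Hloc u" by (rule Hloc_weak_solution[OF u1 Mu w])
  have "compact (deriv f ` {- Mu..Mu})"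
    by (rule compact_continuous_image[OF continuous_on_subset[OF fd(2)]]) auto
  then obtain Lf where Lf: "\<And>x. x \<in> deriv f ` {- Mu..Mu} \<Longrightarrow> norm x \<le> Lf"
    by (meson compact_imp_bounded bounded_iff)
  have fb: "\<bar>deriv f r\<bar> \<le> Lf" if "\<bar>r\<bar> \<le> Mu" for r
  proof -
    have "r \<in> {- Mu..Mu}" using that by (simp add: abs_le_iff minus_le_iff)
    from Lf[OF imageI[OF this]] show ?thesis by simp
  qed
  have cf: "continuous_on UNIV f"
    by (intro continuous_at_imp_continuous_on ballI DERIV_isCont[OF fd(1)])
  have mu: "tr u \<in> borel_measurable borel" by (rule tr_measurable[OF u1])
  have mf: "(\<lambda>x. f (tr u x)) \<in> borel_measurable borel" "(\<lambda>x. deriv f (tr u x)) \<in> borel_measurable borel"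
    by (rule measurable_compose[OF mu borel_measurable_continuous_onI]; fact)+
  have AE: "AE x in lborel. trace0 u x = tr u x \<and> trace0 \<xi> x = tr \<xi> x" if "test \<xi>" for \<xi>
  proof -
    have "Hloc \<xi>" using that by (simp add: test_def)
    from Hloc_convg[OF uH] Hloc_convg[OF this] show ?thesis
      by eventually_elim (simp add: trace0_eq)
  qed
  show thesis
  proof (rule that, unfold_locales)
    fix \<xi> assume xi: "test \<xi>"
    then have C: "C1 \<xi>" by (simp add: test_def Hloc_def)
    have m: "tr \<xi> \<in> borel_measurable borel" by (rule tr_measurable[OF C])
    have "(LINT x|lebesgue. f (trace0 u x) * trace0 \<xi> x) = (\<integral>x. f (tr u x) * tr \<xi> x \<partial>lborel)"
    proof (rule lebesgue_integral_AE_eq)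
      show "AE x in lborel. f (trace0 u x) * trace0 \<xi> x = f (tr u x) * tr \<xi> x"
        using AE[OF xi] by eventually_elim simp
    qed (intro borel_measurable_times mf m)
    then show "(\<integral>p. grad_ip u \<xi> p \<partial>M) = (\<integral>x. f (tr u x) * tr \<xi> x \<partial>lborel)"
      unfolding integral_grad_ip[OF u1 C] using w test_admissible[OF xi] by (simp add: weak_solution_def)
    have "(LINT x|lebesgue. deriv f (trace0 u x) * (trace0 \<xi> x)\<^sup>2) = (\<integral>x. deriv f (tr u x) * (tr \<xi> x)\<^sup>2 \<partial>lborel)"
    proof (rule lebesgue_integral_AE_eq)
      show "AE x in lborel. deriv f (trace0 u x) * (trace0 \<xi> x)\<^sup>2 = deriv f (tr u x) * (tr \<xi> x)\<^sup>2"
        using AE[OF xi] by eventually_elim simp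
    qed (intro borel_measurable_times borel_measurable_power mf m)
    then show "0 \<le> (\<integral>p. grad_ip \<xi> \<xi> p \<partial>M) - (\<integral>x. deriv f (tr u x) * (tr \<xi> x)\<^sup>2 \<partial>lborel)"
      using s[unfolded stable_solution_def power2_norm_eq_inner, rule_format, OF test_admissible[OF xi]]
      unfolding integral_grad_ip[OF C C] by linarith
  qed (use u2 uH Mu loc_bdd_grad_H[OF u1 g] fd fb in auto)
qed

text \<open>If Q were at least d from some point on, its lower limit would be at least d.\<close>

lemma Liminf_zero_frequently:
  fixes Q :: "real \<Rightarrow> real"
  assumes "Liminf at_top (\<lambda>R. ereal (Q R)) = 0" "d > 0"
  shows "\<exists>R\<ge>R0. Q R < d"
proof (rule ccontr)
  assume "\<not> ?thesis"
  then have "\<forall>\<^sub>F R in at_top. ereal d \<le> ereal (Q R)"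
    unfolding eventually_at_top_linorder by (intro exI[of _ R0]) (auto simp: not_less)
  from Liminf_bounded[OF this] show False using assms by simp
qed

theorem theorem1p4:
  fixes s a \<gamma> :: real and f :: "real \<Rightarrow> real" and u :: "(real ^ 3) \<times> real \<Rightarrow> real"
  assumes s: "0 < s" "s < 1"
    and a: "a = 1 - 2 * s"
    and gamma: "\<gamma> > max 0 (1 - 2 * s)"
    and f: "C1_Hoelder \<gamma> f"
    and u_C2: "C2_on half_space u"
    and u_bounded: "bounded (u ` half_space)"
    and u_weak: "weak_solution a f u"
    and u_stable: "stable_solution a f u"
    and grad_bounded: "\<forall>R>0. Linf_on (closure (half_ball R)) (\<lambda>p. norm (grad_H u p))"
    and sign: "\<forall>x y. y > 0 \<and> grad_H u (x, y) \<noteq> 0 \<longrightarrow>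
                 T_normal u (x, y) \<bullet> tangent_H u (x, y) \<ge> 0"
    and growth: "Liminf at_top (\<lambda>R. ereal
                   (((LINT \<tau>:{sqrt R..R}|lebesgue. eta a u \<tau> / \<tau> ^ 5) + eta a u R / R ^ 4)
                    / (ln R)\<^sup>2)) = 0"
  shows "\<forall>y>0. \<forall>c. \<forall>x \<in> {x. u (x, y) = c \<and> grad_H u (x, y) \<noteq> 0}.
           mean_curv u (x, y) = 0 \<and>
           imag_curv u (x, y) =
             - ((hess_H u (x, y) *v tangent_H u (x, y)) \<bullet> normal_H u (x, y))
               / norm (grad_H u (x, y))"
proof -
  have a': "-1 < a" "a < 1" using s a by auto
  have "\<gamma> > 0" using gamma by simp
  from sol_of_stable[OF a' this f u_C2 u_bounded u_weak u_stable grad_bounded]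
  obtain Mu Lf where "sol a u f (deriv f) Mu Lf" .
  then interpret sol a u f "deriv f" Mu Lf .
  have g: "(G 1 u p)\<^sup>2 + (G 2 u p)\<^sup>2 \<noteq> 0 \<longleftrightarrow> grad_H u p \<noteq> 0" if "p \<in> half_space" for p
    using grad_H_norm2[OF u_C1 that] by (metis norm_eq_zero zero_eq_power2)
  \<comment> \<open>The third coordinate direction is central: its field is constant and generates
    left translations, so it commutes with the frame.\<close>
  have pd3: "pd 3 (G k u) p = G k z3 p" if "p \<in> half_space" for k p
  proof -
    have "pd 3 (G k u) p = dV (vf (axis 3 1) (-2)) (G k u) p"
      using vf_expand[OF C2_G[OF u2] that, of "axis 3 1" "-2"] by (simp add: axis_def)
    then show ?thesis unfolding vf_G_commute[OF u2 that] by (simp add: z3_def z_def[abs_def])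
  qed
  have sign_term: "0 \<le> sign_term p" if p: "p \<in> half_space" for p
  proof (cases "grad_H u p = 0")
    case True
    then have "G 1 u p = 0 \<and> G 2 u p = 0" using g[OF p] by (simp add: sum_power2_eq_zero_iff)
    then show ?thesis by (simp add: sign_term_def)
  next
    case False
    have "0 \<le> T_normal u (fst p, snd p) \<bullet> tangent_H u (fst p, snd p)"
      using sign[rule_format, of "snd p" "fst p"] False p by (simp add: half_space_def)
    then have "0 \<le> 4 * (G 1 u p * G 2 z3 p - G 2 u p * G 1 z3 p) / (norm (grad_H u p))\<^sup>2"
      using T_normal_inner_tangent[OF u2 p False] by (simp add: pd3[OF p])
    moreover have "(norm (grad_H u p))\<^sup>2 > 0" using False by simp
    ultimately show ?thesis by (simp add: sign_term_def zero_le_divide_iff)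
  qed
  have small: "\<exists>R\<ge>R0. (etaI R + eta a u R / R ^ 4) / (ln R)\<^sup>2 < d" if "d > 0" for d R0
    using Liminf_zero_frequently[OF growth that] unfolding etaI_eq .
  show ?thesis
  proof (intro allI impI ballI)
    fix y c x assume y: "(0::real) < y" and x: "x \<in> {x. u (x, y) = c \<and> grad_H u (x, y) \<noteq> 0}"
    have p: "(x, y) \<in> half_space" using y by (simp add: half_space_def)
    have n: "grad_H u (x, y) \<noteq> 0" using x by simp
    note n' = g[OF p, THEN iffD2, OF n]
    have "curv_term (x, y) = 0" by (rule curv_term_zero[OF sign_term small p n'])
    note par = curv_term_zeroD[OF this n']
    show "mean_curv u (x, y) = 0 \<and> imag_curv u (x, y) =
      - ((hess_H u (x, y) *v tangent_H u (x, y)) \<bullet> normal_H u (x, y)) / norm (grad_H u (x, y))"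
      using curvature_eqs[OF u2 p n par] by blast
  qed
qed

end
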